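(* Let $K$ be a number field with $r$ real places and $s$ complex places, and put $d=r+2s=[K:\mathbb{Q}]$. Let $\mathbb{Z}_K$ be the ring of integers of $K$, with discriminant $\Delta_K$, and let $R$ be a ring with $\mathbb{Z}_K\subset R\subset K$, endowed with its canonical norm. Then for all $n\in\mathbb{Z}^+$, $$C(R,n)\ge M(K)^{-n},\qquad\text{where}\qquad M(K)=\left(\frac{4}{\pi}\right)^s\frac{d!}{d^d}\,|\Delta_K|^{\frac12}.$$
   Context: $R$ is Dedekind with finite quotients by nonzero ideals; the canonical norm is $|I|=\#R/I$ for nonzero ideals $I$, extended multiplicatively to nonzero fractional ideals; for $x\in K^\times$, $|x|=|xR|$, and $|0|=0$. Put $\mathcal{N}=|K^\times|$ and let $\overline{\mathcal{N}}$ be its closure in $\mathbb{R}^{>0}$. An $R$-lattice in $K^n$ is a finitely generated $R$-submodule $\Lambda\subset K^n$ spanning $K^n$ over $K$. For a finite length $R$-module $M\cong\bigoplus_iR/\mathfrak{p}_i^{n_i}$ put $\chi(M)=\prod_i\mathfrak{p}_i^{n_i}$. For a lattice $\Lambda$ choose nonzero $\alpha\in R$ with $\alpha\Lambda\subset R^n$, and put $\chi(\Lambda)=\alpha^{-n}\chi(R^n/\alpha\Lambda)$ (independent of $\alpha$) and $\operatorname{Covol}\Lambda=|\chi(\Lambda)|$. The linear constant $C(R,n)$ is the supremum of all $C\in\overline{\mathcal{N}}$ such that: for all $M=(m_{ij})\in GL_n(K)$, all $R$-lattices $\Lambda\subset K^n$ and all $\epsilon_1,\ldots,\epsilon_n\in\overline{\mathcal{N}}$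 with $|\det M|\operatorname{Covol}\Lambda\le C\prod_{i=1}^n\epsilon_i$, there is a nonzero $x=(x_1,\ldots,x_n)\in\Lambda$ with $|\sum_{j=1}^nm_{ij}x_j|\le\epsilon_i$ for all $1\le i\le n$. *)

theory Defs
  imports
    Complex_Main
    "HOL-Library.Extended_Real"
    "HOL-Analysis.Elementary_Topology"
    "HOL-Computational_Algebra.Polynomial"
    "HOL-Algebra.Ideal_Product"
    "HOL-Algebra.QuotRing"
    "HOL-Algebra.Subrings"
    "HOL-Algebra.Module"
    "Jordan_Normal_Form.Matrix"
    "Jordan_Normal_Form.Determinant"
begin

section \<open>Number fields\<close>

text \<open>A number field \<open>K\<close> is a type of class \<open>field_char_0\<close> that is finite-dimensional over the
  rationals. Rings and modules are treated with HOL-Algebra; subrings of \<open>K\<close> are carriers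
  inside the following record.\<close>

definition field_ring :: "'k::field ring" where
  "field_ring = \<lparr>carrier = UNIV, monoid.mult = (*), one = 1, zero = 0, add = (+)\<rparr>"

definition ring_on :: "'k::field set \<Rightarrow> 'k ring" where
  "ring_on R = field_ring\<lparr>carrier := R\<rparr>"

definition rat_scale :: "rat \<Rightarrow> 'k::field_char_0 \<Rightarrow> 'k" where
  "rat_scale q x = of_rat q * x"

definition number_field :: "'k::field_char_0 itself \<Rightarrow> bool" where
  "number_field _ \<longleftrightarrow> (\<exists>B :: 'k set. finite B \<and> module.span rat_scale B = UNIV)"

definition field_degree :: "'k::field_char_0 itself \<Rightarrow> nat" where
  "field_degree _ = vector_space.dim rat_scale (UNIV :: 'k set)"

definition ring_of_integers :: "'k::field_char_0 set" where
  "ring_of_integers = {x. algebraic_int x}"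

definition complex_embeddings :: "('k::field_char_0 \<Rightarrow> complex) set" where
  "complex_embeddings =
     {\<sigma>. \<sigma> 1 = 1 \<and> (\<forall>x y. \<sigma> (x + y) = \<sigma> x + \<sigma> y) \<and> (\<forall>x y. \<sigma> (x * y) = \<sigma> x * \<sigma> y)}"

definition real_places :: "('k::field_char_0 \<Rightarrow> complex) set" where
  "real_places = {\<sigma> \<in> complex_embeddings. range \<sigma> \<subseteq> \<real>}"

text \<open>A complex place is a pair of conjugate non-real embeddings.\<close>

definition complex_places :: "('k::field_char_0 \<Rightarrow> complex) set set" where
  "complex_places = (\<lambda>\<sigma>. {\<sigma>, cnj \<circ> \<sigma>}) ` (complex_embeddings - real_places)"

definition integral_basis :: "(nat \<Rightarrow> 'k::field_char_0) \<Rightarrow> bool" where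
  "integral_basis b \<longleftrightarrow>
     bij_betw (\<lambda>c. \<Sum>i<field_degree TYPE('k). of_int (c i) * b i)
       ({..<field_degree TYPE('k)} \<rightarrow>\<^sub>E (UNIV :: int set)) ring_of_integers"

text \<open>\<open>\<Delta>\<^sub>K = det (\<sigma>\<^sub>i b\<^sub>j)\<^sup>2\<close> for any integral basis \<open>b\<close> and any enumeration \<open>\<sigma>\<close> of the embeddings;
  it does not depend on these choices. It is an integer, here viewed as a complex number.\<close>

definition discriminant :: "'k::field_char_0 itself \<Rightarrow> complex" where
  "discriminant _ =
     (let d = field_degree TYPE('k) in
      SOME D. \<exists>(b :: nat \<Rightarrow> 'k) \<sigma>. integral_basis b \<and>
        bij_betw \<sigma> {..<d} complex_embeddings \<and>
        D = (det (mat d d (\<lambda>(i, j). \<sigma> i (b j))))\<^sup>2)"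

section \<open>The canonical norm\<close>

definition nonzero_ideal :: "'k::field set \<Rightarrow> 'k set \<Rightarrow> bool" where
  "nonzero_ideal R I \<longleftrightarrow> ideal I (ring_on R) \<and> I \<noteq> {0}"

definition ideal_norm :: "'k::field set \<Rightarrow> 'k set \<Rightarrow> nat" where
  "ideal_norm R I = card (carrier (ring_on R Quot I))"

text \<open>The multiplicative extension to nonzero fractional ideals: if \<open>I B = A\<close> with \<open>A, B\<close>
  nonzero ideals, then \<open>|I| = |A| / |B|\<close>.\<close>

definition frac_ideal_norm :: "'k::field set \<Rightarrow> 'k set \<Rightarrow> real" where
  "frac_ideal_norm R I =
     (THE c. \<exists>A B. nonzero_ideal R A \<and> nonzero_ideal R B \<and>
        ideal_prod (ring_on R) I B = A \<and>
        c = real (ideal_norm R A) / real (ideal_norm R B))"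

definition canonical_norm :: "'k::field set \<Rightarrow> 'k \<Rightarrow> real" where
  "canonical_norm R x = (if x = 0 then 0 else frac_ideal_norm R ((\<lambda>r. x * r) ` R))"

text \<open>\<open>closed_norm_group R\<close> is the closure of \<open>|K\<^sup>\<times>|\<close> in the positive reals.\<close>

definition norm_group :: "'k::field set \<Rightarrow> real set" where
  "norm_group R = canonical_norm R ` {x. x \<noteq> 0}"

definition closed_norm_group :: "'k::field set \<Rightarrow> real set" where
  "closed_norm_group R = closure (norm_group R) \<inter> {0<..}"

section \<open>Modules and the ideal \<open>\<chi>\<close>\<close>

definition generated_submodule ::
  "('a, 'c) ring_scheme \<Rightarrow> ('a, 'b, 'd) module_scheme \<Rightarrow> 'b set \<Rightarrow> 'b set" where
  "generated_submodule R M S = \<Inter>{N. submodule N R M \<and> S \<subseteq> N}"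

text \<open>The fields \<open>mult\<close> and \<open>one\<close> of a module record play no role.\<close>

definition quotient_module :: "('a, 'b, 'c) module_scheme \<Rightarrow> 'b set \<Rightarrow> ('a, 'b set) module" where
  "quotient_module M N =
     \<lparr>carrier = a_rcosets\<^bsub>M\<^esub> N, monoid.mult = undefined, one = undefined, zero = N, add = set_add M,
      module.smult = (\<lambda>r X. \<Union>x\<in>X. N +>\<^bsub>M\<^esub> (r \<odot>\<^bsub>M\<^esub> x))\<rparr>"

definition direct_sum_module ::
  "'i set \<Rightarrow> ('i \<Rightarrow> ('a, 'b, 'c) module_scheme) \<Rightarrow> ('a, 'i \<Rightarrow> 'b) module" where
  "direct_sum_module I M =
     \<lparr>carrier = (\<Pi>\<^sub>E i\<in>I. carrier (M i)), monoid.mult = undefined, one = undefined,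
      zero = (\<lambda>i\<in>I. \<zero>\<^bsub>M i\<^esub>), add = (\<lambda>x y. \<lambda>i\<in>I. x i \<oplus>\<^bsub>M i\<^esub> y i),
      module.smult = (\<lambda>r x. \<lambda>i\<in>I. r \<odot>\<^bsub>M i\<^esub> x i)\<rparr>"

definition module_isomorphic ::
  "('a, 'r) ring_scheme \<Rightarrow> ('a, 'b, 'c) module_scheme \<Rightarrow> ('a, 'e, 'f) module_scheme \<Rightarrow> bool" where
  "module_isomorphic R M N \<longleftrightarrow>
     (\<exists>f. bij_betw f (carrier M) (carrier N) \<and>
        (\<forall>x\<in>carrier M. \<forall>y\<in>carrier M. f (x \<oplus>\<^bsub>M\<^esub> y) = f x \<oplus>\<^bsub>N\<^esub> f y) \<and>
        (\<forall>r\<in>carrier R. \<forall>x\<in>carrier M. f (r \<odot>\<^bsub>M\<^esub> x) = r \<odot>\<^bsub>N\<^esub> f x))"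

definition regular_module :: "'a ring \<Rightarrow> ('a, 'a) module" where
  "regular_module R =
     \<lparr>carrier = carrier R, monoid.mult = monoid.mult R, one = \<one>\<^bsub>R\<^esub>, zero = \<zero>\<^bsub>R\<^esub>,
      add = add R, module.smult = monoid.mult R\<rparr>"

definition ideal_power :: "('a, 'b) ring_scheme \<Rightarrow> 'a set \<Rightarrow> nat \<Rightarrow> 'a set" where
  "ideal_power R P e = (ideal_prod R P ^^ e) (carrier R)"

text \<open>For \<open>M \<cong> \<Oplus>\<^sub>i R/\<pp>\<^sub>i\<^sup>e\<^sup>i\<close> with nonzero primes \<open>\<pp>\<^sub>i\<close>, \<open>\<chi>(M)\<close> is the product of the \<open>\<pp>\<^sub>i\<^sup>e\<^sup>i\<close>; for
  Dedekind \<open>R\<close> it does not depend on the decomposition.\<close>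

definition chi_module :: "'a ring \<Rightarrow> ('a, 'b, 'c) module_scheme \<Rightarrow> 'a set" where
  "chi_module R M =
     (SOME J. \<exists>m (p :: nat \<Rightarrow> 'a set) (e :: nat \<Rightarrow> nat).
        (\<forall>i<m. primeideal (p i) R \<and> p i \<noteq> {\<zero>\<^bsub>R\<^esub>}) \<and>
        module_isomorphic R M
          (direct_sum_module {..<m}
             (\<lambda>i. quotient_module (regular_module R) (ideal_power R (p i) (e i)))) \<and>
        J = foldr (\<lambda>i. ideal_prod R (ideal_power R (p i) (e i))) [0..<m] (carrier R))"

section \<open>Lattices and the linear constant\<close>

text \<open>\<open>R\<^sup>n\<close> as a subset of \<open>K\<^sup>n\<close>; note that \<open>module_vec TYPE('k) n\<close> is \<open>K\<^sup>n\<close>, and it serves as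
  a module over \<open>K\<close> and over each subring of \<open>K\<close>.\<close>

definition vecs_over :: "'k::field set \<Rightarrow> nat \<Rightarrow> 'k vec set" where
  "vecs_over R n = {v \<in> carrier_vec n. \<forall>i<n. v $ i \<in> R}"

definition is_lattice :: "'k::field set \<Rightarrow> nat \<Rightarrow> 'k vec set \<Rightarrow> bool" where
  "is_lattice R n L \<longleftrightarrow>
     submodule L (ring_on R) (module_vec TYPE('k) n) \<and>
     (\<exists>S. finite S \<and> S \<subseteq> L \<and>
        L = generated_submodule (ring_on R) (module_vec TYPE('k) n) S) \<and>
     generated_submodule field_ring (module_vec TYPE('k) n) L = carrier_vec n"

text \<open>\<open>\<chi>(L) = \<alpha>\<^sup>-\<^sup>n \<chi>(R\<^sup>n / \<alpha>L)\<close> for a chosen \<open>\<alpha>\<close>; the choice is immaterial.\<close>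

definition lattice_chi :: "'k::field set \<Rightarrow> nat \<Rightarrow> 'k vec set \<Rightarrow> 'k set" where
  "lattice_chi R n L =
     (let \<alpha> = (SOME \<alpha>. \<alpha> \<in> R \<and> \<alpha> \<noteq> 0 \<and> (\<lambda>v. \<alpha> \<cdot>\<^sub>v v) ` L \<subseteq> vecs_over R n) in
      (\<lambda>y. inverse (\<alpha> ^ n) * y) `
        chi_module (ring_on R)
          (quotient_module ((module_vec TYPE('k) n)\<lparr>carrier := vecs_over R n\<rparr>)
             ((\<lambda>v. \<alpha> \<cdot>\<^sub>v v) ` L)))"

definition covol :: "'k::field set \<Rightarrow> nat \<Rightarrow> 'k vec set \<Rightarrow> real" where
  "covol R n L = frac_ideal_norm R (lattice_chi R n L)"

definition admissible_constant :: "'k::field set \<Rightarrow> nat \<Rightarrow> real \<Rightarrow> bool" where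
  "admissible_constant R n C \<longleftrightarrow>
     (\<forall>M L \<epsilon>.
        M \<in> carrier_mat n n \<and> invertible_mat M \<and> is_lattice R n L \<and>
        (\<forall>i<n. \<epsilon> i \<in> closed_norm_group R) \<and>
        canonical_norm R (det M) * covol R n L \<le> C * (\<Prod>i<n. \<epsilon> i) \<longrightarrow>
        (\<exists>x\<in>L. x \<noteq> 0\<^sub>v n \<and>
           (\<forall>i<n. canonical_norm R (\<Sum>j<n. M $$ (i, j) * x $ j) \<le> \<epsilon> i)))"

text \<open>The supremum is taken in the extended reals, so that it is meaningful whether or not the
  set of admissible constants is empty or bounded.\<close>

definition linear_constant :: "'k::field set \<Rightarrow> nat \<Rightarrow> ereal" where
  "linear_constant R n =
     Sup (ereal ` {C \<in> closed_norm_group R. admissible_constant R n C})"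

end

theory Submission
  imports Defs "HOL-Analysis.Analysis" "HOL-Library.Function_Algebras" "Jordan_Normal_Form.Char_Poly"
begin

text \<open>The theorem is Minkowski's theorem on linear forms in pigeonhole form. Let \<open>d\<close> be the degree of \<open>K\<close>
  and let \<open>|x|\<close> denote the sum of the absolute values of the \<open>d\<close> conjugates of \<open>x\<close>. In the coordinates
  of an integral basis the set \<open>|x| \<le> 1\<close> is a convex body of volume
  \<open>2\<^sup>r \<pi>\<^sup>s / (d! sqrt |\<Delta>|)\<close>. Folding this body onto the unit cube yields, for every \<open>\<rho> > 0\<close>, a finite set of
  algebraic integers with pairwise differences \<open>|x - y| \<le> \<rho>\<close> that has at least \<open>(\<rho> / 2)\<^sup>d\<close> times as many
  elements as this volume (\<open>close_integers\<close>). For \<open>\<rho> = d \<eta>\<^sup>1\<^sup>/\<^sup>d\<close> this number is \<open>\<eta> / M(K)\<close>, and by the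
  inequality of the arithmetic and geometric means a difference \<open>|x| \<le> \<rho>\<close> has norm at most \<open>\<eta>\<close>. A product of
  \<open>n\<close> such sets has more elements than there are classes modulo a subgroup of index less than
  \<open>M(K)\<^sup>-\<^sup>n \<eta>\<^sub>1 \<dots> \<eta>\<^sub>n\<close>, so the subgroup contains the difference of two of its elements (\<open>minkowski\<close>).

  To apply this to a lattice \<open>L\<close> over \<open>R\<close> and a matrix \<open>M\<close>, the quantities of the statement are expressed as
  indices of additive groups. For a subring with finite quotients and the Pruefer property, the
  decomposition of finite modules into cyclic ones shows that the covolume is the generalised index of
  \<open>L\<close> in \<open>R\<^sup>n\<close> (\<open>covol_eq_index\<close>), and row reduction shows that \<open>M\<close> multiplies such indices by the norm
  of its determinant (\<open>distortion_det\<close>). After a scaling, \<open>M L\<close> is contained in \<open>R\<^sup>n\<close>, and its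
  intersection with the integer vectors has an index that is not larger. Norms of algebraic integers do not
  increase from \<open>\<int>\<^sub>K\<close> to \<open>R\<close> (\<open>canonical_norm_integer_le\<close>). This gives the required vector under a strict
  inequality (\<open>strict_linear_form\<close>).

  The passage to the constant itself uses that the closure of the norm group is a group. Either it has
  elements below \<open>M(K)\<^sup>-\<^sup>n\<close> that come arbitrarily close, or it has a gap there; in a gap the next larger element is
  admissible, since norms cannot take values inside the gap (\<open>linear_constant_ge\<close>).

  The number of embeddings, the existence of an integral basis and the Pruefer property of overrings of
  \<open>\<int>\<^sub>K\<close> are proved along the way: the embeddings are the joint eigenvectors of multiplication on the
  functionals of \<open>K\<close>, a basis of least discriminant is integral, and Horner quotients of a
  primitive polynomial generate the unit ideal.\<close>

section \<open>Indices of additive subgroups\<close>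

definition add_subgroup :: "'a::ab_group_add set \<Rightarrow> bool" where
  "add_subgroup A \<longleftrightarrow> 0 \<in> A \<and> (\<forall>x\<in>A. \<forall>y\<in>A. x - y \<in> A)"

definition coset :: "'a::ab_group_add set \<Rightarrow> 'a \<Rightarrow> 'a set" where
  "coset B x = {y. y - x \<in> B}"

definition finite_index :: "'a::ab_group_add set \<Rightarrow> 'a set \<Rightarrow> bool" where
  "finite_index A B \<longleftrightarrow> finite (coset B ` A)"

definition index :: "'a::ab_group_add set \<Rightarrow> 'a set \<Rightarrow> nat" where
  "index A B = card (coset B ` A)"

lemma add_subgroupD:
  assumes "add_subgroup A"
  shows "0 \<in> A" "\<And>x y. x \<in> A \<Longrightarrow> y \<in> A \<Longrightarrow> x - y \<in> A" "\<And>x. x \<in> A \<Longrightarrow> - x \<in> A"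
    "\<And>x y. x \<in> A \<Longrightarrow> y \<in> A \<Longrightarrow> x + y \<in> A"
proof -
  show 0: "0 \<in> A" and 1: "\<And>x y. x \<in> A \<Longrightarrow> y \<in> A \<Longrightarrow> x - y \<in> A"
    using assms by (auto simp: add_subgroup_def)
  show 2: "- x \<in> A" if "x \<in> A" for x using 1[OF 0 that] by simp
  show "x + y \<in> A" if "x \<in> A" "y \<in> A" for x y using 1[OF that(1) 2[OF that(2)]] by simp
qed

lemma add_subgroup_sum:
  assumes "add_subgroup A" "\<And>i. i \<in> I \<Longrightarrow> f i \<in> A"
  shows "sum f I \<in> A"
  using assms(2) by (induction I rule: infinite_finite_induct) (auto simp: add_subgroupD[OF assms(1)])

lemma add_subgroup_Int: "add_subgroup A \<Longrightarrow> add_subgroup B \<Longrightarrow> add_subgroup (A \<inter> B)"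
  by (auto simp: add_subgroup_def)

lemma add_subgroup_UNIV [simp]: "add_subgroup UNIV"
  by (auto simp: add_subgroup_def)

lemma coset_eq_iff:
  assumes "add_subgroup B"
  shows "coset B x = coset B y \<longleftrightarrow> x - y \<in> B"
proof
  assume "coset B x = coset B y"
  moreover have "x \<in> coset B x" using add_subgroupD(1)[OF assms] by (simp add: coset_def)
  ultimately show "x - y \<in> B" by (auto simp: coset_def)
next
  assume *: "x - y \<in> B"
  have "z - y \<in> B" if "z - x \<in> B" for z
    using add_subgroupD(4)[OF assms that *] by simp
  moreover have "z - x \<in> B" if "z - y \<in> B" for z
    using add_subgroupD(2)[OF assms that *] by simp
  ultimately show "coset B x = coset B y" by (auto simp: coset_def)
qed

text \<open>Quotients are counted as images of arbitrary functions with the right fibres.\<close>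

lemma card_image_same_kernel:
  assumes "\<And>x y. x \<in> A \<Longrightarrow> y \<in> A \<Longrightarrow> f x = f y \<longleftrightarrow> g x = g y"
  shows "card (f ` A) = card (g ` A)" "finite (f ` A) \<longleftrightarrow> finite (g ` A)"
proof -
  define h where "h = (\<lambda>u. g (SOME x. x \<in> A \<and> f x = u))"
  have h: "h (f x) = g x" if "x \<in> A" for x
  proof -
    have "(SOME y. y \<in> A \<and> f y = f x) \<in> A \<and> f (SOME y. y \<in> A \<and> f y = f x) = f x"
      by (rule someI[where x=x]) (use that in simp)
    then show ?thesis unfolding h_def using assms that by blast
  qed
  have "inj_on h (f ` A)" using h assms by (auto simp: inj_on_def)
  moreover have "h ` f ` A = g ` A" using h by force
  ultimately have "bij_betw h (f ` A) (g ` A)" by (simp add: bij_betw_def)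
  then show "card (f ` A) = card (g ` A)" "finite (f ` A) \<longleftrightarrow> finite (g ` A)"
    by (rule bij_betw_same_card, rule bij_betw_finite)
qed

lemma index_eq_card:
  assumes "add_subgroup B" "\<And>x y. x \<in> A \<Longrightarrow> y \<in> A \<Longrightarrow> f x = f y \<longleftrightarrow> x - y \<in> B"
  shows "index A B = card (f ` A)" "finite_index A B \<longleftrightarrow> finite (f ` A)"
  unfolding index_def finite_index_def
  by (rule card_image_same_kernel; simp add: assms coset_eq_iff)+

lemma index_tower:
  assumes A: "add_subgroup A" and B: "add_subgroup B" and C: "add_subgroup C" and "C \<subseteq> B" "B \<subseteq> A"
  shows "index A C = index A B * index B C"
    "finite_index A C \<longleftrightarrow> finite_index A B \<and> finite_index B C"
proof -
  define r where "r a = (SOME y. y \<in> A \<and> coset B y = coset B a)" for a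
  define f where "f a = (coset B a, coset C (a - r a))" for a
  have r: "r a \<in> A" "a - r a \<in> B" "r a - a \<in> B" if "a \<in> A" for a
  proof -
    have *: "r a \<in> A \<and> coset B (r a) = coset B a" unfolding r_def
      by (rule someI[where x=a]) (use that in simp)
    then show "r a \<in> A" "r a - a \<in> B" using coset_eq_iff[OF B] by auto
    from * show "a - r a \<in> B" using coset_eq_iff[OF B] by metis
  qed
  have rc: "r a = r a'" if "coset B a = coset B a'" for a a'
    using that by (simp add: r_def)
  have ker: "f x = f y \<longleftrightarrow> x - y \<in> C" if "x \<in> A" "y \<in> A" for x y
  proof
    assume "f x = f y"
    then have "coset B x = coset B y" "(x - r x) - (y - r y) \<in> C"
      using coset_eq_iff[OF C] by (auto simp: f_def)
    then show "x - y \<in> C" using rc[of x y] by simp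
  next
    assume *: "x - y \<in> C"
    then have "coset B x = coset B y" using coset_eq_iff[OF B] \<open>C \<subseteq> B\<close> by auto
    then show "f x = f y" using rc[of x y] * coset_eq_iff[OF C] by (simp add: f_def)
  qed
  have im: "f ` A = coset B ` A \<times> coset C ` B"
  proof (intro equalityI subsetI)
    fix p assume "p \<in> f ` A" then show "p \<in> coset B ` A \<times> coset C ` B"
      using r by (auto simp: f_def)
  next
    fix p assume "p \<in> coset B ` A \<times> coset C ` B"
    then obtain a b where ab: "a \<in> A" "b \<in> B" "p = (coset B a, coset C b)" by auto
    have 1: "r a + b \<in> A" using r ab \<open>B \<subseteq> A\<close> add_subgroupD(4)[OF A] by blast
    have "r a + b - a \<in> B" using add_subgroupD(4)[OF B r(3)[OF ab(1)] ab(2)] by (simp add: algebra_simps)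
    then have 2: "coset B (r a + b) = coset B a" using coset_eq_iff[OF B] by blast
    then have "f (r a + b) = p" using rc[OF 2] ab by (simp add: f_def)
    with 1 show "p \<in> f ` A" by blast
  qed
  show "index A C = index A B * index B C"
    using index_eq_card(1)[OF C ker] by (simp add: im card_cartesian_product index_def)
  show "finite_index A C \<longleftrightarrow> finite_index A B \<and> finite_index B C"
  proof -
    have "coset B ` A \<noteq> {}" "coset C ` B \<noteq> {}"
      using add_subgroupD(1)[OF A] add_subgroupD(1)[OF B] by auto
    then show ?thesis
      using index_eq_card(2)[OF C ker] by (auto simp: im finite_index_def finite_cartesian_product_iff)
  qed
qed

lemma index_pos:
  assumes "add_subgroup A" "finite_index A B" shows "index A B > 0"
  using assms add_subgroupD(1)[OF assms(1)] unfolding index_def finite_index_def by (auto simp: card_gt_0_iff)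

lemma index_Int_le:
  assumes "add_subgroup A" "add_subgroup B" "A \<subseteq> C" "finite_index C B"
  shows "index A (A \<inter> B) \<le> index C B" "finite_index A (A \<inter> B)"
proof -
  have eq: "index A (A \<inter> B) = card (coset B ` A)" "finite_index A (A \<inter> B) \<longleftrightarrow> finite (coset B ` A)"
    using assms(1,2) by (intro index_eq_card; auto simp: add_subgroup_Int coset_eq_iff add_subgroupD)+
  have sub: "coset B ` A \<subseteq> coset B ` C" using assms(3) by auto
  show "finite_index A (A \<inter> B)" "index A (A \<inter> B) \<le> index C B"
    using eq assms(4) sub by (auto simp: index_def finite_index_def intro: finite_subset card_mono)
qed

lemma index_mono:
  assumes "add_subgroup A" "add_subgroup B" "B \<subseteq> A" "A \<subseteq> C" "finite_index C B"
  shows "index A B \<le> index C B" "finite_index A B"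
  using index_Int_le[OF assms(1,2,4,5)] assms(3) by (simp_all add: Int_absorb1)

lemma index_image:
  assumes "add_subgroup A" "add_subgroup B" "B \<subseteq> A" "\<And>x y. g (x - y) = g x - g y" "inj_on g A"
  shows "index (g ` A) (g ` B) = index A B" "finite_index (g ` A) (g ` B) \<longleftrightarrow> finite_index A B"
proof -
  have gB: "add_subgroup (g ` B)"
  proof -
    have "g 0 = 0" using assms(4)[of 0 0] by simp
    then have "0 \<in> g ` B" using add_subgroupD(1)[OF assms(2)] by force
    moreover have "g x - g y \<in> g ` B" if "x \<in> B" "y \<in> B" for x y
      using assms(4)[symmetric, of x y] add_subgroupD(2)[OF assms(2) that] by simp
    ultimately show ?thesis by (auto simp: add_subgroup_def)
  qed
  have k: "coset (g ` B) (g x) = coset (g ` B) (g y) \<longleftrightarrow> coset B x = coset B y" if "x \<in> A" "y \<in> A" for x y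
  proof -
    have "g x - g y \<in> g ` B \<longleftrightarrow> x - y \<in> B"
    proof
      assume "g x - g y \<in> g ` B"
      then obtain b where "b \<in> B" "g (x - y) = g b" using assms(4) by auto
      then show "x - y \<in> B" using assms(5) add_subgroupD(2)[OF assms(1) that] assms(3)
        by (metis inj_on_def subsetD)
    qed (use assms(4)[of x y] in force)
    then show ?thesis by (simp add: coset_eq_iff assms(2) gB)
  qed
  show "index (g ` A) (g ` B) = index A B" "finite_index (g ` A) (g ` B) \<longleftrightarrow> finite_index A B"
    unfolding index_def finite_index_def image_image
    using card_image_same_kernel[of A "\<lambda>x. coset (g ` B) (g x)" "coset B"] k by auto
qed

lemma add_subgroup_image:
  assumes "add_subgroup B" "\<And>x y. g (x - y) = g x - g y"
  shows "add_subgroup (g ` B)"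
proof -
  have "g 0 = 0" using assms(2)[of 0 0] by simp
  then have "0 \<in> g ` B" using add_subgroupD(1)[OF assms(1)] by force
  moreover have "g x - g y \<in> g ` B" if "x \<in> B" "y \<in> B" for x y
    using assms(2)[symmetric, of x y] add_subgroupD(2)[OF assms(1) that] by simp
  ultimately show ?thesis by (auto simp: add_subgroup_def)
qed

lemma index_less:
  assumes "add_subgroup A" "add_subgroup B" "add_subgroup C" "C \<subseteq> B" "B \<subset> A" "finite_index A C"
  shows "index B C < index A C"
proof -
  have t: "index A C = index A B * index B C" "finite_index A B" "finite_index B C"
    using index_tower[of A B C] assms by auto
  obtain a where a: "a \<in> A" "a \<notin> B" using assms(5) by auto
  have "coset B a \<noteq> coset B 0" using a coset_eq_iff[OF assms(2)] by simp
  then have "card {coset B a, coset B 0} = 2" by simp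
  moreover have "{coset B a, coset B 0} \<subseteq> coset B ` A" using a add_subgroupD(1)[OF assms(1)] by auto
  ultimately have "2 \<le> index A B" using t(2) unfolding index_def finite_index_def by (metis card_mono)
  moreover have "index B C > 0" using index_pos[OF assms(2) t(3)] .
  ultimately show ?thesis using t(1) by (simp add: less_le_trans[of _ "2 * index B C"])
qed

definition commensurable :: "'a::ab_group_add set \<Rightarrow> 'a set \<Rightarrow> bool" where
  "commensurable A B \<longleftrightarrow> add_subgroup A \<and> add_subgroup B \<and>
     finite_index A (A \<inter> B) \<and> finite_index B (A \<inter> B)"

text \<open>For a subgroup this is the index. In general it compares commensurable groups through their
  intersection, and it extends norms from ideals to fractional ideals and lattices.\<close>

definition gen_index :: "'a::ab_group_add set \<Rightarrow> 'a set \<Rightarrow> real" where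
  "gen_index A B = real (index A (A \<inter> B)) / real (index B (A \<inter> B))"

lemma finite_index_Int:
  assumes "add_subgroup A" "add_subgroup B" "add_subgroup C" "finite_index A (A \<inter> B)" "finite_index B (B \<inter> C)"
  shows "finite_index A (A \<inter> B \<inter> C)"
proof -
  have "finite_index (A \<inter> B) (A \<inter> B \<inter> (B \<inter> C))"
    using assms by (intro index_Int_le(2)) (auto simp: add_subgroup_Int)
  moreover have "A \<inter> B \<inter> (B \<inter> C) = A \<inter> B \<inter> C" by auto
  ultimately show ?thesis
    using index_tower(2)[of A "A \<inter> B" "A \<inter> B \<inter> C"] assms by (auto simp: add_subgroup_Int)
qed

lemma gen_index_eq:
  assumes "add_subgroup A" "add_subgroup B" "add_subgroup D" "D \<subseteq> A" "D \<subseteq> B"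
    "finite_index A D" "finite_index B D"
  shows "gen_index A B = real (index A D) / real (index B D)" "commensurable A B"
proof -
  have A: "index A D = index A (A \<inter> B) * index (A \<inter> B) D" "finite_index A (A \<inter> B)" "finite_index (A \<inter> B) D"
    using index_tower[of A "A \<inter> B" D] assms by (auto simp: add_subgroup_Int)
  have B: "index B D = index B (A \<inter> B) * index (A \<inter> B) D" "finite_index B (A \<inter> B)"
    using index_tower[of B "A \<inter> B" D] assms by (auto simp: add_subgroup_Int)
  have "index (A \<inter> B) D > 0" using A(3) assms by (intro index_pos) (auto simp: add_subgroup_Int)
  then show "gen_index A B = real (index A D) / real (index B D)"
    by (simp add: gen_index_def A(1) B(1))
  show "commensurable A B" using assms A B by (simp add: commensurable_def)
qed

lemma commensurable_sym: "commensurable A B \<Longrightarrow> commensurable B A"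
  by (auto simp: commensurable_def Int_commute)

text \<open>All indices are computed over the intersection of the three groups, which has finite index
  in each of them.\<close>

lemma gen_index_trans:
  assumes "commensurable A B" "commensurable B C"
  shows "gen_index A C = gen_index A B * gen_index B C" "commensurable A C"
proof -
  let ?D = "A \<inter> B \<inter> C"
  have s: "add_subgroup A" "add_subgroup B" "add_subgroup C" "add_subgroup ?D"
    using assms by (auto simp: commensurable_def add_subgroup_Int)
  have fA: "finite_index A ?D" using assms by (intro finite_index_Int) (auto simp: commensurable_def)
  have fC: "finite_index C ?D"
    using finite_index_Int[of C B A] assms by (auto simp: commensurable_def Int_ac)
  have fB: "finite_index B ?D"
  proof -
    have e: "A \<inter> B \<inter> (B \<inter> C) = ?D" by auto
    have "finite_index (A \<inter> B) ?D"
      using index_Int_le(2)[of "A \<inter> B" "B \<inter> C" B] assms s e by (auto simp: commensurable_def add_subgroup_Int)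
    moreover have "finite_index B (A \<inter> B)" using assms by (simp add: commensurable_def)
    ultimately show ?thesis using index_tower(2)[of B "A \<inter> B" ?D] s by (auto simp: add_subgroup_Int)
  qed
  have "index B ?D > 0" using index_pos s fB by blast
  moreover have "?D \<subseteq> A" "?D \<subseteq> B" "?D \<subseteq> C" by auto
  moreover note gen_index_eq(1)[of A B ?D] gen_index_eq(1)[of A C ?D] gen_index_eq(1)[of B C ?D]
  ultimately show "gen_index A C = gen_index A B * gen_index B C"
    using s fA fB fC by simp
  show "commensurable A C" by (rule gen_index_eq(2)[of A C ?D]) (use s fA fC in auto)
qed

lemma index_self: assumes "add_subgroup A" shows "index A A = 1" "finite_index A A"
proof -
  have "coset A x = coset A 0" if "x \<in> A" for x using that coset_eq_iff[OF assms] by auto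
  then have "coset A ` A = (\<lambda>_. coset A 0) ` A" by (intro image_cong refl)
  then have "coset A ` A = {coset A 0}"
    using image_constant[OF add_subgroupD(1)[OF assms]] by (simp only:)
  then show "index A A = 1" "finite_index A A" by (simp_all add: finite_index_def index_def)
qed

lemma gen_index_sub:
  assumes "add_subgroup A" "add_subgroup B" "B \<subseteq> A" "finite_index A B"
  shows "gen_index A B = index A B" "commensurable A B"
proof -
  note D = gen_index_eq[OF assms(1,2,2,3) order_refl assms(4) index_self(2)[OF assms(2)]]
  show "gen_index A B = index A B" "commensurable A B"
    by (simp only: D(1) index_self(1)[OF assms(2)] of_nat_1 div_by_1) (rule D(2))
qed

lemma gen_index_image:
  assumes "commensurable A B" "\<And>x y. g (x - y) = g x - g y" "inj_on g (A \<union> B)"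
  shows "gen_index (g ` A) (g ` B) = gen_index A B" "commensurable (g ` A) (g ` B)"
proof -
  have s: "add_subgroup A" "add_subgroup B" "add_subgroup (A \<inter> B)" 
    "finite_index A (A \<inter> B)" "finite_index B (A \<inter> B)"
    using assms by (auto simp: commensurable_def add_subgroup_Int)
  have i: "inj_on g A" "inj_on g B" using assms(3) by (auto simp: inj_on_def)
  note A = index_image[OF s(1) s(3) Int_lower1 assms(2) i(1)]
  note B = index_image[OF s(2) s(3) Int_lower2 assms(2) i(2)]
  note D = gen_index_eq[of "g ` A" "g ` B" "g ` (A \<inter> B)", OF add_subgroup_image[OF s(1) assms(2)]
      add_subgroup_image[OF s(2) assms(2)] add_subgroup_image[OF s(3) assms(2)]
      image_mono[OF Int_lower1] image_mono[OF Int_lower2] iffD2[OF A(2) s(4)] iffD2[OF B(2) s(5)]]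
  show "gen_index (g ` A) (g ` B) = gen_index A B"
    by (simp only: D(1) A(1) B(1) gen_index_def[of A B])
  show "commensurable (g ` A) (g ` B)" by (rule D(2))
qed

lemma gen_index_pos: "commensurable A B \<Longrightarrow> gen_index A B > 0"
  using index_pos[of A "A \<inter> B"] index_pos[of B "A \<inter> B"] by (simp add: gen_index_def commensurable_def)

section \<open>Ideals of a subring of a field\<close>

definition ideal_in :: "'k::field set \<Rightarrow> 'k set \<Rightarrow> bool" where
  "ideal_in R I \<longleftrightarrow> add_subgroup I \<and> I \<subseteq> R \<and> (\<forall>r\<in>R. \<forall>x\<in>I. r * x \<in> I)"

text \<open>The last assumption is the Pruefer property: the fractional ideal \<open>R + r R\<close> is
  invertible, because the elements \<open>c\<close> and \<open>r c\<close> generate its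
  product with the inverse \<open>{c. c \<in> R \<and> r c \<in> R}\<close>.\<close>

locale dedekind_subring =
  fixes R :: "'k::field_char_0 set"
  assumes R_diff: "x \<in> R \<Longrightarrow> y \<in> R \<Longrightarrow> x - y \<in> R"
    and R_mult: "x \<in> R \<Longrightarrow> y \<in> R \<Longrightarrow> x * y \<in> R"
    and R_1 [simp]: "1 \<in> R"
    and finite_quotient: "x \<in> R \<Longrightarrow> x \<noteq> 0 \<Longrightarrow> finite_index R ((*) x ` R)"
    and fraction: "\<exists>a\<in>R. \<exists>b\<in>R. b \<noteq> 0 \<and> k = a / b"
    and prufer: "ideal_in R J \<Longrightarrow> (\<And>c. c \<in> R \<Longrightarrow> r * c \<in> R \<Longrightarrow> c \<in> J \<and> r * c \<in> J) \<Longrightarrow> 1 \<in> J"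
begin

declare R_mult [simp] R_diff [simp]

lemma R_0 [simp]: "0 \<in> R" using R_diff[of 1 1] by simp

lemma R_subgroup [simp]: "add_subgroup R" using R_diff by (simp add: add_subgroup_def)

lemmas R_add [simp] = add_subgroupD(4)[OF R_subgroup]
lemmas R_uminus [simp] = add_subgroupD(3)[OF R_subgroup]

lemma R_of_nat [simp]: "of_nat n \<in> R" by (induction n) auto

lemma R_power [simp]: "x \<in> R \<Longrightarrow> x ^ n \<in> R" by (induction n) auto

lemma R_prod: "(\<And>i. i \<in> A \<Longrightarrow> f i \<in> R) \<Longrightarrow> prod f A \<in> R"
  by (induction A rule: infinite_finite_induct) auto

lemma idealD:
  assumes "ideal_in R I"
  shows "add_subgroup I" "I \<subseteq> R" "\<And>r x. r \<in> R \<Longrightarrow> x \<in> I \<Longrightarrow> r * x \<in> I"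
    "\<And>x. x \<in> I \<Longrightarrow> x \<in> R" "0 \<in> I" "\<And>x y. x \<in> I \<Longrightarrow> y \<in> I \<Longrightarrow> x + y \<in> I"
    "\<And>x y. x \<in> I \<Longrightarrow> y \<in> I \<Longrightarrow> x - y \<in> I" "\<And>x. x \<in> I \<Longrightarrow> - x \<in> I" "\<And>r x. r \<in> R \<Longrightarrow> x \<in> I \<Longrightarrow> x * r \<in> I"
proof -
  have s: "add_subgroup I" and sub: "I \<subseteq> R" and m: "\<And>r x. r \<in> R \<Longrightarrow> x \<in> I \<Longrightarrow> r * x \<in> I"
    using assms unfolding ideal_in_def by blast+
  show "add_subgroup I" "I \<subseteq> R" "\<And>x. x \<in> I \<Longrightarrow> x \<in> R" using s sub by blast+
  show "\<And>r x. r \<in> R \<Longrightarrow> x \<in> I \<Longrightarrow> r * x \<in> I" "\<And>r x. r \<in> R \<Longrightarrow> x \<in> I \<Longrightarrow> x * r \<in> I"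
    using m by (simp_all add: mult.commute)
  show "0 \<in> I" "\<And>x y. x \<in> I \<Longrightarrow> y \<in> I \<Longrightarrow> x + y \<in> I"
    "\<And>x y. x \<in> I \<Longrightarrow> y \<in> I \<Longrightarrow> x - y \<in> I" "\<And>x. x \<in> I \<Longrightarrow> - x \<in> I"
    by (fact add_subgroupD[OF s])+
qed

lemma ideal_R [simp]: "ideal_in R R" by (auto simp: ideal_in_def)

lemma principal_ideal:
  assumes "x \<in> R"
  shows "ideal_in R ((*) x ` R)"
proof -
  have "add_subgroup ((*) x ` R)"
    by (rule add_subgroup_image[OF R_subgroup]) (simp add: right_diff_distrib)
  moreover have "(*) x ` R \<subseteq> R" using assms by (intro image_subsetI) simp
  moreover have "r * y \<in> (*) x ` R" if r: "r \<in> R" "y \<in> (*) x ` R" for r y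
  proof -
    obtain z where "y = x * z" "z \<in> R" using r(2) by (rule imageE)
    then have "r * y = x * (r * z)" "r * z \<in> R" using r(1) by simp_all
    then show ?thesis by (rule image_eqI)
  qed
  ultimately show ?thesis by (simp add: ideal_in_def)
qed

lemma scale_subgroup: "add_subgroup A \<Longrightarrow> add_subgroup ((*) (x::'k) ` A)"
  by (rule add_subgroup_image) (simp_all add: right_diff_distrib)

lemma ideal_finite_index:
  assumes "ideal_in R I" "I \<noteq> {0}"
  shows "finite_index R I"
proof -
  obtain x where x: "x \<in> I" "x \<noteq> 0" using assms idealD(5)[OF assms(1)] by blast
  have sub: "(*) x ` R \<subseteq> I" using idealD(9)[OF assms(1) _ x(1)] by blast
  show ?thesis
    using index_tower(2)[OF R_subgroup idealD(1)[OF assms(1)] scale_subgroup[OF R_subgroup] sub idealD(2)[OF assms(1)]]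
      finite_quotient[OF idealD(4)[OF assms(1) x(1)] x(2)] by simp
qed

definition prime_in :: "'k set \<Rightarrow> bool" where
  "prime_in P \<longleftrightarrow> ideal_in R P \<and> P \<noteq> {0} \<and> 1 \<notin> P \<and> (\<forall>a\<in>R. \<forall>b\<in>R. a * b \<in> P \<longrightarrow> a \<in> P \<or> b \<in> P)"

lemma primeD:
  assumes "prime_in P"
  shows "ideal_in R P" "P \<noteq> {0}" "1 \<notin> P" "\<And>a b. a \<in> R \<Longrightarrow> b \<in> R \<Longrightarrow> a \<notin> P \<Longrightarrow> b \<notin> P \<Longrightarrow> a * b \<notin> P"
  using assms unfolding prime_in_def by blast+

lemma prime_power_notin: "prime_in P \<Longrightarrow> u \<in> R \<Longrightarrow> u \<notin> P \<Longrightarrow> u ^ e \<notin> P"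
  by (induction e) (simp_all add: primeD(3,4) R_power)

lemma prime_prod_notin:
  assumes "prime_in P" "\<And>i. i \<in> A \<Longrightarrow> f i \<in> R - P"
  shows "prod f A \<in> R - P"
  using assms(2) by (induction A rule: infinite_finite_induct) (simp_all add: primeD(3,4)[OF assms(1)] R_mult)

lemma prime_inverse:
  assumes P: "prime_in P" and a: "a \<in> R" "a \<notin> P"
  obtains s where "s \<in> R" "1 - s * a \<in> P"
proof -
  note PI = idealD[OF primeD(1)[OF P]]
  have fin: "finite (coset P ` R)"
    using ideal_finite_index[OF primeD(1,2)[OF P]] by (simp add: finite_index_def)
  have "coset P (a * x) = coset P (a * y) \<longleftrightarrow> coset P x = coset P y" if "x \<in> R" "y \<in> R" for x y
  proof -
    have "a * (x - y) \<in> P \<longleftrightarrow> x - y \<in> P"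
      using primeD(4)[OF P a(1) R_diff[OF that] a(2)] PI(3)[OF a(1), of "x - y"] by (cases "x - y \<in> P") simp_all
    then show ?thesis by (simp add: coset_eq_iff[OF PI(1)] right_diff_distrib)
  qed
  then have c: "card ((\<lambda>x. coset P (a * x)) ` R) = card (coset P ` R)"
    by (rule card_image_same_kernel(1))
  have "(\<lambda>x. coset P (a * x)) ` R \<subseteq> coset P ` R" using a by (simp add: image_subset_iff)
  then have "(\<lambda>x. coset P (a * x)) ` R = coset P ` R" using c by (rule card_subset_eq[OF fin])
  then have "coset P 1 \<in> (\<lambda>x. coset P (a * x)) ` R" by simp
  then obtain s where "s \<in> R" "coset P 1 = coset P (a * s)" by (rule imageE)
  then show ?thesis using that[of s] by (simp add: coset_eq_iff[OF PI(1)] mult.commute)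
qed

text \<open>The localisation at \<open>P\<close> is a valuation ring. The Pruefer property for the
  quotient of \<open>a\<close> and \<open>b\<close> yields a multiplier outside
  \<open>P\<close>, because \<open>P\<close> is proper.\<close>

lemma local_dichotomy:
  assumes P: "prime_in P"
  shows "\<exists>u\<in>R - P. u * a \<in> (*) b ` R \<or> u * b \<in> (*) a ` R"
proof (cases "b = 0")
  case True
  then have "1 * b \<in> (*) a ` R" by (intro image_eqI[of _ _ 0]) simp_all
  then show ?thesis using primeD(3)[OF P] by (intro bexI[of _ 1]) simp_all
next
  case False
  define r where "r = a / b"
  have ab: "a = r * b" using False by (simp add: r_def)
  have "\<not> (\<forall>c. c \<in> R \<longrightarrow> r * c \<in> R \<longrightarrow> c \<in> P \<and> r * c \<in> P)"
    using prufer[of P r] primeD(1,3)[OF P] by blast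
  then obtain c where c: "c \<in> R" "r * c \<in> R" "c \<notin> P \<or> r * c \<notin> P" by blast
  from c(3) show ?thesis
  proof
    assume "c \<notin> P"
    moreover have "c * a = b * (r * c)" using ab by simp
    ultimately show ?thesis using c by blast
  next
    assume "r * c \<notin> P"
    moreover have "(r * c) * b = a * c" using ab by simp
    ultimately show ?thesis using c by blast
  qed
qed

text \<open>Divisibility at \<open>P\<close> is total and quotients are finite, so some element of the
  ideal divides all others at \<open>P\<close>.\<close>

lemma local_generator:
  assumes P: "prime_in P" and I: "ideal_in R I" "I \<noteq> {0}"
  obtains a u where "a \<in> I" "a \<noteq> 0" "u \<in> R" "u \<notin> P" "\<forall>b\<in>I. u * b \<in> (*) a ` R"
proof -
  note PI = idealD[OF primeD(1)[OF P]] and II = idealD[OF I(1)]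
  define C where "C a = (*) a ` R" for a
  have C_id: "ideal_in R (C a)" if "a \<in> R" for a unfolding C_def by (rule principal_ideal[OF that])
  have CI: "a * r \<in> C a" if "r \<in> R" for a r using that by (auto simp: C_def)
  have CE: "\<exists>r\<in>R. x = a * r" if "x \<in> C a" for a x using that by (auto simp: C_def)
  define D where "D a = {b \<in> I. \<exists>u. u \<in> R \<and> u \<notin> P \<and> u * b \<in> C a}" for a
  have DI: "x \<in> D a" if "x \<in> I" "u \<in> R" "u \<notin> P" "u * x \<in> C a" for x a u
    unfolding D_def using that by blast
  have DE: "x \<in> I \<and> (\<exists>u. u \<in> R \<and> u \<notin> P \<and> u * x \<in> C a)" if "x \<in> D a" for x a
    using that unfolding D_def by blast
  have aD: "a \<in> D a" if "a \<in> I" for a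
    using CI[of 1 a] primeD(3)[OF P] that by (intro DI[of a 1]) simp_all
  have Did: "ideal_in R (D a)" if "a \<in> I" for a
  proof -
    have aR: "a \<in> R" using that II by blast
    note aI = idealD[OF C_id[OF aR]]
    have 1: "x - y \<in> D a" if xy: "x \<in> D a" "y \<in> D a" for x y
    proof -
      obtain u v where uv: "u \<in> R" "u \<notin> P" "v \<in> R" "v \<notin> P" "u * x \<in> C a" "v * y \<in> C a"
        using DE[OF xy(1)] DE[OF xy(2)] by blast
      have "v * (u * x) - u * (v * y) \<in> C a" by (rule aI(7)[OF aI(3)[OF uv(3,5)] aI(3)[OF uv(1,6)]])
      then have "(u * v) * (x - y) \<in> C a" by (simp add: algebra_simps)
      then show ?thesis using DE[OF xy(1)] DE[OF xy(2)] uv primeD(4)[OF P] II(7)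
        by (intro DI[of _ "u * v"]) simp_all
    qed
    have 2: "r * x \<in> D a" if r: "r \<in> R" "x \<in> D a" for r x
    proof -
      obtain u where u: "u \<in> R" "u \<notin> P" "u * x \<in> C a" using DE[OF r(2)] by blast
      then have "r * (u * x) \<in> C a" using r(1) by (rule_tac aI(3))
      then have "u * (r * x) \<in> C a" by (simp add: algebra_simps)
      then show ?thesis using u r II(3) DE[OF r(2)] by (intro DI[of _ u]) simp_all
    qed
    have "0 \<in> D a" using 1[OF aD[OF that] aD[OF that]] by simp
    moreover have "D a \<subseteq> R" using II(2) unfolding D_def by blast
    ultimately show "ideal_in R (D a)" using 1 2 unfolding ideal_in_def add_subgroup_def by blast
  qed
  obtain x0 where x0: "x0 \<in> I" "x0 \<noteq> 0" using I II(5) by blast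
  define S where "S = {index R (D a) | a. a \<in> I \<and> a \<noteq> 0}"
  have "S \<noteq> {}" using x0 unfolding S_def by blast
  then have "Inf S \<in> S" by (rule Inf_nat_def1)
  then obtain a where a: "a \<in> I" "a \<noteq> 0" "index R (D a) = Inf S" unfolding S_def by force
  have aR: "a \<in> R" using a(1) by (rule II(4))
  have min: "index R (D a) \<le> index R (D b)" if "b \<in> I" "b \<noteq> 0" for b
    unfolding a(3) by (rule cInf_lower) (use that in \<open>auto simp: S_def\<close>)
  have DaI: "D a = I"
  proof (rule ccontr)
    assume "D a \<noteq> I"
    then obtain b where b: "b \<in> I" "b \<notin> D a" unfolding D_def by blast
    note Db = idealD[OF Did[OF b(1)]] and Da = idealD[OF Did[OF a(1)]]
    have b0: "b \<noteq> 0" using b Da(5) by blast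
    obtain u where u: "u \<in> R" "u \<notin> P" "u * a \<in> C b"
    proof -
      obtain u where u: "u \<in> R - P" "u * a \<in> C b \<or> u * b \<in> C a"
        using local_dichotomy[OF P, of a b] unfolding C_def by (rule bexE)
      then have "u * b \<notin> C a" using DI[OF b(1), of u a] b(2) by auto
      then show ?thesis using that[of u] u by simp
    qed
    have "D a \<subseteq> D b"
    proof
      fix x assume x: "x \<in> D a"
      obtain v where v: "v \<in> R" "v \<notin> P" "v * x \<in> C a" using DE[OF x] by blast
      obtain y where y: "v * x = a * y" "y \<in> R" using CE[OF v(3)] by blast
      obtain z where z: "u * a = b * z" "z \<in> R" using CE[OF u(3)] by blast
      have "(u * v) * x = u * (v * x)" by simp
      also have "\<dots> = (u * a) * y" using y by simp
      also have "\<dots> = b * (z * y)" using z by simp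
      finally have "(u * v) * x \<in> C b" using CI[of "z * y" b] z y by simp
      then show "x \<in> D b" using u v primeD(4)[OF P] DE[OF x] by (intro DI[of _ "u * v"]) simp_all
    qed
    with b aD[OF b(1)] have sub: "D a \<subset> D b" by blast
    have "finite_index R (D a)"
      by (rule ideal_finite_index[OF Did[OF a(1)]]) (use aD[OF a(1)] a(2) in blast)
    then have t: "index R (D a) = index R (D b) * index (D b) (D a)" 
      "finite_index R (D b)" "finite_index (D b) (D a)"
      using index_tower[OF R_subgroup Db(1) Da(1) _ Db(2)] sub by (simp_all add: less_imp_le)
    have "index (D a) (D a) < index (D b) (D a)"
      by (rule index_less[OF Db(1) Da(1) Da(1) order_refl sub t(3)])
    then have "index (D b) (D a) > 1" using index_self(1)[OF Da(1)] by simp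
    moreover have "index R (D b) > 0" by (rule index_pos[OF R_subgroup t(2)])
    ultimately have "index R (D b) < index R (D a)" using t(1) by simp
    with min[OF b(1) b0] show False by simp
  qed
  note CI' = idealD[OF C_id[OF aR]]
  have CsubI: "C a \<subseteq> I" using a II(9) by (auto simp: C_def)
  have "finite (coset (C a) ` I)"
    using index_tower(2)[OF R_subgroup II(1) CI'(1) CsubI II(2)] finite_quotient[OF aR a(2)]
    by (simp add: finite_index_def C_def[symmetric])
  then obtain T where T: "finite T" "T \<subseteq> I" "coset (C a) ` T = coset (C a) ` I"
    using finite_subset_image[OF _ order_refl, of "coset (C a)" I] by metis
  have "\<forall>t\<in>T. \<exists>u. (u \<in> R \<and> u \<notin> P) \<and> u * t \<in> C a"
  proof
    fix t assume "t \<in> T"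
    then have "t \<in> D a" using T(2) DaI by (simp add: subset_iff)
    from DE[OF this] show "\<exists>u. (u \<in> R \<and> u \<notin> P) \<and> u * t \<in> C a" by simp
  qed
  then obtain v where v: "\<And>t. t \<in> T \<Longrightarrow> v t \<in> R \<and> v t \<notin> P" "\<And>t. t \<in> T \<Longrightarrow> v t * t \<in> C a" by metis
  have vP: "prod v T \<in> R - P" by (rule prime_prod_notin[OF P]) (use v(1) in simp)
  have "prod v T * b \<in> C a" if "b \<in> I" for b
  proof -
    have "coset (C a) b \<in> coset (C a) ` T" unfolding T(3) using that by (rule imageI)
    then obtain t where t: "t \<in> T" "coset (C a) b = coset (C a) t" by (rule imageE)
    have "prod v T = prod v (T - {t}) * v t" using T(1) t(1) by (simp add: prod.remove mult.commute)
    then have "prod v T * t = prod v (T - {t}) * (v t * t)" by simp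
    also have "\<dots> \<in> C a"
    proof (rule CI'(3)[OF R_prod v(2)[OF t(1)]])
      fix i assume "i \<in> T - {t}" then show "v i \<in> R" using v(1) by simp
    qed
    finally have 1: "prod v T * t \<in> C a" .
    have "b - t \<in> C a" using t(2) coset_eq_iff[OF CI'(1)] by blast
    then have "prod v T * (b - t) \<in> C a" using vP by (rule_tac CI'(3)) simp_all
    then have "prod v T * (b - t) + prod v T * t \<in> C a" using 1 by (rule CI'(6))
    then show ?thesis by (simp add: algebra_simps)
  qed
  then show ?thesis using that[OF a(1,2), of "prod v T"] vP by (simp add: C_def)
qed

end

lemma ring_on_simps [simp]:
  "carrier (ring_on R) = R" "x \<otimes>\<^bsub>ring_on R\<^esub> y = x * y" "x \<oplus>\<^bsub>ring_on R\<^esub> y = x + y"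
  "\<zero>\<^bsub>ring_on R\<^esub> = 0" "\<one>\<^bsub>ring_on R\<^esub> = 1"
  by (simp_all add: ring_on_def field_ring_def)

context dedekind_subring
begin

lemma cring_ring_on: "cring (ring_on R)"
proof (rule cringI)
  show "abelian_group (ring_on R)"
  proof (rule abelian_groupI)
    fix x assume "x \<in> carrier (ring_on R)"
    then show "\<exists>y\<in>carrier (ring_on R). y \<oplus>\<^bsub>ring_on R\<^esub> x = \<zero>\<^bsub>ring_on R\<^esub>"
      by (intro bexI[of _ "- x"]) simp_all
  qed (simp_all add: add.assoc add.commute)
  show "Group.comm_monoid (ring_on R)"
    by (rule comm_monoidI) (simp_all add: mult.assoc mult.commute)
qed (simp add: distrib_right)

lemma ideal_iff: "ideal I (ring_on R) \<longleftrightarrow> ideal_in R I"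
proof
  interpret cring "ring_on R" by (rule cring_ring_on)
  assume "ideal I (ring_on R)"
  then interpret I: ideal I "ring_on R" .
  have 0: "0 \<in> I" using I.zero_closed by simp
  have add: "x + y \<in> I" if "x \<in> I" "y \<in> I" for x y using I.a_closed that by simp
  have m: "r * x \<in> I" if "r \<in> R" "x \<in> I" for r x using I.I_l_closed that by simp
  have "x - y \<in> I" if "x \<in> I" "y \<in> I" for x y
    using add[OF that(1) m[of "-1", OF _ that(2)]] by simp
  moreover have "I \<subseteq> R" using I.a_subset by simp
  ultimately show "ideal_in R I" using 0 m by (simp add: ideal_in_def add_subgroup_def)
next
  assume I: "ideal_in R I"
  note II = idealD[OF I]
  show "ideal I (ring_on R)"
  proof (rule idealI)
    show "ring (ring_on R)" using cring_ring_on by (simp add: cring_def)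
    show "subgroup I (add_monoid (ring_on R))"
    proof
      fix x assume x: "x \<in> I"
      interpret cring "ring_on R" by (rule cring_ring_on)
      have "\<ominus>\<^bsub>ring_on R\<^esub> x = - x"
        by (rule minus_equality) (use II(4)[OF x] in simp_all)
      then show "inv\<^bsub>add_monoid (ring_on R)\<^esub> x \<in> I" using II(8)[OF x] by (simp add: a_inv_def)
    qed (use II in simp_all)
  qed (use II in simp_all)
qed

lemma prime_iff: "primeideal P (ring_on R) \<and> P \<noteq> {0} \<longleftrightarrow> prime_in P"
proof
  assume *: "primeideal P (ring_on R) \<and> P \<noteq> {0}"
  then interpret primeideal P "ring_on R" by simp
  have I: "ideal_in R P" using is_ideal ideal_iff by simp
  have "1 \<notin> P"
  proof
    assume 1: "1 \<in> P"
    have "r \<in> P" if "r \<in> R" for r using idealD(3)[OF I that 1] by simp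
    then have "R = P" using idealD(2)[OF I] by blast
    with I_notcarr show False by simp
  qed
  then show "prime_in P" using * I I_prime by (simp add: prime_in_def)
next
  assume P: "prime_in P"
  interpret cring "ring_on R" by (rule cring_ring_on)
  have "primeideal P (ring_on R)"
    by (rule primeidealI) (use primeD[OF P] cring_ring_on R_1 in \<open>auto simp: ideal_iff\<close>)
  then show "primeideal P (ring_on R) \<and> P \<noteq> {0}" using primeD(2)[OF P] by simp
qed

section \<open>Products of ideals\<close>

abbreviation IP :: "'k set \<Rightarrow> 'k set \<Rightarrow> 'k set" where
  "IP I J \<equiv> ideal_prod (ring_on R) I J"

lemma IP_prod: "i \<in> I \<Longrightarrow> j \<in> J \<Longrightarrow> i * j \<in> IP I J"
  using ideal_prod.prod[of i I j J "ring_on R"] by simp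

lemma IP_induct [consumes 1, case_names prod sum]:
  assumes "x \<in> IP I J" "\<And>i j. i \<in> I \<Longrightarrow> j \<in> J \<Longrightarrow> Q (i * j)"
    "\<And>x y. x \<in> IP I J \<Longrightarrow> y \<in> IP I J \<Longrightarrow> Q x \<Longrightarrow> Q y \<Longrightarrow> Q (x + y)"
  shows "Q x"
  using assms(1) by (induction rule: ideal_prod.induct) (simp_all add: assms(2,3))

lemma IP_ideal: "ideal_in R I \<Longrightarrow> ideal_in R J \<Longrightarrow> ideal_in R (IP I J)"
proof -
  interpret cring "ring_on R" by (rule cring_ring_on)
  show "ideal_in R I \<Longrightarrow> ideal_in R J \<Longrightarrow> ideal_in R (IP I J)"
    using ideal_prod_is_ideal[of I J] by (simp add: ideal_iff)
qed

lemma IP_R: "ideal_in R I \<Longrightarrow> IP I R = I" "ideal_in R I \<Longrightarrow> IP R I = I"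
proof -
  interpret cring "ring_on R" by (rule cring_ring_on)
  show "ideal_in R I \<Longrightarrow> IP I R = I" "ideal_in R I \<Longrightarrow> IP R I = I"
    using ideal_prod_one[of I] ideal_prod_commute[of I R] by (simp_all add: ideal_iff)
qed

lemma IP_assoc: "ideal_in R I \<Longrightarrow> ideal_in R J \<Longrightarrow> ideal_in R K \<Longrightarrow> IP (IP I J) K = IP I (IP J K)"
proof -
  interpret cring "ring_on R" by (rule cring_ring_on)
  show "ideal_in R I \<Longrightarrow> ideal_in R J \<Longrightarrow> ideal_in R K \<Longrightarrow> IP (IP I J) K = IP I (IP J K)"
    using ideal_prod_assoc[of I J K] by (simp add: ideal_iff)
qed

lemma nonzero_elem: "ideal_in R I \<Longrightarrow> I \<noteq> {0} \<Longrightarrow> \<exists>x\<in>I. x \<noteq> 0"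
  using idealD(5) by (metis insertCI singletonI subsetI subset_singletonD empty_iff singletonD)

lemma IP_nonzero:
  assumes "ideal_in R I" "I \<noteq> {0}" "ideal_in R J" "J \<noteq> {0}"
  shows "IP I J \<noteq> {0}"
proof -
  obtain x where x: "x \<in> I" "x \<noteq> 0" using nonzero_elem[OF assms(1,2)] by (rule bexE)
  obtain y where y: "y \<in> J" "y \<noteq> 0" using nonzero_elem[OF assms(3,4)] by (rule bexE)
  have "x * y \<in> IP I J" "x * y \<noteq> 0" using IP_prod[OF x(1) y(1)] x y by simp_all
  then show ?thesis by (metis singletonD)
qed

lemma IP_subset_right:
  assumes "ideal_in R I" "ideal_in R J" shows "IP I J \<subseteq> J"
proof
  fix x assume "x \<in> IP I J"
  then show "x \<in> J"
  proof (induction rule: IP_induct)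
    case (prod i j) then show ?case using idealD(3)[OF assms(2)] idealD(4)[OF assms(1)] by simp
  next
    case (sum x y) then show ?case using idealD(6)[OF assms(2)] by simp
  qed
qed

text \<open>The quotient of \<open>I\<close> by \<open>P I\<close> is a line over the field \<open>R /
  P\<close>, spanned by a local generator of \<open>I\<close>.\<close>

lemma index_prime_times:
  assumes P: "prime_in P" and I: "ideal_in R I" "I \<noteq> {0}"
  shows "index I (IP P I) = index R P"
proof -
  obtain a u where a: "a \<in> I" "a \<noteq> 0" "u \<in> R" "u \<notin> P" "\<forall>b\<in>I. u * b \<in> (*) a ` R"
    by (rule local_generator[OF P I])
  note PI = idealD[OF primeD(1)[OF P]] and II = idealD[OF I(1)]
    and LI = idealD[OF IP_ideal[OF primeD(1)[OF P] I(1)]]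
  have loc: "\<exists>p\<in>P. u * x = a * p" if "x \<in> IP P I" for x
    using that
  proof (induction rule: IP_induct)
    case (prod p b)
    obtain r where r: "u * b = a * r" "r \<in> R" using bspec[OF a(5) prod(2)] by (rule imageE)
    have "u * (p * b) = p * (u * b)" by simp
    also have "\<dots> = a * (r * p)" unfolding r(1) by simp
    finally have "u * (p * b) = a * (r * p)" .
    moreover have "r * p \<in> P" by (rule PI(3)[OF r(2) prod(1)])
    ultimately show ?case by (rule bexI)
  next
    case (sum x y)
    obtain p where p: "p \<in> P" "u * x = a * p" using sum(3) by (rule bexE)
    obtain q where q: "q \<in> P" "u * y = a * q" using sum(4) by (rule bexE)
    have "u * (x + y) = a * (p + q)" "p + q \<in> P" using p q PI(6) by (simp_all add: distrib_left)
    then show ?case by (rule bexI)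
  qed
  define f where "f r = coset (IP P I) (r * a)" for r
  have ker: "f r = f r' \<longleftrightarrow> r - r' \<in> P" if "r \<in> R" "r' \<in> R" for r r'
  proof -
    have "(r - r') * a \<in> IP P I \<longleftrightarrow> r - r' \<in> P"
    proof
      assume "(r - r') * a \<in> IP P I"
      then obtain p where p: "p \<in> P" "u * ((r - r') * a) = a * p" using loc by blast
      have "a * (u * (r - r')) = a * p" using p(2) by (simp add: mult_ac)
      then have "u * (r - r') = p" using a(2) by simp
      then show "r - r' \<in> P" using p primeD(4)[OF P a(3) R_diff[OF that] a(4)] by metis
    qed (rule IP_prod[OF _ a(1)])
    then show ?thesis unfolding f_def coset_eq_iff[OF LI(1)] by (simp add: left_diff_distrib)
  qed
  have "f ` R = coset (IP P I) ` I"
  proof (intro equalityI subsetI)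
    fix X assume "X \<in> f ` R"
    then obtain r where "X = f r" "r \<in> R" by (rule imageE)
    then show "X \<in> coset (IP P I) ` I" using II(3)[OF _ a(1)] by (simp add: f_def)
  next
    fix X assume "X \<in> coset (IP P I) ` I"
    then obtain b where b: "X = coset (IP P I) b" "b \<in> I" by (rule imageE)
    obtain c where c: "u * b = a * c" "c \<in> R" using bspec[OF a(5) b(2)] by (rule imageE)
    obtain s where s: "s \<in> R" "1 - s * u \<in> P" by (rule prime_inverse[OF P a(3,4)])
    have "b - (s * c) * a = (1 - s * u) * b"
      using c(1) by (simp add: algebra_simps)
    also have "\<dots> \<in> IP P I" by (rule IP_prod[OF s(2) b(2)])
    finally have "X = f (s * c)" by (simp add: b f_def coset_eq_iff[OF LI(1)])
    moreover have "s * c \<in> R" using s c by simp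
    ultimately show "X \<in> f ` R" by (rule image_eqI)
  qed
  moreover have "index R P = card (f ` R)" by (rule index_eq_card(1)[OF PI(1) ker])
  ultimately show ?thesis by (simp add: index_def)
qed

text \<open>The index need not be known to be multiplicative for all ideals: products of primes suffice
  for the ideal \<open>\<chi>\<close>.\<close>

definition multiplicative_ideal :: "'k set \<Rightarrow> bool" where
  "multiplicative_ideal J \<longleftrightarrow> ideal_in R J \<and> J \<noteq> {0} \<and>
     (\<forall>B. ideal_in R B \<longrightarrow> B \<noteq> {0} \<longrightarrow> index R (IP J B) = index R J * index R B)"

lemma multiplicativeD:
  assumes "multiplicative_ideal J"
  shows "ideal_in R J" "J \<noteq> {0}"
    "\<And>B. ideal_in R B \<Longrightarrow> B \<noteq> {0} \<Longrightarrow> index R (IP J B) = index R J * index R B"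
  using assms by (simp_all add: multiplicative_ideal_def)

lemma ideal_index_tower:
  assumes "ideal_in R I" "ideal_in R J" "J \<noteq> {0}" "J \<subseteq> I"
  shows "index R J = index R I * index I J" "finite_index R I" "finite_index I J"
  using index_tower[OF R_subgroup idealD(1)[OF assms(1)] idealD(1)[OF assms(2)] assms(4) idealD(2)[OF assms(1)]]
    ideal_finite_index[OF assms(2,3)] by simp_all

lemma multiplicative_prime: "prime_in P \<Longrightarrow> multiplicative_ideal P"
  using ideal_index_tower(1)[OF _ IP_ideal IP_nonzero IP_subset_right]
  by (simp add: multiplicative_ideal_def index_prime_times primeD)

lemma R_nonzero: "R \<noteq> {0}" using R_1 by (metis singletonD zero_neq_one)

lemma multiplicative_R: "multiplicative_ideal R"
  using IP_R(2) index_self(1)[OF R_subgroup] R_nonzero by (simp add: multiplicative_ideal_def)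

lemma multiplicative_IP:
  assumes "multiplicative_ideal I" "multiplicative_ideal J"
  shows "multiplicative_ideal (IP I J)"
  using assms by (simp add: multiplicative_ideal_def IP_ideal IP_nonzero IP_assoc)

abbreviation PW :: "'k set \<Rightarrow> nat \<Rightarrow> 'k set" where
  "PW P e \<equiv> ideal_power (ring_on R) P e"

lemma PW_0 [simp]: "PW P 0 = R" and PW_Suc: "PW P (Suc e) = IP P (PW P e)"
  by (simp_all add: ideal_power_def)

lemma multiplicative_PW: "prime_in P \<Longrightarrow> multiplicative_ideal (PW P e)"
  by (induction e) (simp_all add: PW_Suc multiplicative_R multiplicative_prime multiplicative_IP)

lemma PW_ideal: "prime_in P \<Longrightarrow> ideal_in R (PW P e)" "prime_in P \<Longrightarrow> PW P e \<noteq> {0}"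
  using multiplicative_PW by (simp_all add: multiplicative_ideal_def)

lemma PW_1: "prime_in P \<Longrightarrow> PW P (Suc 0) = P"
  by (simp add: PW_Suc IP_R primeD)

lemma PW_antimono:
  assumes "prime_in P" "i \<le> j" shows "PW P j \<subseteq> PW P i"
  using assms(2)
proof (induction rule: dec_induct)
  case (step j) then show ?case
    using IP_subset_right[OF primeD(1) PW_ideal(1), OF assms(1,1), of j] unfolding PW_Suc by simp
qed simp

lemma index_prime_ge_2:
  assumes "prime_in P" shows "index R P \<ge> 2"
proof -
  note PI = primeD[OF assms]
  have "P \<subset> R" using idealD(2)[OF PI(1)] PI(3) R_1 by blast
  then have "index P P < index R P"
    using index_less[OF R_subgroup idealD(1)[OF PI(1)] idealD(1)[OF PI(1)] order_refl] ideal_finite_index[OF PI(1,2)]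
    by simp
  then show ?thesis using index_self(1)[OF idealD(1)[OF PI(1)]] by simp
qed

lemma index_PW: "prime_in P \<Longrightarrow> index R (PW P e) = index R P ^ e"
  by (induction e)
     (simp_all add: index_self PW_Suc multiplicativeD(3)[OF multiplicative_prime] PW_ideal)

lemma PW_strict: "prime_in P \<Longrightarrow> \<not> PW P e \<subseteq> PW P (Suc e)"
proof
  assume P: "prime_in P" and "PW P e \<subseteq> PW P (Suc e)"
  then have "PW P e = PW P (Suc e)" using PW_antimono[OF P, of e "Suc e"] by simp
  then have "index R P ^ e = index R P ^ Suc e" using index_PW[OF P] by metis
  then show False using index_prime_ge_2[OF P] by simp
qed

lemma unit_mod_PW:
  assumes P: "prime_in P" and v: "v \<in> R" "v \<notin> P"
  obtains s where "s \<in> R" "1 - s * v \<in> PW P e"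
proof -
  obtain t where t: "t \<in> R" "1 - t * v \<in> P" by (rule prime_inverse[OF P v])
  have "\<exists>s\<in>R. 1 - s * v \<in> PW P e"
  proof (induction e)
    case 0 show ?case by (intro bexI[of _ 0]) simp_all
  next
    case (Suc e)
    then obtain s where s: "s \<in> R" "1 - s * v \<in> PW P e" by (rule bexE)
    have "(1 - t * v) * (1 - s * v) \<in> PW P (Suc e)" unfolding PW_Suc by (rule IP_prod[OF t(2) s(2)])
    moreover have "(1 - t * v) * (1 - s * v) = 1 - (s + t - t * s * v) * v" by (simp add: algebra_simps)
    ultimately show ?case using s t v by (intro bexI[of _ "s + t - t * s * v"]) simp_all
  qed
  then show ?thesis using that by blast
qed

text \<open>A local generator of \<open>P\<close>; its powers generate the powers of \<open>P\<close> up
  to multipliers outside \<open>P\<close>.\<close>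

lemma uniformizer:
  assumes P: "prime_in P"
  obtains p u where "p \<in> P" "p \<noteq> 0" "u \<in> R" "u \<notin> P" 
    "\<And>e. p ^ e \<in> PW P e" "\<And>z e. z \<in> PW P e \<Longrightarrow> \<exists>w\<in>R. u ^ e * z = p ^ e * w"
proof -
  obtain p u where p: "p \<in> P" "p \<noteq> 0" "u \<in> R" "u \<notin> P" "\<forall>b\<in>P. u * b \<in> (*) p ` R"
    by (rule local_generator[OF P primeD(1,2)[OF P]])
  have 1: "p ^ e \<in> PW P e" for e
  proof (induction e)
    case (Suc e) show ?case using IP_prod[OF p(1) Suc] by (simp add: PW_Suc)
  qed simp
  have 2: "\<exists>w\<in>R. u ^ e * z = p ^ e * w" if "z \<in> PW P e" for z e
    using that
  proof (induction e arbitrary: z)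
    case 0 then show ?case by (intro bexI[of _ z]) simp_all
  next
    case (Suc e)
    from Suc.prems[unfolded PW_Suc] show ?case
    proof (induction rule: IP_induct)
      case (prod b z)
      obtain r where r: "u * b = p * r" "r \<in> R" using bspec[OF p(5) prod(1)] by (rule imageE)
      obtain w where w: "w \<in> R" "u ^ e * z = p ^ e * w" using Suc.IH[OF prod(2)] by (rule bexE)
      have "u ^ Suc e * (b * z) = (u * b) * (u ^ e * z)" by simp
      also have "\<dots> = p ^ Suc e * (r * w)" unfolding r w by simp
      finally show ?case using r w by (intro bexI[of _ "r * w"]) simp_all
    next
      case (sum x y)
      obtain w where w: "w \<in> R" "u ^ Suc e * x = p ^ Suc e * w" using sum(3) by (rule bexE)
      obtain w' where w': "w' \<in> R" "u ^ Suc e * y = p ^ Suc e * w'" using sum(4) by (rule bexE)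
      have "u ^ Suc e * (x + y) = p ^ Suc e * (w + w')" unfolding distrib_left w w' ..
      then show ?case using w(1) w'(1) by (intro bexI[of _ "w + w'"]) simp_all
    qed
  qed
  show ?thesis using that[OF p(1-4) 1 2] by blast
qed

end

section \<open>Finite modules\<close>

locale dedekind_module = dedekind_subring R + vector_space scale
  for R :: "'k::field_char_0 set" and scale :: "'k \<Rightarrow> 'v::ab_group_add \<Rightarrow> 'v" (infixr \<open>\<star>\<close> 75)
begin

definition submod :: "'v set \<Rightarrow> bool" where
  "submod N \<longleftrightarrow> add_subgroup N \<and> (\<forall>r\<in>R. \<forall>x\<in>N. r \<star> x \<in> N)"

lemma submodD:
  assumes "submod N"
  shows "add_subgroup N" "\<And>r x. r \<in> R \<Longrightarrow> x \<in> N \<Longrightarrow> r \<star> x \<in> N" "0 \<in> N"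
    "\<And>x y. x \<in> N \<Longrightarrow> y \<in> N \<Longrightarrow> x + y \<in> N" "\<And>x y. x \<in> N \<Longrightarrow> y \<in> N \<Longrightarrow> x - y \<in> N"
proof -
  show s: "add_subgroup N" and "\<And>r x. r \<in> R \<Longrightarrow> x \<in> N \<Longrightarrow> r \<star> x \<in> N"
    using assms unfolding submod_def by blast+
  show "0 \<in> N" "\<And>x y. x \<in> N \<Longrightarrow> y \<in> N \<Longrightarrow> x + y \<in> N" "\<And>x y. x \<in> N \<Longrightarrow> y \<in> N \<Longrightarrow> x - y \<in> N"
    by (fact add_subgroupD[OF s])+
qed

definition annih :: "'v set \<Rightarrow> 'v \<Rightarrow> 'k set" where
  "annih W y = {r \<in> R. r \<star> y \<in> W}"

lemma annih_iff: "r \<in> annih W y \<longleftrightarrow> r \<in> R \<and> r \<star> y \<in> W"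
  by (simp add: annih_def)

lemma annih_ideal:
  assumes "submod W" shows "ideal_in R (annih W y)"
proof -
  note W = submodD[OF assms]
  have "add_subgroup (annih W y)"
    unfolding add_subgroup_def Ball_def annih_iff using W(3,5) by (simp add: scale_left_diff_distrib)
  moreover have "r * x \<in> annih W y" if "r \<in> R" "x \<in> annih W y" for r x
    using that W(2)[of r "x \<star> y"] unfolding annih_iff by simp
  ultimately show ?thesis unfolding ideal_in_def by (auto simp: annih_iff)
qed

lemma index_annih:
  assumes A: "submod A" and B: "submod B" and fin: "finite_index A B" and y: "y \<in> A"
  shows "index R (annih B y) \<le> index A B" "annih B y \<noteq> {0}"
proof -
  note BI = submodD[OF B]
  define f where "f r = coset B (r \<star> y)" for r
  have ker: "f r = f r' \<longleftrightarrow> r - r' \<in> annih B y" if "r \<in> R" "r' \<in> R" for r r'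
    unfolding f_def coset_eq_iff[OF BI(1)] annih_iff using that by (simp add: scale_left_diff_distrib)
  have sub: "f ` R \<subseteq> coset B ` A"
  proof (rule image_subsetI)
    fix r assume "r \<in> R" then show "f r \<in> coset B ` A"
      unfolding f_def by (intro imageI submodD(2)[OF A _ y])
  qed
  have finA: "finite (coset B ` A)" using fin by (simp add: finite_index_def)
  have "index R (annih B y) = card (f ` R)"
    by (rule index_eq_card(1)[OF idealD(1)[OF annih_ideal[OF B]] ker])
  also have "\<dots> \<le> index A B" unfolding index_def by (rule card_mono[OF finA sub])
  finally show "index R (annih B y) \<le> index A B" .
  have "range (\<lambda>n. f (of_nat n)) \<subseteq> f ` R" by (intro image_subsetI imageI R_of_nat)
  then have "finite (range (\<lambda>n::nat. f (of_nat n)))" using finite_subset[OF sub finA] by (rule finite_subset)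
  then have "\<not> inj (\<lambda>n::nat. f (of_nat n))" using finite_imageD[of _ UNIV] by auto
  then obtain m n :: nat where mn: "m \<noteq> n" "f (of_nat m) = f (of_nat n)" by (auto simp: inj_def)
  then have "of_nat m - of_nat n \<in> annih B y" "of_nat m - of_nat n \<noteq> (0::'k)" using ker by simp_all
  then show "annih B y \<noteq> {0}" by (metis singletonD)
qed

text \<open>Among the elements outside \<open>W\<close>, one whose annihilator modulo \<open>W\<close>
  is as large as possible has a prime annihilator.\<close>

lemma exists_prime_annih:
  assumes A: "submod A" and W: "submod W" and sub: "W \<subset> A" and fin: "finite_index A W"
  obtains y where "y \<in> A" "y \<notin> W" "prime_in (annih W y)"
proof -
  note WI = submodD[OF W] and AI = submodD[OF A]
  obtain y0 where y0: "y0 \<in> A - W" using sub by blast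
  obtain y where y: "y \<in> A - W" and min: "\<And>z. z \<in> A - W \<Longrightarrow> index R (annih W y) \<le> index R (annih W z)"
    using ex_has_least_nat[of "\<lambda>z. z \<in> A - W" y0 "\<lambda>z. index R (annih W z)"] y0 by blast
  have nz: "annih W z \<noteq> {0}" if "z \<in> A" for z by (rule index_annih(2)[OF A W fin that])
  have yA: "y \<in> A" "y \<notin> W" using y by simp_all
  have "prime_in (annih W y)"
    unfolding prime_in_def
  proof (intro conjI ballI impI)
    show "ideal_in R (annih W y)" by (rule annih_ideal[OF W])
    show "annih W y \<noteq> {0}" by (rule nz[OF yA(1)])
    show "1 \<notin> annih W y" using yA(2) by (simp add: annih_iff)
    fix a b assume ab: "a \<in> R" "b \<in> R" "a * b \<in> annih W y"
    show "a \<in> annih W y \<or> b \<in> annih W y"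
    proof (rule disjCI)
      assume b: "b \<notin> annih W y"
      have byA: "b \<star> y \<in> A - W" using b ab(2) AI(2)[OF ab(2) yA(1)] by (simp add: annih_iff)
      have le: "annih W y \<subseteq> annih W (b \<star> y)"
      proof
        fix r assume r: "r \<in> annih W y"
        then have "b \<star> r \<star> y \<in> W" by (intro WI(2)[OF ab(2)]) (simp add: annih_iff)
        then show "r \<in> annih W (b \<star> y)" using r by (simp add: annih_iff mult.commute)
      qed
      have "\<not> annih W y \<subset> annih W (b \<star> y)"
      proof
        assume lt: "annih W y \<subset> annih W (b \<star> y)"
        note t = ideal_index_tower[OF annih_ideal[OF W] annih_ideal[OF W] nz[OF yA(1)] le]
        have "index (annih W y) (annih W y) < index (annih W (b \<star> y)) (annih W y)"
          by (rule index_less[OF _ _ _ order_refl lt t(3)]; rule idealD(1)[OF annih_ideal[OF W]])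
        then have "index (annih W (b \<star> y)) (annih W y) > 1"
          using index_self(1)[OF idealD(1)[OF annih_ideal[OF W]]] by simp
        moreover have "index R (annih W (b \<star> y)) > 0" by (rule index_pos[OF R_subgroup t(2)])
        ultimately show False using t(1) min[OF byA] by simp
      qed
      then have "annih W y = annih W (b \<star> y)" using le by blast
      moreover have "a \<in> annih W (b \<star> y)" using ab by (simp add: annih_iff)
      ultimately show "a \<in> annih W y" by simp
    qed
  qed
  then show ?thesis using that yA by blast
qed

lemma local_cancel:
  assumes P: "prime_in P" and B: "submod B" and v: "v \<in> R" "v \<notin> P"
    and "v \<star> z \<in> B" "\<And>w. w \<in> PW P e \<Longrightarrow> w \<star> z \<in> B"
  shows "z \<in> B"
proof -
  obtain s where s: "s \<in> R" "1 - s * v \<in> PW P e" by (rule unit_mod_PW[OF P v])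
  have "s \<star> v \<star> z + (1 - s * v) \<star> z \<in> B"
    by (rule submodD(4)[OF B submodD(2)[OF B s(1) assms(5)] assms(6)[OF s(2)]])
  then show ?thesis by (simp add: scale_left_diff_distrib)
qed

lemma local_cancel_ideal:
  assumes P: "prime_in P" and v: "v \<in> R" "v \<notin> P" and z: "z \<in> R" "v * z \<in> PW P e"
  shows "z \<in> PW P e"
proof -
  obtain s where s: "s \<in> R" "1 - s * v \<in> PW P e" by (rule unit_mod_PW[OF P v])
  note I = idealD[OF PW_ideal(1)[OF P, of e]]
  have "s * (v * z) + z * (1 - s * v) \<in> PW P e" by (rule I(6)[OF I(3)[OF s(1) z(2)] I(3)[OF z(1) s(2)]])
  then show ?thesis by (simp add: algebra_simps)
qed

text \<open>The order is the power \<open>e + 1\<close> of \<open>P\<close>; the offset excludes the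
  trivial order.\<close>

definition has_order :: "'k set \<Rightarrow> 'v set \<Rightarrow> 'v \<Rightarrow> nat \<Rightarrow> bool" where
  "has_order P B x e \<longleftrightarrow> PW P (Suc e) \<subseteq> annih B x \<and> \<not> PW P e \<subseteq> annih B x"

lemma annih_has_order:
  assumes P: "prime_in P" and B: "submod B" and o: "has_order P B x e"
  shows "annih B x = PW P (Suc e)"
proof
  show "PW P (Suc e) \<subseteq> annih B x" using o by (simp add: has_order_def)
  obtain p u where pu: "p \<in> P" "p \<noteq> 0" "u \<in> R" "u \<notin> P" 
    "\<And>e. p ^ e \<in> PW P e" "\<And>z e. z \<in> PW P e \<Longrightarrow> \<exists>w\<in>R. u ^ e * z = p ^ e * w"
    using uniformizer[OF P] by metis
  show "annih B x \<subseteq> PW P (Suc e)"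
  proof (rule ccontr)
    assume "\<not> annih B x \<subseteq> PW P (Suc e)"
    then obtain r where r: "r \<in> annih B x" "r \<notin> PW P (Suc e)" unfolding subset_iff by metis
    have rR: "r \<in> R" using r by (simp add: annih_iff)
    define j where "j = (LEAST i. r \<notin> PW P (Suc i))"
    have j: "r \<notin> PW P (Suc j)" unfolding j_def by (rule LeastI[of _ e]) (rule r(2))
    have je: "j \<le> e" unfolding j_def by (rule Least_le) (rule r(2))
    have rj: "r \<in> PW P j"
    proof (cases j)
      case (Suc i) then show ?thesis using not_less_Least[of i "\<lambda>i. r \<notin> PW P (Suc i)"] j_def by auto
    qed (simp add: rR)
    obtain v where v: "v \<in> R" "u ^ j * r = p ^ j * v" using pu(6)[OF rj] by (rule bexE)
    have uP: "u ^ j \<in> R" "u ^ j \<notin> P" for j using pu(3,4) prime_power_notin[OF P] by simp_all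
    have vP: "v \<notin> P"
    proof
      assume "v \<in> P"
      then have "v * p ^ j \<in> PW P (Suc j)" unfolding PW_Suc by (rule IP_prod[OF _ pu(5)])
      then have "u ^ j * r \<in> PW P (Suc j)" using v by (simp add: mult.commute)
      then show False using local_cancel_ideal[OF P uP rR] j by blast
    qed
    have "PW P j \<subseteq> annih B x"
    proof
      fix z assume z: "z \<in> PW P j"
      obtain w where w: "w \<in> R" "u ^ j * z = p ^ j * w" using pu(6)[OF z] by (rule bexE)
      have zR: "z \<in> R" using idealD(4)[OF PW_ideal(1)[OF P] z] .
      have "(v * u ^ j) * z = v * (u ^ j * z)" by simp
      also have "\<dots> = w * (p ^ j * v)" unfolding w by simp
      also have "\<dots> = (w * u ^ j) * r" unfolding v(2)[symmetric] by simp
      finally have eq: "(v * u ^ j) * z = (w * u ^ j) * r" .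
      have "(w * u ^ j) \<star> r \<star> x \<in> B"
        by (rule submodD(2)[OF B]) (use r(1) w(1) pu(3) in \<open>simp_all add: annih_iff\<close>)
      then have "((w * u ^ j) * r) \<star> x \<in> B" by simp
      then have 1: "(v * u ^ j) \<star> z \<star> x \<in> B" unfolding eq[symmetric] by simp
      have 2: "t \<star> z \<star> x \<in> B" if t: "t \<in> PW P (Suc e)" for t
      proof -
        have "t \<in> annih B x" using t o unfolding has_order_def by blast
        then have "z \<star> t \<star> x \<in> B" using zR by (rule_tac submodD(2)[OF B]) (simp_all add: annih_iff)
        then show ?thesis by (simp add: mult.commute)
      qed
      have "z \<star> x \<in> B" 
        by (rule local_cancel[OF P B R_mult[OF v(1) uP(1)] primeD(4)[OF P v(1) uP(1) vP uP(2)] 1 2])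
      then show "z \<in> annih B x" using zR by (simp add: annih_iff)
    qed
    then show False using PW_antimono[OF P je] o by (auto simp: has_order_def)
  qed
qed


end

context dedekind_module
begin

lemma submod_extend:
  assumes N: "submod N"
  shows "submod {n + r \<star> y | n r. n \<in> N \<and> r \<in> R}" (is "submod ?N")
proof -
  note NI = submodD[OF N]
  have I: "n + r \<star> y \<in> ?N" if "n \<in> N" "r \<in> R" for n r using that by blast
  have "0 \<in> ?N" using I[OF NI(3) R_0] by simp
  moreover have "a - b \<in> ?N" if ab: "a \<in> ?N" "b \<in> ?N" for a b
  proof -
    obtain n r n' r' where "a = n + r \<star> y" "n \<in> N" "r \<in> R" "b = n' + r' \<star> y" "n' \<in> N" "r' \<in> R"
      using ab by blast
    then show ?thesis using I[of "n - n'" "r - r'"] NI(5) by (simp add: scale_left_diff_distrib algebra_simps)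
  qed
  moreover have "c \<star> a \<in> ?N" if ca: "c \<in> R" "a \<in> ?N" for c a
  proof -
    obtain n r where "a = n + r \<star> y" "n \<in> N" "r \<in> R" using ca by blast
    then show ?thesis using I[of "c \<star> n" "c * r"] NI(2) ca(1) by (simp add: scale_right_distrib)
  qed
  ultimately show ?thesis unfolding submod_def add_subgroup_def by blast
qed

text \<open>An element of maximal order with respect to some prime generates a direct summand: a
  submodule that is maximal among those meeting its span only in \<open>B\<close> is a
  complement.\<close>

lemma cyclic_summand:
  assumes A: "submod A" and B: "submod B" and sub: "B \<subset> A" and fin: "finite_index A B"
  obtains x P e N where "x \<in> A" "prime_in P" "annih B x = PW P e" "submod N" "B \<subseteq> N" "N \<subset> A"
    "\<And>y. y \<in> A \<Longrightarrow> \<exists>r\<in>R. y - r \<star> x \<in> N" "\<And>r. r \<in> R \<Longrightarrow> r \<star> x \<in> N \<Longrightarrow> r \<star> x \<in> B"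
proof -
  note AI = submodD[OF A] and BI = submodD[OF B]
  obtain y0 where y0: "y0 \<in> A" "y0 \<notin> B" "prime_in (annih B y0)"
    by (rule exists_prime_annih[OF A B sub fin])
  define P where "P = annih B y0"
  have P: "prime_in P" using y0(3) by (simp add: P_def)
  obtain p u where pu: "p \<in> P" "p \<noteq> 0" "u \<in> R" "u \<notin> P" 
    "\<And>e. p ^ e \<in> PW P e" "\<And>z e. z \<in> PW P e \<Longrightarrow> \<exists>w\<in>R. u ^ e * z = p ^ e * w"
    using uniformizer[OF P] by metis
  have pR: "p \<in> R" using pu(1) idealD(4)[OF primeD(1)[OF P]] by simp
  have "has_order P B y0 0"
  proof -
    have "\<not> R \<subseteq> P" using primeD(3)[OF P] R_1 by (rule_tac notI) (drule (1) subsetD, simp)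
    then show ?thesis using PW_1[OF P] by (simp add: has_order_def P_def[symmetric])
  qed
  then have ex0: "\<exists>x\<in>A. has_order P B x 0" using y0(1) by blast
  have bound: "e < index A B" if ex: "\<exists>x\<in>A. has_order P B x e" for e
  proof -
    obtain x where x: "x \<in> A" "has_order P B x e" using ex by (rule bexE)
    have "Suc e \<le> 2 ^ Suc e" using less_exp[of "Suc e"] by simp
    also have "\<dots> \<le> index R P ^ Suc e" by (rule power_mono[OF index_prime_ge_2[OF P]]) simp
    also have "\<dots> = index R (annih B x)" using index_PW[OF P] annih_has_order[OF P B x(2)] by simp
    also have "\<dots> \<le> index A B" by (rule index_annih(1)[OF A B fin x(1)])
    finally show ?thesis by simp
  qed
  have "\<exists>e. (\<exists>x\<in>A. has_order P B x e) \<and> (\<forall>e'. (\<exists>x\<in>A. has_order P B x e') \<longrightarrow> e' \<le> e)"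
    by (rule ex_has_greatest_nat[where P = "\<lambda>e. \<exists>x\<in>A. has_order P B x e" and f = "\<lambda>e. e" and b = "index A B", OF ex0]) (intro allI impI bound)
  then obtain e where e: "\<exists>x\<in>A. has_order P B x e" "\<forall>e'. (\<exists>x\<in>A. has_order P B x e') \<longrightarrow> e' \<le> e"
    by (elim exE conjE)
  obtain x where x: "x \<in> A" "has_order P B x e" using e(1) by (rule bexE)
  have ax: "annih B x = PW P (Suc e)" by (rule annih_has_order[OF P B x(2)])
  \<comment> \<open>maximality of the order bounds every P-primary element\<close>
  have tors: "PW P (Suc e) \<subseteq> annih B y" if y: "y \<in> A" "PW P k \<subseteq> annih B y" for y k
  proof -
    define j where "j = (LEAST i. PW P i \<subseteq> annih B y)"
    have j: "PW P j \<subseteq> annih B y" unfolding j_def by (rule LeastI) (rule y(2))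
    have "j \<le> Suc e"
    proof (cases j)
      case (Suc i)
      have "\<not> PW P i \<subseteq> annih B y" using not_less_Least[of i "\<lambda>i. PW P i \<subseteq> annih B y"] Suc j_def by simp
      then have "has_order P B y i" using j Suc by (simp add: has_order_def)
      then have "i \<le> e" using e(2) y(1) by blast
      then show ?thesis using Suc by simp
    qed simp
    then show ?thesis using PW_antimono[OF P] j by blast
  qed
  define good where "good N \<longleftrightarrow> submod N \<and> B \<subseteq> N \<and> N \<subseteq> A \<and> (\<forall>r\<in>R. r \<star> x \<in> N \<longrightarrow> r \<star> x \<in> B)" for N
  have good_fin: "finite_index N B" "index N B \<le> index A B" if "good N" for N
    using index_mono[OF submodD(1) BI(1) _ _ fin, of N] that by (auto simp: good_def)
  have "good B" using B sub by (auto simp: good_def)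
  have "\<exists>N. good N \<and> (\<forall>N'. good N' \<longrightarrow> index N' B \<le> index N B)"
    by (rule ex_has_greatest_nat[where P = good and f = "\<lambda>N. index N B" and b = "Suc (index A B)", OF \<open>good B\<close>])
       (use good_fin(2) in \<open>simp add: less_Suc_eq_le\<close>)
  then obtain N where gN: "good N" and maxN: "\<forall>N'. good N' \<longrightarrow> index N' B \<le> index N B"
    by (elim exE conjE)
  have N: "submod N" "B \<subseteq> N" "N \<subseteq> A" "\<And>r. r \<in> R \<Longrightarrow> r \<star> x \<in> N \<Longrightarrow> r \<star> x \<in> B"
    using gN unfolding good_def by blast+
  note NI = submodD[OF N(1)]
  define W where "W = {n + r \<star> x | n r. n \<in> N \<and> r \<in> R}"
  have W: "submod W" unfolding W_def by (rule submod_extend[OF N(1)])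
  note WI = submodD[OF W]
  have Wsub: "W \<subseteq> A"
  proof
    fix z assume "z \<in> W"
    then obtain n r where "z = n + r \<star> x" "n \<in> N" "r \<in> R" unfolding W_def by blast
    then show "z \<in> A" using AI(4)[OF subsetD[OF N(3)] AI(2)[OF _ x(1)]] by simp
  qed
  have NW: "N \<subseteq> W"
  proof
    fix n assume "n \<in> N"
    moreover have "n = n + 0 \<star> x" by simp
    ultimately show "n \<in> W" unfolding W_def using R_0 by blast
  qed
  have Wx: "r \<star> x \<in> W" if "r \<in> R" for r
  proof -
    have "r \<star> x = 0 + r \<star> x" by simp
    then show ?thesis unfolding W_def using NI(3) that by blast
  qed
  \<comment> \<open>a new element killed into N by a prime would enlarge N\<close>
  have no_new: False if y: "y \<in> A" "y \<notin> W" and Q: "prime_in Q" and Qy: "\<And>q. q \<in> Q \<Longrightarrow> q \<star> y \<in> N" for y Q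
  proof -
    define N' where "N' = {n + r \<star> y | n r. n \<in> N \<and> r \<in> R}"
    have N': "submod N'" unfolding N'_def by (rule submod_extend[OF N(1)])
    have NN': "N \<subseteq> N'"
    proof
      fix n assume "n \<in> N"
      moreover have "n = n + 0 \<star> y" by simp
      ultimately show "n \<in> N'" unfolding N'_def using R_0 by blast
    qed
    have "y = 0 + 1 \<star> y" by simp
    then have "y \<in> N'" unfolding N'_def using NI(3) R_1 by blast
    moreover have "y \<notin> N" using y(2) NW by blast
    ultimately have lt: "N \<subset> N'" using NN' by blast
    have "s \<star> x \<in> B" if s: "s \<in> R" "s \<star> x \<in> N'" for s
    proof -
      obtain n r where nr: "s \<star> x = n + r \<star> y" "n \<in> N" "r \<in> R" using s(2) unfolding N'_def by blast
      have "r \<in> Q"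
      proof (rule ccontr)
        assume "r \<notin> Q"
        then obtain t where t: "t \<in> R" "1 - t * r \<in> Q" using prime_inverse[OF Q nr(3)] by metis
        have "s \<star> x - n \<in> W" by (rule WI(5)[OF Wx[OF s(1)] subsetD[OF NW nr(2)]])
        then have "r \<star> y \<in> W" using nr(1) by simp
        then have "t \<star> r \<star> y + (1 - t * r) \<star> y \<in> W"
          by (rule WI(4)[OF WI(2)[OF t(1)] subsetD[OF NW Qy[OF t(2)]]])
        then show False using y(2) by (simp add: scale_left_diff_distrib)
      qed
      then have "s \<star> x \<in> N" unfolding nr(1) by (rule NI(4)[OF nr(2) Qy])
      then show ?thesis by (rule N(4)[OF s(1)])
    qed
    moreover have "N' \<subseteq> A"
    proof
      fix z assume "z \<in> N'"
      then obtain n r where "z = n + r \<star> y" "n \<in> N" "r \<in> R" unfolding N'_def by blast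
      then show "z \<in> A" using AI(4)[OF subsetD[OF N(3)] AI(2)[OF _ y(1)]] by simp
    qed
    moreover have "B \<subseteq> N'" using NN' N(2) by simp
    ultimately have g: "good N'" using N' unfolding good_def by simp
    have "index N B < index N' B"
      by (rule index_less[OF submodD(1)[OF N'] NI(1) BI(1) N(2) lt good_fin(1)[OF g]])
    then show False using maxN g by (simp add: not_less[symmetric])
  qed
  have "W = A"
  proof (rule ccontr)
    assume "W \<noteq> A"
    then have lt: "W \<subset> A" using Wsub by blast
    have BW: "B \<subseteq> W" using N(2) NW by blast
    have finW: "finite_index A W"
      using index_tower(2)[OF AI(1) WI(1) BI(1) BW Wsub] fin by simp
    obtain y where y: "y \<in> A" "y \<notin> W" and Q: "prime_in (annih W y)"
      by (rule exists_prime_annih[OF A W lt finW])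
    define Q where "Q = annih W y"
    have Qp: "prime_in Q" using Q by (simp add: Q_def)
    have Qd: "q \<in> Q \<longleftrightarrow> q \<in> R \<and> q \<star> y \<in> W" for q by (simp add: Q_def annih_iff)
    show False
    proof (cases "P \<subseteq> Q")
      case False
      then obtain v where v: "v \<in> P" "v \<notin> Q" by blast
      have vR: "v \<in> R" using v(1) idealD(4)[OF primeD(1)[OF P]] by simp
      have ve: "v ^ Suc e \<in> PW P (Suc e)" for e
      proof (induction e)
        case 0 then show ?case using v PW_1[OF P] by simp
      next
        case (Suc e) show ?case using IP_prod[OF v(1) Suc] unfolding PW_Suc[of P "Suc e"] by simp
      qed
      define y' where "y' = v ^ Suc e \<star> y"
      have veR: "v ^ Suc e \<in> R" using vR by simp
      have "y' \<in> A" unfolding y'_def by (rule AI(2)[OF veR y(1)])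
      moreover have "y' \<notin> W" unfolding y'_def using prime_power_notin[OF Qp vR v(2), of "Suc e"] Qd[of "v ^ Suc e"] veR by simp
      moreover have "q \<star> y' \<in> N" if q: "q \<in> Q" for q
      proof -
        obtain n r where nr: "q \<star> y = n + r \<star> x" "n \<in> N" "r \<in> R" using q Qd unfolding W_def by blast
        have "v ^ Suc e \<star> x \<in> B" using ve ax annih_iff by blast
        then have "v ^ Suc e \<star> n + r \<star> v ^ Suc e \<star> x \<in> N"
          by (rule NI(4)[OF NI(2)[OF veR nr(2)] NI(2)[OF nr(3) subsetD[OF N(2)]]])
        also have "v ^ Suc e \<star> n + r \<star> v ^ Suc e \<star> x = v ^ Suc e \<star> q \<star> y"
          unfolding nr(1) by (simp add: scale_right_distrib mult_ac)
        also have "\<dots> = q \<star> y'" unfolding y'_def by (simp add: mult_ac)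
        finally show ?thesis .
      qed
      ultimately show False by (rule no_new[OF _ _ Qp])
    next
      case True
      \<comment> \<open>both ideals are maximal\<close>
      have QP: "Q = P"
      proof (rule ccontr)
        assume "Q \<noteq> P"
        then obtain q where q: "q \<in> Q" "q \<notin> P" using True by blast
        have qR: "q \<in> R" using q(1) Qd by blast
        obtain t where t: "t \<in> R" "1 - t * q \<in> P" by (rule prime_inverse[OF P qR q(2)])
        have "1 - t * q + t * q \<in> Q"
          by (rule idealD(6)[OF primeD(1)[OF Qp] subsetD[OF True t(2)] idealD(3)[OF primeD(1)[OF Qp] t(1) q(1)]])
        then show False using primeD(3)[OF Qp] by simp
      qed
      \<comment> \<open>replace y by a multiple that is P-primary\<close>
      obtain a where a: "a \<in> annih B y" "a \<noteq> 0"
        using nonzero_elem[OF annih_ideal[OF B] index_annih(2)[OF A B fin y(1)]] by (rule bexE)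
      have aR: "a \<in> R" using a by (simp add: annih_iff)
      have "\<exists>k. a \<notin> PW P k"
      proof (rule ccontr)
        assume "\<not> ?thesis"
        then have all: "a \<in> PW P k" for k by blast
        have fa: "finite_index R ((*) a ` R)" by (rule finite_quotient[OF aR a(2)])
        define k where "k = index R ((*) a ` R)"
        have s: "(*) a ` R \<subseteq> PW P k"
          by (rule image_subsetI) (rule idealD(9)[OF PW_ideal(1)[OF P] _ all[of k]])
        have "k < 2 ^ k" by (rule less_exp)
        also have "\<dots> \<le> index R P ^ k" by (rule power_mono[OF index_prime_ge_2[OF P]]) simp
        also have "\<dots> = index R (PW P k)" by (rule index_PW[OF P, symmetric])
        also have "\<dots> \<le> k"
        proof -
          note t = index_tower[OF R_subgroup idealD(1)[OF PW_ideal(1)[OF P]] scale_subgroup[OF R_subgroup] s idealD(2)[OF PW_ideal(1)[OF P]]]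
          have "index (PW P k) ((*) a ` R) > 0"
            using index_pos[OF idealD(1)[OF PW_ideal(1)[OF P]]] t(2) fa by simp
          then have "index R (PW P k) \<le> index R (PW P k) * index (PW P k) ((*) a ` R)" by simp
          also have "\<dots> = index R ((*) a ` R)" by (rule t(1)[symmetric])
          also have "\<dots> = k" by (rule k_def[symmetric])
          finally show ?thesis .
        qed
        finally show False by simp
      qed
      then obtain k where k: "a \<notin> PW P k" "\<And>i. i < k \<Longrightarrow> a \<in> PW P i"
        using exists_least_iff[of "\<lambda>k. a \<notin> PW P k"] by blast
      then obtain m where m: "k = Suc m" "a \<in> PW P m" using aR by (cases k) auto
      obtain v where v: "v \<in> R" "u ^ m * a = p ^ m * v" using pu(6)[OF m(2)] by (rule bexE)
      have uP: "u ^ j \<in> R" "u ^ j \<notin> P" for j using pu(3,4) prime_power_notin[OF P] by simp_all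
      have vP: "v \<notin> P"
      proof
        assume "v \<in> P"
        then have "v * p ^ m \<in> PW P (Suc m)" unfolding PW_Suc by (rule IP_prod[OF _ pu(5)])
        then have "u ^ m * a \<in> PW P (Suc m)" using v by (simp add: mult.commute)
        then show False using local_cancel_ideal[OF P uP aR] k(1) m(1) by blast
      qed
      define w where "w = v * u ^ m"
      have w: "w \<in> R" "w \<notin> P" unfolding w_def using v(1) uP primeD(4)[OF P v(1) uP(1) vP uP(2)] by simp_all
      define y1 where "y1 = w \<star> y"
      have y1: "y1 \<in> A" "y1 \<notin> W" unfolding y1_def
        using AI(2)[OF w(1) y(1)] w Qd[of w] QP by simp_all
      have "PW P m \<subseteq> annih B y1"
      proof
        fix z assume z: "z \<in> PW P m"
        obtain c where c: "c \<in> R" "u ^ m * z = p ^ m * c" using pu(6)[OF z] by (rule bexE)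
        have "z * w = v * (u ^ m * z)" unfolding w_def by (simp add: mult_ac)
        also have "\<dots> = c * (p ^ m * v)" unfolding c(2) by (simp add: mult_ac)
        also have "\<dots> = (c * u ^ m) * a" unfolding v(2)[symmetric] by (simp add: mult_ac)
        finally have eq: "z * w = (c * u ^ m) * a" .
        have "(c * u ^ m) \<star> a \<star> y \<in> B"
          by (rule submodD(2)[OF B]) (use a(1) c(1) uP(1) in \<open>simp_all add: annih_iff\<close>)
        then have "(z * w) \<star> y \<in> B" unfolding eq by simp
        then show "z \<in> annih B y1" using idealD(4)[OF PW_ideal(1)[OF P] z] by (simp add: annih_iff y1_def)
      qed
      then have y1_tors: "PW P (Suc e) \<subseteq> annih B y1" by (rule tors[OF y1(1)])
      have "p \<star> y1 \<in> W"
      proof -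
        have "w \<star> p \<star> y \<in> W" by (rule WI(2)[OF w(1)]) (use pu(1) Qd QP in blast)
        then show ?thesis unfolding y1_def by (simp add: mult.commute)
      qed
      then obtain n c where nc: "p \<star> y1 = n + c \<star> x" "n \<in> N" "c \<in> R" unfolding W_def by blast
      have "p ^ e \<star> p \<star> y1 \<in> B" using pu(5)[of "Suc e"] y1_tors by (auto simp: annih_iff mult.commute)
      then have "p ^ e \<star> p \<star> y1 - p ^ e \<star> n \<in> N"
        by (rule NI(5)[OF subsetD[OF N(2)] NI(2)[OF R_power[OF pR] nc(2)]])
      then have "(p ^ e * c) \<star> x \<in> N" unfolding nc(1) by (simp add: scale_right_distrib)
      then have pec: "p ^ e * c \<in> PW P (Suc e)" unfolding ax[symmetric] annih_iff using N(4) pR nc(3) by simp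
      have cP: "c \<in> P"
      proof (rule ccontr)
        assume "c \<notin> P"
        then have pe: "p ^ e \<in> PW P (Suc e)"
          by (intro local_cancel_ideal[OF P nc(3) _ R_power[OF pR]]) (use pec in \<open>simp_all add: mult.commute\<close>)
        have "PW P e \<subseteq> PW P (Suc e)"
        proof
          fix z assume z: "z \<in> PW P e"
          obtain t where t: "t \<in> R" "u ^ e * z = p ^ e * t" using pu(6)[OF z] by (rule bexE)
          have "u ^ e * z \<in> PW P (Suc e)" unfolding t(2) by (rule idealD(9)[OF PW_ideal(1)[OF P] t(1) pe])
          then show "z \<in> PW P (Suc e)"
            by (rule local_cancel_ideal[OF P uP idealD(4)[OF PW_ideal(1)[OF P] z]])
        qed
        then show False using PW_strict[OF P] by blast
      qed
      obtain c' where c': "c' \<in> R" "u * c = p * c'"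
        using pu(6)[of c "Suc 0"] cP PW_1[OF P] by auto
      define y2 where "y2 = u \<star> (u \<star> y1 - c' \<star> x)"
      have y2A: "y2 \<in> A" unfolding y2_def
        by (rule AI(2)[OF pu(3) AI(5)[OF AI(2)[OF pu(3) y1(1)] AI(2)[OF c'(1) x(1)]]])
      have y2W: "y2 \<notin> W"
      proof
        assume "y2 \<in> W"
        then have "y2 + (u * c') \<star> x \<in> W" using WI(4) Wx[of "u * c'"] pu(3) c'(1) by simp
        then have "(u * u * w) \<star> y \<in> W" unfolding y2_def y1_def by (simp add: scale_right_diff_distrib mult_ac)
        then have "u * u * w \<in> P" using Qd QP pu(3) w(1) by simp
        moreover have "u * u * w \<notin> P" by (intro primeD(4)[OF P]) (use pu(3,4) w primeD(4)[OF P pu(3,3,4,4)] in simp_all)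
        ultimately show False by simp
      qed
      have "q \<star> y2 \<in> N" if q: "q \<in> P" for q
      proof -
        obtain q' where q': "q' \<in> R" "u * q = p * q'" using pu(6)[of q "Suc 0"] q PW_1[OF P] by auto
        have "p \<star> (u \<star> y1 - c' \<star> x) = u \<star> (p \<star> y1) - (p * c') \<star> x"
          by (simp add: scale_right_diff_distrib mult_ac)
        also have "\<dots> = u \<star> n" unfolding nc(1) c'(2)[symmetric] by (simp add: scale_right_distrib)
        finally have 1: "p \<star> (u \<star> y1 - c' \<star> x) = u \<star> n" .
        have "q \<star> y2 = (u * q) \<star> (u \<star> y1 - c' \<star> x)" unfolding y2_def by (simp add: mult_ac del: scale_right_diff_distrib)
        also have "\<dots> = q' \<star> p \<star> (u \<star> y1 - c' \<star> x)" unfolding q'(2) by (simp add: mult_ac)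
        also have "\<dots> = q' \<star> u \<star> n" unfolding 1 ..
        also have "\<dots> \<in> N" by (rule NI(2)[OF q'(1) NI(2)[OF pu(3) nc(2)]])
        finally show ?thesis .
      qed
      then show False by (rule no_new[OF y2A y2W P])
    qed
  qed
  have "\<exists>r\<in>R. y - r \<star> x \<in> N" if "y \<in> A" for y
  proof -
    have "y \<in> W" using that \<open>W = A\<close> by simp
    then obtain n r where "y = n + r \<star> x" "n \<in> N" "r \<in> R" unfolding W_def by blast
    then show ?thesis by (intro bexI[of _ r]) simp_all
  qed
  moreover have "N \<noteq> A"
  proof
    assume "N = A"
    then have "1 \<star> x \<in> B" using N(4)[OF R_1] x(1) by simp
    then have "PW P e \<subseteq> annih B x"
      using BI(2) idealD(4)[OF PW_ideal(1)[OF P]] by (simp add: subset_iff annih_iff)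
    then show False using x(2) by (simp add: has_order_def)
  qed
  then have "N \<subset> A" using N(3) by simp
  ultimately show ?thesis by (intro that[OF x(1) P ax N(1,2)] N(4)) simp_all
qed

end

context dedekind_module
begin

text \<open>Cyclic summands are split off one after another; the index decreases.\<close>

theorem finite_module_decomposition:
  assumes A: "submod A" and B: "submod B" and sub: "B \<subseteq> A" and fin: "finite_index A B"
  obtains m :: nat and x P e where
    "\<forall>i<m. x i \<in> A \<and> prime_in (P i)"
    "\<forall>y\<in>A. \<exists>r. (\<forall>i<m. r i \<in> R) \<and> y - (\<Sum>i<m. r i \<star> x i) \<in> B"
    "\<forall>r. (\<forall>i<m. r i \<in> R) \<longrightarrow> ((\<Sum>i<m. r i \<star> x i) \<in> B \<longleftrightarrow> (\<forall>i<m. r i \<in> PW (P i) (e i)))"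
proof -
  have "\<exists>(m::nat) x P e. (\<forall>i<m. x i \<in> A \<and> prime_in (P i)) \<and>
      (\<forall>y\<in>A. \<exists>r. (\<forall>i<m. r i \<in> R) \<and> y - (\<Sum>i<m. r i \<star> x i) \<in> B) \<and>
      (\<forall>r. (\<forall>i<m. r i \<in> R) \<longrightarrow> ((\<Sum>i<m. r i \<star> x i) \<in> B \<longleftrightarrow> (\<forall>i<m. r i \<in> PW (P i) (e i))))"
    using A sub fin
  proof (induction "index A B" arbitrary: A rule: less_induct)
    case less
    show ?case
    proof (cases "A = B")
      case True
      then show ?thesis using submodD(3)[OF B] by (intro exI[of _ "0::nat"]) simp
    next
      case False
      then have lt: "B \<subset> A" using less.prems(2) by blast
      obtain x P e N where x: "x \<in> A" "prime_in P" "annih B x = PW P e" "submod N" "B \<subseteq> N" "N \<subset> A"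
        "\<And>y. y \<in> A \<Longrightarrow> \<exists>r\<in>R. y - r \<star> x \<in> N" "\<And>r. r \<in> R \<Longrightarrow> r \<star> x \<in> N \<Longrightarrow> r \<star> x \<in> B"
        using cyclic_summand[OF less.prems(1) B lt less.prems(3)] by metis
      note s = submodD(1)[OF less.prems(1)] submodD(1)[OF x(4)] submodD(1)[OF B]
      have "index N B < index A B" by (rule index_less[OF s x(5,6) less.prems(3)])
      have "finite_index N B" using index_mono(2)[OF s(2,3) x(5) _ less.prems(3)] x(6) by blast
      obtain m :: nat and y Q f where IH: "\<forall>i<m. y i \<in> N \<and> prime_in (Q i)"
          "\<forall>z\<in>N. \<exists>r. (\<forall>i<m. r i \<in> R) \<and> z - (\<Sum>i<m. r i \<star> y i) \<in> B"
          "\<forall>r. (\<forall>i<m. r i \<in> R) \<longrightarrow> ((\<Sum>i<m. r i \<star> y i) \<in> B \<longleftrightarrow> (\<forall>i<m. r i \<in> PW (Q i) (f i)))"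
        using less.hyps[OF _ x(4) x(5), OF \<open>index N B < index A B\<close> \<open>finite_index N B\<close>]
        by (elim exE conjE)
      define y' where "y' = y(m := x)"
      define Q' where "Q' = Q(m := P)"
      define f' where "f' = f(m := e)"
      have sum: "(\<Sum>i<Suc m. r i \<star> y' i) = (\<Sum>i<m. r i \<star> y i) + r m \<star> x" for r
        by (simp add: y'_def)
      have sumN: "(\<Sum>i<m. r i \<star> y i) \<in> N" if "\<forall>i<m. r i \<in> R" for r
        by (rule add_subgroup_sum[OF s(2)]) (use that IH(1) submodD(2)[OF x(4)] in simp)
      have 1: "\<forall>i<Suc m. y' i \<in> A \<and> prime_in (Q' i)"
        using IH(1) x(1,2,6) by (auto simp: y'_def Q'_def less_Suc_eq)
      have 2: "\<exists>r. (\<forall>i<Suc m. r i \<in> R) \<and> z - (\<Sum>i<Suc m. r i \<star> y' i) \<in> B" if z: "z \<in> A" for z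
      proof -
        obtain c where c: "c \<in> R" "z - c \<star> x \<in> N" using x(7)[OF z] by (rule bexE)
        obtain r where r: "\<forall>i<m. r i \<in> R" "z - c \<star> x - (\<Sum>i<m. r i \<star> y i) \<in> B" using IH(2) c(2) by blast
        have "(\<Sum>i<m. (r(m := c)) i \<star> y i) = (\<Sum>i<m. r i \<star> y i)" by (rule sum.cong) simp_all
        then show ?thesis unfolding sum using r c
          by (intro exI[of _ "r(m := c)"]) (simp add: less_Suc_eq algebra_simps)
      qed
      have 3: "(\<Sum>i<Suc m. r i \<star> y' i) \<in> B \<longleftrightarrow> (\<forall>i<Suc m. r i \<in> PW (Q' i) (f' i))" if r: "\<forall>i<Suc m. r i \<in> R" for r
      proof -
        have rm: "r m \<in> R" "\<forall>i<m. r i \<in> R" using r by simp_all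
        have "(\<Sum>i<Suc m. r i \<star> y' i) \<in> B \<longleftrightarrow> (\<Sum>i<m. r i \<star> y i) \<in> B \<and> r m \<star> x \<in> B"
        proof
          assume *: "(\<Sum>i<Suc m. r i \<star> y' i) \<in> B"
          then have "(\<Sum>i<Suc m. r i \<star> y' i) - (\<Sum>i<m. r i \<star> y i) \<in> N"
            using x(5) sumN[OF rm(2)] submodD(5)[OF x(4)] by blast
          then have "r m \<star> x \<in> N" unfolding sum by simp
          then have 4: "r m \<star> x \<in> B" by (rule x(8)[OF rm(1)])
          then have "(\<Sum>i<Suc m. r i \<star> y' i) - r m \<star> x \<in> B" using * submodD(5)[OF B] by blast
          then show "(\<Sum>i<m. r i \<star> y i) \<in> B \<and> r m \<star> x \<in> B" using 4 unfolding sum by simp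
        next
          assume "(\<Sum>i<m. r i \<star> y i) \<in> B \<and> r m \<star> x \<in> B"
          then show "(\<Sum>i<Suc m. r i \<star> y' i) \<in> B" unfolding sum using submodD(4)[OF B] by simp
        qed
        also have "\<dots> \<longleftrightarrow> (\<forall>i<m. r i \<in> PW (Q i) (f i)) \<and> r m \<in> PW P e"
          using IH(3) rm unfolding x(3)[symmetric] annih_iff by blast
        also have "\<dots> \<longleftrightarrow> (\<forall>i<Suc m. r i \<in> PW (Q' i) (f' i))"
          by (auto simp: less_Suc_eq Q'_def f'_def)
        finally show ?thesis .
      qed
      show ?thesis
      proof (intro exI conjI)
        show "\<forall>i<Suc m. y' i \<in> A \<and> prime_in (Q' i)" by (rule 1)
        show "\<forall>z\<in>A. \<exists>r. (\<forall>i<Suc m. r i \<in> R) \<and> z - (\<Sum>i<Suc m. r i \<star> y' i) \<in> B"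
          by (rule ballI) (rule 2)
        show "\<forall>r. (\<forall>i<Suc m. r i \<in> R) \<longrightarrow>
            ((\<Sum>i<Suc m. r i \<star> y' i) \<in> B \<longleftrightarrow> (\<forall>i<Suc m. r i \<in> PW (Q' i) (f' i)))"
          by (intro allI impI) (rule 3)
      qed
    qed
  qed
  then show ?thesis by (elim exE conjE) (rule that)
qed

end

context dedekind_subring
begin

lemma commensurable_scale_R:
  assumes "x \<noteq> 0" shows "commensurable R ((*) x ` R)"
proof -
  obtain a b where ab: "a \<in> R" "b \<in> R" "b \<noteq> 0" "x = a / b" using fraction[of x] by blast
  have a0: "a \<noteq> 0" using ab assms by auto
  have eq: "(*) a ` R = (*) x ` (*) b ` R" using ab by (simp add: image_image)
  have sub: "(*) b ` R \<subseteq> R" "(*) a ` R \<subseteq> R" using ab by (simp_all add: image_subset_iff)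
  have inj: "inj_on ((*) x) R" using assms by (simp add: inj_on_def)
  have "finite_index ((*) x ` R) ((*) a ` R)"
    unfolding eq using index_image(2)[OF R_subgroup scale_subgroup[OF R_subgroup] sub(1) _ inj]
      finite_quotient[OF ab(2,3)] by (simp add: right_diff_distrib)
  moreover have "(*) a ` R \<subseteq> (*) x ` R" unfolding eq by (rule image_mono[OF sub(1)])
  ultimately show ?thesis
    using gen_index_eq(2)[OF R_subgroup scale_subgroup[OF R_subgroup] scale_subgroup[OF R_subgroup] sub(2)]
      finite_quotient[OF ab(1) a0] by blast
qed

section \<open>The canonical norm\<close>

text \<open>The norm as an index; \<open>R\<close> and \<open>x R\<close> are commensurable for every
  nonzero \<open>x\<close> of the field of fractions.\<close>

definition elem_norm :: "'k \<Rightarrow> real" where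
  "elem_norm x = gen_index R ((*) x ` R)"

lemma elem_norm_pos: "x \<noteq> 0 \<Longrightarrow> elem_norm x > 0"
  unfolding elem_norm_def by (rule gen_index_pos[OF commensurable_scale_R])

lemma gen_index_scale:
  assumes "x \<noteq> 0" "commensurable A B"
  shows "gen_index ((*) x ` A) ((*) x ` B) = gen_index A B" "commensurable ((*) x ` A) ((*) (x::'k) ` B)"
  by (rule gen_index_image[OF assms(2)]; use assms(1) in \<open>simp add: right_diff_distrib inj_on_def\<close>)+

lemma elem_norm_mult:
  assumes "x \<noteq> 0" "y \<noteq> 0" shows "elem_norm (x * y) = elem_norm x * elem_norm y"
proof -
  have e: "(*) (x * y) ` R = (*) x ` (*) y ` R" by (simp add: image_image mult.assoc)
  note g = gen_index_scale[OF assms(1) commensurable_scale_R[OF assms(2)]]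
  show ?thesis
    unfolding elem_norm_def e gen_index_trans(1)[OF commensurable_scale_R[OF assms(1)] g(2)] g(1) ..
qed

lemma elem_norm_1: "elem_norm 1 = 1"
  using index_self(1)[OF R_subgroup] by (simp add: elem_norm_def gen_index_def)

lemma elem_norm_power: "x \<noteq> 0 \<Longrightarrow> elem_norm (x ^ n) = elem_norm x ^ n"
  by (induction n) (simp_all add: elem_norm_1 elem_norm_mult)

lemma elem_norm_inverse: "x \<noteq> 0 \<Longrightarrow> elem_norm (inverse x) = inverse (elem_norm x)"
  using elem_norm_mult[of x "inverse x"] elem_norm_pos[of x] by (simp add: elem_norm_1 field_simps)

lemma elem_norm_in_R: "x \<in> R \<Longrightarrow> x \<noteq> 0 \<Longrightarrow> elem_norm x = index R ((*) x ` R)"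
  unfolding elem_norm_def
  by (rule gen_index_sub(1)[OF R_subgroup scale_subgroup[OF R_subgroup] _ finite_quotient]) (simp_all add: image_subset_iff)

lemma ideal_norm_eq: "ideal_norm R A = index R A"
proof -
  have "a_r_coset (ring_on R) A x = coset A x" for x
  proof -
    have "\<exists>h\<in>A. y = h + x" if "y - x \<in> A" for y using that by (intro bexI[of _ "y - x"]) simp_all
    then show ?thesis by (auto simp: a_r_coset_def' coset_def)
  qed
  then have "carrier (ring_on R Quot A) = coset A ` R"
    by (auto simp: FactRing_def A_RCOSETS_def')
  then show ?thesis by (simp add: ideal_norm_def index_def)
qed

lemma IP_scale: "IP ((*) x ` J) B = (*) x ` IP J B"
proof (intro equalityI subsetI)
  fix z assume "z \<in> IP ((*) x ` J) B"
  then show "z \<in> (*) x ` IP J B"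
  proof (induction rule: IP_induct)
    case (prod i j)
    obtain k where k: "i = x * k" "k \<in> J" using prod(1) by (rule imageE)
    have "i * j = x * (k * j)" using k by simp
    then show ?case using IP_prod[OF k(2) prod(2)] by (rule image_eqI)
  next
    case (sum a b)
    obtain a' where a: "a = x * a'" "a' \<in> IP J B" using sum(3) by (rule imageE)
    obtain b' where b: "b = x * b'" "b' \<in> IP J B" using sum(4) by (rule imageE)
    have "a + b = x * (a' + b')" using a b by (simp add: distrib_left)
    moreover have "a' + b' \<in> IP J B" using ideal_prod.sum[OF a(2) b(2)] by simp
    ultimately show ?case by (rule image_eqI)
  qed
next
  fix z assume "z \<in> (*) x ` IP J B"
  then obtain w where w: "z = x * w" "w \<in> IP J B" by (rule imageE)
  have "x * w \<in> IP ((*) x ` J) B"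
    using w(2)
  proof (induction rule: IP_induct)
    case (prod i j)
    then show ?case using IP_prod[OF imageI[OF prod(1), of "(*) x"] prod(2)] by (simp add: mult.assoc)
  next
    case (sum a b)
    then show ?case using ideal_prod.sum[OF sum(3,4)] by (simp add: distrib_left)
  qed
  then show "z \<in> IP ((*) x ` J) B" using w by simp
qed

lemma ideal_commensurable:
  assumes "ideal_in R I" "I \<noteq> {0}"
  shows "commensurable R I" "gen_index R I = index R I"
  using gen_index_sub[OF R_subgroup idealD(1,2)[OF assms(1)] ideal_finite_index[OF assms]] by simp_all

text \<open>Clearing denominators exhibits the fractional ideal as a quotient of ideals;
  multiplicativity of the index makes the value independent of that choice.\<close>

lemma frac_ideal_norm_eq:
  assumes J: "multiplicative_ideal J" and x: "x \<noteq> 0"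
  shows "frac_ideal_norm R ((*) x ` J) = elem_norm x * index R J"
  unfolding frac_ideal_norm_def
proof (rule the_equality)
  note JI = multiplicativeD[OF J]
  have calc: "index R A = elem_norm x * (index R J * index R B)" 
    if A: "ideal_in R A" "A \<noteq> {0}" and B: "ideal_in R B" "B \<noteq> {0}" and eq: "(*) x ` IP J B = A" for A B
  proof -
    note c = ideal_commensurable[OF IP_ideal[OF JI(1) B(1)] IP_nonzero[OF JI(1,2) B]]
    have "gen_index R A = elem_norm x * gen_index R (IP J B)"
      unfolding eq[symmetric] elem_norm_def gen_index_scale(1)[OF x c(1), symmetric]
      by (rule gen_index_trans(1)[OF commensurable_scale_R[OF x] gen_index_scale(2)[OF x c(1)]])
    then show ?thesis using ideal_commensurable(2)[OF A] c(2) JI(3)[OF B] by simp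
  qed
  have pos: "real (index R B) > 0" if "ideal_in R B" "B \<noteq> {0}" for B
    using index_pos[OF R_subgroup ideal_finite_index[OF that]] by simp
  have ni: "nonzero_ideal R A \<longleftrightarrow> ideal_in R A \<and> A \<noteq> {0}" for A
    by (simp add: nonzero_ideal_def ideal_iff)
  obtain a b where ab: "a \<in> R" "b \<in> R" "b \<noteq> 0" "x = a / b" using fraction[of x] by blast
  have a0: "a \<noteq> 0" using ab x by auto
  define B where "B = (*) b ` R"
  define A where "A = (*) a ` J"
  have B: "ideal_in R B" "B \<noteq> {0}"
    unfolding B_def using principal_ideal[OF ab(2)] ab(3) imageI[OF R_1, of "(*) b"] by auto
  have bJ: "IP J B = (*) b ` J"
  proof -
    interpret cring "ring_on R" by (rule cring_ring_on)
    have "IP J B = IP B J" using ideal_prod_commute[of J B] JI(1) B(1) by (simp add: ideal_iff)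
    also have "\<dots> = (*) b ` IP R J" unfolding B_def by (rule IP_scale)
    finally show ?thesis using IP_R(2)[OF JI(1)] by simp
  qed
  have eq: "(*) x ` IP J B = A" unfolding bJ A_def image_image using ab by simp
  have A: "ideal_in R A" "A \<noteq> {0}"
  proof -
    have "IP ((*) a ` R) J = A" unfolding IP_scale A_def using IP_R(2)[OF JI(1)] by simp
    moreover have "(*) a ` R \<noteq> {0}" using a0 imageI[OF R_1, of "(*) a"] by auto
    ultimately show "ideal_in R A" "A \<noteq> {0}"
      using IP_ideal[OF principal_ideal[OF ab(1)] JI(1)] IP_nonzero[OF principal_ideal[OF ab(1)] _ JI(1,2)] by simp_all
  qed
  show "\<exists>A B. nonzero_ideal R A \<and> nonzero_ideal R B \<and> IP ((*) x ` J) B = A \<and>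
      elem_norm x * index R J = real (ideal_norm R A) / real (ideal_norm R B)"
    using A B eq calc[OF A B eq] pos[OF B] 
    by (intro exI[of _ A] exI[of _ B]) (simp add: ni IP_scale ideal_norm_eq)
  fix c assume "\<exists>A B. nonzero_ideal R A \<and> nonzero_ideal R B \<and> IP ((*) x ` J) B = A \<and>
      c = real (ideal_norm R A) / real (ideal_norm R B)"
  then obtain A B where *: "ideal_in R A" "A \<noteq> {0}" "ideal_in R B" "B \<noteq> {0}" "(*) x ` IP J B = A" 
    "c = real (index R A) / real (index R B)"
    by (auto simp: ni IP_scale ideal_norm_eq)
  show "c = elem_norm x * index R J"
    unfolding *(6) calc[OF *(1-5)] using pos[OF *(3,4)] by simp
qed

lemma canonical_norm_eq: "x \<noteq> 0 \<Longrightarrow> canonical_norm R x = elem_norm x"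
  using frac_ideal_norm_eq[OF multiplicative_R, of x] index_self(1)[OF R_subgroup]
  by (simp add: canonical_norm_def)

end

section \<open>The norm of the ideal \<open>\<chi>\<close>\<close>

text \<open>The abstract modules of the definition of \<open>\<chi>\<close> are transported by
  \<open>\<phi>\<close> to submodules \<open>B \<subseteq> A\<close> of a vector space, where
  indices of groups are available.\<close>

locale represented_quotient = dedekind_module R scale
  for R :: "'k::field_char_0 set" and scale :: "'k \<Rightarrow> 'v::ab_group_add \<Rightarrow> 'v" (infixr \<open>\<star>\<close> 75) +
  fixes M :: "('k, 'x, 'c) module_scheme" and N :: "'x set" and \<phi> :: "'x \<Rightarrow> 'v" and A B :: "'v set"
  assumes A: "submod A" and B: "submod B" and BA: "B \<subseteq> A"
    and bij: "bij_betw \<phi> (carrier M) A" and N_def: "N = {x \<in> carrier M. \<phi> x \<in> B}"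
    and add_closed: "x \<in> carrier M \<Longrightarrow> y \<in> carrier M \<Longrightarrow> x \<oplus>\<^bsub>M\<^esub> y \<in> carrier M"
    and add_hom: "x \<in> carrier M \<Longrightarrow> y \<in> carrier M \<Longrightarrow> \<phi> (x \<oplus>\<^bsub>M\<^esub> y) = \<phi> x + \<phi> y"
    and smult_closed: "r \<in> R \<Longrightarrow> x \<in> carrier M \<Longrightarrow> r \<odot>\<^bsub>M\<^esub> x \<in> carrier M"
    and smult_hom: "r \<in> R \<Longrightarrow> x \<in> carrier M \<Longrightarrow> \<phi> (r \<odot>\<^bsub>M\<^esub> x) = r \<star> \<phi> x"
begin

lemma phi_in: "x \<in> carrier M \<Longrightarrow> \<phi> x \<in> A" using bij by (auto simp: bij_betw_def)

lemma phi_onto: "y \<in> A \<Longrightarrow> \<exists>x\<in>carrier M. \<phi> x = y" using bij by (auto simp: bij_betw_def)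

lemma phi_inj: "x \<in> carrier M \<Longrightarrow> y \<in> carrier M \<Longrightarrow> \<phi> x = \<phi> y \<Longrightarrow> x = y"
  using bij by (auto simp: bij_betw_def inj_on_def)

lemma coset_eq:
  assumes v: "v \<in> carrier M"
  shows "N +>\<^bsub>M\<^esub> v = {w \<in> carrier M. \<phi> w - \<phi> v \<in> B}"
proof (intro equalityI subsetI)
  fix w assume "w \<in> N +>\<^bsub>M\<^esub> v"
  then obtain h where "h \<in> carrier M" "\<phi> h \<in> B" "w = h \<oplus>\<^bsub>M\<^esub> v" by (auto simp: a_r_coset_def' N_def)
  then show "w \<in> {w \<in> carrier M. \<phi> w - \<phi> v \<in> B}" using v by (simp add: add_closed add_hom)
next
  fix w assume "w \<in> {w \<in> carrier M. \<phi> w - \<phi> v \<in> B}"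
  then have w: "w \<in> carrier M" "\<phi> w - \<phi> v \<in> B" by simp_all
  obtain h where h: "h \<in> carrier M" "\<phi> h = \<phi> w - \<phi> v" using phi_onto[OF subsetD[OF BA w(2)]] by (rule bexE)
  have "w = h \<oplus>\<^bsub>M\<^esub> v" by (rule phi_inj) (use h v w in \<open>simp_all add: add_closed add_hom\<close>)
  moreover have "h \<in> N" using h w by (simp add: N_def)
  ultimately show "w \<in> N +>\<^bsub>M\<^esub> v" by (auto simp: a_r_coset_def')
qed

lemma coset_eq_coset_iff:
  assumes "v \<in> carrier M" "w \<in> carrier M"
  shows "N +>\<^bsub>M\<^esub> v = N +>\<^bsub>M\<^esub> w \<longleftrightarrow> \<phi> v - \<phi> w \<in> B"
proof
  assume "N +>\<^bsub>M\<^esub> v = N +>\<^bsub>M\<^esub> w"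
  moreover have "v \<in> N +>\<^bsub>M\<^esub> v" using assms(1) submodD(3)[OF B] by (simp add: coset_eq)
  ultimately show "\<phi> v - \<phi> w \<in> B" using assms(2) by (simp add: coset_eq)
next
  assume *: "\<phi> v - \<phi> w \<in> B"
  have "\<phi> z - \<phi> v \<in> B \<longleftrightarrow> \<phi> z - \<phi> w \<in> B" for z
    using submodD(4)[OF B _ *, of "\<phi> z - \<phi> v"] submodD(5)[OF B _ *, of "\<phi> z - \<phi> w"]
    by (auto simp: algebra_simps)
  then show "N +>\<^bsub>M\<^esub> v = N +>\<^bsub>M\<^esub> w" using assms by (simp add: coset_eq)
qed

lemma carrier_quotient: "carrier (quotient_module M N) = (\<lambda>v. N +>\<^bsub>M\<^esub> v) ` carrier M"
  by (auto simp: quotient_module_def A_RCOSETS_def')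

lemma add_quotient:
  assumes v: "v \<in> carrier M" and w: "w \<in> carrier M"
  shows "(N +>\<^bsub>M\<^esub> v) \<oplus>\<^bsub>quotient_module M N\<^esub> (N +>\<^bsub>M\<^esub> w) = N +>\<^bsub>M\<^esub> (v \<oplus>\<^bsub>M\<^esub> w)"
proof -
  have "(N +>\<^bsub>M\<^esub> v) <+>\<^bsub>M\<^esub> (N +>\<^bsub>M\<^esub> w) = N +>\<^bsub>M\<^esub> (v \<oplus>\<^bsub>M\<^esub> w)"
  proof (intro equalityI subsetI)
    fix z assume "z \<in> (N +>\<^bsub>M\<^esub> v) <+>\<^bsub>M\<^esub> (N +>\<^bsub>M\<^esub> w)"
    then obtain a b where ab: "a \<in> N +>\<^bsub>M\<^esub> v" "b \<in> N +>\<^bsub>M\<^esub> w" "z = a \<oplus>\<^bsub>M\<^esub> b"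
      by (auto simp: set_add_def')
    then have "(\<phi> a - \<phi> v) + (\<phi> b - \<phi> w) \<in> B" using v w by (intro submodD(4)[OF B]) (simp_all add: coset_eq)
    then show "z \<in> N +>\<^bsub>M\<^esub> (v \<oplus>\<^bsub>M\<^esub> w)"
      using ab v w by (simp add: coset_eq add_closed add_hom algebra_simps)
  next
    fix z assume z: "z \<in> N +>\<^bsub>M\<^esub> (v \<oplus>\<^bsub>M\<^esub> w)"
    then have z1: "z \<in> carrier M" "\<phi> z - (\<phi> v + \<phi> w) \<in> B" using v w by (simp_all add: coset_eq add_closed add_hom)
    have "\<phi> z - \<phi> w \<in> A" by (rule submodD(5)[OF A phi_in[OF z1(1)] phi_in[OF w]])
    then obtain a where a: "a \<in> carrier M" "\<phi> a = \<phi> z - \<phi> w" using phi_onto by blast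
    have "\<phi> a - \<phi> v = \<phi> z - (\<phi> v + \<phi> w)" unfolding a(2) by simp
    then have "\<phi> a - \<phi> v \<in> B" using z1(2) by (simp only:)
    then have "a \<in> N +>\<^bsub>M\<^esub> v" using a(1) by (simp only: coset_eq[OF v] mem_Collect_eq)
    moreover have "w \<in> N +>\<^bsub>M\<^esub> w" using w submodD(3)[OF B] by (simp add: coset_eq)
    moreover have "z = a \<oplus>\<^bsub>M\<^esub> w" by (rule phi_inj) (use a w z1 in \<open>simp_all add: add_closed add_hom\<close>)
    ultimately show "z \<in> (N +>\<^bsub>M\<^esub> v) <+>\<^bsub>M\<^esub> (N +>\<^bsub>M\<^esub> w)" by (auto simp: set_add_def')
  qed
  then show ?thesis by (simp add: quotient_module_def)
qed

lemma smult_quotient: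
  assumes v: "v \<in> carrier M" and r: "r \<in> R"
  shows "r \<odot>\<^bsub>quotient_module M N\<^esub> (N +>\<^bsub>M\<^esub> v) = N +>\<^bsub>M\<^esub> (r \<odot>\<^bsub>M\<^esub> v)"
proof -
  have "N +>\<^bsub>M\<^esub> (r \<odot>\<^bsub>M\<^esub> x) = N +>\<^bsub>M\<^esub> (r \<odot>\<^bsub>M\<^esub> v)" if x: "x \<in> N +>\<^bsub>M\<^esub> v" for x
  proof -
    have x1: "x \<in> carrier M" "\<phi> x - \<phi> v \<in> B" using x v by (simp_all add: coset_eq)
    have "r \<star> (\<phi> x - \<phi> v) \<in> B" by (rule submodD(2)[OF B r x1(2)])
    then show ?thesis using x1(1) v r
      by (simp add: coset_eq_coset_iff smult_closed smult_hom scale_right_diff_distrib)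
  qed
  moreover have "v \<in> N +>\<^bsub>M\<^esub> v" using v submodD(3)[OF B] by (simp add: coset_eq)
  ultimately have "(\<Union>x\<in>N +>\<^bsub>M\<^esub> v. N +>\<^bsub>M\<^esub> (r \<odot>\<^bsub>M\<^esub> x)) = N +>\<^bsub>M\<^esub> (r \<odot>\<^bsub>M\<^esub> v)" by blast
  then show ?thesis by (simp add: quotient_module_def)
qed

lemma card_quotient: "card (carrier (quotient_module M N)) = index A B"
proof -
  have "card ((\<lambda>v. N +>\<^bsub>M\<^esub> v) ` carrier M) = card ((\<lambda>v. coset B (\<phi> v)) ` carrier M)"
    by (rule card_image_same_kernel(1)) (simp add: coset_eq_coset_iff coset_eq_iff[OF submodD(1)[OF B]])
  also have "(\<lambda>v. coset B (\<phi> v)) ` carrier M = coset B ` A"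
    using bij unfolding bij_betw_def by (metis image_image)
  finally show ?thesis by (simp add: carrier_quotient index_def)
qed

end

context dedekind_subring
begin

lemma regular_quotient:
  assumes I: "ideal_in R I"
  shows "represented_quotient R (*) (regular_module (ring_on R)) I (\<lambda>x. x) R I"
proof -
  interpret K: dedekind_module R "(*)" by unfold_locales (simp_all add: algebra_simps)
  have sm: "K.submod J" if "ideal_in R J" for J using idealD[OF that] by (simp add: K.submod_def)
  show ?thesis
    by unfold_locales
      (use sm[OF I] sm[OF ideal_R] idealD(2,4)[OF I] in
        \<open>auto simp: regular_module_def ring_on_def field_ring_def bij_betw_def\<close>)
qed

lemma foldr_PW:
  assumes "\<forall>i<m. prime_in (p i)"
  shows "multiplicative_ideal (foldr (\<lambda>i. IP (PW (p i) (e i))) [0..<m] R)"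
    and "index R (foldr (\<lambda>i. IP (PW (p i) (e i))) [0..<m] R) = (\<Prod>i<m. index R (PW (p i) (e i)))"
proof -
  have gen: "multiplicative_ideal (foldr (\<lambda>i. IP (PW (p i) (e i))) is R) \<and>
      index R (foldr (\<lambda>i. IP (PW (p i) (e i))) is R) = (\<Prod>i\<leftarrow>is. index R (PW (p i) (e i)))"
    if "\<forall>i\<in>set is. prime_in (p i)" for "is"
    using that
  proof (induction "is")
    case Nil then show ?case using multiplicative_R index_self(1)[OF R_subgroup] by simp
  next
    case (Cons j js)
    then have IH: "multiplicative_ideal (foldr (\<lambda>i. IP (PW (p i) (e i))) js R)"
      "index R (foldr (\<lambda>i. IP (PW (p i) (e i))) js R) = (\<Prod>i\<leftarrow>js. index R (PW (p i) (e i)))"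
      and pj: "multiplicative_ideal (PW (p j) (e j))"
      by (simp_all add: multiplicative_PW)
    then show ?case
      using multiplicative_IP[OF pj IH(1)] multiplicativeD(3)[OF pj multiplicativeD(1,2)[OF IH(1)]] by simp
  qed
  have *: "\<forall>i\<in>set [0..<m]. prime_in (p i)" using assms by simp
  show "multiplicative_ideal (foldr (\<lambda>i. IP (PW (p i) (e i))) [0..<m] R)"
    using gen[OF *] by simp
  have "(\<Prod>i\<leftarrow>[0..<m]. index R (PW (p i) (e i))) = (\<Prod>i<m. index R (PW (p i) (e i)))"
    by (simp add: prod.list_conv_set_nth atLeast0LessThan)
  then show "index R (foldr (\<lambda>i. IP (PW (p i) (e i))) [0..<m] R) = (\<Prod>i<m. index R (PW (p i) (e i)))"
    using gen[OF *] by simp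
qed

end

context represented_quotient
begin

lemma chi_decomposition_exists:
  assumes fin: "finite_index A B"
  shows "\<exists>(m::nat) (p :: nat \<Rightarrow> 'k set) (e :: nat \<Rightarrow> nat). (\<forall>i<m. prime_in (p i)) \<and>
     module_isomorphic (ring_on R) (quotient_module M N)
       (direct_sum_module {..<m} (\<lambda>i. quotient_module (regular_module (ring_on R)) (PW (p i) (e i))))"
proof -
  obtain m :: nat and x P e where dec: "\<forall>i<m. x i \<in> A \<and> prime_in (P i)"
    "\<forall>y\<in>A. \<exists>r. (\<forall>i<m. r i \<in> R) \<and> y - (\<Sum>i<m. r i \<star> x i) \<in> B"
    "\<forall>r. (\<forall>i<m. r i \<in> R) \<longrightarrow> ((\<Sum>i<m. r i \<star> x i) \<in> B \<longleftrightarrow> (\<forall>i<m. r i \<in> PW (P i) (e i)))"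
    by (rule finite_module_decomposition[OF A B BA fin])
  have P: "prime_in (P i)" if "i < m" for i using dec(1) that by simp
  define Q where "Q i = quotient_module (regular_module (ring_on R)) (PW (P i) (e i))" for i
  define c where "c i r = PW (P i) (e i) +>\<^bsub>regular_module (ring_on R)\<^esub> r" for i r
  have rq: "represented_quotient R (*) (regular_module (ring_on R)) (PW (P i) (e i)) (\<lambda>x. x) R (PW (P i) (e i))"
    if "i < m" for i by (rule regular_quotient[OF PW_ideal(1)[OF P[OF that]]])
  have reg [simp]: "carrier (regular_module (ring_on R)) = R"
    "a \<oplus>\<^bsub>regular_module (ring_on R)\<^esub> b = a + b" "a \<odot>\<^bsub>regular_module (ring_on R)\<^esub> b = a * b" for a b
    by (simp_all add: regular_module_def ring_on_def field_ring_def)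
  have c_eq: "c i r = c i r' \<longleftrightarrow> r - r' \<in> PW (P i) (e i)" if "i < m" "r \<in> R" "r' \<in> R" for i r r'
    using represented_quotient.coset_eq_coset_iff[OF rq[OF that(1)]] that(2,3) by (simp add: c_def)
  have c_car: "carrier (Q i) = c i ` R" if "i < m" for i
    using represented_quotient.carrier_quotient[OF rq[OF that]] by (simp add: Q_def c_def)
  have c_add: "c i r \<oplus>\<^bsub>Q i\<^esub> c i r' = c i (r + r')" if "i < m" "r \<in> R" "r' \<in> R" for i r r'
    using represented_quotient.add_quotient[OF rq[OF that(1)]] that(2,3) by (simp add: Q_def c_def)
  have c_smult: "s \<odot>\<^bsub>Q i\<^esub> c i r = c i (s * r)" if "i < m" "r \<in> R" "s \<in> R" for i r s
    using represented_quotient.smult_quotient[OF rq[OF that(1)]] that(2,3) by (simp add: Q_def c_def)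
  define coords where "coords y r \<longleftrightarrow> (\<forall>i<m. r i \<in> R) \<and> y - (\<Sum>i<m. r i \<star> x i) \<in> B" for y and r :: "nat \<Rightarrow> 'k"
  have sumA: "(\<Sum>i<m. r i \<star> x i) \<in> A" if "\<forall>i<m. r i \<in> R" for r
    by (rule add_subgroup_sum[OF submodD(1)[OF A]]) (use that dec(1) submodD(2)[OF A] in simp)
  \<comment> \<open>coordinates are unique modulo the prime powers\<close>
  have coords_eq: "y - y' \<in> B \<longleftrightarrow> (\<forall>i<m. c i (r i) = c i (r' i))"
    if c: "coords y r" "coords y' r'" for y y' r r'
  proof -
    have rR: "\<forall>i<m. r i - r' i \<in> R" using c by (simp add: coords_def)
    have s: "(\<Sum>i<m. (r i - r' i) \<star> x i) = (\<Sum>i<m. r i \<star> x i) - (\<Sum>i<m. r' i \<star> x i)"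
      by (simp add: scale_left_diff_distrib sum_subtractf)
    have d: "(y - (\<Sum>i<m. r i \<star> x i)) - (y' - (\<Sum>i<m. r' i \<star> x i)) \<in> B"
      by (rule submodD(5)[OF B]) (use c in \<open>simp_all add: coords_def\<close>)
    have "y - y' \<in> B \<longleftrightarrow> (\<Sum>i<m. (r i - r' i) \<star> x i) \<in> B"
    proof
      assume "y - y' \<in> B"
      from submodD(5)[OF B this d] show "(\<Sum>i<m. (r i - r' i) \<star> x i) \<in> B" unfolding s by (simp add: algebra_simps)
    next
      assume "(\<Sum>i<m. (r i - r' i) \<star> x i) \<in> B"
      from submodD(4)[OF B this d] show "y - y' \<in> B" unfolding s by (simp add: algebra_simps)
    qed
    also have "\<dots> \<longleftrightarrow> (\<forall>i<m. r i - r' i \<in> PW (P i) (e i))" by (rule dec(3)[THEN spec, THEN mp, OF rR])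
    also have "\<dots> \<longleftrightarrow> (\<forall>i<m. c i (r i) = c i (r' i))" using c c_eq by (auto simp: coords_def)
    finally show ?thesis .
  qed
  define f where "f X = (\<lambda>i\<in>{..<m}. c i ((SOME r. \<exists>v\<in>carrier M. X = N +>\<^bsub>M\<^esub> v \<and> coords (\<phi> v) r) i))" for X
  have ex: "\<exists>r. coords (\<phi> v) r" if "v \<in> carrier M" for v
    using dec(2) phi_in[OF that] by (simp add: coords_def)
  have f_eq: "f (N +>\<^bsub>M\<^esub> v) = (\<lambda>i\<in>{..<m}. c i (r i))" if v: "v \<in> carrier M" and r: "coords (\<phi> v) r" for v r
  proof -
    define r' where "r' = (SOME r. \<exists>w\<in>carrier M. N +>\<^bsub>M\<^esub> v = N +>\<^bsub>M\<^esub> w \<and> coords (\<phi> w) r)"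
    have "\<exists>w\<in>carrier M. N +>\<^bsub>M\<^esub> v = N +>\<^bsub>M\<^esub> w \<and> coords (\<phi> w) r'"
      unfolding r'_def by (rule someI[of _ r]) (use v r in blast)
    then obtain w where w: "w \<in> carrier M" "N +>\<^bsub>M\<^esub> v = N +>\<^bsub>M\<^esub> w" "coords (\<phi> w) r'" by blast
    have "\<phi> w - \<phi> v \<in> B" using coset_eq_coset_iff[OF w(1) v] w(2) by simp
    then have "\<forall>i<m. c i (r' i) = c i (r i)" using coords_eq[OF w(3) r] by simp
    then show ?thesis unfolding f_def r'_def[symmetric] by (intro restrict_ext) simp
  qed
  have f_inj: "inj_on f (carrier (quotient_module M N))"
  proof (rule inj_onI)
    fix X Y assume "X \<in> carrier (quotient_module M N)" "Y \<in> carrier (quotient_module M N)" and eq: "f X = f Y"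
    then obtain v w where vw: "v \<in> carrier M" "X = N +>\<^bsub>M\<^esub> v" "w \<in> carrier M" "Y = N +>\<^bsub>M\<^esub> w"
      unfolding carrier_quotient by blast
    obtain r r' where r: "coords (\<phi> v) r" "coords (\<phi> w) r'" using ex[OF vw(1)] ex[OF vw(3)] by blast
    have "\<forall>i<m. c i (r i) = c i (r' i)"
    proof (intro allI impI)
      fix i assume "i < m"
      then show "c i (r i) = c i (r' i)"
        using fun_cong[OF eq[unfolded vw(2,4) f_eq[OF vw(1) r(1)] f_eq[OF vw(3) r(2)]], of i] by simp
    qed
    then show "X = Y" unfolding vw(2,4) coset_eq_coset_iff[OF vw(1,3)] coords_eq[OF r] .
  qed
  have f_onto: "f ` carrier (quotient_module M N) = (\<Pi>\<^sub>E i\<in>{..<m}. carrier (Q i))"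
  proof (intro equalityI subsetI)
    fix g assume "g \<in> f ` carrier (quotient_module M N)"
    then obtain v where v: "v \<in> carrier M" "g = f (N +>\<^bsub>M\<^esub> v)" unfolding carrier_quotient by blast
    obtain r where r: "coords (\<phi> v) r" using ex[OF v(1)] by blast
    show "g \<in> (\<Pi>\<^sub>E i\<in>{..<m}. carrier (Q i))"
      unfolding v(2) f_eq[OF v(1) r] using r by (auto simp: c_car coords_def)
  next
    fix g assume g: "g \<in> (\<Pi>\<^sub>E i\<in>{..<m}. carrier (Q i))"
    have "\<forall>i\<in>{..<m}. \<exists>r\<in>R. g i = c i r"
    proof
      fix i assume i: "i \<in> {..<m}"
      then have "g i \<in> c i ` R" using PiE_mem[OF g i] c_car by simp
      then show "\<exists>r\<in>R. g i = c i r" by blast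
    qed
    then obtain r where r: "\<forall>i\<in>{..<m}. r i \<in> R \<and> g i = c i (r i)" by metis
    obtain v where v: "v \<in> carrier M" "\<phi> v = (\<Sum>i<m. r i \<star> x i)" using phi_onto[OF sumA[of r]] r by auto
    have "coords (\<phi> v) r" using r v(2) submodD(3)[OF B] by (simp add: coords_def)
    then have "f (N +>\<^bsub>M\<^esub> v) = (\<lambda>i\<in>{..<m}. c i (r i))" by (rule f_eq[OF v(1)])
    also have "\<dots> = g" using g r by (intro PiE_ext[OF _ g]) (simp_all add: c_car)
    finally show "g \<in> f ` carrier (quotient_module M N)" unfolding carrier_quotient using v(1) by blast
  qed
  have f_add: "f (X \<oplus>\<^bsub>quotient_module M N\<^esub> Y) = (\<lambda>i\<in>{..<m}. f X i \<oplus>\<^bsub>Q i\<^esub> f Y i)"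
    if XY: "X \<in> carrier (quotient_module M N)" "Y \<in> carrier (quotient_module M N)" for X Y
  proof -
    obtain v w where vw: "v \<in> carrier M" "X = N +>\<^bsub>M\<^esub> v" "w \<in> carrier M" "Y = N +>\<^bsub>M\<^esub> w"
      using XY unfolding carrier_quotient by blast
    obtain r r' where r: "coords (\<phi> v) r" "coords (\<phi> w) r'" using ex[OF vw(1)] ex[OF vw(3)] by blast
    have "coords (\<phi> (v \<oplus>\<^bsub>M\<^esub> w)) (\<lambda>i. r i + r' i)"
    proof -
      have "(\<phi> v - (\<Sum>i<m. r i \<star> x i)) + (\<phi> w - (\<Sum>i<m. r' i \<star> x i)) \<in> B"
        by (rule submodD(4)[OF B]) (use r in \<open>simp_all add: coords_def\<close>)
      then show ?thesis using r vw unfolding coords_def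
        by (simp add: add_hom scale_left_distrib sum.distrib algebra_simps)
    qed
    from f_eq[OF add_closed[OF vw(1,3)] this] show ?thesis
      unfolding vw(2,4) add_quotient[OF vw(1,3)] f_eq[OF vw(1) r(1)] f_eq[OF vw(3) r(2)]
      using r by (simp add: c_add coords_def cong: restrict_cong)
  qed
  have f_smult: "f (s \<odot>\<^bsub>quotient_module M N\<^esub> X) = (\<lambda>i\<in>{..<m}. s \<odot>\<^bsub>Q i\<^esub> f X i)"
    if X: "X \<in> carrier (quotient_module M N)" and s: "s \<in> R" for X s
  proof -
    obtain v where v: "v \<in> carrier M" "X = N +>\<^bsub>M\<^esub> v" using X unfolding carrier_quotient by blast
    obtain r where r: "coords (\<phi> v) r" using ex[OF v(1)] by blast
    have "coords (\<phi> (s \<odot>\<^bsub>M\<^esub> v)) (\<lambda>i. s * r i)"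
    proof -
      have "s \<star> (\<phi> v - (\<Sum>i<m. r i \<star> x i)) \<in> B"
        by (rule submodD(2)[OF B s]) (use r in \<open>simp add: coords_def\<close>)
      then show ?thesis using r v s unfolding coords_def
        by (simp add: smult_hom scale_right_diff_distrib scale_sum_right)
    qed
    from f_eq[OF smult_closed[OF s v(1)] this] show ?thesis
      unfolding v(2) smult_quotient[OF v(1) s] f_eq[OF v(1) r]
      using r s by (simp add: c_smult coords_def cong: restrict_cong)
  qed
  have "module_isomorphic (ring_on R) (quotient_module M N) (direct_sum_module {..<m} Q)"
    unfolding module_isomorphic_def
  proof (intro exI[of _ f] conjI ballI)
    show "bij_betw f (carrier (quotient_module M N)) (carrier (direct_sum_module {..<m} Q))"
      using f_inj f_onto by (simp add: bij_betw_def direct_sum_module_def)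
  qed (use f_add f_smult in \<open>simp_all add: direct_sum_module_def\<close>)
  then show ?thesis unfolding Q_def using P by blast
qed

text \<open>In every decomposition into cyclic modules the orders multiply to the number of elements,
  and so do the norms of the prime powers; hence the choice inside \<open>\<chi>\<close> does
  not affect its norm.\<close>

lemma chi_index:
  assumes fin: "finite_index A B"
  shows "multiplicative_ideal (chi_module (ring_on R) (quotient_module M N))"
    and "index R (chi_module (ring_on R) (quotient_module M N)) = index A B"
proof -
  define good where "good J \<longleftrightarrow> (\<exists>m (p :: nat \<Rightarrow> 'k set) (e :: nat \<Rightarrow> nat).
        (\<forall>i<m. primeideal (p i) (ring_on R) \<and> p i \<noteq> {\<zero>\<^bsub>ring_on R\<^esub>}) \<and>
        module_isomorphic (ring_on R) (quotient_module M N)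
          (direct_sum_module {..<m}
             (\<lambda>i. quotient_module (regular_module (ring_on R)) (PW (p i) (e i)))) \<and>
        J = foldr (\<lambda>i. IP (PW (p i) (e i))) [0..<m] (carrier (ring_on R)))" for J
  have chi: "chi_module (ring_on R) (quotient_module M N) = (SOME J. good J)"
    unfolding chi_module_def good_def ..
  have "\<exists>J. good J"
    using chi_decomposition_exists[OF fin] unfolding good_def by (auto simp: prime_iff)
  then have "good (chi_module (ring_on R) (quotient_module M N))" unfolding chi by (rule someI_ex)
  then obtain m p e where J: "\<forall>i<m. prime_in (p i)"
    "module_isomorphic (ring_on R) (quotient_module M N)
          (direct_sum_module {..<m}
             (\<lambda>i. quotient_module (regular_module (ring_on R)) (PW (p i) (e i))))"
    "chi_module (ring_on R) (quotient_module M N) = foldr (\<lambda>i. IP (PW (p i) (e i))) [0..<m] R"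
    unfolding good_def by (auto simp: prime_iff)
  show "multiplicative_ideal (chi_module (ring_on R) (quotient_module M N))"
    unfolding J(3) by (rule foldr_PW(1)[OF J(1)])
  have "index A B = card (carrier (quotient_module M N))" by (rule card_quotient[symmetric])
  also have "\<dots> = card (\<Pi>\<^sub>E i\<in>{..<m}. carrier (quotient_module (regular_module (ring_on R)) (PW (p i) (e i))))"
    using J(2) unfolding module_isomorphic_def by (auto simp: direct_sum_module_def dest: bij_betw_same_card)
  also have "\<dots> = (\<Prod>i<m. card (carrier (quotient_module (regular_module (ring_on R)) (PW (p i) (e i)))))"
    by (rule card_PiE) simp
  also have "\<dots> = (\<Prod>i<m. index R (PW (p i) (e i)))"
    using J(1) represented_quotient.card_quotient[OF regular_quotient[OF PW_ideal(1)]] by (intro prod.cong) simp_all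
  finally show "index R (chi_module (ring_on R) (quotient_module M N)) = index A B"
    unfolding J(3) foldr_PW(2)[OF J(1)] by simp
qed

end

section \<open>Row reduction\<close>

text \<open>Gaussian elimination as an induction principle: row additions and scalings turn an
  invertible matrix into the identity.\<close>

lemma row_reduction_induct:
  fixes Q :: "'a::field mat \<Rightarrow> bool"
  assumes zero: "\<And>A. A \<in> carrier_mat n n \<Longrightarrow> Determinant.det A = 0 \<Longrightarrow> Q A"
    and one: "Q (1\<^sub>m n)"
    and add: "\<And>A a k l. A \<in> carrier_mat n n \<Longrightarrow> k < n \<Longrightarrow> l < n \<Longrightarrow> k \<noteq> l \<Longrightarrow> Q (addrow a k l A) \<Longrightarrow> Q A"
    and mult: "\<And>A a k. A \<in> carrier_mat n n \<Longrightarrow> k < n \<Longrightarrow> a \<noteq> 0 \<Longrightarrow> Q (multrow k a A) \<Longrightarrow> Q A"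
    and A: "A \<in> carrier_mat n n"
  shows "Q A"
proof -
  define unit_cols where "unit_cols c A \<longleftrightarrow> (\<forall>j<c. \<forall>i<n. A $$ (i,j) = (if i = j then 1 else 0))" for c and A :: "'a mat"
  have "Q A" if "c \<le> n" "A \<in> carrier_mat n n" "unit_cols c A" for c A
    using that
  proof (induction "n - c" arbitrary: c A)
    case 0
    then have "A = 1\<^sub>m n" by (intro eq_matI) (auto simp: unit_cols_def)
    then show ?case using one by simp
  next
    case (Suc m)
    then have c: "c < n" and m: "m = n - Suc c" by simp_all
    \<comment> \<open>once column c is cleared outside the diagonal, the induction hypothesis applies\<close>
    have clear: "Q B" if "B \<in> carrier_mat n n" "unit_cols c B" "B $$ (c,c) = 1" "k \<le> n"
        "\<forall>i<k. i \<noteq> c \<longrightarrow> B $$ (i,c) = 0" for k B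
      using that
    proof (induction "n - k" arbitrary: k B)
      case 0
      then have "unit_cols (Suc c) B" by (auto simp: unit_cols_def less_Suc_eq)
      then show ?case using Suc.hyps(1)[OF m, of B] 0 c by simp
    next
      case (Suc m')
      then have k: "k < n" and m': "m' = n - Suc k" by simp_all
      show ?case
      proof (cases "k = c")
        case True
        then show ?thesis using Suc.hyps(1)[OF m', of B] Suc.prems k by (auto simp: less_Suc_eq)
      next
        case False
        define B' where "B' = addrow (- (B $$ (k,c))) k c B"
        have "Q B'"
        proof (rule Suc.hyps(1)[OF m'])
          show "B' \<in> carrier_mat n n" using Suc.prems(1) by (auto simp: B'_def)
          show "unit_cols c B'" using Suc.prems(1,2) k c by (auto simp: unit_cols_def B'_def)
          show "B' $$ (c,c) = 1" using Suc.prems(1,3) k c False by (auto simp: B'_def)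
          show "\<forall>i<Suc k. i \<noteq> c \<longrightarrow> B' $$ (i,c) = 0" using Suc.prems k c by (auto simp: B'_def less_Suc_eq)
        qed (use k in simp)
        then show ?thesis unfolding B'_def by (rule add[OF Suc.prems(1) k c False])
      qed
    qed
    have scale: "Q B" if B: "B \<in> carrier_mat n n" "unit_cols c B" "B $$ (c,c) \<noteq> 0" for B
    proof -
      have "Q (multrow c (inverse (B $$ (c,c))) B)"
        by (rule clear[of _ 0]) (use B c in \<open>auto simp: unit_cols_def\<close>)
      then show ?thesis using mult[OF B(1) c, of "inverse (B $$ (c,c))"] B(3) by simp
    qed
    show ?case
    proof (cases "\<exists>r. c \<le> r \<and> r < n \<and> A $$ (r,c) \<noteq> 0")
      case True
      then obtain r where r: "c \<le> r" "r < n" "A $$ (r,c) \<noteq> 0" by blast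
      show ?thesis
      proof (cases "A $$ (c,c) = 0")
        case True
        then have rc: "r \<noteq> c" using r by auto
        have "Q (addrow 1 c r A)"
          by (rule scale) (use Suc.prems r c True rc in \<open>auto simp: unit_cols_def\<close>)
        then show ?thesis using add[OF Suc.prems(2) c r(2)] rc by metis
      qed (use scale Suc.prems in simp)
    next
      case False
      then have z: "A $$ (r,c) = 0" if "c \<le> r" "r < n" for r using that by blast
      define v where "v = Matrix.vec n (\<lambda>j. if j < c then A $$ (j,c) else if j = c then - 1 else 0)"
      have v: "v \<in> carrier_vec n" by (simp add: v_def)
      have "A *\<^sub>v v = 0\<^sub>v n"
      proof (rule eq_vecI)
        fix i assume "i < dim_vec (0\<^sub>v n :: 'a Matrix.vec)"
        then have i: "i < n" by simp
        have "vec_index (A *\<^sub>v v) i = (\<Sum>j<n. A $$ (i,j) * (if j < c then A $$ (j,c) else if j = c then - 1 else 0))"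
          using Suc.prems(2) i by (simp add: scalar_prod_def v_def atLeast0LessThan)
        also have "\<dots> = (\<Sum>j<n. (if j = i \<and> i < c then A $$ (i,c) else 0) + (if j = c then - A $$ (i,c) else 0))"
          using Suc.prems(3) i by (intro sum.cong refl) (auto simp: unit_cols_def)
        also have "\<dots> = (\<Sum>j<n. if j = i \<and> i < c then A $$ (i,c) else 0) + (\<Sum>j<n. if j = c then - A $$ (i,c) else 0)"
          by (rule sum.distrib)
        also have "(\<Sum>j<n. if j = i \<and> i < c then A $$ (i,c) else 0) = (if i < c then A $$ (i,c) else 0)"
          using i by (cases "i < c") (simp_all add: sum.delta)
        also have "(\<Sum>j<n. if j = c then - A $$ (i,c) else 0) = - A $$ (i,c)" using c by (simp add: sum.delta)
        also have "(if i < c then A $$ (i,c) else 0) + - A $$ (i,c) = 0" using z[of i] i by simp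
        finally show "vec_index (A *\<^sub>v v) i = vec_index (0\<^sub>v n) i" using i by simp
      qed (use Suc.prems(2) in simp)
      moreover have "v \<noteq> 0\<^sub>v n"
      proof
        assume "v = 0\<^sub>v n"
        then have "vec_index v c = vec_index (0\<^sub>v n) c" by simp
        then show False using c by (simp add: v_def)
      qed
      ultimately have "Determinant.det A = 0" using det_0_iff_vec_prod_zero_field[OF Suc.prems(2)] v by blast
      then show ?thesis by (rule zero[OF Suc.prems(2)])
    qed
  qed
  from this[of 0 A] show ?thesis using A by (simp add: unit_cols_def)
qed

section \<open>Lattices in coordinate space\<close>

definition vscale :: "'k::field_char_0 \<Rightarrow> (nat \<Rightarrow> 'k) \<Rightarrow> nat \<Rightarrow> 'k" where
  "vscale c f = (\<lambda>i. c * f i)"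

definition mat_apply :: "nat \<Rightarrow> 'k::field_char_0 mat \<Rightarrow> (nat \<Rightarrow> 'k) \<Rightarrow> nat \<Rightarrow> 'k" where
  "mat_apply n A f = (\<lambda>i. if i < n then \<Sum>j<n. A $$ (i,j) * f j else 0)"

definition coord_space :: "nat \<Rightarrow> (nat \<Rightarrow> 'k::field_char_0) set" where
  "coord_space n = {f. \<forall>i\<ge>n. f i = 0}"

lemma vscale_vector_space: "vector_space (vscale :: 'k::field_char_0 \<Rightarrow> _)"
  by unfold_locales (auto simp: vscale_def fun_eq_iff algebra_simps)

lemma vscale_simps [simp]: "vscale c f i = c * f i" "vscale a (vscale b f) = vscale (a * b) f"
    "vscale 1 f = f" "vscale c 0 = 0"
  by (auto simp: vscale_def fun_eq_iff)

lemma vscale_diff: "vscale c (f - g) = vscale c f - vscale c g"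
  by (auto simp: vscale_def fun_eq_iff algebra_simps)

lemma vscale_subgroup: "add_subgroup L \<Longrightarrow> add_subgroup (vscale c ` L)"
  by (rule add_subgroup_image[where g = "vscale c"]) (simp_all add: vscale_diff)

lemma coord_spaceI: "(\<And>i. i \<ge> n \<Longrightarrow> f i = 0) \<Longrightarrow> f \<in> coord_space n"
  and coord_spaceD: "f \<in> coord_space n \<Longrightarrow> i \<ge> n \<Longrightarrow> f i = 0"
  by (simp_all add: coord_space_def)

context dedekind_subring
begin

definition std_lattice :: "nat \<Rightarrow> (nat \<Rightarrow> 'k) set" where
  "std_lattice n = {f. f \<in> coord_space n \<and> (\<forall>i<n. f i \<in> R)}"

lemma std_lattice_iff: "f \<in> std_lattice n \<longleftrightarrow> f \<in> coord_space n \<and> (\<forall>i<n. f i \<in> R)"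
  by (simp add: std_lattice_def)

lemma std_lattice_subgroup [simp]: "add_subgroup (std_lattice n)"
  by (simp add: add_subgroup_def std_lattice_def coord_space_def)

text \<open>A group squeezed between two multiples of \<open>R\<^sup>n\<close>: this is what index
  computations use of a lattice.\<close>

definition lattice_like :: "nat \<Rightarrow> (nat \<Rightarrow> 'k) set \<Rightarrow> bool" where
  "lattice_like n L \<longleftrightarrow> add_subgroup L \<and> L \<subseteq> coord_space n \<and>
     (\<exists>a\<in>R. a \<noteq> 0 \<and> (\<forall>f\<in>L. vscale a f \<in> std_lattice n)) \<and>
     (\<exists>b\<in>R. b \<noteq> 0 \<and> (\<forall>f\<in>std_lattice n. vscale b f \<in> L))"

lemma std_lattice_scale: "a \<in> R \<Longrightarrow> f \<in> std_lattice n \<Longrightarrow> vscale a f \<in> std_lattice n"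
  by (simp add: std_lattice_def coord_space_def)

lemma std_lattice_like: "lattice_like n (std_lattice n)"
proof -
  have "std_lattice n \<subseteq> coord_space n" by (auto simp: std_lattice_def)
  moreover have "\<exists>a\<in>R. a \<noteq> 0 \<and> (\<forall>f\<in>std_lattice n. vscale a f \<in> std_lattice n)"
    by (rule bexI[of _ 1]) simp_all
  ultimately show ?thesis by (simp add: lattice_like_def)
qed

lemma finite_index_std_scale:
  assumes b: "b \<in> R" "b \<noteq> 0"
  shows "finite_index (std_lattice n) (vscale b ` std_lattice n)"
proof -
  define C where "C = (*) b ` R"
  have C: "add_subgroup C" unfolding C_def by (rule scale_subgroup[OF R_subgroup])
  have fin: "finite (coset C ` R)" using finite_quotient[OF b] by (simp add: finite_index_def C_def)
  define F where "F f = (\<lambda>i\<in>{..<n}. coset C (f i))" for f :: "nat \<Rightarrow> 'k"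
  have ker: "F f = F g \<longleftrightarrow> f - g \<in> vscale b ` std_lattice n" if fg: "f \<in> std_lattice n" "g \<in> std_lattice n" for f g
  proof
    assume eq: "F f = F g"
    have "\<forall>i\<in>{..<n}. \<exists>r\<in>R. f i - g i = b * r"
    proof
      fix i assume i: "i \<in> {..<n}"
      have "coset C (f i) = coset C (g i)" using fun_cong[OF eq, of i] i by (simp add: F_def)
      then have "f i - g i \<in> C" by (simp add: coset_eq_iff[OF C])
      then show "\<exists>r\<in>R. f i - g i = b * r" unfolding C_def by blast
    qed
    then obtain r where r: "\<forall>i\<in>{..<n}. r i \<in> R \<and> f i - g i = b * r i" by metis
    define h where "h = (\<lambda>i. if i < n then r i else 0)"
    have "h \<in> std_lattice n" using r by (simp add: h_def std_lattice_def coord_space_def)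
    moreover have "f - g = vscale b h"
      using r fg by (auto simp: fun_eq_iff h_def std_lattice_def coord_space_def)
    ultimately show "f - g \<in> vscale b ` std_lattice n" by blast
  next
    assume "f - g \<in> vscale b ` std_lattice n"
    then obtain h where h: "f - g = vscale b h" "h \<in> std_lattice n" by (rule imageE)
    show "F f = F g" unfolding F_def
    proof (rule restrict_ext)
      fix i assume "i \<in> {..<n}"
      then have "f i - g i = b * h i" "h i \<in> R" using fun_cong[OF h(1), of i] h(2) by (simp_all add: std_lattice_def)
      then have "f i - g i \<in> C" by (simp only: C_def imageI)
      then show "coset C (f i) = coset C (g i)" by (simp add: coset_eq_iff[OF C])
    qed
  qed
  have "F ` std_lattice n \<subseteq> (\<Pi>\<^sub>E i\<in>{..<n}. coset C ` R)"
  proof (rule image_subsetI)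
    fix f assume "f \<in> std_lattice n"
    then show "F f \<in> (\<Pi>\<^sub>E i\<in>{..<n}. coset C ` R)"
      by (intro PiE_I) (simp_all add: F_def std_lattice_def)
  qed
  moreover have "finite (\<Pi>\<^sub>E i\<in>{..<n}. coset C ` R)" by (rule finite_PiE) (simp_all add: fin)
  ultimately have "finite (F ` std_lattice n)" by (rule finite_subset)
  moreover have "add_subgroup (vscale b ` std_lattice n)"
    by (rule vscale_subgroup[OF std_lattice_subgroup])
  ultimately show ?thesis using index_eq_card(2)[OF _ ker] by blast
qed

lemma lattice_like_finite_index:
  assumes L: "lattice_like n L" and c: "c \<in> R" "c \<noteq> 0" and sub: "\<forall>f\<in>std_lattice n. vscale c f \<in> L"
  shows "finite_index L (vscale c ` std_lattice n)"
proof -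
  obtain a where a: "a \<in> R" "a \<noteq> 0" "\<forall>f\<in>L. vscale a f \<in> std_lattice n"
    using L unfolding lattice_like_def by blast
  have s: "add_subgroup L" using L by (simp add: lattice_like_def)
  have t: "add_subgroup (vscale c ` std_lattice n)" for c by (rule vscale_subgroup[OF std_lattice_subgroup])
  have u: "add_subgroup (vscale a ` L)" by (rule vscale_subgroup[OF s])
  have sub': "vscale c ` std_lattice n \<subseteq> L" using sub by (simp add: image_subset_iff)
  have inj: "inj_on (vscale a) L" using a(2) by (auto simp: inj_on_def vscale_def fun_eq_iff)
  have e: "vscale a ` vscale c ` std_lattice n = vscale (a * c) ` std_lattice n" by (simp add: image_image)
  have "finite_index (vscale a ` L) (vscale (a * c) ` std_lattice n)"
  proof (rule index_mono(2)[OF u t])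
    show "vscale (a * c) ` std_lattice n \<subseteq> vscale a ` L" unfolding e[symmetric] by (rule image_mono[OF sub'])
    show "vscale a ` L \<subseteq> std_lattice n" using a(3) by (simp add: image_subset_iff)
    show "finite_index (std_lattice n) (vscale (a * c) ` std_lattice n)"
      by (rule finite_index_std_scale) (use a c in simp_all)
  qed
  then show ?thesis using index_image(2)[OF s t sub' vscale_diff inj] by (simp only: e)
qed

lemma lattice_like_commensurable:
  assumes L: "lattice_like n L" and L': "lattice_like n L'"
  shows "commensurable L L'"
proof -
  obtain b where b: "b \<in> R" "b \<noteq> 0" "\<forall>f\<in>std_lattice n. vscale b f \<in> L"
    using L unfolding lattice_like_def by blast
  obtain b' where b': "b' \<in> R" "b' \<noteq> 0" "\<forall>f\<in>std_lattice n. vscale b' f \<in> L'"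
    using L' unfolding lattice_like_def by blast
  have c: "b * b' \<in> R" "b * b' \<noteq> 0" using b b' by simp_all
  have 1: "\<forall>f\<in>std_lattice n. vscale (b * b') f \<in> L"
  proof
    fix f assume "f \<in> std_lattice n"
    then have "vscale b (vscale b' f) \<in> L" using b(3) std_lattice_scale[OF b'(1)] by blast
    then show "vscale (b * b') f \<in> L" by simp
  qed
  have 2: "\<forall>f\<in>std_lattice n. vscale (b * b') f \<in> L'"
  proof
    fix f assume "f \<in> std_lattice n"
    then have "vscale b' (vscale b f) \<in> L'" using b'(3) std_lattice_scale[OF b(1)] by blast
    then show "vscale (b * b') f \<in> L'" by (simp add: mult.commute)
  qed
  show ?thesis
    by (rule gen_index_eq(2)[OF _ _ _ _ _ lattice_like_finite_index[OF L c 1] lattice_like_finite_index[OF L' c 2]])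
       (use 1 2 L L' in \<open>simp_all add: lattice_like_def image_subset_iff vscale_subgroup[OF std_lattice_subgroup]\<close>)
qed

definition lattice_map :: "nat \<Rightarrow> ((nat \<Rightarrow> 'k) \<Rightarrow> (nat \<Rightarrow> 'k)) \<Rightarrow> bool" where
  "lattice_map n g \<longleftrightarrow> (\<forall>f h. g (f - h) = g f - g h) \<and> (\<forall>c f. g (vscale c f) = vscale c (g f)) \<and>
     g ` coord_space n \<subseteq> coord_space n \<and> inj_on g (coord_space n) \<and> lattice_like n (g ` std_lattice n)"

lemma lattice_mapD:
  assumes "lattice_map n g"
  shows "\<And>f h. g (f - h) = g f - g h" "\<And>c f. g (vscale c f) = vscale c (g f)"
     "g ` coord_space n \<subseteq> coord_space n" "inj_on g (coord_space n)" "lattice_like n (g ` std_lattice n)"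
  using assms unfolding lattice_map_def by blast+

lemma lattice_map_image:
  assumes g: "lattice_map n g" and L: "lattice_like n L"
  shows "lattice_like n (g ` L)"
proof -
  note G = lattice_mapD[OF g]
  obtain a where a: "a \<in> R" "a \<noteq> 0" "\<forall>f\<in>L. vscale a f \<in> std_lattice n"
    using L unfolding lattice_like_def by blast
  obtain b where b: "b \<in> R" "b \<noteq> 0" "\<forall>f\<in>std_lattice n. vscale b f \<in> L"
    using L unfolding lattice_like_def by blast
  obtain a' where a': "a' \<in> R" "a' \<noteq> 0" "\<forall>f\<in>g ` std_lattice n. vscale a' f \<in> std_lattice n"
    using G(5) unfolding lattice_like_def by blast
  obtain b' where b': "b' \<in> R" "b' \<noteq> 0" "\<forall>f\<in>std_lattice n. vscale b' f \<in> g ` std_lattice n"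
    using G(5) unfolding lattice_like_def by blast
  have "vscale (a' * a) (g f) \<in> std_lattice n" if "f \<in> L" for f
  proof -
    have "vscale a' (g (vscale a f)) \<in> std_lattice n" using a(3) that a'(3) by blast
    then show ?thesis by (simp add: G(2))
  qed
  moreover have "vscale (b * b') f \<in> g ` L" if "f \<in> std_lattice n" for f
  proof -
    have "vscale b' f \<in> g ` std_lattice n" using b'(3) that by blast
    then obtain h where h: "vscale b' f = g h" "h \<in> std_lattice n" by (rule imageE)
    have "vscale (b * b') f = vscale b (vscale b' f)" by simp
    also have "\<dots> = g (vscale b h)" unfolding h(1) by (simp only: G(2))
    finally show ?thesis using b(3) h(2) by blast
  qed
  moreover have "g ` L \<subseteq> coord_space n" using L G(3) unfolding lattice_like_def by blast
  moreover have "add_subgroup (g ` L)" using L by (intro add_subgroup_image G(1)) (simp add: lattice_like_def)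
  moreover have "a' * a \<in> R" "a' * a \<noteq> 0" "b * b' \<in> R" "b * b' \<noteq> 0" using a b a' b' by simp_all
  ultimately show ?thesis unfolding lattice_like_def by blast
qed

definition distortion :: "nat \<Rightarrow> ((nat \<Rightarrow> 'k) \<Rightarrow> (nat \<Rightarrow> 'k)) \<Rightarrow> real" where
  "distortion n g = gen_index (std_lattice n) (g ` std_lattice n)"

text \<open>The factor is the same for all lattices, because \<open>g\<close> preserves the index
  between two of them.\<close>

lemma distortion_index:
  assumes g: "lattice_map n g" and L: "lattice_like n L"
  shows "gen_index (std_lattice n) (g ` L) = distortion n g * gen_index (std_lattice n) L"
proof -
  note G = lattice_mapD[OF g]
  have c: "commensurable (std_lattice n) L" by (rule lattice_like_commensurable[OF std_lattice_like L])
  have "std_lattice n \<union> L \<subseteq> coord_space n" using L by (auto simp: lattice_like_def std_lattice_def)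
  then have "inj_on g (std_lattice n \<union> L)" using G(4) by (rule inj_on_subset[rotated])
  note i = gen_index_image[OF c G(1) this]
  show ?thesis unfolding distortion_def i(1)[symmetric]
    by (rule gen_index_trans(1)[OF lattice_like_commensurable[OF std_lattice_like G(5)] i(2)])
qed

lemma lattice_map_comp:
  assumes g: "lattice_map n g" and h: "lattice_map n h"
  shows "lattice_map n (\<lambda>f. g (h f))" "distortion n (\<lambda>f. g (h f)) = distortion n g * distortion n h"
proof -
  note G = lattice_mapD[OF g] and H = lattice_mapD[OF h]
  have e: "(\<lambda>f. g (h f)) ` X = g ` h ` X" for X by (simp add: image_image)
  have "(\<lambda>f. g (h f)) ` coord_space n \<subseteq> coord_space n" unfolding e using G(3) H(3) by blast
  moreover have "inj_on (\<lambda>f. g (h f)) (coord_space n)"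
    using comp_inj_on[OF H(4) inj_on_subset[OF G(4) H(3)]] by (simp add: o_def)
  moreover have "lattice_like n ((\<lambda>f. g (h f)) ` std_lattice n)" unfolding e by (rule lattice_map_image[OF g H(5)])
  ultimately show "lattice_map n (\<lambda>f. g (h f))"
    unfolding lattice_map_def by (simp only: G(1,2) H(1,2) simp_thms)
  show "distortion n (\<lambda>f. g (h f)) = distortion n g * distortion n h"
    using distortion_index[OF g H(5)] unfolding distortion_def e .
qed

lemma lattice_mapI:
  assumes "\<And>f h. g (f - h) = g f - g h" "\<And>c f. g (vscale c f) = vscale c (g f)"
    "\<And>f. f \<in> coord_space n \<Longrightarrow> g f \<in> coord_space n" "\<And>f. f \<in> coord_space n \<Longrightarrow> g' f \<in> coord_space n"
    "\<And>f. f \<in> coord_space n \<Longrightarrow> g' (g f) = f" "\<And>f. f \<in> coord_space n \<Longrightarrow> g (g' f) = f"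
    "a \<in> R" "a \<noteq> 0" "\<And>f. f \<in> std_lattice n \<Longrightarrow> vscale a (g f) \<in> std_lattice n"
    "b \<in> R" "b \<noteq> 0" "\<And>f. f \<in> std_lattice n \<Longrightarrow> vscale b (g' f) \<in> std_lattice n"
  shows "lattice_map n g"
proof -
  have std: "f \<in> coord_space n" if "f \<in> std_lattice n" for f using that by (simp add: std_lattice_def)
  have "vscale b f \<in> g ` std_lattice n" if f: "f \<in> std_lattice n" for f
  proof -
    have "vscale b f = g (vscale b (g' f))" using assms(6)[OF std[OF f]] by (simp add: assms(2))
    then show ?thesis using assms(12)[OF f] by (rule image_eqI)
  qed
  then have 1: "\<exists>b\<in>R. b \<noteq> 0 \<and> (\<forall>f\<in>std_lattice n. vscale b f \<in> g ` std_lattice n)"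
    using assms(10,11) by (intro bexI[of _ b] conjI ballI)
  have 2: "\<exists>a\<in>R. a \<noteq> 0 \<and> (\<forall>f\<in>g ` std_lattice n. vscale a f \<in> std_lattice n)"
    using assms(7-9) by (intro bexI[of _ a] conjI) simp_all
  have 3: "g ` std_lattice n \<subseteq> coord_space n" using std assms(3) by (simp add: image_subset_iff)
  have 4: "inj_on g (coord_space n)" by (rule inj_on_inverseI[of _ g']) (rule assms(5))
  have 5: "g ` coord_space n \<subseteq> coord_space n" using assms(3) by (simp add: image_subset_iff)
  have 6: "add_subgroup (g ` std_lattice n)" by (rule add_subgroup_image[where g = g]) (simp_all add: assms(1))
  show ?thesis unfolding lattice_map_def lattice_like_def
    using assms(1,2) 1 2 3 4 5 6 by simp
qed

definition shear :: "'k \<Rightarrow> nat \<Rightarrow> nat \<Rightarrow> (nat \<Rightarrow> 'k) \<Rightarrow> nat \<Rightarrow> 'k" where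
  "shear a k l f = (\<lambda>i. if i = k then f k + a * f l else f i)"

definition dilation :: "'k \<Rightarrow> nat \<Rightarrow> (nat \<Rightarrow> 'k) \<Rightarrow> nat \<Rightarrow> 'k" where
  "dilation a k f = (\<lambda>i. if i = k then a * f k else f i)"

lemma lattice_map_shear:
  assumes "k < n" "l < n" "k \<noteq> l"
  shows "lattice_map n (shear a k l)"
proof -
  obtain p q where pq: "p \<in> R" "q \<in> R" "q \<noteq> 0" "a = p / q" using fraction[of a] by blast
  have s: "vscale q (shear a k l f) \<in> std_lattice n" if "f \<in> std_lattice n" "a = p / q \<or> a = - p / q" for f a
    using that pq(1-3) assms
    by (auto simp: std_lattice_def coord_space_def shear_def distrib_left mult.assoc[symmetric])
  show ?thesis
  proof (rule lattice_mapI[where g' = "shear (- a) k l" and a = q and b = q])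
    show "vscale q (shear a k l f) \<in> std_lattice n" if "f \<in> std_lattice n" for f using s[OF that] pq(4) by simp
    show "vscale q (shear (- a) k l f) \<in> std_lattice n" if "f \<in> std_lattice n" for f using s[OF that] pq(4) by simp
  qed (use pq assms in \<open>auto simp: shear_def fun_eq_iff coord_space_def algebra_simps\<close>)
qed

lemma lattice_map_dilation:
  assumes "k < n" "a \<noteq> 0"
  shows "lattice_map n (dilation a k)"
proof -
  obtain p q where pq: "p \<in> R" "q \<in> R" "q \<noteq> 0" "a = p / q" using fraction[of a] by blast
  have p0: "p \<noteq> 0" using assms pq by auto
  show ?thesis
  proof (rule lattice_mapI[where g' = "dilation (inverse a) k" and a = q and b = p])
    show "vscale q (dilation a k f) \<in> std_lattice n" if "f \<in> std_lattice n" for f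
      using that pq by (auto simp: std_lattice_def coord_space_def dilation_def mult.assoc[symmetric])
    show "vscale p (dilation (inverse a) k f) \<in> std_lattice n" if "f \<in> std_lattice n" for f
      using that pq p0 by (auto simp: std_lattice_def coord_space_def dilation_def mult.assoc[symmetric])
  qed (use pq p0 assms in \<open>auto simp: dilation_def fun_eq_iff coord_space_def algebra_simps\<close>)
qed

lemma distortion_pos: "lattice_map n g \<Longrightarrow> distortion n g > 0"
  unfolding distortion_def by (rule gen_index_pos[OF lattice_like_commensurable[OF std_lattice_like lattice_mapD(5)]])

text \<open>Conjugation by the dilation with factor \<open>2\<close> relates a shear to its square, while the distortion is
  multiplicative; hence the distortion of a shear is its own square.\<close>

lemma distortion_shear:
  assumes "k < n" "l < n" "k \<noteq> l"
  shows "distortion n (shear a k l) = 1"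
proof -
  note S = lattice_map_shear[OF assms, of a]
  have D: "lattice_map n (dilation 2 k)" "lattice_map n (dilation (1/2) k)"
    by (rule lattice_map_dilation[OF assms(1)]; simp)+
  have e1: "shear (2 * a) k l = (\<lambda>f. shear a k l (shear a k l f))"
    using assms(3) by (auto simp: shear_def fun_eq_iff)
  have e2: "shear (2 * a) k l = (\<lambda>f. dilation 2 k (shear a k l (dilation (1/2) k f)))"
    using assms(3) by (auto simp: shear_def dilation_def fun_eq_iff algebra_simps)
  have e3: "(\<lambda>f. dilation 2 k (dilation (1/2) k f)) = (\<lambda>f. f)"
    by (auto simp: dilation_def fun_eq_iff)
  have id: "distortion n (\<lambda>f. f) = 1"
    using index_self(1)[OF std_lattice_subgroup] by (simp add: distortion_def gen_index_def)
  have "distortion n (shear a k l) * distortion n (shear a k l) = distortion n (shear (2 * a) k l)"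
    unfolding e1 lattice_map_comp(2)[OF S S] ..
  also have "\<dots> = distortion n (dilation 2 k) * (distortion n (shear a k l) * distortion n (dilation (1/2) k))"
    unfolding e2 lattice_map_comp(2)[OF D(1) lattice_map_comp(1)[OF S D(2)]] lattice_map_comp(2)[OF S D(2)] ..
  also have "\<dots> = (distortion n (dilation 2 k) * distortion n (dilation (1/2) k)) * distortion n (shear a k l)" by simp
  also have "distortion n (dilation 2 k) * distortion n (dilation (1/2) k) = 1"
    unfolding lattice_map_comp(2)[OF D, symmetric] e3 by (rule id)
  finally show ?thesis using distortion_pos[OF S] by simp
qed

lemma distortion_dilation:
  assumes k: "k < n" and a: "a \<noteq> 0"
  shows "distortion n (dilation a k) = elem_norm a"
proof -
  have int: "distortion n (dilation a k) = elem_norm a" if a: "a \<in> R" "a \<noteq> 0" for a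
  proof -
    define D where "D = dilation a k ` std_lattice n"
    have sub: "D \<subseteq> std_lattice n"
      using a by (auto simp: D_def dilation_def std_lattice_def coord_space_def)
    have D_iff: "f \<in> D \<longleftrightarrow> f \<in> std_lattice n \<and> f k \<in> (*) a ` R" for f
    proof
      assume "f \<in> D" then show "f \<in> std_lattice n \<and> f k \<in> (*) a ` R"
        using sub k by (auto simp: D_def dilation_def std_lattice_def)
    next
      assume *: "f \<in> std_lattice n \<and> f k \<in> (*) a ` R"
      then obtain r where r: "f k = a * r" "r \<in> R" by blast
      have "f = dilation a k (f(k := r))" using r by (auto simp: dilation_def fun_eq_iff)
      moreover have "f(k := r) \<in> std_lattice n" using * r k by (auto simp: std_lattice_def coord_space_def)
      ultimately show "f \<in> D" unfolding D_def by (rule image_eqI)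
    qed
    note Dm = lattice_mapD(5)[OF lattice_map_dilation[OF k a(2)], folded D_def]
    have Ds: "add_subgroup D" using Dm by (simp add: lattice_like_def)
    have C: "add_subgroup ((*) a ` R)" by (rule scale_subgroup[OF R_subgroup])
    have "index (std_lattice n) D = card ((\<lambda>f. coset ((*) a ` R) (f k)) ` std_lattice n)"
    proof (rule index_eq_card(1)[OF Ds])
      fix f g assume fg: "f \<in> std_lattice n" "g \<in> std_lattice n"
      then show "coset ((*) a ` R) (f k) = coset ((*) a ` R) (g k) \<longleftrightarrow> f - g \<in> D"
        using add_subgroupD(2)[OF std_lattice_subgroup fg] by (simp add: coset_eq_iff[OF C] D_iff)
    qed
    also have "(\<lambda>f. coset ((*) a ` R) (f k)) ` std_lattice n = coset ((*) a ` R) ` R"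
    proof (intro equalityI subsetI)
      fix X assume "X \<in> coset ((*) a ` R) ` R"
      then obtain r where r: "X = coset ((*) a ` R) r" "r \<in> R" by (rule imageE)
      have "(\<lambda>i. if i = k then r else 0) \<in> std_lattice n" using r k by (auto simp: std_lattice_def coord_space_def)
      then show "X \<in> (\<lambda>f. coset ((*) a ` R) (f k)) ` std_lattice n"
        using r(1) by (intro image_eqI[where x = "\<lambda>i. if i = k then r else 0"]) simp_all
    qed (use k in \<open>auto simp: std_lattice_def\<close>)
    finally have idx: "index (std_lattice n) D = index R ((*) a ` R)" by (simp add: index_def)
    have "finite_index (std_lattice n) D"
    proof -
      have "std_lattice n \<inter> D = D" using sub by blast
      then show ?thesis
        using lattice_like_commensurable[OF std_lattice_like Dm] by (simp add: commensurable_def)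
    qed
    then show ?thesis
      unfolding distortion_def D_def[symmetric] gen_index_sub(1)[OF std_lattice_subgroup Ds sub]
      using idx elem_norm_in_R[OF a] gen_index_sub(1)[OF std_lattice_subgroup Ds sub] by simp
  qed
  obtain p q where pq: "p \<in> R" "q \<in> R" "q \<noteq> 0" "a = p / q" using fraction[of a] by blast
  have p0: "p \<noteq> 0" using a pq by auto
  have e: "dilation p k = (\<lambda>f. dilation a k (dilation q k f))"
    using pq by (auto simp: dilation_def fun_eq_iff)
  have "elem_norm a * elem_norm q = elem_norm p" using elem_norm_mult[OF a pq(3)] pq by simp
  moreover have "elem_norm p = distortion n (dilation a k) * elem_norm q"
    using lattice_map_comp(2)[OF lattice_map_dilation[OF k a] lattice_map_dilation[OF k pq(3)]]
    unfolding e[symmetric] int[OF pq(1) p0] int[OF pq(2,3)] .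
  ultimately show ?thesis using elem_norm_pos[OF pq(3)] by simp
qed

text \<open>Both sides are multiplicative, so row reduction leaves shears and dilations.\<close>

theorem distortion_det:
  assumes A: "A \<in> carrier_mat n n" and det: "Determinant.det A \<noteq> 0"
  shows "lattice_map n (mat_apply n A)" "distortion n (mat_apply n A) = elem_norm (Determinant.det A)"
proof -
  define Q where "Q A \<longleftrightarrow> Determinant.det A \<noteq> 0 \<longrightarrow> lattice_map n (mat_apply n A) \<and>
      distortion n (mat_apply n A) = elem_norm (Determinant.det A)" for A :: "'k mat"
  have loc: "lattice_map n g \<longleftrightarrow> lattice_map n g'" "distortion n g = distortion n g'"
    if eq: "\<And>f. f \<in> coord_space n \<Longrightarrow> g f = g' f" and lin: "\<And>f h. g (f - h) = g f - g h" "\<And>c f. g (vscale c f) = vscale c (g f)"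
      "\<And>f h. g' (f - h) = g' f - g' h" "\<And>c f. g' (vscale c f) = vscale c (g' f)" for g g'
  proof -
    have 1: "g ` coord_space n = g' ` coord_space n" "g ` std_lattice n = g' ` std_lattice n"
      using eq by (auto simp: std_lattice_def)
    have 2: "inj_on g (coord_space n) \<longleftrightarrow> inj_on g' (coord_space n)" by (rule inj_on_cong) (rule eq)
    show "lattice_map n g \<longleftrightarrow> lattice_map n g'" unfolding lattice_map_def 1 2 using lin by simp
    show "distortion n g = distortion n g'" unfolding distortion_def 1 ..
  qed
  have lin: "mat_apply n A (f - h) = mat_apply n A f - mat_apply n A h"
    "mat_apply n A (vscale c f) = vscale c (mat_apply n A f)" for A f h c
    by (auto simp: mat_apply_def fun_eq_iff right_diff_distrib sum_subtractf sum_distrib_left intro!: sum.cong)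
  have "Q A"
  proof (rule row_reduction_induct[OF _ _ _ _ A])
    show "Q A" if "Determinant.det A = 0" for A using that by (simp add: Q_def)
    have one: "mat_apply n (1\<^sub>m n) f = f" if "f \<in> coord_space n" for f
    proof
      fix i show "mat_apply n (1\<^sub>m n) f i = f i"
      proof (cases "i < n")
        case True
        have "(\<Sum>j<n. (1\<^sub>m n) $$ (i,j) * f j) = (\<Sum>j<n. if i = j then f j else 0)"
          by (rule sum.cong) (use True in auto)
        then show ?thesis using True by (simp add: mat_apply_def)
      qed (use that in \<open>simp add: mat_apply_def coord_space_def\<close>)
    qed
    have "lattice_map n (\<lambda>f. f)"
      unfolding lattice_map_def using std_lattice_like by simp
    moreover have "distortion n (\<lambda>f. f) = 1"
      using index_self(1)[OF std_lattice_subgroup] by (simp add: distortion_def gen_index_def)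
    ultimately show "Q (1\<^sub>m n)"
      unfolding Q_def using loc[of "mat_apply n (1\<^sub>m n)" "\<lambda>f. f", OF one lin] by (simp add: elem_norm_1)
  next
    fix A :: "'k mat" and a k l
    assume A: "A \<in> carrier_mat n n" and kl: "k < n" "l < n" "k \<noteq> l" and Q: "Q (addrow a k l A)"
    have e: "mat_apply n A = (\<lambda>f. shear (- a) k l (mat_apply n (addrow a k l A) f))"
      using A kl by (auto simp: mat_apply_def shear_def fun_eq_iff sum.distrib sum_distrib_left sum_negf algebra_simps)
    show "Q A" unfolding Q_def
    proof
      assume d: "Determinant.det A \<noteq> 0"
      have da: "Determinant.det (addrow a k l A) = Determinant.det A" by (rule det_addrow[OF kl(2,3) A])
      then have "lattice_map n (mat_apply n (addrow a k l A))"
        "distortion n (mat_apply n (addrow a k l A)) = elem_norm (Determinant.det A)"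
        using Q d by (simp_all add: Q_def)
      then show "lattice_map n (mat_apply n A) \<and> distortion n (mat_apply n A) = elem_norm (Determinant.det A)"
        unfolding e using lattice_map_comp[OF lattice_map_shear[OF kl, of "- a"]] distortion_shear[OF kl, of "- a"] by simp
    qed
  next
    fix A :: "'k mat" and a k
    assume A: "A \<in> carrier_mat n n" and k: "k < n" and a: "a \<noteq> 0" and Q: "Q (multrow k a A)"
    have e: "mat_apply n A = (\<lambda>f. dilation (inverse a) k (mat_apply n (multrow k a A) f))"
      using A k a by (auto simp: mat_apply_def dilation_def fun_eq_iff sum_distrib_left mult.assoc[symmetric])
    have ia: "inverse a \<noteq> 0" using a by simp
    show "Q A" unfolding Q_def
    proof
      assume d: "Determinant.det A \<noteq> 0"
      have da: "Determinant.det (multrow k a A) = a * Determinant.det A" by (rule det_multrow[OF k A])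
      then have 1: "lattice_map n (mat_apply n (multrow k a A))"
        "distortion n (mat_apply n (multrow k a A)) = elem_norm (a * Determinant.det A)"
        using Q d a by (simp_all add: Q_def)
      have "elem_norm (inverse a) * elem_norm (a * Determinant.det A) = elem_norm (Determinant.det A)"
        using elem_norm_mult[OF ia, of "a * Determinant.det A"] a d by (simp add: mult.assoc[symmetric])
      then show "lattice_map n (mat_apply n A) \<and> distortion n (mat_apply n A) = elem_norm (Determinant.det A)"
        unfolding e using lattice_map_comp[OF lattice_map_dilation[OF k ia] 1(1)] distortion_dilation[OF k ia] 1(2) by simp
    qed
  qed
  then show "lattice_map n (mat_apply n A)" "distortion n (mat_apply n A) = elem_norm (Determinant.det A)"
    using det by (simp_all add: Q_def)
qed

end

section \<open>Covolumes as indices\<close>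

definition of_vec :: "'k::field_char_0 Matrix.vec \<Rightarrow> nat \<Rightarrow> 'k" where
  "of_vec v = (\<lambda>i. if i < dim_vec v then vec_index v i else 0)"

lemma of_vec_bij: "bij_betw of_vec (carrier_vec n) (coord_space n)"
proof (rule bij_betwI[where g = "Matrix.vec n"])
  show "of_vec \<in> carrier_vec n \<rightarrow> coord_space n" by (auto simp: of_vec_def coord_space_def)
  show "Matrix.vec n \<in> coord_space n \<rightarrow> carrier_vec n" by auto
  show "Matrix.vec n (of_vec v) = v" if "v \<in> carrier_vec n" for v using that by (intro eq_vecI) (auto simp: of_vec_def)
  show "of_vec (Matrix.vec n f) = f" if "f \<in> coord_space n" for f using that by (auto simp: of_vec_def coord_space_def)
qed

lemma of_vec_add: "v \<in> carrier_vec n \<Longrightarrow> w \<in> carrier_vec n \<Longrightarrow> of_vec (v + w) = of_vec v + of_vec w"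
  by (auto simp: of_vec_def fun_eq_iff)

lemma of_vec_smult: "of_vec (c \<cdot>\<^sub>v v) = vscale c (of_vec v)"
  by (auto simp: of_vec_def fun_eq_iff)

lemma of_vec_zero: "of_vec (0\<^sub>v n) = 0"
  by (auto simp: of_vec_def fun_eq_iff)

lemma of_vec_inj: "v \<in> carrier_vec n \<Longrightarrow> w \<in> carrier_vec n \<Longrightarrow> of_vec v = of_vec w \<Longrightarrow> v = w"
  using of_vec_bij[of n] by (auto simp: bij_betw_def inj_on_def)

context dedekind_subring
begin

lemma common_denominator:
  assumes "finite X" shows "\<exists>a\<in>R. a \<noteq> 0 \<and> (\<forall>x\<in>X. a * x \<in> R)"
  using assms
proof induction
  case empty show ?case by (rule bexI[of _ 1]) simp_all
next
  case (insert x X)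
  then obtain a where a: "a \<in> R" "a \<noteq> 0" "\<forall>x\<in>X. a * x \<in> R" by blast
  obtain p q where pq: "p \<in> R" "q \<in> R" "q \<noteq> 0" "x = p / q" using fraction[of x] by blast
  have "a * q * y \<in> R" if "y \<in> X" for y
  proof -
    have "q * (a * y) \<in> R" using a(3) pq(2) that by simp
    then show ?thesis by (simp add: mult_ac)
  qed
  moreover have "a * q * x \<in> R" using a(1) pq by simp
  ultimately show ?case using a pq by (intro bexI[of _ "a * q"]) simp_all
qed

lemma submodule_vecI:
  fixes F :: "'k set"
  assumes "N \<subseteq> carrier_vec n" "0\<^sub>v n \<in> N" "\<And>v w. v \<in> N \<Longrightarrow> w \<in> N \<Longrightarrow> v + w \<in> N"
    "\<And>c v. c \<in> F \<Longrightarrow> v \<in> N \<Longrightarrow> c \<cdot>\<^sub>v v \<in> N" "- 1 \<in> F" "carrier S = F"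
  shows "submodule N S (module_vec TYPE('k) n)"
proof -
  have neg: "inv\<^bsub>add_monoid (module_vec TYPE('k) n)\<^esub> v \<in> N" if v: "v \<in> N" for v
  proof -
    have vc: "v \<in> carrier_vec n" using v assms(1) by blast
    have "- v = - 1 \<cdot>\<^sub>v v" by auto
    then have "- v \<in> N" using assms(4,5) v by simp
    moreover have "inv\<^bsub>add_monoid (module_vec TYPE('k) n)\<^esub> v = - v"
      unfolding m_inv_def
    proof (rule the_equality)
      show "- v \<in> carrier (add_monoid (module_vec TYPE('k) n)) \<and>
          v \<otimes>\<^bsub>add_monoid (module_vec TYPE('k) n)\<^esub> - v = \<one>\<^bsub>add_monoid (module_vec TYPE('k) n)\<^esub> \<and>
          - v \<otimes>\<^bsub>add_monoid (module_vec TYPE('k) n)\<^esub> v = \<one>\<^bsub>add_monoid (module_vec TYPE('k) n)\<^esub>"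
        using vc by (simp add: module_vec_simps)
      fix w assume "w \<in> carrier (add_monoid (module_vec TYPE('k) n)) \<and>
          v \<otimes>\<^bsub>add_monoid (module_vec TYPE('k) n)\<^esub> w = \<one>\<^bsub>add_monoid (module_vec TYPE('k) n)\<^esub> \<and>
          w \<otimes>\<^bsub>add_monoid (module_vec TYPE('k) n)\<^esub> v = \<one>\<^bsub>add_monoid (module_vec TYPE('k) n)\<^esub>"
      then have w: "w \<in> carrier_vec n" "v + w = 0\<^sub>v n" by (simp_all add: module_vec_simps)
      show "w = - v"
      proof (rule eq_vecI)
        fix i assume "i < dim_vec (- v)"
        then have i: "i < n" using vc by simp
        have "vec_index (v + w) i = 0" using w(2) i by simp
        then show "vec_index w i = vec_index (- v) i" using i vc w(1) by (simp add: add_eq_0_iff)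
      qed (use vc w in simp)
    qed
    ultimately show ?thesis by simp
  qed
  show ?thesis
    by (unfold_locales) (use assms neg in \<open>auto simp: module_vec_simps\<close>)
qed

text \<open>For \<open>\<alpha> L\<close> inside \<open>R\<^sup>n\<close> the norm of
  \<open>\<chi>\<close> is the index of \<open>\<alpha> L\<close>, and multiplication by
  \<open>\<alpha>\<close>, a map of determinant \<open>\<alpha>\<^sup>n\<close>, accounts for
  the factor \<open>\<alpha>\<^sup>-\<^sup>n\<close>.\<close>

theorem covol_eq_index:
  assumes L: "is_lattice R n L"
  shows "lattice_like n (of_vec ` L)" "covol R n L = gen_index (std_lattice n) (of_vec ` L)"
    "L \<subseteq> carrier_vec n"
proof -
  obtain S where S: "finite S" "S \<subseteq> L" "L = generated_submodule (ring_on R) (module_vec TYPE('k) n) S"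
    and sub: "submodule L (ring_on R) (module_vec TYPE('k) n)"
    and span: "generated_submodule field_ring (module_vec TYPE('k) n) L = carrier_vec n"
    using L unfolding is_lattice_def by blast
  interpret sm: submodule L "ring_on R" "module_vec TYPE('k) n" by (rule sub)
  show Lc: "L \<subseteq> carrier_vec n" using sm.subset by (simp add: module_vec_simps)
  have L0: "0\<^sub>v n \<in> L" using sm.one_closed by (simp add: module_vec_simps)
  have Ladd: "v + w \<in> L" if "v \<in> L" "w \<in> L" for v w using sm.m_closed[OF that] by (simp add: module_vec_simps)
  have Lsm: "r \<cdot>\<^sub>v v \<in> L" if "r \<in> R" "v \<in> L" for r v using sm.smult_closed that by (simp add: module_vec_simps)
  define \<Lambda> where "\<Lambda> = of_vec ` L"
  have Lam_add: "f + g \<in> \<Lambda>" if fg: "f \<in> \<Lambda>" "g \<in> \<Lambda>" for f g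
  proof -
    obtain v where v: "f = of_vec v" "v \<in> L" using fg(1) unfolding \<Lambda>_def by (rule imageE)
    obtain w where w: "g = of_vec w" "w \<in> L" using fg(2) unfolding \<Lambda>_def by (rule imageE)
    have "f + g = of_vec (v + w)" unfolding v(1) w(1) using v(2) w(2) Lc by (intro of_vec_add[symmetric]) blast+
    then show ?thesis unfolding \<Lambda>_def using Ladd[OF v(2) w(2)] by (rule image_eqI)
  qed
  have Lam_sm: "vscale r f \<in> \<Lambda>" if rf: "r \<in> R" "f \<in> \<Lambda>" for r f
  proof -
    obtain v where v: "f = of_vec v" "v \<in> L" using rf(2) unfolding \<Lambda>_def by (rule imageE)
    show ?thesis unfolding \<Lambda>_def v(1) of_vec_smult[symmetric] by (rule imageI[OF Lsm[OF rf(1) v(2)]])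
  qed
  have Lam_0: "0 \<in> \<Lambda>" unfolding \<Lambda>_def of_vec_zero[of n, symmetric] by (rule imageI[OF L0])
  have Lam_grp: "add_subgroup \<Lambda>"
    unfolding add_subgroup_def
  proof (intro conjI ballI)
    fix f g assume fg: "f \<in> \<Lambda>" "g \<in> \<Lambda>"
    have "f + vscale (- 1) g \<in> \<Lambda>" by (rule Lam_add[OF fg(1) Lam_sm[OF _ fg(2)]]) simp
    moreover have "f + vscale (- 1) g = f - g" by (auto simp: fun_eq_iff)
    ultimately show "f - g \<in> \<Lambda>" by simp
  qed (rule Lam_0)
  have Lam_c: "\<Lambda> \<subseteq> coord_space n"
    unfolding \<Lambda>_def using of_vec_bij[of n] Lc by (auto simp: bij_betw_def)
  \<comment> \<open>a common denominator of the generators clears the whole lattice\<close>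
  have ex_a: "\<exists>a. a \<in> R \<and> a \<noteq> 0 \<and> (\<lambda>v. a \<cdot>\<^sub>v v) ` L \<subseteq> vecs_over R n"
  proof -
    obtain a where a: "a \<in> R" "a \<noteq> 0" "\<forall>x\<in>(\<Union>v\<in>S. vec_index v ` {..<n}). a * x \<in> R"
      using common_denominator[of "\<Union>v\<in>S. vec_index v ` {..<n}"] S(1) by auto
    define N where "N = {v \<in> carrier_vec n. \<forall>i<n. a * vec_index v i \<in> R}"
    have "submodule N (ring_on R) (module_vec TYPE('k) n)"
    proof (rule submodule_vecI[where F = R])
      fix c v assume cv: "c \<in> R" "v \<in> N"
      then have "c * (a * vec_index v i) \<in> R" if "i < n" for i using that by (simp add: N_def)
      then show "c \<cdot>\<^sub>v v \<in> N" using cv by (auto simp: N_def mult_ac)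
    qed (auto simp: N_def distrib_left)
    moreover have "S \<subseteq> N" using a(3) S(2) Lc by (auto simp: N_def)
    ultimately have "L \<subseteq> N" unfolding S(3) generated_submodule_def by blast
    then have "(\<lambda>v. a \<cdot>\<^sub>v v) ` L \<subseteq> vecs_over R n" by (auto simp: N_def vecs_over_def)
    then show ?thesis using a by blast
  qed
  \<comment> \<open>conversely, some multiple of each coordinate vector lies in the lattice\<close>
  have ex_t: "\<exists>t\<in>R. t \<noteq> 0 \<and> t \<cdot>\<^sub>v v \<in> L" if v: "v \<in> carrier_vec n" for v
  proof -
    define N where "N = {v \<in> carrier_vec n. \<exists>t\<in>R. t \<noteq> 0 \<and> t \<cdot>\<^sub>v v \<in> L}"
    have "submodule N field_ring (module_vec TYPE('k) n)"
    proof (rule submodule_vecI[where F = UNIV])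
      show "0\<^sub>v n \<in> N" using L0 unfolding N_def by (auto intro!: bexI[of _ 1])
    next
      fix v w assume vw: "v \<in> N" "w \<in> N"
      then obtain t u where tu: "t \<in> R" "t \<noteq> 0" "t \<cdot>\<^sub>v v \<in> L" "u \<in> R" "u \<noteq> 0" "u \<cdot>\<^sub>v w \<in> L"
        and c: "v \<in> carrier_vec n" "w \<in> carrier_vec n" unfolding N_def by blast
      have "u \<cdot>\<^sub>v (t \<cdot>\<^sub>v v) + t \<cdot>\<^sub>v (u \<cdot>\<^sub>v w) \<in> L" by (rule Ladd[OF Lsm[OF tu(4,3)] Lsm[OF tu(1,6)]])
      also have "u \<cdot>\<^sub>v (t \<cdot>\<^sub>v v) + t \<cdot>\<^sub>v (u \<cdot>\<^sub>v w) = (t * u) \<cdot>\<^sub>v (v + w)"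
        using c by (intro eq_vecI) (auto simp: algebra_simps)
      finally show "v + w \<in> N" using tu c unfolding N_def by (auto intro!: bexI[of _ "t * u"])
    next
      fix c :: 'k and v assume v: "v \<in> N"
      then obtain t where t: "t \<in> R" "t \<noteq> 0" "t \<cdot>\<^sub>v v \<in> L" and vc: "v \<in> carrier_vec n" unfolding N_def by blast
      obtain p q where pq: "p \<in> R" "q \<in> R" "q \<noteq> 0" "c = p / q" using fraction[of c] by blast
      have "p \<cdot>\<^sub>v (t \<cdot>\<^sub>v v) \<in> L" by (rule Lsm[OF pq(1) t(3)])
      also have "p \<cdot>\<^sub>v (t \<cdot>\<^sub>v v) = (q * t) \<cdot>\<^sub>v (c \<cdot>\<^sub>v v)"
        using pq by (intro eq_vecI) auto
      finally show "c \<cdot>\<^sub>v v \<in> N" using t pq vc unfolding N_def by (auto intro!: bexI[of _ "q * t"])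
    qed (auto simp: N_def field_ring_def)
    moreover have "L \<subseteq> N"
    proof
      fix v assume "v \<in> L"
      then have "1 \<cdot>\<^sub>v v \<in> L" "v \<in> carrier_vec n" using Lc by auto
      then show "v \<in> N" unfolding N_def by (auto intro!: bexI[of _ 1])
    qed
    ultimately have "generated_submodule field_ring (module_vec TYPE('k) n) L \<subseteq> N"
      unfolding generated_submodule_def by blast
    then show ?thesis using v unfolding span N_def by blast
  qed
  have ex_b: "\<exists>b\<in>R. b \<noteq> 0 \<and> (\<forall>f\<in>std_lattice n. vscale b f \<in> \<Lambda>)"
  proof -
    define E where "E i = (\<lambda>j. if j = i then 1 else (0::'k))" for i :: nat
    have "\<exists>t\<in>R. t \<noteq> 0 \<and> vscale t (E i) \<in> \<Lambda>" if i: "i < n" for i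
    proof -
      obtain t where t: "t \<in> R" "t \<noteq> 0" "t \<cdot>\<^sub>v unit_vec n i \<in> L" using ex_t[of "unit_vec n i"] by auto
      have "of_vec (unit_vec n i) = E i" using i by (auto simp: of_vec_def E_def fun_eq_iff)
      then have "vscale t (E i) \<in> \<Lambda>" using imageI[OF t(3), of of_vec] unfolding \<Lambda>_def of_vec_smult by simp
      then show ?thesis using t by blast
    qed
    then obtain t where t: "\<And>i. i < n \<Longrightarrow> t i \<in> R" "\<And>i. i < n \<Longrightarrow> t i \<noteq> 0" "\<And>i. i < n \<Longrightarrow> vscale (t i) (E i) \<in> \<Lambda>"
      by metis
    define b where "b = (\<Prod>i<n. t i)"
    have "vscale b f \<in> \<Lambda>" if f: "f \<in> std_lattice n" for f
    proof -
      have bi: "b = t i * (\<Prod>j\<in>{..<n} - {i}. t j)" if "i < n" for i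
        unfolding b_def using that by (simp add: prod.remove)
      have "vscale b f = (\<Sum>i<n. vscale (f i * (\<Prod>j\<in>{..<n} - {i}. t j)) (vscale (t i) (E i)))"
      proof
        fix j
        have ev: "(\<Sum>i<n. g i) j = (\<Sum>i<n. g i j)" for g :: "nat \<Rightarrow> nat \<Rightarrow> 'k"
          by (induction n) simp_all
        have "(\<Sum>i<n. vscale (f i * (\<Prod>j\<in>{..<n} - {i}. t j)) (vscale (t i) (E i)) j)
            = (\<Sum>i<n. if i = j then b * f j else 0)"
          by (rule sum.cong) (auto simp: E_def bi mult_ac)
        also have "\<dots> = b * f j" using f by (auto simp: sum.delta std_lattice_def coord_space_def)
        finally show "vscale b f j = (\<Sum>i<n. vscale (f i * (\<Prod>j\<in>{..<n} - {i}. t j)) (vscale (t i) (E i))) j"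
          unfolding ev by simp
      qed
      also have "\<dots> \<in> \<Lambda>"
      proof (rule add_subgroup_sum[OF Lam_grp])
        fix i assume "i \<in> {..<n}"
        then have i: "i < n" by simp
        have "(\<Prod>j\<in>{..<n} - {i}. t j) \<in> R" by (rule R_prod) (simp add: t(1))
        then have "f i * (\<Prod>j\<in>{..<n} - {i}. t j) \<in> R" using f i by (simp add: std_lattice_def)
        then show "vscale (f i * (\<Prod>j\<in>{..<n} - {i}. t j)) (vscale (t i) (E i)) \<in> \<Lambda>"
          by (rule Lam_sm[OF _ t(3)[OF i]])
      qed
      finally show ?thesis .
    qed
    moreover have "b \<in> R" unfolding b_def by (rule R_prod) (simp add: t(1))
    moreover have "b \<noteq> 0" unfolding b_def using t(2) by simp
    ultimately show ?thesis by blast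
  qed
  define a where "a = (SOME a. a \<in> R \<and> a \<noteq> 0 \<and> (\<lambda>v. a \<cdot>\<^sub>v v) ` L \<subseteq> vecs_over R n)"
  have a: "a \<in> R" "a \<noteq> 0" "(\<lambda>v. a \<cdot>\<^sub>v v) ` L \<subseteq> vecs_over R n"
    using someI_ex[OF ex_a] unfolding a_def by blast+
  have vo: "of_vec v \<in> std_lattice n \<longleftrightarrow> v \<in> vecs_over R n" if "v \<in> carrier_vec n" for v
    using that by (auto simp: of_vec_def std_lattice_def coord_space_def vecs_over_def)
  have aLam: "vscale a f \<in> std_lattice n" if f: "f \<in> \<Lambda>" for f
  proof -
    obtain v where v: "f = of_vec v" "v \<in> L" using f unfolding \<Lambda>_def by (rule imageE)
    have "a \<cdot>\<^sub>v v \<in> vecs_over R n" using a(3) v(2) by blast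
    then show ?thesis unfolding v(1) of_vec_smult[symmetric] using vo[of "a \<cdot>\<^sub>v v"] by (simp add: vecs_over_def)
  qed
  have LL: "lattice_like n \<Lambda>" unfolding lattice_like_def
    using Lam_grp Lam_c ex_b aLam a(1,2) by blast
  then show "lattice_like n (of_vec ` L)" by (simp add: \<Lambda>_def)
  \<comment> \<open>multiplication by a as a lattice map\<close>
  define A where "A = a \<cdot>\<^sub>m (1\<^sub>m n :: 'k mat)"
  have A: "A \<in> carrier_mat n n" "Determinant.det A = a ^ n" by (simp_all add: A_def Determinant.det_smult)
  have A0: "Determinant.det A \<noteq> 0" using A(2) a(2) by simp
  have appA: "mat_apply n A f = vscale a f" if f: "f \<in> coord_space n" for f
  proof
    fix i show "mat_apply n A f i = vscale a f i"
    proof (cases "i < n")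
      case True
      have "(\<Sum>j<n. A $$ (i,j) * f j) = (\<Sum>j<n. if i = j then a * f j else 0)"
        by (rule sum.cong) (use True in \<open>auto simp: A_def\<close>)
      then show ?thesis using True by (simp add: mat_apply_def)
    qed (use f in \<open>simp add: mat_apply_def coord_space_def\<close>)
  qed
  define B where "B = vscale a ` \<Lambda>"
  have appL: "mat_apply n A ` \<Lambda> = B" unfolding B_def using appA Lam_c by (intro image_cong) auto
  have BL: "lattice_like n B"
    using lattice_map_image[OF distortion_det(1)[OF A(1) A0] LL] unfolding appL .
  have idx: "gen_index (std_lattice n) B = elem_norm a ^ n * gen_index (std_lattice n) \<Lambda>"
    using distortion_index[OF distortion_det(1)[OF A(1) A0] LL] distortion_det(2)[OF A(1) A0]
    unfolding appL A(2) elem_norm_power[OF a(2)] by simp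
  interpret V: dedekind_module R vscale
    by (intro dedekind_module.intro dedekind_subring_axioms vscale_vector_space)
  have Bsub: "B \<subseteq> std_lattice n" using aLam by (auto simp: B_def)
  have Bgrp: "add_subgroup B" using BL by (simp add: lattice_like_def)
  have Bsm: "V.submod B" unfolding V.submod_def
  proof (intro conjI ballI Bgrp)
    fix r f assume rf: "r \<in> R" "f \<in> B"
    obtain g where g: "f = vscale a g" "g \<in> \<Lambda>" using rf(2) unfolding B_def by (rule imageE)
    have "vscale r f = vscale a (vscale r g)" unfolding g(1) by (simp add: mult.commute)
    then show "vscale r f \<in> B" unfolding B_def using Lam_sm[OF rf(1) g(2)] by (rule image_eqI)
  qed
  have finB: "finite_index (std_lattice n) B"
  proof -
    have "std_lattice n \<inter> B = B" using Bsub by blast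
    then show ?thesis
      using lattice_like_commensurable[OF std_lattice_like BL] by (simp add: commensurable_def)
  qed
  define Md where "Md = (module_vec TYPE('k) n)\<lparr>carrier := vecs_over R n\<rparr>"
  have Md [simp]: "carrier Md = vecs_over R n" "v \<oplus>\<^bsub>Md\<^esub> w = v + w" "c \<odot>\<^bsub>Md\<^esub> v = c \<cdot>\<^sub>v v" for v w c
    by (simp_all add: Md_def module_vec_def)
  have voc: "vecs_over R n \<subseteq> carrier_vec n" by (auto simp: vecs_over_def)
  interpret Q: represented_quotient R vscale Md "(\<lambda>v. a \<cdot>\<^sub>v v) ` L" of_vec "std_lattice n" B
  proof (unfold_locales)
    show "V.submod (std_lattice n)" by (simp add: V.submod_def std_lattice_scale)
    show "V.submod B" by (rule Bsm)
    show "B \<subseteq> std_lattice n" by (rule Bsub)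
    show "bij_betw of_vec (carrier Md) (std_lattice n)"
    proof (rule bij_betw_subset[OF of_vec_bij[of n]])
      have "std_lattice n = of_vec ` {v \<in> carrier_vec n. of_vec v \<in> std_lattice n}"
        using of_vec_bij[of n] unfolding bij_betw_def std_lattice_def by auto
      also have "{v \<in> carrier_vec n. of_vec v \<in> std_lattice n} = vecs_over R n" using vo voc by blast
      finally show "of_vec ` carrier Md = std_lattice n" by simp
    qed (use voc in simp)
    have BE: "B = of_vec ` (\<lambda>v. a \<cdot>\<^sub>v v) ` L" unfolding B_def \<Lambda>_def image_image of_vec_smult ..
    show "(\<lambda>v. a \<cdot>\<^sub>v v) ` L = {x \<in> carrier Md. of_vec x \<in> B}"
    proof (intro equalityI subsetI)
      fix v assume "v \<in> (\<lambda>v. a \<cdot>\<^sub>v v) ` L" then show "v \<in> {x \<in> carrier Md. of_vec x \<in> B}"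
        using a(3) unfolding BE by auto
    next
      fix v assume "v \<in> {x \<in> carrier Md. of_vec x \<in> B}"
      then have v: "v \<in> vecs_over R n" "of_vec v \<in> of_vec ` (\<lambda>v. a \<cdot>\<^sub>v v) ` L" unfolding BE by simp_all
      from v(2) obtain w where w: "of_vec v = of_vec w" "w \<in> (\<lambda>v. a \<cdot>\<^sub>v v) ` L" by (rule imageE)
      have "v = w" by (rule of_vec_inj[of _ n]) (use v(1) w a(3) voc in auto)
      then show "v \<in> (\<lambda>v. a \<cdot>\<^sub>v v) ` L" using w(2) by simp
    qed
  qed (auto simp: vecs_over_def of_vec_smult intro!: of_vec_add)
  define J where "J = chi_module (ring_on R) (quotient_module Md ((\<lambda>v. a \<cdot>\<^sub>v v) ` L))"
  have J: "multiplicative_ideal J" "index R J = index (std_lattice n) B"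
    using Q.chi_index[OF finB] by (simp_all add: J_def)
  have "lattice_chi R n L = (*) (inverse (a ^ n)) ` J"
    unfolding lattice_chi_def a_def[symmetric] Let_def J_def Md_def ..
  then have "covol R n L = elem_norm (inverse (a ^ n)) * index R J"
    unfolding covol_def using frac_ideal_norm_eq[OF J(1), of "inverse (a ^ n)"] a(2) by simp
  also have "elem_norm (inverse (a ^ n)) = inverse (elem_norm a ^ n)"
    using a(2) by (simp add: elem_norm_inverse elem_norm_power)
  also have "real (index R J) = elem_norm a ^ n * gen_index (std_lattice n) \<Lambda>"
    unfolding J(2) idx[symmetric] by (rule gen_index_sub(1)[OF std_lattice_subgroup Bgrp Bsub finB, symmetric])
  finally show "covol R n L = gen_index (std_lattice n) (of_vec ` L)"
    using elem_norm_pos[OF a(2)] by (simp add: \<Lambda>_def)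
qed

end

section \<open>Algebraic integers\<close>

definition int_span :: "'k::field_char_0 set \<Rightarrow> 'k set" where
  "int_span W = {\<Sum>w\<in>W. of_int (c w) * w | c. True}"

lemma int_span_subgroup: "add_subgroup (int_span W)"
proof -
  have "0 \<in> int_span W" unfolding int_span_def by (rule CollectI) (rule exI[of _ "\<lambda>_. 0"], simp)
  moreover have "x - y \<in> int_span W" if xy: "x \<in> int_span W" "y \<in> int_span W" for x y
  proof -
    obtain c c' where "x = (\<Sum>w\<in>W. of_int (c w) * w)" "y = (\<Sum>w\<in>W. of_int (c' w) * w)"
      using xy unfolding int_span_def by blast
    then have "x - y = (\<Sum>w\<in>W. of_int (c w - c' w) * w)" by (simp add: sum_subtractf left_diff_distrib)
    then show ?thesis unfolding int_span_def by (intro CollectI exI[of _ "\<lambda>w. c w - c' w"] conjI TrueI)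
  qed
  ultimately show ?thesis by (simp add: add_subgroup_def)
qed

lemma int_span_base:
  assumes "finite W" "w \<in> W" shows "w \<in> int_span W"
proof -
  have "(\<Sum>v\<in>W. of_int (if v = w then 1 else 0) * v) = (\<Sum>v\<in>W. if v = w then w else 0)"
    by (rule sum.cong) auto
  also have "\<dots> = w" using assms by (simp add: sum.delta)
  finally show ?thesis unfolding int_span_def by (intro CollectI exI[of _ "\<lambda>v. if v = w then 1 else 0"]) simp
qed

lemma add_subgroup_int_mult:
  fixes A :: "'k::field_char_0 set"
  assumes A: "add_subgroup A" and x: "x \<in> A" shows "of_int m * x \<in> A"
proof -
  have nat: "of_nat n * x \<in> A" for n
    by (induction n) (simp_all add: add_subgroupD(1)[OF A] add_subgroupD(4)[OF A] x distrib_right)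
  show ?thesis
  proof (cases m rule: int_cases2)
    case (nonneg n) then show ?thesis using nat by simp
  next
    case (nonpos n) then show ?thesis using add_subgroupD(3)[OF A nat[of n]] by simp
  qed
qed

lemma int_span_mult_closed:
  assumes "\<And>w. w \<in> W \<Longrightarrow> x * w \<in> int_span W" "y \<in> int_span W"
  shows "x * y \<in> int_span W"
proof -
  obtain c where c: "y = (\<Sum>w\<in>W. of_int (c w) * w)" using assms(2) unfolding int_span_def by blast
  have "x * y = (\<Sum>w\<in>W. of_int (c w) * (x * w))" unfolding c sum_distrib_left by (simp add: mult_ac)
  also have "\<dots> \<in> int_span W"
    by (rule add_subgroup_sum[OF int_span_subgroup]) (rule add_subgroup_int_mult[OF int_span_subgroup assms(1)])
  finally show ?thesis .
qed

text \<open>The characteristic polynomial of multiplication by x on a finitely generated group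
  annihilates x.\<close>

lemma algebraic_int_if_stable:
  fixes x :: "'k::field_char_0"
  assumes W: "finite W" "w0 \<in> W" "w0 \<noteq> 0" and x: "\<And>w. w \<in> W \<Longrightarrow> x * w \<in> int_span W"
  shows "algebraic_int x"
proof -
  obtain ws where ws: "set ws = W" "distinct ws" using finite_distinct_list[OF W(1)] by blast
  define n where "n = length ws"
  have "\<forall>w\<in>W. \<exists>c. x * w = (\<Sum>v\<in>W. of_int (c v) * v)" using x unfolding int_span_def by blast
  then obtain c where c: "\<And>w. w \<in> W \<Longrightarrow> x * w = (\<Sum>v\<in>W. of_int (c w v) * v)" by metis
  define A :: "int mat" where "A = Matrix.mat n n (\<lambda>(i,j). c (ws ! i) (ws ! j))"
  define v where "v = Matrix.vec n (\<lambda>i. ws ! i)"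
  have A: "A \<in> carrier_mat n n" by (simp add: A_def)
  have AK: "map_mat (of_int :: int \<Rightarrow> 'k) A \<in> carrier_mat n n" by (simp add: A_def)
  have sum_ws: "(\<Sum>v\<in>W. f v) = (\<Sum>j<n. f (ws ! j))" for f :: "'k \<Rightarrow> 'k"
    unfolding ws(1)[symmetric] sum.distinct_set_conv_list[OF ws(2)] n_def
    by (simp add: sum_list_sum_nth atLeast0LessThan)
  have "map_mat of_int A *\<^sub>v v = x \<cdot>\<^sub>v v"
  proof (rule eq_vecI)
    fix i assume "i < dim_vec (x \<cdot>\<^sub>v v)"
    then have i: "i < n" by (simp add: v_def)
    have "vec_index (map_mat of_int A *\<^sub>v v) i = (\<Sum>j<n. of_int (c (ws ! i) (ws ! j)) * ws ! j)"
      using i by (simp add: A_def v_def scalar_prod_def atLeast0LessThan)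
    also have "\<dots> = x * ws ! i" using c[of "ws ! i"] nth_mem[of i ws] i ws(1) by (simp add: sum_ws n_def)
    finally show "vec_index (map_mat of_int A *\<^sub>v v) i = vec_index (x \<cdot>\<^sub>v v) i" using i by (simp add: v_def)
  qed (simp add: A_def v_def)
  moreover have "v \<noteq> 0\<^sub>v n"
  proof
    assume z: "v = 0\<^sub>v n"
    obtain i where i: "i < n" "ws ! i = w0" using W(2) ws(1) by (auto simp: in_set_conv_nth n_def)
    have "vec_index v i = vec_index (0\<^sub>v n) i" using z by simp
    then show False using i W(3) by (simp add: v_def)
  qed
  ultimately have "eigenvalue (map_mat of_int A) x"
    unfolding eigenvalue_def eigenvector_def by (intro exI[of _ v]) (simp add: v_def A_def)
  then have "poly (char_poly (map_mat of_int A)) x = 0" using eigenvalue_root_char_poly[OF AK] by simp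
  then have "poly (map_poly of_int (char_poly A)) x = 0" by (simp only: of_int_hom.char_poly_hom[OF A])
  moreover have "lead_coeff (char_poly A) = 1" using degree_monic_char_poly[OF A] by simp
  ultimately show ?thesis unfolding algebraic_int_altdef_ipoly by blast
qed

lemma algebraic_int_monic:
  fixes x :: "'k::field_char_0"
  assumes "algebraic_int x"
  obtains m :: nat and c :: "nat \<Rightarrow> int" where "m > 0" "x ^ m = (\<Sum>i<m. of_int (c i) * x ^ i)"
proof -
  obtain p where p: "poly (map_poly of_int p) x = 0" "lead_coeff p = 1"
    using assms unfolding algebraic_int_altdef_ipoly by blast
  define m where "m = degree p"
  have m: "m > 0"
  proof (rule ccontr)
    assume "\<not> m > 0"
    then have "degree p = 0" by (simp add: m_def)
    then obtain a where "p = [:a:]" by (rule degree_eq_zeroE)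
    then show False using p by (simp add: map_poly_pCons)
  qed
  have "0 = (\<Sum>i\<le>m. of_int (coeff p i) * x ^ i)"
    using p(1) by (simp add: poly_altdef m_def degree_map_poly coeff_map_poly)
  also have "\<dots> = (\<Sum>i<m. of_int (coeff p i) * x ^ i) + x ^ m"
    using p(2) by (simp add: lessThan_Suc_atMost[symmetric] m_def)
  finally have "x ^ m = (\<Sum>i<m. of_int (- coeff p i) * x ^ i)"
    by (simp add: sum_negf eq_neg_iff_add_eq_0 add.commute)
  then show ?thesis by (rule that[OF m])
qed

text \<open>The monomials in \<open>x\<close> and \<open>y\<close> of bounded degree span a group that
  is stable under both.\<close>

lemma algebraic_int_common_module:
  fixes x y :: "'k::field_char_0"
  assumes "algebraic_int x" "algebraic_int y"
  obtains W where "finite W" "1 \<in> W" "\<And>w. w \<in> W \<Longrightarrow> x * w \<in> int_span W" "\<And>w. w \<in> W \<Longrightarrow> y * w \<in> int_span W"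
proof -
  obtain m c where m: "m > 0" "x ^ m = (\<Sum>i<m. of_int (c i) * x ^ i)" by (rule algebraic_int_monic[OF assms(1)])
  obtain k e where k: "k > 0" "y ^ k = (\<Sum>i<k. of_int (e i) * y ^ i)" by (rule algebraic_int_monic[OF assms(2)])
  define W where "W = (\<lambda>(i,j). x ^ i * y ^ j) ` ({..<m} \<times> {..<k})"
  have fin: "finite W" by (simp add: W_def)
  have WI: "x ^ i * y ^ j \<in> int_span W" if "i < m" "j < k" for i j
  proof -
    have "(case (i, j) of (i, j) \<Rightarrow> x ^ i * y ^ j) \<in> W" unfolding W_def by (rule imageI) (use that in simp)
    then show ?thesis using int_span_base[OF fin] by simp
  qed
  have "x * w \<in> int_span W" if "w \<in> W" for w
  proof -
    obtain i j where ij: "w = x ^ i * y ^ j" "i < m" "j < k" using \<open>w \<in> W\<close> by (auto simp: W_def)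
    show ?thesis
    proof (cases "Suc i < m")
      case True then show ?thesis using WI[OF True ij(3)] ij(1) by (simp add: mult_ac)
    next
      case False
      then have "x * w = x ^ m * y ^ j" using ij by (metis Suc_lessI mult.assoc power_Suc)
      also have "\<dots> = (\<Sum>i<m. of_int (c i) * (x ^ i * y ^ j))" unfolding m(2) sum_distrib_right by (simp add: mult_ac)
      also have "\<dots> \<in> int_span W"
        by (rule add_subgroup_sum[OF int_span_subgroup]) (simp add: add_subgroup_int_mult[OF int_span_subgroup] WI ij(3))
      finally show ?thesis .
    qed
  qed
  moreover have "y * w \<in> int_span W" if "w \<in> W" for w
  proof -
    obtain i j where ij: "w = x ^ i * y ^ j" "i < m" "j < k" using \<open>w \<in> W\<close> by (auto simp: W_def)
    show ?thesis
    proof (cases "Suc j < k")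
      case True then show ?thesis using WI[OF ij(2) True] ij(1) by (simp add: mult_ac)
    next
      case False
      then have "Suc j = k" using ij by simp
      then have "y * w = x ^ i * y ^ k" using ij(1) by (auto simp: mult_ac)
      also have "\<dots> = (\<Sum>j<k. of_int (e j) * (x ^ i * y ^ j))" unfolding k(2) sum_distrib_left by (simp add: mult_ac)
      also have "\<dots> \<in> int_span W"
        by (rule add_subgroup_sum[OF int_span_subgroup]) (simp add: add_subgroup_int_mult[OF int_span_subgroup] WI ij(2))
      finally show ?thesis .
    qed
  qed
  moreover have "1 \<in> W"
    unfolding W_def using m(1) k(1) by (intro image_eqI[where x = "(0,0)"]) simp_all
  ultimately show ?thesis using that fin by blast
qed

lemma algebraic_int_add_mult:
  fixes x y :: "'k::field_char_0"
  assumes x: "algebraic_int x" and y: "algebraic_int y"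
  shows "algebraic_int (x + y)" "algebraic_int (x * y)"
proof -
  obtain W where W: "finite W" "1 \<in> W" "\<And>w. w \<in> W \<Longrightarrow> x * w \<in> int_span W" "\<And>w. w \<in> W \<Longrightarrow> y * w \<in> int_span W"
    using algebraic_int_common_module[OF x y] by metis
  show "algebraic_int (x + y)"
    by (rule algebraic_int_if_stable[OF W(1,2)]) (simp_all add: distrib_right add_subgroupD(4)[OF int_span_subgroup] W(3,4))
  show "algebraic_int (x * y)"
    by (rule algebraic_int_if_stable[OF W(1,2)]) (simp_all add: mult.assoc int_span_mult_closed W(3,4))
qed

lemma ring_of_integers_subgroup: "add_subgroup (ring_of_integers :: 'k::field_char_0 set)"
proof -
  have "x - y \<in> ring_of_integers" if "x \<in> ring_of_integers" "y \<in> ring_of_integers" for x y :: 'k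
    using algebraic_int_add_mult(1)[of x "- y"] that by (simp add: ring_of_integers_def)
  then show ?thesis by (simp add: add_subgroup_def ring_of_integers_def)
qed

lemma ring_of_integers_mult: "x \<in> ring_of_integers \<Longrightarrow> y \<in> ring_of_integers \<Longrightarrow> x * y \<in> ring_of_integers"
  by (simp add: ring_of_integers_def algebraic_int_add_mult)

lemma ring_of_integers_of_int: "of_int m \<in> ring_of_integers"
  by (simp add: ring_of_integers_def int_imp_algebraic_int)

text \<open>At a root \<open>r\<close> these are the coefficients of the quotient of \<open>p\<close> by \<open>X - r\<close>.\<close>

definition horner_tail :: "int poly \<Rightarrow> 'k::field_char_0 \<Rightarrow> nat \<Rightarrow> 'k" where
  "horner_tail p r j = (\<Sum>i=j..degree p. of_int (coeff p i) * r ^ (i - j))"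

lemma horner_tail_Suc:
  assumes "j < degree p" shows "horner_tail p r j = of_int (coeff p j) + r * horner_tail p r (Suc j)"
proof -
  have "horner_tail p r j = of_int (coeff p j) + (\<Sum>i=Suc j..degree p. of_int (coeff p i) * r ^ (i - j))"
    unfolding horner_tail_def using assms by (subst sum.atLeast_Suc_atMost) simp_all
  also have "(\<Sum>i=Suc j..degree p. of_int (coeff p i) * r ^ (i - j)) = r * horner_tail p r (Suc j)"
    unfolding horner_tail_def sum_distrib_left
  proof (rule sum.cong)
    fix i assume "i \<in> {Suc j..degree p}"
    then have "i - j = Suc (i - Suc j)" by auto
    then show "of_int (coeff p i) * r ^ (i - j) = r * (of_int (coeff p i) * r ^ (i - Suc j))" by (simp add: mult_ac)
  qed simp
  finally show ?thesis .
qed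

text \<open>These elements \<open>c\<close> satisfy that \<open>c\<close> and \<open>r c\<close> are
  both integral; they are the witnesses for the Pruefer property of overrings of
  \<open>\<int>\<^sub>K\<close>.\<close>

lemma horner_tail_integral:
  fixes r :: "'k::field_char_0"
  assumes root: "poly (map_poly of_int p) r = 0" and p: "p \<noteq> 0" and j: "1 \<le> j" "j \<le> degree p"
  shows "algebraic_int (horner_tail p r j)"
proof -
  define m where "m = degree p"
  define W where "W = (\<lambda>i. r ^ i) ` {..<m}"
  have fin: "finite W" by (simp add: W_def)
  have WI: "r ^ i \<in> int_span W" if "i < m" for i
    by (rule int_span_base[OF fin]) (use that in \<open>simp add: W_def\<close>)
  have total: "(\<Sum>i\<le>m. of_int (coeff p i) * r ^ i) = 0"
    using root by (simp add: poly_altdef m_def degree_map_poly coeff_map_poly)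
  have stable: "horner_tail p r j * r ^ l \<in> int_span W" if l: "l < m" for l
  proof (cases "l < j")
    case True
    have "horner_tail p r j * r ^ l = (\<Sum>i=j..m. of_int (coeff p i) * r ^ (i - j + l))"
      unfolding horner_tail_def sum_distrib_right m_def power_add by (simp only: mult.assoc)
    also have "\<dots> \<in> int_span W"
    proof (rule add_subgroup_sum[OF int_span_subgroup])
      fix i assume "i \<in> {j..m}"
      then have "i - j + l < m" using True by auto
      then show "of_int (coeff p i) * r ^ (i - j + l) \<in> int_span W"
        by (intro add_subgroup_int_mult[OF int_span_subgroup] WI)
    qed
    finally show ?thesis .
  next
    case False
    have "horner_tail p r j * r ^ j = (\<Sum>i=j..m. of_int (coeff p i) * r ^ i)"
      unfolding horner_tail_def sum_distrib_right m_def
      by (rule sum.cong) (auto simp: mult.assoc power_add[symmetric])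
    also have "\<dots> = - (\<Sum>i<j. of_int (coeff p i) * r ^ i)"
    proof -
      have "{..m} = {..<j} \<union> {j..m}" using j by (auto simp: m_def)
      then have "(\<Sum>i\<le>m. of_int (coeff p i) * r ^ i) = (\<Sum>i<j. of_int (coeff p i) * r ^ i) + (\<Sum>i=j..m. of_int (coeff p i) * r ^ i)"
        by (simp only:) (rule sum.union_disjoint; auto)
      then show ?thesis using total by (simp add: eq_neg_iff_add_eq_0 add.commute)
    qed
    finally have 1: "horner_tail p r j * r ^ j = - (\<Sum>i<j. of_int (coeff p i) * r ^ i)" .
    have "r ^ l = r ^ j * r ^ (l - j)" using False by (simp add: power_add[symmetric])
    then have "horner_tail p r j * r ^ l = (horner_tail p r j * r ^ j) * r ^ (l - j)" by simp
    also have "\<dots> = - (\<Sum>i<j. of_int (coeff p i) * r ^ (i + (l - j)))"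
      unfolding 1 by (simp only: mult_minus_left sum_distrib_right power_add mult.assoc)
    also have "\<dots> \<in> int_span W"
    proof (rule add_subgroupD(3)[OF int_span_subgroup], rule add_subgroup_sum[OF int_span_subgroup])
      fix i assume "i \<in> {..<j}"
      then have "i + (l - j) < m" using False l by auto
      then show "of_int (coeff p i) * r ^ (i + (l - j)) \<in> int_span W"
        by (intro add_subgroup_int_mult[OF int_span_subgroup] WI)
    qed
    finally show ?thesis .
  qed
  show ?thesis
  proof (rule algebraic_int_if_stable[OF fin, of 1])
    show "1 \<in> W" unfolding W_def using j by (intro image_eqI[where x = 0]) (simp_all add: m_def)
  qed (use stable in \<open>auto simp: W_def\<close>)
qed

text \<open>For a root r of a primitive integer polynomial the Horner quotients c satisfy
  c, r c \<open>\<in>\<close> R, and together they generate the unit ideal.\<close>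

lemma overring_prufer:
  fixes r :: "'k::field_char_0"
  assumes int: "ring_of_integers \<subseteq> R" and J: "add_subgroup J"
    and closed: "\<And>x y. x \<in> R \<Longrightarrow> y \<in> R \<Longrightarrow> x - y \<in> R"
    and c: "\<And>c. c \<in> R \<Longrightarrow> r * c \<in> R \<Longrightarrow> c \<in> J \<and> r * c \<in> J" and alg: "algebraic r"
  shows "1 \<in> J"
proof -
  obtain q :: "int poly" where q: "poly (map_poly of_int q) r = 0" "q \<noteq> 0"
    using algebraicE'[OF alg] by metis
  define p where "p = primitive_part q"
  have qp: "q = smult (Polynomial.content q) p" by (simp add: p_def)
  have "poly (map_poly of_int q) r = of_int (Polynomial.content q) * poly (map_poly of_int p) r"
    by (subst qp) (simp add: of_int_hom.map_poly_hom_smult)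
  then have root: "poly (map_poly of_int p) r = 0" using q by simp
  have p0: "p \<noteq> 0" using q(2) by (simp add: p_def)
  have cont: "Polynomial.content p = 1" using q(2) by (simp add: p_def)
  have deg: "degree p \<ge> 1"
  proof (rule ccontr)
    assume "\<not> degree p \<ge> 1"
    then have "degree p = 0" by simp
    then obtain a where "p = [:a:]" by (rule degree_eq_zeroE)
    then show False using root p0 by (simp add: map_poly_pCons)
  qed
  define h where "h = horner_tail p r"
  have h0: "h 0 = 0" using root by (simp add: h_def horner_tail_def poly_altdef degree_map_poly coeff_map_poly atLeast0AtMost)
  have hR: "h j \<in> R" if "j \<le> degree p" for j
  proof (cases "j = 0")
    case True
    then show ?thesis using h0 ring_of_integers_of_int[of 0] int by auto
  next
    case False
    then have "algebraic_int (h j)" unfolding h_def using that by (intro horner_tail_integral[OF root p0]) simp_all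
    then show ?thesis using int by (auto simp: ring_of_integers_def)
  qed
  have rh: "r * h (Suc j) = h j - of_int (coeff p j)" if "j < degree p" for j
    using horner_tail_Suc[OF that, of r] by (simp add: h_def)
  have hJ: "h (Suc j) \<in> J" "r * h (Suc j) \<in> J" if "j < degree p" for j
  proof -
    have "r * h (Suc j) \<in> R" unfolding rh[OF that]
      using that int ring_of_integers_of_int by (intro closed hR) auto
    then show "h (Suc j) \<in> J" "r * h (Suc j) \<in> J" using c[of "h (Suc j)"] hR[of "Suc j"] that by auto
  qed
  have coeffJ: "of_int (coeff p j) \<in> J" for j
  proof (cases "j < degree p")
    case True
    have "h j \<in> J"
    proof (cases j)
      case 0 then show ?thesis using h0 add_subgroupD(1)[OF J] by simp
    next
      case (Suc i) then show ?thesis using hJ(1)[of i] True by simp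
    qed
    then have "h j - r * h (Suc j) \<in> J" using hJ(2)[OF True] by (rule add_subgroupD(2)[OF J])
    then show ?thesis by (simp add: rh[OF True])
  next
    case False
    show ?thesis
    proof (cases "j = degree p")
      case True
      have "h j = of_int (coeff p j)" using True by (simp add: h_def horner_tail_def)
      then show ?thesis using hJ(1)[of "j - 1"] True deg by simp
    qed (use False add_subgroupD(1)[OF J] in \<open>simp add: coeff_eq_0\<close>)
  qed
  \<comment> \<open>the integers in J form an ideal containing all coefficients\<close>
  define g where "g = (LEAST n::nat. n > 0 \<and> of_nat n \<in> J)"
  have abs: "of_nat (nat \<bar>a\<bar>) \<in> J" if "of_int a \<in> J" for a
    using that add_subgroupD(3)[OF J that] by (cases "a \<ge> 0") simp_all
  have "\<exists>n::nat. n > 0 \<and> of_nat n \<in> J"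
    by (rule exI[of _ "nat \<bar>lead_coeff p\<bar>"]) (use abs[OF coeffJ] p0 in simp)
  then have g: "g > 0" "of_nat g \<in> J" unfolding g_def by (metis (mono_tags, lifting) LeastI_ex)+
  have dvd: "int g dvd a" if a: "of_int a \<in> J" for a
  proof -
    have "of_int a - of_int (a div int g) * of_nat g \<in> J"
      by (rule add_subgroupD(2)[OF J a add_subgroup_int_mult[OF J g(2)]])
    moreover have "of_int a - of_int (a div int g) * of_nat g = (of_nat (nat (a mod int g)) :: 'k)"
    proof -
      have "a - (a div int g) * int g = a mod int g" by (simp add: minus_div_mult_eq_mod)
      then have "(of_int (a - (a div int g) * int g) :: 'k) = of_int (a mod int g)" by simp
      then show ?thesis using g(1) by simp
    qed
    ultimately have m: "of_nat (nat (a mod int g)) \<in> J" by simp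
    have "nat (a mod int g) < g" using g(1) by (simp add: nat_less_iff)
    then have "\<not> (nat (a mod int g) > 0 \<and> of_nat (nat (a mod int g)) \<in> J)"
      unfolding g_def by (rule not_less_Least)
    then have "nat (a mod int g) = 0" using m by simp
    moreover have "a mod int g \<ge> 0" using g(1) by simp
    ultimately have "a mod int g = 0" by simp
    then show ?thesis by (simp add: dvd_eq_mod_eq_0)
  qed
  have "[:int g:] dvd p" using dvd coeffJ by (simp add: const_poly_dvd_iff)
  then have "int g dvd Polynomial.content p" by (simp add: const_poly_dvd_iff_dvd_content)
  then have "g = 1" using cont by simp
  then show ?thesis using g(2) by simp
qed

section \<open>Joint eigenvectors of multiplications\<close>

lemma rat_vector_space: "vector_space (rat_scale :: rat \<Rightarrow> 'k::field_char_0 \<Rightarrow> 'k)"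
  by unfold_locales (simp_all add: rat_scale_def of_rat_add of_rat_mult algebra_simps)

lemma complex_functional_vector_space:
  "vector_space (\<lambda>(c::complex) (f :: 'k \<Rightarrow> complex) x. c * f x)"
  by unfold_locales (simp_all add: fun_eq_iff algebra_simps)

definition rat_linear :: "('k::field_char_0 \<Rightarrow> complex) \<Rightarrow> bool" where
  "rat_linear f \<longleftrightarrow> (\<forall>x y. f (x + y) = f x + f y) \<and> (\<forall>q x. f (of_rat q * x) = of_rat q * f x)"

lemma rat_linearD:
  assumes "rat_linear f"
  shows "f (x + y) = f x + f y" "f (of_rat q * x) = of_rat q * f x" "f 0 = 0" "f (sum g A) = (\<Sum>i\<in>A. f (g i))"
proof -
  show a: "f (x + y) = f x + f y" "f (of_rat q * x) = of_rat q * f x" for x y q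
    using assms by (simp_all add: rat_linear_def)
  show 0: "f 0 = 0" using a(1)[of 0 0] by simp
  show "f (sum g A) = (\<Sum>i\<in>A. f (g i))" by (induction A rule: infinite_finite_induct) (simp_all add: 0 a(1))
qed

lemma rat_linear_combine:
  assumes "rat_linear f" "rat_linear g"
  shows "rat_linear (\<lambda>x. f x - g x)" "rat_linear (\<lambda>x. c * f x)" "rat_linear (\<lambda>x. f (a * x))"
proof -
  show "rat_linear (\<lambda>x. f x - g x)" "rat_linear (\<lambda>x. c * f x)"
    using assms by (auto simp: rat_linear_def algebra_simps)
  show "rat_linear (\<lambda>x. f (a * x))"
    unfolding rat_linear_def distrib_left mult.left_commute[of a]
    by (intro conjI allI) (rule rat_linearD[OF assms(1)])+
qed

lemma rat_linear_sum:
  assumes "\<And>i. i \<in> A \<Longrightarrow> rat_linear (g i)"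
  shows "rat_linear (\<lambda>x. \<Sum>i\<in>A. g i x)"
  using assms by (auto simp: rat_linear_def sum.distrib sum_distrib_left intro!: sum.cong)

lemma embedding_rat_linear:
  assumes "\<sigma> \<in> complex_embeddings" shows "rat_linear \<sigma>"
proof -
  have h: "\<sigma> 1 = 1" "\<sigma> (x + y) = \<sigma> x + \<sigma> y" "\<sigma> (x * y) = \<sigma> x * \<sigma> y" for x y
    using assms by (auto simp: complex_embeddings_def)
  have h0: "\<sigma> 0 = 0" using h(2)[of 0 0] by simp
  have nat: "\<sigma> (of_nat n) = of_nat n" for n by (induction n) (simp_all add: h h0)
  have neg: "\<sigma> (- x) = - \<sigma> x" for x using h(2)[of x "- x"] h0 by (simp add: eq_neg_iff_add_eq_0 add.commute)
  have int: "\<sigma> (of_int m) = of_int m" for m by (cases m rule: int_cases2) (simp_all add: nat neg)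
  have "\<sigma> (of_rat q) = of_rat q" for q
  proof (cases q)
    case (Fract a b)
    have "\<sigma> (of_rat q * of_int b) = of_int a" using Fract by (simp add: of_rat_rat int)
    then have "\<sigma> (of_rat q) * of_int b = of_int a" by (simp add: h int)
    then show ?thesis using Fract by (simp add: of_rat_rat field_simps)
  qed
  then show ?thesis by (simp add: rat_linear_def h)
qed

text \<open>An operator annihilated by a product of distinct linear factors is diagonalisable.
  The subtraction of an explicit preimage isolates one eigenvector at a time.\<close>

lemma eigenvector_decomposition:
  fixes f :: "'k::field_char_0 \<Rightarrow> complex"
  assumes "distinct zs" "rat_linear f"
    "foldr (\<lambda>z g. (\<lambda>y. g (x * y) - z * g y)) zs f = (\<lambda>_. 0)"
    and commuting: "\<forall>a\<in>A. \<exists>l. \<forall>y. f (a * y) = l * f y"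
  shows "\<exists>F. (\<forall>z\<in>set zs. rat_linear (F z) \<and> (\<forall>y. F z (x * y) = z * F z y) \<and>
      (\<forall>a\<in>A. \<exists>l. \<forall>y. F z (a * y) = l * F z y)) \<and> f = (\<lambda>y. \<Sum>z\<in>set zs. F z y)"
proof -
  have comm: "foldr (\<lambda>z g. (\<lambda>y. g (x * y) - z * g y)) zs (\<lambda>y. f (x * y) - w * f y) =
      (\<lambda>y. foldr (\<lambda>z g. (\<lambda>y. g (x * y) - z * g y)) zs f (x * y) - w * foldr (\<lambda>z g. (\<lambda>y. g (x * y) - z * g y)) zs f y)"
    for zs :: "complex list" and w and f :: "'k \<Rightarrow> complex"
  proof (induction zs)
    case (Cons a zs)
    show ?case unfolding foldr.simps o_apply Cons.IH by (simp add: fun_eq_iff algebra_simps)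
  qed simp
  have ex: "\<exists>l. \<forall>a\<in>A. \<forall>y. f (a * y) = l a * f y" using commuting by metis
  then obtain l where l: "\<forall>a\<in>A. \<forall>y. f (a * y) = l a * f y" by blast
  have "\<exists>F. (\<forall>z\<in>set zs. rat_linear (F z) \<and> (\<forall>y. F z (x * y) = z * F z y) \<and>
      (\<forall>a\<in>A. \<forall>y. F z (a * y) = l a * F z y)) \<and> f = (\<lambda>y. \<Sum>z\<in>set zs. F z y)"
    using assms(1-3) l
  proof (induction zs arbitrary: f)
    case Nil
    then show ?case by simp
  next
    case (Cons w zs)
    define g where "g = (\<lambda>y. f (x * y) - w * f y)"
    have g1: "rat_linear g" unfolding g_def using Cons.prems(2) by (intro rat_linear_combine)
    have g2: "foldr (\<lambda>z g. (\<lambda>y. g (x * y) - z * g y)) zs g = (\<lambda>_. 0)"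
      using Cons.prems(3) comm[of zs f w] by (simp add: g_def)
    have g3: "\<forall>a\<in>A. \<forall>y. g (a * y) = l a * g y"
    proof (intro ballI allI)
      fix a y assume a: "a \<in> A"
      have "g (a * y) = f (a * (x * y)) - w * f (a * y)" by (simp add: g_def mult.left_commute)
      then show "g (a * y) = l a * g y" using Cons.prems(4) a by (simp add: g_def algebra_simps)
    qed
    obtain F where F: "\<forall>z\<in>set zs. rat_linear (F z) \<and> (\<forall>y. F z (x * y) = z * F z y) \<and> (\<forall>a\<in>A. \<forall>y. F z (a * y) = l a * F z y)"
      "g = (\<lambda>y. \<Sum>z\<in>set zs. F z y)"
      using Cons.IH[OF _ g1 g2 g3] Cons.prems(1) by auto
    define h where "h = (\<lambda>y. \<Sum>z\<in>set zs. inverse (z - w) * F z y)"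
    have wz: "w \<notin> set zs" using Cons.prems(1) by simp
    have h1: "rat_linear h" unfolding h_def by (rule rat_linear_sum, rule rat_linear_combine) (use F(1) in auto)
    have hx: "h (x * y) - w * h y = g y" for y
    proof -
      have "h (x * y) - w * h y = (\<Sum>z\<in>set zs. inverse (z - w) * (z - w) * F z y)"
        unfolding h_def sum_distrib_left sum_subtractf[symmetric]
      proof (rule sum.cong)
        fix z assume "z \<in> set zs"
        then have e: "F z (x * y) = z * F z y" using F(1) by blast
        show "inverse (z - w) * F z (x * y) - w * (inverse (z - w) * F z y) = inverse (z - w) * (z - w) * F z y"
          unfolding e by (simp add: algebra_simps)
      qed simp
      also have "\<dots> = (\<Sum>z\<in>set zs. F z y)"
      proof (rule sum.cong)
        fix z assume "z \<in> set zs"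
        then have "z - w \<noteq> 0" using wz by auto
        then have "inverse (z - w) * (z - w) = 1" by (rule field_class.field_inverse)
        then show "inverse (z - w) * (z - w) * F z y = F z y" by (simp only: mult_1_left)
      qed simp
      also have "\<dots> = g y" unfolding F(2) ..
      finally show ?thesis .
    qed
    have h3: "h (a * y) = l a * h y" if a: "a \<in> A" for a y
      unfolding h_def sum_distrib_left by (rule sum.cong) (use F(1) a in \<open>simp_all add: mult.left_commute\<close>)
    define F' where "F' z = (if z = w then (\<lambda>y. f y - h y) else (\<lambda>y. inverse (z - w) * F z y))" for z
    have "\<forall>z\<in>set (w # zs). rat_linear (F' z) \<and> (\<forall>y. F' z (x * y) = z * F' z y) \<and> (\<forall>a\<in>A. \<forall>y. F' z (a * y) = l a * F' z y)"
    proof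
      fix z assume z: "z \<in> set (w # zs)"
      show "rat_linear (F' z) \<and> (\<forall>y. F' z (x * y) = z * F' z y) \<and> (\<forall>a\<in>A. \<forall>y. F' z (a * y) = l a * F' z y)"
      proof (cases "z = w")
        case True
        have "f (x * y) - h (x * y) = w * (f y - h y)" for y
          using hx[of y] by (simp add: g_def algebra_simps)
        then show ?thesis using True Cons.prems(2,4) h1 h3
          by (auto simp: F'_def right_diff_distrib intro: rat_linear_combine)
      next
        case False
        then show ?thesis using F(1) z by (auto simp: F'_def mult.left_commute intro: rat_linear_combine)
      qed
    qed
    moreover have "f = (\<lambda>y. \<Sum>z\<in>set (w # zs). F' z y)"
    proof
      fix y
      have "(\<Sum>z\<in>set zs. F' z y) = h y" unfolding h_def by (rule sum.cong) (use wz in \<open>auto simp: F'_def\<close>)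
      then show "f y = (\<Sum>z\<in>set (w # zs). F' z y)" using wz by (simp add: F'_def)
    qed
    ultimately show ?case by blast
  qed
  then show ?thesis by blast
qed

text \<open>A minimal polynomial over the rationals has simple complex roots, because it is coprime
  to its derivative.\<close>

lemma separable_annihilator:
  fixes x :: "'k::field_char_0"
  assumes "algebraic x"
  obtains p :: "rat poly" where "p \<noteq> 0" "poly (map_poly of_rat p) x = 0" "rsquarefree (map_poly of_rat p :: complex poly)"
proof -
  define Z where "Z p \<longleftrightarrow> p \<noteq> 0 \<and> poly (map_poly of_rat p) x = 0" for p :: "rat poly"
  obtain q :: "int poly" where q: "poly (map_poly of_int q) x = 0" "q \<noteq> 0" using algebraicE'[OF assms] by metis
  have "map_poly of_rat (map_poly of_int q) = (map_poly of_int q :: 'k poly)"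
    by (rule poly_eqI) (simp add: coeff_map_poly)
  then have "Z (map_poly of_int q)" using q unfolding Z_def by (simp add: map_poly_eq_0_iff)
  then obtain p where p: "Z p" "\<And>r. Z r \<Longrightarrow> degree p \<le> degree r"
    using ex_has_least_nat[of Z _ degree] by blast
  have hom_mult: "poly (map_poly of_rat (a * b)) y = poly (map_poly of_rat a) y * poly (map_poly of_rat b) y"
    and hom_add: "poly (map_poly of_rat (a + b)) y = poly (map_poly of_rat a) y + poly (map_poly of_rat b) y"
    for a b :: "rat poly" and y :: "'c::field_char_0"
  proof -
    interpret comm_ring_hom "of_rat :: rat \<Rightarrow> 'c" by unfold_locales (simp_all add: of_rat_add of_rat_mult)
    interpret mp: map_poly_comm_ring_hom "of_rat :: rat \<Rightarrow> 'c" ..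
    show "poly (map_poly of_rat (a * b)) y = poly (map_poly of_rat a) y * poly (map_poly of_rat b) y"
      "poly (map_poly of_rat (a + b)) y = poly (map_poly of_rat a) y + poly (map_poly of_rat b) y"
      by (simp_all add: mp.hom_mult mp.hom_add)
  qed
  have const: "degree s > 0" if "s \<noteq> 0" "poly (map_poly of_rat s) y = 0" for s :: "rat poly" and y :: "'c::field_char_0"
  proof (rule ccontr)
    assume "\<not> ?thesis"
    then have "degree s = 0" by simp
    then obtain a where "s = [:a:]" by (rule degree_eq_zeroE)
    then show False using that by (simp add: map_poly_pCons)
  qed
  have p0: "p \<noteq> 0" "poly (map_poly of_rat p) x = 0" using p(1) by (simp_all add: Z_def)
  have deg: "degree p > 0" by (rule const[OF p0])
  have "rsquarefree (map_poly of_rat p :: complex poly)"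
    unfolding rsquarefree_roots
  proof (intro allI notI)
    fix a :: complex
    assume a: "poly (map_poly of_rat p) a = 0 \<and> poly (pderiv (map_poly of_rat p)) a = 0"
    define Y where "Y s \<longleftrightarrow> s \<noteq> 0 \<and> poly (map_poly of_rat s) a = 0" for s :: "rat poly"
    have "Y p" using a p0 by (simp add: Y_def)
    then obtain s where s: "Y s" "\<And>t. Y t \<Longrightarrow> degree s \<le> degree t"
      using ex_has_least_nat[of Y p degree] by blast
    have s0: "s \<noteq> 0" using s(1) by (simp add: Y_def)
    have "poly (map_poly of_rat (p div s * s + p mod s)) a = 0" using a by simp
    then have "poly (map_poly of_rat (p mod s)) a = 0" using s(1) by (simp only: hom_add hom_mult Y_def) simp
    then have "p mod s = 0"
      using s(2)[of "p mod s"] degree_mod_less[OF s0, of p] unfolding Y_def by (metis not_less)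
    then have eq: "p = (p div s) * s" by (metis add.right_neutral div_mult_mod_eq)
    define t where "t = p div s"
    have pt: "p = t * s" using eq by (simp add: t_def)
    have t0: "t \<noteq> 0" using pt p0 by auto
    have "Z t \<or> Z s" using p0(2) hom_mult[of t s x] t0 s0 unfolding pt[symmetric] Z_def by auto
    moreover have "\<not> Z t"
    proof
      assume "Z t"
      then have "degree p \<le> degree t" by (rule p(2))
      then have "degree s = 0" using pt t0 s0 by (simp add: degree_mult_eq)
      then show False using const[of s a] s(1) by (simp add: Y_def)
    qed
    ultimately have "degree p \<le> degree s" using p(2) by blast
    moreover have "Y (pderiv p)"
    proof -
      have "map_poly of_rat (pderiv p) = (pderiv (map_poly of_rat p) :: complex poly)"
        by (rule poly_eqI) (simp add: coeff_map_poly coeff_pderiv of_rat_mult of_rat_add)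
      then show ?thesis using a deg by (simp add: Y_def pderiv_eq_0_iff)
    qed
    then have "degree s \<le> degree (pderiv p)" by (rule s(2))
    ultimately show False using deg by (simp add: degree_pderiv)
  qed
  then show ?thesis using that[of p] p0 by blast
qed

definition coeff_functional :: "(nat \<Rightarrow> complex) \<Rightarrow> complex poly \<Rightarrow> complex" where
  "coeff_functional g q = (\<Sum>i\<le>degree q. coeff q i * g i)"

lemma coeff_functional_upto:
  assumes "degree q \<le> N" shows "coeff_functional g q = (\<Sum>i\<le>N. coeff q i * g i)"
  unfolding coeff_functional_def by (rule sum.mono_neutral_left) (use assms in \<open>auto simp: coeff_eq_0\<close>)

lemma coeff_functional_linear_factor:
  "coeff_functional g ([:-z, 1:] * q) = coeff_functional (\<lambda>i. g (Suc i)) q - z * coeff_functional g q"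
proof -
  define N where "N = degree q"
  have "degree ([:-z, 1:] * q) \<le> Suc N" unfolding N_def using degree_mult_le[of "[:-z, 1:]" q] by simp
  then have "coeff_functional g ([:-z, 1:] * q) = (\<Sum>i\<le>Suc N. coeff ([:-z, 1:] * q) i * g i)"
    by (rule coeff_functional_upto)
  also have "\<dots> = (\<Sum>i\<le>Suc N. coeff (pCons 0 q) i * g i - z * (coeff q i * g i))"
    by (rule sum.cong) (simp_all add: algebra_simps)
  also have "\<dots> = (\<Sum>i\<le>Suc N. coeff (pCons 0 q) i * g i) - z * (\<Sum>i\<le>Suc N. coeff q i * g i)"
    by (simp only: sum_subtractf sum_distrib_left)
  also have "(\<Sum>i\<le>Suc N. coeff q i * g i) = coeff_functional g q"
    by (rule coeff_functional_upto[symmetric]) (simp add: N_def)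
  also have "(\<Sum>i\<le>Suc N. coeff (pCons 0 q) i * g i) = coeff_functional (\<lambda>i. g (Suc i)) q"
    by (simp only: sum.atMost_Suc_shift coeff_pCons_0 coeff_pCons_Suc) (simp add: coeff_functional_def N_def)
  finally show ?thesis .
qed

lemma foldr_linear_factors:
  fixes x :: "'a::comm_ring_1"
  shows "foldr (\<lambda>z g. (\<lambda>y. g (x * y) - z * g y)) zs f =
     (\<lambda>y. coeff_functional (\<lambda>i. f (x ^ i * y)) (\<Prod>z\<leftarrow>zs. [:-z, 1:]))"
proof (induction zs)
  case Nil then show ?case by (simp add: coeff_functional_def)
next
  case (Cons z zs)
  show ?case unfolding foldr.simps o_apply Cons.IH list.map prod_list.Cons coeff_functional_linear_factor
    by (simp add: mult.assoc[symmetric] mult.commute[of _ x])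
qed

text \<open>The decomposition is refined for one algebraic element after another; earlier eigenvalues
  survive because multiplications commute.\<close>

lemma joint_eigenvectors:
  assumes "\<forall>x\<in>set xs. algebraic x" "rat_linear f"
  shows "\<exists>gs. (\<forall>g\<in>set gs. rat_linear g \<and> (\<forall>a\<in>set xs. \<exists>l. \<forall>y. g (a * y) = l * g y)) \<and>
     f = (\<lambda>y. \<Sum>g\<leftarrow>gs. g y)"
  using assms(1)
proof (induction xs)
  case Nil
  show ?case by (rule exI[of _ "[f]"]) (use assms(2) in simp)
next
  case (Cons x xs)
  then obtain gs where gs: "\<forall>g\<in>set gs. rat_linear g \<and> (\<forall>a\<in>set xs. \<exists>l. \<forall>y. g (a * y) = l * g y)"
    "f = (\<lambda>y. \<Sum>g\<leftarrow>gs. g y)" by auto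
  have "\<exists>hs. (\<forall>h\<in>set hs. rat_linear h \<and> (\<forall>a\<in>set (x # xs). \<exists>l. \<forall>y. h (a * y) = l * h y)) \<and>
     g = (\<lambda>y. \<Sum>h\<leftarrow>hs. h y)" if g: "g \<in> set gs" for g
  proof -
    obtain p :: "rat poly" where p: "p \<noteq> 0" "poly (map_poly of_rat p) x = 0" "rsquarefree (map_poly of_rat p :: complex poly)"
      using separable_annihilator[of x] Cons.prems by auto
    let ?P = "map_poly of_rat p :: complex poly"
    have P0: "?P \<noteq> 0" using p(3) by (simp add: rsquarefree_def)
    have fin: "finite {z. poly ?P z = 0}" by (rule poly_roots_finite[OF P0])
    obtain zs where zs: "set zs = {z. poly ?P z = 0}" "distinct zs" using finite_distinct_list[OF fin] by blast
    have "(\<Prod>z\<leftarrow>zs. [:-z, 1:]) = (\<Prod>z|poly ?P z = 0. [:-z, 1:])"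
      unfolding zs(1)[symmetric] by (rule prod.distinct_set_conv_list[OF zs(2), symmetric])
    then have dec: "smult (lead_coeff ?P) (\<Prod>z\<leftarrow>zs. [:-z, 1:]) = ?P"
      using complex_poly_decompose_rsquarefree[OF p(3)] by simp
    have rl: "rat_linear g" using gs(1) g by blast
    have "foldr (\<lambda>z g. (\<lambda>y. g (x * y) - z * g y)) zs g = (\<lambda>_. 0)"
      unfolding foldr_linear_factors
    proof
      fix y
      let ?G = "\<lambda>i. g (x ^ i * y)" and ?Q = "\<Prod>z\<leftarrow>zs. [:-z, 1:]"
      have "lead_coeff ?P * coeff_functional ?G ?Q = coeff_functional ?G (smult (lead_coeff ?P) ?Q)"
        by (subst coeff_functional_upto[of "smult _ _" "degree ?Q"])
           (simp_all add: coeff_functional_def sum_distrib_left mult.assoc degree_smult_le)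
      also have "\<dots> = (\<Sum>i\<le>degree p. of_rat (coeff p i) * g (x ^ i * y))"
        unfolding dec by (simp add: coeff_functional_def degree_map_poly coeff_map_poly)
      also have "\<dots> = g (\<Sum>i\<le>degree p. of_rat (coeff p i) * (x ^ i * y))"
        by (simp add: rat_linearD(4)[OF rl] rat_linearD(2)[OF rl])
      also have "(\<Sum>i\<le>degree p. of_rat (coeff p i) * (x ^ i * y)) = poly (map_poly of_rat p) x * y"
        by (simp add: poly_altdef degree_map_poly coeff_map_poly sum_distrib_right mult.assoc)
      finally show "coeff_functional ?G ?Q = 0" using p(2) P0 rat_linearD(3)[OF rl] by simp
    qed
    have "\<forall>a\<in>set xs. \<exists>l. \<forall>y. g (a * y) = l * g y" using gs(1) g by simp
    from eigenvector_decomposition[OF zs(2) rl \<open>foldr _ zs g = _\<close> this]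
    obtain F where F: "\<forall>z\<in>set zs. rat_linear (F z) \<and> (\<forall>y. F z (x * y) = z * F z y) \<and>
      (\<forall>a\<in>set xs. \<exists>l. \<forall>y. F z (a * y) = l * F z y)" "g = (\<lambda>y. \<Sum>z\<in>set zs. F z y)" by (elim exE conjE)
    have "g = (\<lambda>y. \<Sum>h\<leftarrow>map F zs. h y)" unfolding F(2)
      by (simp add: o_def sum_list_distinct_conv_sum_set[OF zs(2)])
    moreover have "\<forall>h\<in>set (map F zs). rat_linear h \<and> (\<forall>a\<in>set (x # xs). \<exists>l. \<forall>y. h (a * y) = l * h y)"
      using F(1) by auto
    ultimately show ?thesis by (intro exI[of _ "map F zs"] conjI)
  qed
  then have "\<forall>g\<in>set gs. \<exists>hs. (\<forall>h\<in>set hs. rat_linear h \<and> (\<forall>a\<in>set (x # xs). \<exists>l. \<forall>y. h (a * y) = l * h y)) \<and>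
     g = (\<lambda>y. \<Sum>h\<leftarrow>hs. h y)" by blast
  then obtain H where H: "\<forall>g\<in>set gs. (\<forall>h\<in>set (H g). rat_linear h \<and> (\<forall>a\<in>set (x # xs). \<exists>l. \<forall>y. h (a * y) = l * h y)) \<and>
     g = (\<lambda>y. \<Sum>h\<leftarrow>H g. h y)" by (rule bchoice[THEN exE])
  have "f = (\<lambda>y. \<Sum>h\<leftarrow>concat (map H gs). h y)"
  proof
    fix y
    have "(\<Sum>h\<leftarrow>concat (map H gs). h y) = (\<Sum>g\<leftarrow>gs. \<Sum>h\<leftarrow>H g. h y)"
      by (induction gs) simp_all
    also have "\<dots> = (\<Sum>g\<leftarrow>gs. g y)"
    proof (rule arg_cong[where f = sum_list], rule map_cong[OF refl])
      fix g assume "g \<in> set gs"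
      then have "g = (\<lambda>y. \<Sum>h\<leftarrow>H g. h y)" using H by blast
      then show "(\<Sum>h\<leftarrow>H g. h y) = g y" by (rule fun_cong[symmetric])
    qed
    finally show "f y = (\<Sum>h\<leftarrow>concat (map H gs). h y)" using gs(2) by simp
  qed
  moreover have "\<forall>h\<in>set (concat (map H gs)). rat_linear h \<and> (\<forall>a\<in>set (x # xs). \<exists>l. \<forall>y. h (a * y) = l * h y)"
    using H by auto
  ultimately show ?case by (intro exI[of _ "concat (map H gs)"] conjI)
qed

section \<open>The number of embeddings\<close>

locale num_field =
  fixes K :: "'k::field_char_0 itself"
  assumes nf: "number_field K"
begin

sublocale Q: vector_space "rat_scale :: rat \<Rightarrow> 'k \<Rightarrow> 'k" by (rule rat_vector_space)
sublocale F: vector_space "\<lambda>(c::complex) (f :: 'k \<Rightarrow> complex) x. c * f x"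
  by (rule complex_functional_vector_space)

abbreviation "d \<equiv> field_degree K"

lemma d_eq: "d = Q.dim UNIV" by (simp add: field_degree_def)

lemma obtain_basis:
  obtains b :: "nat \<Rightarrow> 'k" where "inj_on b {..<d}" "Q.independent (b ` {..<d})" "Q.span (b ` {..<d}) = UNIV"
proof -
  obtain S :: "'k set" where S: "finite S" "Q.span S = UNIV" using nf by (auto simp: number_field_def)
  obtain B where B: "B \<subseteq> UNIV" "Q.independent B" "UNIV \<subseteq> Q.span B" "card B = Q.dim UNIV"
    by (rule Q.basis_exists[of UNIV])
  have fin: "finite B" using Q.independent_span_bound[OF S(1) B(2)] S(2) by simp
  then obtain b where b: "bij_betw b {..<card B} B" using ex_bij_betw_nat_finite[OF fin] by (auto simp: atLeast0LessThan)
  have card: "card B = d" using B(4) d_eq by simp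
  have im: "b ` {..<d} = B" "inj_on b {..<d}" using b unfolding card bij_betw_def by simp_all
  have "Q.span B = UNIV" using B(3) by (simp add: top_le)
  then show ?thesis using that[OF im(2)] im(1) B(2) by simp
qed

definition qbasis :: "nat \<Rightarrow> 'k" where
  "qbasis = (SOME b. inj_on b {..<d} \<and> Q.independent (b ` {..<d}) \<and> Q.span (b ` {..<d}) = UNIV)"

lemma qbasis: "inj_on qbasis {..<d}" "Q.independent (qbasis ` {..<d})" "Q.span (qbasis ` {..<d}) = UNIV"
proof -
  have "\<exists>b. inj_on b {..<d} \<and> Q.independent (b ` {..<d}) \<and> Q.span (b ` {..<d}) = UNIV"
    by (rule obtain_basis) (intro exI conjI)
  from someI_ex[OF this] show "inj_on qbasis {..<d}" "Q.independent (qbasis ` {..<d})" "Q.span (qbasis ` {..<d}) = UNIV"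
    unfolding qbasis_def by blast+
qed

definition qcoord :: "nat \<Rightarrow> 'k \<Rightarrow> rat" where
  "qcoord j x = Q.representation (qbasis ` {..<d}) x (qbasis j)"

lemma qcoord_sum: "x = (\<Sum>j<d. of_rat (qcoord j x) * qbasis j)"
proof -
  have "(\<Sum>v\<in>qbasis ` {..<d}. rat_scale (Q.representation (qbasis ` {..<d}) x v) v) = x"
    by (rule Q.sum_representation_eq) (use qbasis in auto)
  then show ?thesis unfolding sum.reindex[OF qbasis(1)] by (simp add: qcoord_def rat_scale_def)
qed

lemma qcoord_linear: "qcoord j (x + y) = qcoord j x + qcoord j y" "qcoord j (of_rat q * x) = q * qcoord j x"
  unfolding qcoord_def
  by (simp_all only: Q.representation_add[OF qbasis(2)] Q.representation_scale[OF qbasis(2)] qbasis(3) UNIV_I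
        rat_scale_def[symmetric])

lemma qcoord_basis: "i < d \<Longrightarrow> j < d \<Longrightarrow> qcoord j (qbasis i) = (if i = j then 1 else 0)"
  unfolding qcoord_def using Q.representation_basis[OF qbasis(2), of "qbasis i"] qbasis(1)
  by (auto simp: inj_on_def)

lemma qcoord_rat_linear: "rat_linear (\<lambda>x. of_rat (qcoord j x))"
  by (simp add: rat_linear_def qcoord_linear of_rat_add of_rat_mult)

lemma integral_multiple: "\<exists>D::nat. D > 0 \<and> of_nat D * x \<in> (ring_of_integers :: 'k set)"
proof -
  have "\<exists>D. D > 0 \<and> (\<forall>q\<in>(\<lambda>(i,j). qcoord j (x * qbasis i)) ` ({..<d} \<times> {..<d}). \<exists>m::int. rat_of_nat D * q = of_int m)"
  proof -
    have main: "\<exists>D::nat. D > 0 \<and> (\<forall>q\<in>X. \<exists>m::int. rat_of_nat D * q = of_int m)" if "finite X" for X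
      using that
    proof induction
      case empty show ?case by (rule exI[of _ 1]) simp
    next
      case (insert q X)
      then obtain D :: nat where D: "D > 0" "\<forall>q\<in>X. \<exists>m::int. rat_of_nat D * q = of_int m" by blast
      obtain a e where ae: "q = Rat.Fract a e" "e > 0" by (cases q) auto
      have q: "rat_of_nat (nat e) * q = of_int a" using ae by (simp add: Fract_of_int_quotient)
      have "\<exists>m::int. rat_of_nat (D * nat e) * r = of_int m" if r: "r \<in> insert q X" for r
      proof (cases "r = q")
        case True
        then have "rat_of_nat (D * nat e) * r = of_int (int D * a)" using q by (simp add: mult.assoc)
        then show ?thesis by blast
      next
        case False
        then obtain m where "rat_of_nat D * r = of_int m" using D(2) r by blast
        then have "rat_of_nat (D * nat e) * r = of_int (e * m)" using ae(2) by simp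
        then show ?thesis by blast
      qed
      then show ?case using D(1) ae(2) by (intro exI[of _ "D * nat e"]) auto
    qed
    show ?thesis by (rule main) simp
  qed
  then obtain D where D: "D > 0" "\<forall>q\<in>(\<lambda>(i,j). qcoord j (x * qbasis i)) ` ({..<d} \<times> {..<d}). \<exists>m::int. rat_of_nat D * q = of_int m" by blast
  define W where "W = qbasis ` {..<d}"
  have fin: "finite W" by (simp add: W_def)
  have stable: "of_nat D * x * w \<in> int_span W" if w: "w \<in> W" for w
  proof -
    obtain i where i: "w = qbasis i" "i < d" using w by (auto simp: W_def)
    have "of_nat D * x * w = (\<Sum>j<d. of_nat D * of_rat (qcoord j (x * qbasis i)) * qbasis j)"
      unfolding i(1) mult.assoc by (subst qcoord_sum[of "x * qbasis i"]) (simp add: sum_distrib_left mult.assoc)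
    also have "\<dots> \<in> int_span W"
    proof (rule add_subgroup_sum[OF int_span_subgroup])
      fix j assume j: "j \<in> {..<d}"
      have "\<exists>m::int. rat_of_nat D * qcoord j (x * qbasis i) = of_int m"
        using D(2) i(2) j by auto
      then obtain m :: int where m: "rat_of_nat D * qcoord j (x * qbasis i) = of_int m" by blast
      have "of_nat D * of_rat (qcoord j (x * qbasis i)) = (of_rat (rat_of_nat D * qcoord j (x * qbasis i)) :: 'k)"
        by (simp add: of_rat_mult)
      also have "\<dots> = of_int m" unfolding m by simp
      finally show "of_nat D * of_rat (qcoord j (x * qbasis i)) * qbasis j \<in> int_span W"
        using add_subgroup_int_mult[OF int_span_subgroup int_span_base[OF fin, of "qbasis j"]] j by (simp add: W_def)
    qed
    finally show ?thesis .
  qed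
  have "\<exists>w\<in>W. w \<noteq> 0"
  proof (rule ccontr)
    assume "\<not> ?thesis"
    then have "1 = (0::'k)" by (subst qcoord_sum) (auto simp: W_def)
    then show False by simp
  qed
  then obtain w where "w \<in> W" "w \<noteq> 0" by blast
  then have "algebraic_int (of_nat D * x)" by (rule algebraic_int_if_stable[OF fin _ _ stable])
  then show ?thesis using D(1) by (auto simp: ring_of_integers_def)
qed

lemma algebraic: "algebraic (x :: 'k)"
proof -
  obtain D :: nat where D: "D > 0" "algebraic_int (of_nat D * x)"
    using integral_multiple[of x] by (auto simp: ring_of_integers_def)
  obtain p where p: "poly (map_poly of_int p) (of_nat D * x) = 0" "lead_coeff p = 1"
    using D(2) unfolding algebraic_int_altdef_ipoly by blast
  define q where "q = pcompose (map_poly of_int p :: 'k poly) [:0, of_nat D:]"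
  have "poly q x = 0" using p(1) by (simp add: q_def poly_pcompose mult.commute)
  moreover have "q \<noteq> 0"
  proof -
    have "map_poly of_int p \<noteq> (0 :: 'k poly)" using p(2) by (auto simp: map_poly_eq_0_iff)
    then show ?thesis using D(1) unfolding q_def by (simp add: pcompose_eq_0_iff)
  qed
  moreover have "coeff q i \<in> \<int>" for i
  proof -
    have "map_poly of_int [:0, int D:] = [:0, of_nat D :: 'k:]"
      by (rule poly_eqI) (simp add: coeff_map_poly coeff_pCons split: nat.splits)
    then have "q = map_poly of_int (pcompose p [:0, int D:])"
      unfolding q_def by (simp only: of_int_hom.map_poly_pcompose)
    then show ?thesis by (simp add: coeff_map_poly)
  qed
  ultimately show ?thesis by (intro algebraicI[of q])
qed

text \<open>Normalised at \<open>1\<close>, a joint eigenvector coincides with its eigenvalues, hence is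
  multiplicative.\<close>

lemma eigen_embedding:
  assumes g: "rat_linear g" "g \<noteq> (\<lambda>_. 0)" and eig: "\<forall>a\<in>qbasis ` {..<d}. \<exists>l. \<forall>y. g (a * y) = l * g y"
  shows "\<exists>\<sigma>\<in>complex_embeddings. g = (\<lambda>y. g 1 * \<sigma> (y::'k))"
proof -
  have "\<forall>j. \<exists>l. j < d \<longrightarrow> (\<forall>y. g (qbasis j * y) = l * g y)" using eig by auto
  then obtain l where l: "\<And>j y. j < d \<Longrightarrow> g (qbasis j * y) = l j * g y" by metis
  define L where "L x = (\<Sum>j<d. of_rat (qcoord j x) * l j)" for x
  have L: "g (x * y) = L x * g y" for x y
  proof -
    have "g (x * y) = g (\<Sum>j<d. of_rat (qcoord j x) * (qbasis j * y))"
      by (subst qcoord_sum[of x]) (simp add: sum_distrib_right mult.assoc)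
    also have "\<dots> = (\<Sum>j<d. of_rat (qcoord j x) * (l j * g y))"
      by (simp add: rat_linearD(4)[OF g(1)] rat_linearD(2)[OF g(1)] l)
    finally show ?thesis by (simp add: L_def sum_distrib_right mult.assoc)
  qed
  have gL: "g x = L x * g 1" for x using L[of x 1] by simp
  have g1: "g 1 \<noteq> 0"
  proof
    assume "g 1 = 0"
    then have "g x = 0" for x using gL[of x] by (simp only: mult_zero_right)
    then have "g = (\<lambda>_. 0)" by (rule ext)
    then show False using g(2) by simp
  qed
  have add: "L (x + y) = L x + L y" for x y using gL[of "x + y"] gL[of x] gL[of y] rat_linearD(1)[OF g(1), of x y] g1
    by (simp add: distrib_right[symmetric])
  have mult: "L (x * y) = L x * L y" for x y using gL[of "x * y"] gL[of y] L[of x y] g1 by simp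
  have one: "L 1 = 1" using gL[of 1, symmetric] g1 by (simp only: mult_cancel_right2 simp_thms)
  have "L \<in> complex_embeddings" using add mult one by (simp add: complex_embeddings_def)
  moreover have "g = (\<lambda>y. g 1 * L y)" by (rule ext) (subst mult.commute, rule gL)
  ultimately show ?thesis by blast
qed

lemma embeddings_span: "rat_linear f \<Longrightarrow> f \<in> F.span (complex_embeddings :: ('k \<Rightarrow> complex) set)"
proof -
  assume f: "rat_linear f"
  have "\<forall>x\<in>set (map qbasis [0..<d]). algebraic x" using algebraic by blast
  from joint_eigenvectors[OF this f]
  obtain gs where gs: "\<forall>g\<in>set gs. rat_linear g \<and> (\<forall>a\<in>set (map qbasis [0..<d]). \<exists>l. \<forall>y. g (a * y) = l * g y)"
     "f = (\<lambda>y. \<Sum>g\<leftarrow>gs. g y)"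
    by (elim exE conjE)
  have "g \<in> F.span complex_embeddings" if g: "g \<in> set gs" for g
  proof (cases "g = (\<lambda>_. 0)")
    case True
    then have "g = 0" by (simp add: fun_eq_iff)
    then show ?thesis using F.span_zero by simp
  next
    case False
    then obtain \<sigma> where \<sigma>: "\<sigma> \<in> complex_embeddings" "g = (\<lambda>y. g 1 * \<sigma> y)"
      using eigen_embedding[of g] gs(1) g by (auto simp: atLeast0LessThan)
    show ?thesis by (subst \<sigma>(2)) (rule F.span_scale[OF F.span_base[OF \<sigma>(1)]])
  qed
  then have "sum_list gs \<in> F.span complex_embeddings"
    by (induction gs) (auto simp: F.span_zero F.span_add)
  moreover have "sum_list gs = (\<lambda>y. \<Sum>g\<leftarrow>gs. g y)" by (induction gs) (auto simp: fun_eq_iff)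
  ultimately show ?thesis using gs(2) by simp
qed

lemma embeddings_independent: "F.independent (complex_embeddings :: ('k \<Rightarrow> complex) set)"
proof -
  have main: "(\<forall>x. (\<Sum>\<sigma>\<in>S. c \<sigma> * \<sigma> x) = 0) \<longrightarrow> (\<forall>\<sigma>\<in>S. c \<sigma> = 0)"
    if "finite S" "S \<subseteq> (complex_embeddings :: ('k \<Rightarrow> complex) set)" for S c
    using that
  proof (induction S arbitrary: c)
    case (insert \<tau> S)
    show ?case
    proof (intro impI)
      assume z: "\<forall>x. (\<Sum>\<sigma>\<in>insert \<tau> S. c \<sigma> * \<sigma> x) = 0"
      have emb: "\<sigma> 1 = 1" "\<sigma> (x * y) = \<sigma> x * \<sigma> y" if "\<sigma> \<in> insert \<tau> S" for \<sigma> x y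
        using insert.prems that by (auto simp: complex_embeddings_def)
      have c0: "c \<sigma> = 0" if \<sigma>: "\<sigma> \<in> S" for \<sigma>
      proof -
        have "\<sigma> \<noteq> \<tau>" using \<sigma> insert.hyps by auto
        then obtain y where y: "\<sigma> y \<noteq> \<tau> y" by (auto simp: fun_eq_iff)
        have "(\<Sum>\<rho>\<in>S. (c \<rho> * (\<rho> y - \<tau> y)) * \<rho> x) = 0" for x
        proof -
          have "(\<Sum>\<rho>\<in>insert \<tau> S. c \<rho> * \<rho> (y * x)) - \<tau> y * (\<Sum>\<rho>\<in>insert \<tau> S. c \<rho> * \<rho> x) = 0" using z by simp
          moreover have "(\<Sum>\<rho>\<in>insert \<tau> S. c \<rho> * \<rho> (y * x)) - \<tau> y * (\<Sum>\<rho>\<in>insert \<tau> S. c \<rho> * \<rho> x)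
              = (\<Sum>\<rho>\<in>insert \<tau> S. (c \<rho> * (\<rho> y - \<tau> y)) * \<rho> x)"
            unfolding sum_distrib_left sum_subtractf[symmetric]
          proof (rule sum.cong)
            fix \<rho> assume "\<rho> \<in> insert \<tau> S"
            then have e: "\<rho> (y * x) = \<rho> y * \<rho> x" by (rule emb(2))
            show "c \<rho> * \<rho> (y * x) - \<tau> y * (c \<rho> * \<rho> x) = c \<rho> * (\<rho> y - \<tau> y) * \<rho> x"
              unfolding e by (simp add: algebra_simps)
          qed simp
          ultimately show ?thesis using insert.hyps by simp
        qed
        then have "c \<sigma> * (\<sigma> y - \<tau> y) = 0" using insert.IH[of "\<lambda>\<rho>. c \<rho> * (\<rho> y - \<tau> y)"] insert.prems \<sigma> by simp
        then show ?thesis using y by simp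
      qed
      have "c \<tau> = 0"
      proof -
        have "(\<Sum>\<sigma>\<in>insert \<tau> S. c \<sigma> * \<sigma> 1) = 0" using z by blast
        then show ?thesis using insert.hyps c0 emb(1)[OF insertI1] by simp
      qed
      then show "\<forall>\<sigma>\<in>insert \<tau> S. c \<sigma> = 0" using c0 by simp
    qed
  qed simp
  show ?thesis
    unfolding F.dependent_explicit
  proof
    assume "\<exists>t u. finite t \<and> t \<subseteq> (complex_embeddings :: ('k \<Rightarrow> complex) set) \<and> (\<Sum>v\<in>t. (\<lambda>x. u v * v x)) = 0 \<and> (\<exists>v\<in>t. u v \<noteq> 0)"
    then obtain t u where t: "finite t" "t \<subseteq> (complex_embeddings :: ('k \<Rightarrow> complex) set)" "(\<Sum>v\<in>t. (\<lambda>x. u v * v x)) = 0" "\<exists>v\<in>t. u v \<noteq> 0"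
      by blast
    have ev: "(\<Sum>v\<in>t. (\<lambda>x. u v * v x)) y = (\<Sum>v\<in>t. u v * v y)" for y
      using t(1) by (induction t) simp_all
    have "(\<Sum>v\<in>t. u v * v y) = 0" for y using ev[of y] t(3) by simp
    then show False using main[OF t(1,2), of u] t(4) by blast
  qed
qed

text \<open>The embeddings are a basis of the \<open>d\<close>-dimensional space of complex valued
  functionals: they span it by the eigenvector decomposition and are independent by Dedekind's
  argument.\<close>

lemma embeddings_card: "finite (complex_embeddings :: ('k \<Rightarrow> complex) set)" "card (complex_embeddings :: ('k \<Rightarrow> complex) set) = d"
proof -
  define \<phi> :: "nat \<Rightarrow> 'k \<Rightarrow> complex" where "\<phi> j = (\<lambda>x. of_rat (qcoord j x))" for j
  have inj: "inj_on \<phi> {..<d}"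
  proof (rule inj_onI)
    fix i j assume ij: "i \<in> {..<d}" "j \<in> {..<d}" "\<phi> i = \<phi> j"
    then have "\<phi> i (qbasis i) = \<phi> j (qbasis i)" by (simp only:)
    then have "qcoord i (qbasis i) = qcoord j (qbasis i)" by (simp add: \<phi>_def)
    then show "i = j" using ij(1,2) by (simp add: qcoord_basis split: if_splits)
  qed
  have sp: "(complex_embeddings :: ('k \<Rightarrow> complex) set) \<subseteq> F.span (\<phi> ` {..<d})"
  proof
    fix \<sigma> :: "'k \<Rightarrow> complex" assume "\<sigma> \<in> complex_embeddings"
    then have r: "rat_linear \<sigma>" by (rule embedding_rat_linear)
    have "\<sigma> = (\<Sum>j<d. (\<lambda>x. \<sigma> (qbasis j) * \<phi> j x))"
    proof
      fix x
      have ev: "(\<Sum>j<m. (\<lambda>x. \<sigma> (qbasis j) * \<phi> j x)) x = (\<Sum>j<m. \<sigma> (qbasis j) * \<phi> j x)" for m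
        by (induction m) simp_all
      have "\<sigma> x = (\<Sum>j<d. of_rat (qcoord j x) * \<sigma> (qbasis j))"
        by (subst qcoord_sum[of x]) (simp add: rat_linearD(4)[OF r] rat_linearD(2)[OF r])
      then show "\<sigma> x = (\<Sum>j<d. (\<lambda>x. \<sigma> (qbasis j) * \<phi> j x)) x" unfolding ev by (simp add: \<phi>_def mult.commute)
    qed
    also have "\<dots> \<in> F.span (\<phi> ` {..<d})"
      by (rule F.span_sum, rule F.span_scale, rule F.span_base) simp
    finally show "\<sigma> \<in> F.span (\<phi> ` {..<d})" .
  qed
  note bound = F.independent_span_bound[OF _ embeddings_independent sp]
  then show fin: "finite (complex_embeddings :: ('k \<Rightarrow> complex) set)" by simp
  have le: "card (complex_embeddings :: ('k \<Rightarrow> complex) set) \<le> d" using bound card_image[OF inj] by simp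
  have ind: "F.independent (\<phi> ` {..<d})"
  proof (rule F.independent_if_scalars_zero)
    fix u f assume z: "(\<Sum>x\<in>\<phi> ` {..<d}. (\<lambda>y. u x * x y)) = 0" and f: "f \<in> \<phi> ` {..<d}"
    obtain k where k: "f = \<phi> k" "k < d" using f by auto
    have ev: "(\<Sum>x\<in>X. (\<lambda>y. u x * x y)) w = (\<Sum>x\<in>X. u x * x w)" if "finite X" for X w
      using that by (induction X) simp_all
    have "0 = (\<Sum>x\<in>\<phi> ` {..<d}. u x * x (qbasis k))" using ev[of "\<phi> ` {..<d}" "qbasis k"] z by simp
    also have "\<dots> = (\<Sum>j<d. u (\<phi> j) * \<phi> j (qbasis k))" by (simp add: sum.reindex[OF inj])
    also have "\<dots> = (\<Sum>j<d. if j = k then u (\<phi> j) else 0)"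
      by (rule sum.cong) (use k(2) in \<open>auto simp: \<phi>_def qcoord_basis\<close>)
    also have "\<dots> = u f" using k by (simp add: sum.delta)
    finally show "u f = 0" by simp
  qed simp
  have "\<phi> ` {..<d} \<subseteq> F.span complex_embeddings"
    using embeddings_span qcoord_rat_linear by (auto simp: \<phi>_def)
  then have "d \<le> card (complex_embeddings :: ('k \<Rightarrow> complex) set)"
    using F.independent_span_bound[OF fin ind] card_image[OF inj] by simp
  then show "card (complex_embeddings :: ('k \<Rightarrow> complex) set) = d" using le by simp
qed

end

no_notation vec_index (infixl \<open>$\<close> 100)
hide_const (open) Matrix.mat Determinant.det Matrix.row

section \<open>Discriminant and integral bases\<close>

lemma embedding_hom:
  assumes "\<sigma> \<in> complex_embeddings"
  shows "\<sigma> 1 = 1" "\<sigma> (x + y) = \<sigma> x + \<sigma> y" "\<sigma> (x * y) = \<sigma> x * \<sigma> y" "\<sigma> 0 = 0"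
    "\<sigma> (x - y) = \<sigma> x - \<sigma> y" "\<sigma> (of_rat q) = of_rat q" "\<sigma> (of_int m) = of_int m" "\<sigma> (sum g A) = (\<Sum>i\<in>A. \<sigma> (g i))"
    "\<sigma> (x ^ n) = \<sigma> x ^ n" "\<sigma> x = 0 \<longleftrightarrow> x = 0"
proof -
  note rl = embedding_rat_linear[OF assms]
  show h: "\<sigma> 1 = 1" "\<sigma> (x + y) = \<sigma> x + \<sigma> y" "\<sigma> (x * y) = \<sigma> x * \<sigma> y" for x y
    using assms by (auto simp: complex_embeddings_def)
  show "\<sigma> 0 = 0" "\<sigma> (sum g A) = (\<Sum>i\<in>A. \<sigma> (g i))" by (rule rat_linearD[OF rl])+
  show rat: "\<sigma> (of_rat q) = of_rat q" for q using rat_linearD(2)[OF rl, of q 1] h(1) by simp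
  show "\<sigma> (of_int m) = of_int m" using rat[of "of_int m"] by simp
  show "\<sigma> (x - y) = \<sigma> x - \<sigma> y" using h(2)[of "x - y" y] by simp
  show "\<sigma> (x ^ n) = \<sigma> x ^ n" by (induction n) (simp_all add: h)
  show "\<sigma> x = 0 \<longleftrightarrow> x = 0"
  proof
    assume z: "\<sigma> x = 0"
    show "x = 0"
    proof (rule ccontr)
      assume "x \<noteq> 0"
      then have "\<sigma> x * \<sigma> (inverse x) = 1" using h(3)[of x "inverse x"] h(1) by simp
      then show False using z by simp
    qed
  qed (use \<open>\<sigma> 0 = 0\<close> in simp)
qed

lemma embedding_algebraic_int:
  assumes "\<sigma> \<in> complex_embeddings" "algebraic_int x" shows "algebraic_int (\<sigma> x)"
proof -
  note h = embedding_hom[OF assms(1)]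
  obtain p where p: "poly (map_poly of_int p) x = 0" "lead_coeff p = 1"
    using assms(2) unfolding algebraic_int_altdef_ipoly by blast
  have "poly (map_poly of_int p) (\<sigma> x) = \<sigma> (poly (map_poly of_int p) x)"
    by (simp add: poly_altdef degree_map_poly coeff_map_poly h(3,7,8,9))
  then show ?thesis unfolding algebraic_int_altdef_ipoly using p h(4) by auto
qed

lemma cnj_embedding: "\<sigma> \<in> complex_embeddings \<Longrightarrow> (\<lambda>x. cnj (\<sigma> x)) \<in> complex_embeddings"
  by (auto simp: complex_embeddings_def)

lemma det_mat_reindex:
  fixes f :: "nat \<times> nat \<Rightarrow> 'a::comm_ring_1"
  assumes h: "bij_betw h (UNIV :: 'e::finite set) {0..<n}"
  shows "Determinant.det (Matrix.mat n n f) = Determinants.det (\<chi> i j. f (h i, h j))"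
proof -
  have inj: "inj_on h UNIV" using h by (simp add: bij_betw_def)
  have "Determinant.det (Matrix.mat n n f) = (\<Sum>p | p permutes {0..<n}. of_int (sign p) * (\<Prod>i = 0..<n. Matrix.mat n n f $$ (i, p i)))"
    by (rule det_def') simp
  also have "\<dots> = (\<Sum>p | p permutes (UNIV :: 'e set). of_int (sign p) * (\<Prod>i\<in>UNIV. f (h i, h (p i))))"
  proof (rule sum.reindex_bij_witness[of _ "map_permutation UNIV h" "map_permutation {0..<n} (inv_into UNIV h)"])
    fix p assume "p \<in> {p. p permutes {0..<n}}"
    then have p: "p permutes {0..<n}" by simp
    have hi: "bij_betw (inv_into UNIV h) {0..<n} UNIV" by (rule bij_betw_inv_into[OF h])
    show "map_permutation UNIV h (map_permutation {0..<n} (inv_into UNIV h) p) = p"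
      by (rule map_permutation_compose_inv[OF hi p]) (use h in \<open>simp add: bij_betw_inv_into_right\<close>)
    show "map_permutation {0..<n} (inv_into UNIV h) p \<in> {p. p permutes UNIV}"
      using map_permutation_permutes[OF hi p] by simp
    have s: "sign (map_permutation {0..<n} (inv_into UNIV h) p) = sign p"
      by (rule sign_map_permutation[OF _ p]) (use hi in \<open>simp_all add: bij_betw_def\<close>)
    have "(\<Prod>i\<in>UNIV. f (h i, h (map_permutation {0..<n} (inv_into UNIV h) p i))) = (\<Prod>i = 0..<n. Matrix.mat n n f $$ (i, p i))"
    proof (rule prod.reindex_bij_witness[of _ "inv_into UNIV h" h])
      fix i :: 'e assume "i \<in> UNIV"
      show "inv_into UNIV h (h i) = i" by (rule inv_into_f_f[OF inj]) simp
      show hin: "h i \<in> {0..<n}" using h by (auto simp: bij_betw_def)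
      have pin: "p (h i) \<in> {0..<n}" using permutes_in_image[OF p] hin by simp
      have "map_permutation {0..<n} (inv_into UNIV h) p (inv_into UNIV h (h i)) = inv_into UNIV h (p (h i))"
        by (rule map_permutation_apply[OF _ hin]) (use hi in \<open>simp add: bij_betw_def\<close>)
      then have "map_permutation {0..<n} (inv_into UNIV h) p i = inv_into UNIV h (p (h i))"
        using inv_into_f_f[OF inj, of i] by simp
      then have "h (map_permutation {0..<n} (inv_into UNIV h) p i) = p (h i)"
        using bij_betw_inv_into_right[OF h pin] by simp
      then show "Matrix.mat n n f $$ (h i, p (h i)) = f (h i, h (map_permutation {0..<n} (inv_into UNIV h) p i))"
        using hin pin by simp
    next
      fix i assume i: "i \<in> {0..<n}"
      show "h (inv_into UNIV h i) = i" by (rule bij_betw_inv_into_right[OF h i])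
    qed simp
    then show "of_int (sign (map_permutation {0..<n} (inv_into UNIV h) p)) *
        (\<Prod>i\<in>UNIV. f (h i, h (map_permutation {0..<n} (inv_into UNIV h) p i))) =
        of_int (sign p) * (\<Prod>i = 0..<n. Matrix.mat n n f $$ (i, p i))" unfolding s by simp
  next
    fix p assume "p \<in> {p. p permutes (UNIV :: 'e set)}"
    then have p: "p permutes UNIV" by simp
    show "map_permutation {0..<n} (inv_into UNIV h) (map_permutation UNIV h p) = p"
      by (rule map_permutation_compose_inv[OF h p]) (simp add: inv_into_f_f[OF inj])
    show "map_permutation UNIV h p \<in> {p. p permutes {0..<n}}" using map_permutation_permutes[OF h p] by simp
  qed
  finally show ?thesis unfolding Determinants.det_def by simp
qed

locale embedding_index = num_field K for K :: "'k::field_char_0 itself" +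
  fixes \<sigma> :: "'e::finite \<Rightarrow> 'k \<Rightarrow> complex"
  assumes \<sigma>_bij: "bij_betw \<sigma> UNIV complex_embeddings"
begin

lemma \<sigma>_emb: "\<sigma> e \<in> complex_embeddings" using \<sigma>_bij by (auto simp: bij_betw_def)

lemmas \<sigma>_hom = embedding_hom[OF \<sigma>_emb]

lemma card_e: "CARD('e) = d"
  using bij_betw_same_card[OF \<sigma>_bij] embeddings_card(2) by simp

definition emb_matrix :: "('e \<Rightarrow> 'k) \<Rightarrow> complex^'e^'e" where
  "emb_matrix b = (\<chi> i j. \<sigma> i (b j))"

text \<open>A linear relation between the rows is a relation between the embeddings on a spanning set,
  hence everywhere.\<close>

lemma det_emb_matrix_nonzero:
  assumes sp: "Q.span (range b) = UNIV"
  shows "Determinants.det (emb_matrix b) \<noteq> 0"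
proof
  assume z: "Determinants.det (emb_matrix b) = 0"
  define S where "S = Finite_Cartesian_Product.transpose (emb_matrix b)"
  have "\<not> invertible S" unfolding S_def using z by (simp add: invertible_det_nz det_transpose)
  then have "\<not> (\<forall>x. S *v x = 0 \<longrightarrow> x = 0)"
    unfolding invertible_left_inverse matrix_left_invertible_ker .
  then obtain c where c: "S *v c = 0" "c \<noteq> 0" by blast
  define f where "f x = (\<Sum>i\<in>UNIV. c $ i * \<sigma> i x)" for x
  have fb: "f (b j) = 0" for j
  proof -
    have "(S *v c) $ j = 0" using c(1) by simp
    then show ?thesis by (simp add: S_def emb_matrix_def matrix_vector_mult_def transpose_def f_def mult.commute)
  qed
  have rl: "rat_linear f"
    unfolding f_def by (intro rat_linear_sum rat_linear_combine(2)[OF embedding_rat_linear[OF \<sigma>_emb] embedding_rat_linear[OF \<sigma>_emb]])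
  have f0: "f x = 0" for x
  proof -
    have "x \<in> Q.span (range b)" using sp by simp
    then show ?thesis
    proof (induction rule: Q.span_induct_alt)
      case base show ?case by (rule rat_linearD(3)[OF rl])
    next
      case (step q x y)
      then show ?case using rat_linearD(1)[OF rl] rat_linearD(2)[OF rl] fb by (auto simp: rat_scale_def)
    qed
  qed
  have inj: "inj \<sigma>" using \<sigma>_bij by (simp add: bij_betw_def)
  have "\<exists>t u. finite t \<and> t \<subseteq> complex_embeddings \<and> (\<Sum>v\<in>t. (\<lambda>x. u v * v (x::'k))) = 0 \<and> (\<exists>v\<in>t. u v \<noteq> (0::complex))"
  proof (intro exI conjI)
    show "finite (range \<sigma>)" by simp
    show "range \<sigma> \<subseteq> complex_embeddings" using \<sigma>_emb by auto
    have ev: "(\<Sum>e\<in>X. (\<lambda>x. c $ e * \<sigma> e x)) y = (\<Sum>e\<in>X. c $ e * \<sigma> e y)" if "finite X" for X y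
      using that by (induction X) simp_all
    have "(\<Sum>v\<in>range \<sigma>. (\<lambda>x. c $ (inv_into UNIV \<sigma> v) * v x)) = (\<Sum>e\<in>UNIV. (\<lambda>x. c $ e * \<sigma> e x))"
      by (simp add: sum.reindex[OF inj] inv_f_f[OF inj])
    also have "\<dots> = 0" using f0 by (auto simp: fun_eq_iff ev f_def)
    finally show "(\<Sum>v\<in>range \<sigma>. (\<lambda>x. c $ (inv_into UNIV \<sigma> v) * v x)) = 0" .
    obtain e where "c $ e \<noteq> 0" using c(2) by (auto simp: vec_eq_iff)
    then show "\<exists>v\<in>range \<sigma>. c $ (inv_into UNIV \<sigma> v) \<noteq> 0" by (intro bexI[of _ "\<sigma> e"]) (simp_all add: inv_f_f[OF inj])
  qed
  then show False using embeddings_independent unfolding F.dependent_explicit by blast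
qed

lemma span_of_det_nonzero:
  assumes det: "Determinants.det (emb_matrix b) \<noteq> 0"
  shows "inj b" "Q.span (range b) = UNIV" "\<exists>q. x = (\<Sum>e\<in>UNIV. of_rat (q e) * b e)"
proof -
  have ker: "q = (\<lambda>_. 0)" if z: "(\<Sum>e\<in>UNIV. of_rat (q e) * b e) = 0" for q
  proof -
    define v :: "complex^'e" where "v = (\<chi> e. of_rat (q e))"
    have "emb_matrix b *v v = 0"
    proof (rule vec_eq_iff[THEN iffD2], rule allI)
      fix i
      have "0 = \<sigma> i (\<Sum>e\<in>UNIV. of_rat (q e) * b e)" using z \<sigma>_hom(4) by simp
      also have "\<dots> = (\<Sum>e\<in>UNIV. of_rat (q e) * \<sigma> i (b e))" by (simp only: \<sigma>_hom(8,3,6))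
      finally show "(emb_matrix b *v v) $ i = 0 $ i"
        by (simp add: emb_matrix_def matrix_vector_mult_def v_def mult.commute)
    qed
    then have "v = 0" using det invertible_det_nz[of "emb_matrix b"]
      unfolding invertible_left_inverse matrix_left_invertible_ker by blast
    then show ?thesis by (auto simp: v_def vec_eq_iff fun_eq_iff)
  qed
  show inj: "inj b"
  proof (rule injI, rule ccontr)
    fix i j assume ij: "b i = b j" "i \<noteq> j"
    define q :: "'e \<Rightarrow> rat" where "q e = (if e = i then 1 else if e = j then - 1 else 0)" for e
    have "(\<Sum>e\<in>UNIV. of_rat (q e) * b e) = (\<Sum>e\<in>UNIV. (if e = i then b i else 0) - (if e = j then b i else 0))"
      by (rule sum.cong) (use ij in \<open>auto simp: q_def\<close>)
    also have "\<dots> = 0" by (simp add: sum_subtractf)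
    finally have "q = (\<lambda>_. 0)" by (rule ker)
    then have "q i = 0" by (rule fun_cong)
    then show False by (simp add: q_def)
  qed
  have ind: "Q.independent (range b)"
  proof (rule Q.independent_if_scalars_zero)
    fix f x assume z: "(\<Sum>x\<in>range b. rat_scale (f x) x) = 0" and x: "x \<in> range b"
    have "(\<Sum>e\<in>UNIV. of_rat (f (b e)) * b e) = 0" using z by (simp add: sum.reindex[OF inj] rat_scale_def)
    then have "(\<lambda>e. f (b e)) = (\<lambda>_. 0)" by (rule ker)
    then show "f x = 0" using x by (auto simp: fun_eq_iff)
  qed simp
  have card: "card (range b) = d" using card_image[OF inj] card_e by simp
  define B where "B = Q.extend_basis (range b)"
  have B: "range b \<subseteq> B" "Q.independent B" "Q.span B = UNIV"
    unfolding B_def using Q.extend_basis_superset[OF ind] Q.independent_extend_basis[OF ind] Q.span_extend_basis[OF ind] by simp_all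
  have "finite B \<and> card B \<le> card (qbasis ` {..<d})"
    by (rule Q.independent_span_bound[OF _ B(2)]) (simp_all add: qbasis(3))
  then have fB: "finite B" and "card B \<le> d" using card_image[OF qbasis(1)] by simp_all
  then have eq: "range b = B" using card_seteq[OF fB B(1)] card by simp
  then show sp: "Q.span (range b) = UNIV" using B(3) by simp
  have "(\<Sum>v\<in>range b. rat_scale (Q.representation (range b) x v) v) = x"
    by (rule Q.sum_representation_eq[OF ind]) (simp_all add: sp)
  then have "x = (\<Sum>e\<in>UNIV. of_rat (Q.representation (range b) x (b e)) * b e)"
    by (simp add: sum.reindex[OF inj] rat_scale_def)
  then show "\<exists>q. x = (\<Sum>e\<in>UNIV. of_rat (q e) * b e)" by (rule exI[of _ "\<lambda>e. Q.representation (range b) x (b e)"])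
qed

text \<open>The matrix of multiplication by x in a basis is conjugate to the diagonal matrix of the
  conjugates of x.\<close>

lemma multiplication_matrix:
  fixes M :: "'e \<Rightarrow> 'e \<Rightarrow> rat"
  assumes det: "Determinants.det (emb_matrix b) \<noteq> 0"
    and M: "\<And>k. x * b k = (\<Sum>j\<in>UNIV. of_rat (M j k) * b j)"
  shows "(\<Sum>i\<in>UNIV. \<sigma> i x) = of_rat (\<Sum>j\<in>UNIV. M j j)"
    "Determinants.det (\<chi> j k. of_rat (M j k)) = (\<Prod>i\<in>UNIV. \<sigma> i x)"
proof -
  define S where "S = emb_matrix b"
  define N :: "complex^'e^'e" where "N = (\<chi> j k. of_rat (M j k))"
  define D :: "complex^'e^'e" where "D = (\<chi> i j. if i = j then \<sigma> i x else 0)"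
  have SN: "S ** N = D ** S"
  proof (rule vec_eq_iff[THEN iffD2], rule allI, rule vec_eq_iff[THEN iffD2], rule allI)
    fix i k
    have "(S ** N) $ i $ k = (\<Sum>j\<in>UNIV. \<sigma> i (b j) * of_rat (M j k))"
      by (simp add: S_def N_def emb_matrix_def matrix_matrix_mult_def)
    also have "\<dots> = \<sigma> i (\<Sum>j\<in>UNIV. of_rat (M j k) * b j)"
      by (simp only: \<sigma>_hom(8,3,6) mult.commute)
    also have "\<dots> = \<sigma> i x * \<sigma> i (b k)" unfolding M[symmetric] by (rule \<sigma>_hom(3))
    also have "\<dots> = (\<Sum>j\<in>UNIV. (if i = j then \<sigma> i x else 0) * \<sigma> j (b k))"
      by (subst sum.remove[of UNIV i]) (auto intro!: sum.neutral)
    also have "\<dots> = (D ** S) $ i $ k" by (simp add: S_def D_def emb_matrix_def matrix_matrix_mult_def)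
    finally show "(S ** N) $ i $ k = (D ** S) $ i $ k" .
  qed
  have dS: "Determinants.det S \<noteq> 0" using det by (simp add: S_def)
  then obtain T where T: "T ** S = Finite_Cartesian_Product.mat 1" "S ** T = Finite_Cartesian_Product.mat 1"
    using invertible_det_nz[of S] by (auto simp: invertible_def)
  have "trace D = trace (D ** (S ** T))" by (simp add: T(2))
  also have "\<dots> = trace ((S ** N) ** T)" unfolding SN by (simp only: matrix_mul_assoc)
  also have "\<dots> = trace (S ** (N ** T))" by (simp only: matrix_mul_assoc)
  also have "\<dots> = trace ((N ** T) ** S)" by (rule trace_mul_sym)
  also have "\<dots> = trace (N ** (T ** S))" by (simp only: matrix_mul_assoc)
  also have "\<dots> = trace N" by (simp add: T(1))
  finally show "(\<Sum>i\<in>UNIV. \<sigma> i x) = of_rat (\<Sum>j\<in>UNIV. M j j)"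
    by (simp add: trace_def D_def N_def of_rat_sum)
  have "Determinants.det S * Determinants.det N = Determinants.det D * Determinants.det S"
    using SN by (metis det_mul)
  then have "Determinants.det N = Determinants.det D" using dS by simp
  also have "\<dots> = (\<Prod>i\<in>UNIV. \<sigma> i x)" unfolding D_def by (subst det_diagonal) simp_all
  finally show "Determinants.det (\<chi> j k. of_rat (M j k)) = (\<Prod>i\<in>UNIV. \<sigma> i x)" by (simp add: N_def)
qed

lemma ex_rational_matrix:
  assumes det: "Determinants.det (emb_matrix b) \<noteq> 0"
  obtains M :: "'e \<Rightarrow> 'e \<Rightarrow> rat" where "\<And>k. x * b k = (\<Sum>j\<in>UNIV. of_rat (M j k) * b j)"
proof -
  have "\<forall>k. \<exists>q. x * b k = (\<Sum>e\<in>UNIV. of_rat (q e) * b e)" using span_of_det_nonzero(3)[OF det] by blast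
  then obtain q where "\<forall>k. x * b k = (\<Sum>e\<in>UNIV. of_rat (q k e) * b e)" by (rule choice[THEN exE])
  then show ?thesis using that[of "\<lambda>j k. q k j"] by blast
qed

lemma ex_basis: "\<exists>b. (\<forall>e. b e \<in> ring_of_integers) \<and> Determinants.det (emb_matrix b) \<noteq> 0"
proof -
  obtain h :: "'e \<Rightarrow> nat" where h: "bij_betw h UNIV {..<d}"
    using ex_bij_betw_finite_nat[of "UNIV :: 'e set"] card_e by (auto simp: atLeast0LessThan)
  obtain D :: "'k \<Rightarrow> nat" where D: "\<And>x. D x > 0 \<and> of_nat (D x) * x \<in> ring_of_integers"
    using integral_multiple by metis
  define c where "c e = of_nat (D (qbasis (h e))) * qbasis (h e)" for e
  have "qbasis ` {..<d} \<subseteq> Q.span (range c)"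
  proof
    fix x assume "x \<in> qbasis ` {..<d}"
    then obtain j where j: "x = qbasis j" "j < d" by auto
    have "j \<in> range h" using j(2) bij_betw_imp_surj_on[OF h] by simp
    then obtain e where "j = h e" by (rule rangeE)
    then have e: "h e = j" by simp
    have "rat_scale (inverse (of_nat (D x))) (c e) = x"
      using D[of x] e j by (simp add: rat_scale_def c_def of_rat_inverse)
    moreover have "rat_scale (inverse (of_nat (D x))) (c e) \<in> Q.span (range c)"
      by (rule Q.span_scale[OF Q.span_base]) simp
    ultimately show "x \<in> Q.span (range c)" by simp
  qed
  then have "Q.span (qbasis ` {..<d}) \<subseteq> Q.span (Q.span (range c))" by (rule Q.span_mono)
  then have "Q.span (range c) = UNIV" using qbasis(3) by (simp add: Q.span_span top_le)
  then have "Determinants.det (emb_matrix c) \<noteq> 0" by (rule det_emb_matrix_nonzero)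
  moreover have "c e \<in> ring_of_integers" for e using D[of "qbasis (h e)"] by (simp add: c_def)
  ultimately show ?thesis by blast
qed

text \<open>The trace is rational as the trace of a rational matrix, and integral as a sum of
  conjugates.\<close>

lemma trace_integral:
  assumes x: "x \<in> ring_of_integers" shows "(\<Sum>i\<in>UNIV. \<sigma> i x) \<in> \<int>"
proof (rule rational_algebraic_int_is_int)
  obtain b where b: "Determinants.det (emb_matrix b) \<noteq> 0" using ex_basis by blast
  obtain M :: "'e \<Rightarrow> 'e \<Rightarrow> rat" where "\<And>k. x * b k = (\<Sum>j\<in>UNIV. of_rat (M j k) * b j)"
    using ex_rational_matrix[OF b] by metis
  from multiplication_matrix(1)[OF b this] show "(\<Sum>i\<in>UNIV. \<sigma> i x) \<in> \<rat>" by simp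
  have "algebraic_int (\<Sum>i\<in>X. \<sigma> i x)" if "finite X" for X
    using that
  proof induction
    case (insert i X)
    then show ?case using x algebraic_int_add_mult(1)[OF embedding_algebraic_int[OF \<sigma>_emb]]
      by (simp add: ring_of_integers_def)
  qed simp
  then show "algebraic_int (\<Sum>i\<in>UNIV. \<sigma> i x)" by simp
qed

lemma det_square_integral:
  assumes b: "\<forall>e. b e \<in> ring_of_integers"
  shows "(Determinants.det (emb_matrix b))\<^sup>2 \<in> \<int>"
proof -
  define G where "G = Finite_Cartesian_Product.transpose (emb_matrix b) ** emb_matrix b"
  have G: "G $ j $ k \<in> \<int>" for j k
  proof -
    have "G $ j $ k = (\<Sum>i\<in>UNIV. \<sigma> i (b j * b k))"
      by (simp add: G_def emb_matrix_def transpose_def matrix_matrix_mult_def \<sigma>_hom(3))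
    then show ?thesis using trace_integral[OF ring_of_integers_mult] b by simp
  qed
  have "Determinants.det G \<in> \<int>"
    unfolding Determinants.det_def by (intro Ints_sum Ints_mult Ints_prod G Ints_of_int)
  then show ?thesis by (simp add: G_def det_mul det_transpose power2_eq_square)
qed

text \<open>A basis of integers of minimal discriminant is an integral basis: a fractional coordinate
  would allow an exchange that shrinks the determinant.\<close>

lemma ex_integral_basis:
  "\<exists>b. (\<forall>e. b e \<in> ring_of_integers) \<and> Determinants.det (emb_matrix b) \<noteq> 0 \<and>
     (\<forall>x\<in>ring_of_integers. \<exists>c. x = (\<Sum>e\<in>UNIV. of_int (c e) * b e))"
proof -
  define good where "good b \<longleftrightarrow> (\<forall>e. b e \<in> ring_of_integers) \<and> Determinants.det (emb_matrix b) \<noteq> 0" for b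
  define f where "f b = nat \<lfloor>cmod ((Determinants.det (emb_matrix b))\<^sup>2)\<rfloor>" for b
  have f: "cmod ((Determinants.det (emb_matrix b))\<^sup>2) = real (f b)" if g: "good b" for b
  proof -
    obtain m where "(Determinants.det (emb_matrix b))\<^sup>2 = of_int m"
      using det_square_integral[of b] g unfolding good_def by (auto elim: Ints_cases)
    then have "cmod ((Determinants.det (emb_matrix b))\<^sup>2) = real_of_int \<bar>m\<bar>" by (simp only: norm_of_int)
    then show ?thesis by (simp add: f_def)
  qed
  obtain b0 where "good b0" using ex_basis by (auto simp: good_def)
  then obtain b where b: "good b" and min: "\<And>b'. good b' \<Longrightarrow> f b \<le> f b'"
    using ex_has_least_nat[of good b0 f] by blast
  have bO: "b e \<in> ring_of_integers" for e using b by (simp add: good_def)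
  have det: "Determinants.det (emb_matrix b) \<noteq> 0" using b by (simp add: good_def)
  have "\<exists>c. x = (\<Sum>e\<in>UNIV. of_int (c e) * b e)" if x: "x \<in> ring_of_integers" for x
  proof -
    obtain q where q: "x = (\<Sum>e\<in>UNIV. of_rat (q e) * b e)" using span_of_det_nonzero(3)[OF det] by blast
    have "q k = of_int \<lfloor>q k\<rfloor>" for k
    proof (rule ccontr)
      assume nz: "q k \<noteq> of_int \<lfloor>q k\<rfloor>"
      define t where "t = q k - of_int \<lfloor>q k\<rfloor>"
      have t: "0 < t" "t < 1" unfolding t_def using nz by linarith+
      define y where "y = x - of_int \<lfloor>q k\<rfloor> * b k"
      have yO: "y \<in> ring_of_integers"
        unfolding y_def by (rule add_subgroupD(2)[OF ring_of_integers_subgroup x add_subgroup_int_mult[OF ring_of_integers_subgroup bO]])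
      define b' where "b' = b(k := y)"
      define v :: "complex^'e" where "v = (\<chi> e. of_rat (if e = k then t else q e))"
      have "emb_matrix b' = (\<chi> i j. if j = k then (emb_matrix b *v v) $ i else emb_matrix b $ i $ j)"
      proof (rule vec_eq_iff[THEN iffD2], rule allI, rule vec_eq_iff[THEN iffD2], rule allI)
        fix i j
        have ye: "y = (\<Sum>e\<in>UNIV. of_rat (if e = k then t else q e) * b e)"
        proof -
          have "y = (\<Sum>e\<in>UNIV. of_rat (q e) * b e) - (\<Sum>e\<in>UNIV. if e = k then of_int \<lfloor>q k\<rfloor> * b k else 0)"
            unfolding y_def q[symmetric] by simp
          also have "\<dots> = (\<Sum>e\<in>UNIV. of_rat (q e) * b e - (if e = k then of_int \<lfloor>q k\<rfloor> * b k else 0))"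
            by (rule sum_subtractf[symmetric])
          also have "\<dots> = (\<Sum>e\<in>UNIV. of_rat (if e = k then t else q e) * b e)"
            by (rule sum.cong) (auto simp: t_def of_rat_diff left_diff_distrib)
          finally show ?thesis .
        qed
        have "\<sigma> i y = (\<Sum>e\<in>UNIV. \<sigma> i (b e) * v $ e)"
          by (subst ye) (simp only: \<sigma>_hom(8,3,6) v_def vec_lambda_beta mult.commute)
        then show "emb_matrix b' $ i $ j = (\<chi> i j. if j = k then (emb_matrix b *v v) $ i else emb_matrix b $ i $ j) $ i $ j"
          by (simp add: emb_matrix_def b'_def matrix_vector_mult_def)
      qed
      then have d': "Determinants.det (emb_matrix b') = of_rat t * Determinants.det (emb_matrix b)"
        by (simp only: cramer_lemma) (simp add: v_def)
      then have g': "good b'" using t(1) det bO yO by (auto simp: good_def b'_def)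
      have "real (f b') = (cmod (of_rat t))\<^sup>2 * real (f b)"
        unfolding f[OF g', symmetric] f[OF b, symmetric] d' by (simp add: norm_mult norm_power power_mult_distrib)
      also have "cmod (of_rat t) = real_of_rat t"
      proof -
        have "(of_rat t :: complex) = of_real (real_of_rat t)" by (cases t) (simp add: of_rat_rat)
        then have "cmod (of_rat t) = \<bar>real_of_rat t\<bar>" by (simp only: norm_of_real)
        then show ?thesis using t(1) by simp
      qed
      also have "(real_of_rat t)\<^sup>2 * real (f b) < 1 * real (f b)"
      proof (rule mult_strict_right_mono)
        have "real_of_rat t < 1" "0 < real_of_rat t" using t by simp_all
        then show "(real_of_rat t)\<^sup>2 < 1" by (simp add: power_less_one_iff abs_square_less_1)
        have "cmod ((Determinants.det (emb_matrix b))\<^sup>2) > 0" using det by simp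
        then show "0 < real (f b)" using f[OF b] by simp
      qed
      finally show False using min[OF g'] by simp
    qed
    then have "of_rat (q e) = (of_rat (of_int \<lfloor>q e\<rfloor>) :: 'k)" for e by (rule arg_cong)
    then have "x = (\<Sum>e\<in>UNIV. of_int \<lfloor>q e\<rfloor> * b e)" unfolding q by (simp only: of_rat_of_int_eq)
    then show ?thesis by (rule exI[of _ "\<lambda>e. \<lfloor>q e\<rfloor>"])
  qed
  then show ?thesis using b by (auto simp: good_def)
qed

lemma int_combination_unique:
  assumes det: "Determinants.det (emb_matrix b) \<noteq> 0"
    and eq: "(\<Sum>e\<in>UNIV. of_int (c e) * b e) = (\<Sum>e\<in>UNIV. of_int (c' e) * b e)"
  shows "c = c'"
proof -
  define v :: "complex^'e" where "v = (\<chi> e. of_int (c e - c' e))"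
  have z: "(\<Sum>e\<in>UNIV. of_int (c e - c' e) * b e) = 0"
    using eq by (simp add: sum_subtractf left_diff_distrib)
  have "emb_matrix b *v v = 0"
  proof (rule vec_eq_iff[THEN iffD2], rule allI)
    fix i
    have "0 = \<sigma> i (\<Sum>e\<in>UNIV. of_int (c e - c' e) * b e)" unfolding z \<sigma>_hom(4) ..
    also have "\<dots> = (\<Sum>e\<in>UNIV. of_int (c e - c' e) * \<sigma> i (b e))" by (simp only: \<sigma>_hom(8,3,7))
    finally show "(emb_matrix b *v v) $ i = 0 $ i"
      by (simp add: emb_matrix_def matrix_vector_mult_def v_def mult.commute)
  qed
  then have "v = 0" using det invertible_det_nz[of "emb_matrix b"]
    unfolding invertible_left_inverse matrix_left_invertible_ker by blast
  then have "c e - c' e = 0" for e by (auto simp: v_def vec_eq_iff)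
  then show ?thesis by (auto simp: fun_eq_iff)
qed

theorem discriminant_basis:
  obtains b where "\<forall>e. b e \<in> ring_of_integers" "Determinants.det (emb_matrix b) \<noteq> 0"
    "\<forall>x\<in>ring_of_integers. \<exists>c. x = (\<Sum>e\<in>UNIV. of_int (c e) * b e)"
    "discriminant K = (Determinants.det (emb_matrix b))\<^sup>2"
proof -
  obtain h :: "'e \<Rightarrow> nat" where h: "bij_betw h UNIV {0..<d}"
    using ex_bij_betw_finite_nat[of "UNIV :: 'e set"] card_e by auto
  have K: "field_degree TYPE('k) = d" by (simp add: field_degree_def)
  define P where "P D \<longleftrightarrow> (\<exists>(b :: nat \<Rightarrow> 'k) \<tau>. integral_basis b \<and>
        bij_betw \<tau> {..<d} complex_embeddings \<and>
        D = (Determinant.det (Matrix.mat d d (\<lambda>(i, j). \<tau> i (b j))))\<^sup>2)" for D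
  have disc: "discriminant K = (SOME D. P D)"
    unfolding discriminant_def P_def Let_def K ..
  have ib_iff: "integral_basis b \<longleftrightarrow> bij_betw (\<lambda>c. \<Sum>e\<in>UNIV. of_int (c e) * b (h e)) UNIV (ring_of_integers :: 'k set)"
    for b :: "nat \<Rightarrow> 'k"
  proof -
    define E where "E c = (\<lambda>i\<in>{..<d}. c (inv_into UNIV h i))" for c :: "'e \<Rightarrow> int"
    have hb: "bij_betw h UNIV {..<d}" using h by (simp add: atLeast0LessThan)
    have hinj: "inj h" using h by (simp add: bij_betw_def)
    have bE: "bij_betw E UNIV ({..<d} \<rightarrow>\<^sub>E UNIV)"
    proof (rule bij_betwI[where g = "\<lambda>g e. g (h e)"])
      show "(\<lambda>e. E c (h e)) = c" for c
        using hb by (auto simp: E_def fun_eq_iff inv_f_f[OF hinj] bij_betw_def)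
      show "E (\<lambda>e. g (h e)) = g" if "g \<in> {..<d} \<rightarrow>\<^sub>E UNIV" for g
      proof
        fix i show "E (\<lambda>e. g (h e)) i = g i"
          using that bij_betw_inv_into_right[OF hb, of i] by (cases "i < d") (auto simp: E_def PiE_def extensional_def)
      qed
    qed (auto simp: E_def)
    have comp: "(\<Sum>i<d. of_int (E c i) * b i) = (\<Sum>e\<in>UNIV. of_int (c e) * b (h e))" for c
    proof -
      have "(\<Sum>i<d. of_int (E c i) * b i) = (\<Sum>e\<in>UNIV. of_int (E c (h e)) * b (h e))"
        by (rule sum.reindex_bij_betw[OF hb, symmetric])
      also have "\<dots> = (\<Sum>e\<in>UNIV. of_int (c e) * b (h e))"
        by (rule sum.cong) (use hb in \<open>auto simp: E_def inv_f_f[OF hinj] bij_betw_def\<close>)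
      finally show ?thesis .
    qed
    have "integral_basis b \<longleftrightarrow> bij_betw (\<lambda>c. \<Sum>i<d. of_int (c i) * b i) ({..<d} \<rightarrow>\<^sub>E UNIV) ring_of_integers"
      unfolding integral_basis_def K ..
    also have "\<dots> \<longleftrightarrow> bij_betw ((\<lambda>c. \<Sum>i<d. of_int (c i) * b i) \<circ> E) UNIV ring_of_integers"
      by (rule bij_betw_comp_iff[OF bE])
    finally show ?thesis unfolding o_def comp .
  qed
  have "\<exists>D. P D"
  proof -
    obtain b where b: "\<forall>e. b e \<in> ring_of_integers" "Determinants.det (emb_matrix b) \<noteq> 0"
      "\<forall>x\<in>ring_of_integers. \<exists>c. x = (\<Sum>e\<in>UNIV. of_int (c e) * b e)" using ex_integral_basis by blast
    define b' where "b' i = b (inv_into UNIV h i)" for i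
    have hinj: "inj h" using h by (simp add: bij_betw_def)
    have bh: "b' (h e) = b e" for e by (simp add: b'_def inv_f_f[OF hinj])
    have "integral_basis b'" unfolding ib_iff bh
    proof (rule bij_betw_imageI)
      show "inj (\<lambda>c. \<Sum>e\<in>UNIV. of_int (c e) * b e)" by (rule injI) (rule int_combination_unique[OF b(2)])
      show "range (\<lambda>c. \<Sum>e\<in>UNIV. of_int (c e) * b e) = ring_of_integers"
      proof (intro equalityI subsetI)
        fix x assume "x \<in> range (\<lambda>c. \<Sum>e\<in>UNIV. of_int (c e) * b e)"
        then obtain c where c: "x = (\<Sum>e\<in>UNIV. of_int (c e) * b e)" by (rule rangeE)
        show "x \<in> ring_of_integers" unfolding c
          by (rule add_subgroup_sum[OF ring_of_integers_subgroup], rule add_subgroup_int_mult[OF ring_of_integers_subgroup])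
             (use b(1) in simp)
      qed (use b(3) in auto)
    qed
    moreover have "bij_betw (\<sigma> \<circ> inv_into UNIV h) {..<d} complex_embeddings"
      using bij_betw_trans[OF bij_betw_inv_into[OF h] \<sigma>_bij] by (simp add: atLeast0LessThan)
    ultimately show ?thesis unfolding P_def by blast
  qed
  then have "P (discriminant K)" unfolding disc by (rule someI_ex)
  then obtain b \<tau> where b: "integral_basis b" "bij_betw \<tau> {..<d} (complex_embeddings :: ('k \<Rightarrow> complex) set)"
    "discriminant K = (Determinant.det (Matrix.mat d d (\<lambda>(i, j). \<tau> i (b j))))\<^sup>2" unfolding P_def by blast
  \<comment> \<open>number the basis so that the enumeration of the embeddings matches the index type\<close>
  define k where "k e = inv_into {..<d} \<tau> (\<sigma> e)" for e
  have k: "bij_betw k UNIV {0..<d}"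
    using bij_betw_trans[OF \<sigma>_bij bij_betw_inv_into[OF b(2)]] by (simp add: k_def[abs_def] o_def atLeast0LessThan)
  have \<tau>k: "\<tau> (k e) = \<sigma> e" for e
    unfolding k_def by (rule bij_betw_inv_into_right[OF b(2) \<sigma>_emb])
  define c where "c e = b (k e)" for e
  have "Determinant.det (Matrix.mat d d (\<lambda>(i, j). \<tau> i (b j))) = Determinants.det (emb_matrix c)"
    unfolding det_mat_reindex[OF k] emb_matrix_def c_def by (simp add: \<tau>k)
  then have D: "discriminant K = (Determinants.det (emb_matrix c))\<^sup>2" using b(3) by simp
  have bb: "bij_betw (\<lambda>c. \<Sum>e\<in>UNIV. of_int (c e) * b (h e)) UNIV ring_of_integers" using b(1) unfolding ib_iff .
  have spO: "\<exists>g. x = (\<Sum>e\<in>UNIV. of_int (g e) * c e)" if x: "x \<in> ring_of_integers" for x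
  proof -
    have "x \<in> range (\<lambda>c. \<Sum>e\<in>UNIV. of_int (c e) * b (h e))"
      unfolding bij_betw_imp_surj_on[OF bb] by (rule x)
    then obtain g where g: "x = (\<Sum>e\<in>UNIV. of_int (g e) * b (h e))" by (rule rangeE)
    define w where "w = inv_into UNIV h \<circ> k"
    have w: "bij_betw w UNIV UNIV" unfolding w_def by (rule bij_betw_trans[OF k bij_betw_inv_into[OF h]])
    have hw: "h (w e) = k e" for e
    proof -
      have "k e \<in> {0..<d}" using k by (auto simp: bij_betw_def)
      then show ?thesis unfolding w_def o_def by (rule bij_betw_inv_into_right[OF h])
    qed
    have "x = (\<Sum>e\<in>UNIV. of_int (g (w e)) * b (h (w e)))" unfolding g
      by (rule sum.reindex_bij_betw[OF w, symmetric])
    then show ?thesis unfolding hw c_def by (rule exI[of _ "\<lambda>e. g (w e)"])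
  qed
  have cO: "c e \<in> ring_of_integers" for e
  proof -
    have "k e \<in> range h" using bij_betw_imp_surj_on[OF h] bij_betw_apply[OF k, of e] by simp
    then obtain e' where "k e = h e'" by (rule rangeE)
    then have e': "h e' = k e" by simp
    have "(\<Sum>i\<in>UNIV. of_int (if i = e' then 1 else 0) * b (h i)) = (\<Sum>i\<in>UNIV. if i = e' then b (h e') else 0)"
      by (rule sum.cong) auto
    also have "\<dots> = c e" using e' by (simp add: c_def)
    finally have "c e = (\<Sum>i\<in>UNIV. of_int (if i = e' then 1 else 0) * b (h i))" by (rule sym)
    moreover have "(\<Sum>i\<in>UNIV. of_int (if i = e' then 1 else 0) * b (h i)) \<in> range (\<lambda>c. \<Sum>e\<in>UNIV. of_int (c e) * b (h e))"
      by (rule range_eqI[of _ _ "\<lambda>i. if i = e' then 1 else 0"]) (rule refl)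
    ultimately show ?thesis unfolding bij_betw_imp_surj_on[OF bb] by (simp only:)
  qed
  have "Determinants.det (emb_matrix c) \<noteq> 0"
  proof (rule det_emb_matrix_nonzero, rule UNIV_eq_I[symmetric])
    fix x :: 'k
    obtain D :: nat where D: "D > 0" "of_nat D * x \<in> ring_of_integers" using integral_multiple by blast
    obtain g where g: "of_nat D * x = (\<Sum>e\<in>UNIV. of_int (g e) * c e)" using spO[OF D(2)] by blast
    have "of_nat D * x \<in> Q.span (range c)" unfolding g
    proof (rule Q.span_sum)
      fix e
      have "rat_scale (of_int (g e)) (c e) \<in> Q.span (range c)" by (rule Q.span_scale[OF Q.span_base]) simp
      then show "of_int (g e) * c e \<in> Q.span (range c)" by (simp add: rat_scale_def)
    qed
    then have "rat_scale (inverse (of_nat D)) (of_nat D * x) \<in> Q.span (range c)" by (rule Q.span_scale)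
    then show "x \<in> Q.span (range c)" using D(1) by (simp add: rat_scale_def of_rat_inverse mult.assoc[symmetric])
  qed
  then show ?thesis using that[of c] cO spO D by blast
qed

end


section \<open>Counting lattice points by folding onto the unit cube\<close>

definition unit_cube :: "(real^'e::finite) set" where
  "unit_cube = {v. \<forall>e. 0 \<le> v $ e \<and> v $ e < 1}"

definition int_vec :: "('e::finite \<Rightarrow> int) \<Rightarrow> real^'e" where
  "int_vec z = (\<chi> e. of_int (z e))"

lemma unit_cube_borel [measurable]: "(unit_cube :: (real^'e::finite) set) \<in> sets borel"
proof -
  have "unit_cube = (\<Inter>e::'e. {v::real^'e. 0 \<le> v $ e} \<inter> {v. v $ e < 1})"
    by (auto simp: unit_cube_def)
  also have "\<dots> \<in> sets borel"
    by (intro sets.finite_INT sets.Int borel_closed borel_open closed_halfspace_component_ge_cart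
        open_halfspace_component_lt_cart) auto
  finally show ?thesis .
qed

lemma emeasure_unit_cube: "emeasure lborel (unit_cube :: (real^'e::finite) set) = 1"
proof (rule antisym)
  have le: "(0 :: real^'e) \<bullet> b \<le> (\<chi> i. 1) \<bullet> b" if b: "b \<in> Basis" for b :: "real^'e"
    using b by (auto simp: Basis_vec_def inner_axis)
  have p: "(\<Prod>b\<in>Basis. ((\<chi> i. 1) - (0 :: real^'e)) \<bullet> b) = 1"
    by (rule prod.neutral) (auto simp: Basis_vec_def inner_axis)
  have "emeasure lborel (unit_cube :: (real^'e) set) \<le> emeasure lborel (cbox 0 (\<chi> i. 1) :: (real^'e) set)"
    by (rule emeasure_mono) (auto simp: unit_cube_def mem_box_cart less_imp_le)
  also have "\<dots> = 1" using le p by (subst emeasure_lborel_cbox) auto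
  finally show "emeasure lborel (unit_cube :: (real^'e) set) \<le> 1" .
  have "1 = emeasure lborel (box 0 (\<chi> i. 1) :: (real^'e) set)"
    using le p by (subst emeasure_lborel_box) auto
  also have "\<dots> \<le> emeasure lborel (unit_cube :: (real^'e) set)"
    by (rule emeasure_mono) (auto simp: unit_cube_def mem_box_cart less_imp_le)
  finally show "1 \<le> emeasure lborel (unit_cube :: (real^'e) set)" .
qed

lemma unit_cube_translate: "x - int_vec z \<in> unit_cube \<longleftrightarrow> z = (\<lambda>e. \<lfloor>x $ e\<rfloor>)"
proof -
  have "(0 \<le> x $ e - of_int (z e) \<and> x $ e - of_int (z e) < 1) \<longleftrightarrow> z e = \<lfloor>x $ e\<rfloor>" for e by linarith
  then show ?thesis by (auto simp: unit_cube_def int_vec_def fun_eq_iff)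
qed

text \<open>The pieces of \<open>S\<close> in the integer translates of the cube are moved into the
  cube; translations preserve volume.\<close>

lemma folding:
  fixes S :: "(real^'e::finite) set"
  assumes S [measurable]: "S \<in> sets borel"
  obtains z :: "nat \<Rightarrow> 'e \<Rightarrow> int" where "bij z"
    "emeasure lborel S = (\<integral>\<^sup>+t. (\<Sum>i. indicator S (t + int_vec (z i))) * indicator unit_cube t \<partial>lborel)"
proof -
  have inf: "infinite (UNIV :: ('e \<Rightarrow> int) set)"
    using finite_fun_UNIVD2[where 'a = 'e and 'b = int] infinite_UNIV_int by blast
  define z :: "nat \<Rightarrow> 'e \<Rightarrow> int" where "z = from_nat_into UNIV"
  have z: "bij z" unfolding z_def using bij_betw_from_nat_into[OF _ inf] by simp
  have one: "(\<Sum>i. indicator unit_cube (x - int_vec (z i))) = (1::ennreal)" for x :: "real^'e"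
  proof -
    obtain k where k: "z k = (\<lambda>e. \<lfloor>x $ e\<rfloor>)" using z by (metis bij_pointE)
    have "(indicator unit_cube (x - int_vec (z i)) :: ennreal) = (if i = k then 1 else 0)" for i
    proof -
      have "z i = z k \<longleftrightarrow> i = k" by (rule inj_eq[OF bij_is_inj[OF z]])
      then show ?thesis by (simp only: indicator_def unit_cube_translate k) simp
    qed
    then show ?thesis using suminf_finite[of "{k}" "\<lambda>i. if i = k then 1 else (0::ennreal)"] by simp
  qed
  have "emeasure lborel S = (\<integral>\<^sup>+x. indicator S x \<partial>lborel)" by simp
  also have "\<dots> = (\<integral>\<^sup>+x. (\<Sum>i. indicator S x * indicator unit_cube (x - int_vec (z i))) \<partial>lborel)"
    by (intro nn_integral_cong) (simp only: ennreal_suminf_cmult one mult_1_right)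
  also have "\<dots> = (\<Sum>i. \<integral>\<^sup>+x. indicator S x * indicator unit_cube (x - int_vec (z i)) \<partial>lborel)"
    by (rule nn_integral_suminf) measurable
  also have "\<dots> = (\<Sum>i. \<integral>\<^sup>+t. indicator S (t + int_vec (z i)) * indicator unit_cube t \<partial>lborel)"
  proof (rule suminf_cong)
    fix i
    have "(\<integral>\<^sup>+x. indicator S x * indicator unit_cube (x - int_vec (z i)) \<partial>lborel) =
        (\<integral>\<^sup>+x. indicator S x * indicator unit_cube (x - int_vec (z i)) \<partial>(distr lborel borel ((+) (int_vec (z i)))))"
      by (simp only: lborel_distr_plus)
    also have "\<dots> = (\<integral>\<^sup>+t. indicator S (t + int_vec (z i)) * indicator unit_cube t \<partial>lborel)"
      by (subst nn_integral_distr) (auto simp: add.commute)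
    finally show "(\<integral>\<^sup>+x. indicator S x * indicator unit_cube (x - int_vec (z i)) \<partial>lborel) = \<dots>" .
  qed
  also have "\<dots> = (\<integral>\<^sup>+t. (\<Sum>i. indicator S (t + int_vec (z i)) * indicator unit_cube t) \<partial>lborel)"
    by (rule nn_integral_suminf[symmetric]) measurable
  also have "\<dots> = (\<integral>\<^sup>+t. (\<Sum>i. indicator S (t + int_vec (z i))) * indicator unit_cube t \<partial>lborel)"
    by (simp only: ennreal_suminf_multc)
  finally show ?thesis using z that by blast
qed

text \<open>If every translate of the integer points had at most \<open>m\<close> points in
  \<open>S\<close>, then folding would bound the volume by \<open>m\<close>.\<close>

lemma many_points_in_translate:
  fixes S :: "(real^'e::finite) set"
  assumes S: "S \<in> sets borel" and m: "emeasure lborel S > of_nat m"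
  obtains t X where "finite X" "card X > m" "\<forall>z\<in>X. t + int_vec z \<in> S"
proof -
  obtain z :: "nat \<Rightarrow> 'e \<Rightarrow> int" where z: "bij z"
    "emeasure lborel S = (\<integral>\<^sup>+t. (\<Sum>i. indicator S (t + int_vec (z i))) * indicator unit_cube t \<partial>lborel)"
    using folding[OF S] .
  have "\<exists>t. (\<Sum>i. indicator S (t + int_vec (z i))) > (of_nat m :: ennreal)"
  proof (rule ccontr)
    assume "\<not> ?thesis"
    then have "emeasure lborel S \<le> (\<integral>\<^sup>+t. of_nat m * indicator (unit_cube :: (real^'e) set) t \<partial>lborel)"
      unfolding z(2) by (intro nn_integral_mono mult_right_mono) (auto simp: not_less)
    also have "\<dots> = of_nat m" by (subst nn_integral_cmult_indicator) (auto simp: emeasure_unit_cube)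
    finally show False using m by simp
  qed
  then obtain t where t: "(\<Sum>i. indicator S (t + int_vec (z i))) > (of_nat m :: ennreal)" by blast
  define I where "I = {i. t + int_vec (z i) \<in> S}"
  have "\<exists>J\<subseteq>I. finite J \<and> card J > m"
  proof (cases "finite I")
    case True
    have "(\<Sum>i. indicator S (t + int_vec (z i))) = (\<Sum>i\<in>I. indicator S (t + int_vec (z i)) :: ennreal)"
      by (rule suminf_finite[OF True]) (auto simp: I_def)
    also have "\<dots> = of_nat (card I)" by (simp add: I_def)
    finally have "card I > m" using t by simp
    then show ?thesis using True by blast
  next
    case False
    then obtain J where "finite J" "card J = Suc m" "J \<subseteq> I" using infinite_arbitrarily_large by blast
    then show ?thesis by (intro exI[of _ J]) auto
  qed
  then obtain J where J: "J \<subseteq> I" "finite J" "card J > m" by blast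
  have "card (z ` J) = card J" using z(1) by (intro card_image) (auto simp: bij_def intro: inj_on_subset)
  then show ?thesis using J by (intro that[of "z ` J" t]) (auto simp: I_def)
qed

lemma measure_ge_points:
  fixes S :: "(real^'e::finite) set"
  assumes S: "S \<in> sets borel"
    and m: "\<And>t. \<exists>X. finite X \<and> card X = m \<and> (\<forall>z\<in>X. t + int_vec z \<in> S)"
  shows "emeasure lborel S \<ge> of_nat m"
proof -
  obtain z :: "nat \<Rightarrow> 'e \<Rightarrow> int" where z: "bij z"
    "emeasure lborel S = (\<integral>\<^sup>+t. (\<Sum>i. indicator S (t + int_vec (z i))) * indicator unit_cube t \<partial>lborel)"
    using folding[OF S] .
  have ge: "(\<Sum>i. indicator S (t + int_vec (z i))) \<ge> (of_nat m :: ennreal)" for t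
  proof -
    obtain X where X: "finite X" "card X = m" "\<forall>z\<in>X. t + int_vec z \<in> S" using m by blast
    define J where "J = inv_into UNIV z ` X"
    have zi: "z (inv_into UNIV z x) = x" for x using z(1) by (simp add: bij_is_surj surj_f_inv_f)
    have J: "finite J" "card J = m"
      using X z(1) unfolding J_def
      by (auto simp: card_image bij_is_surj inj_on_subset[OF inj_on_inv_into[of UNIV z]])
    have "of_nat m = (\<Sum>i\<in>J. indicator S (t + int_vec (z i)) :: ennreal)"
      using X(3) J zi by (subst sum.cong[OF refl, of _ _ "\<lambda>_. 1"]) (auto simp: J_def)
    also have "\<dots> \<le> (\<Sum>i. indicator S (t + int_vec (z i)))" by (rule sum_le_suminf) (use J in auto)
    finally show ?thesis .
  qed
  have "of_nat m = (\<integral>\<^sup>+t. of_nat m * indicator (unit_cube :: (real^'e) set) t \<partial>lborel)"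
    by (subst nn_integral_cmult_indicator) (auto simp: emeasure_unit_cube)
  also have "\<dots> \<le> emeasure lborel S"
    unfolding z(2) by (intro nn_integral_mono mult_right_mono ge) auto
  finally show ?thesis .
qed

section \<open>Volumes of gauge balls by the Laplace transform\<close>

lemma nn_integral_exp_from: "(\<integral>\<^sup>+s. ennreal (exp (- s)) * indicator {a..} s \<partial>lborel) = ennreal (exp (- a :: real))"
proof -
  have "((\<lambda>x::real. - exp (- x)) \<longlongrightarrow> - 0) at_top"
    by (intro tendsto_minus filterlim_compose[OF exp_at_bot] filterlim_uminus_at_bot_at_top)
  then have "(\<integral>\<^sup>+s. ennreal (exp (- s)) * indicator {a..} s \<partial>lborel) = ennreal (0 - - exp (- a))"
    by (intro nn_integral_FTC_atLeast) (auto intro!: derivative_eq_intros)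
  then show ?thesis by simp
qed

lemma nn_integral_power_exp:
  "(\<integral>\<^sup>+s. ennreal (s ^ n * exp (- s)) * indicator {0<..} s \<partial>lborel) = ennreal (fact n)"
proof -
  have "ennreal (fact n) = ennreal (Gamma (real n + 1))" by (simp add: Gamma_fact[symmetric] add.commute)
  also have "\<dots> = (\<integral>\<^sup>+t. ennreal (indicator {0..} t * t powr (real n + 1 - 1) / exp t) \<partial>lborel)"
    by (rule Gamma_conv_nn_integral_real) simp
  also have "\<dots> = (\<integral>\<^sup>+s. ennreal (s ^ n * exp (- s)) * indicator {0<..} s \<partial>lborel)"
  proof (rule nn_integral_cong_AE)
    have "AE t in lborel. t \<noteq> (0::real)" by (rule AE_lborel_singleton)
    then show "AE t in lborel. ennreal (indicator {0..} t * t powr (real n + 1 - 1) / exp t) =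
        ennreal (t ^ n * exp (- t)) * indicator {0<..} t"
      by eventually_elim (auto simp: powr_realpow exp_minus field_simps split: split_indicator)
  qed
  finally show ?thesis by simp
qed

context
  fixes f :: "'a::euclidean_space \<Rightarrow> real"
  assumes f_meas [measurable]: "f \<in> borel_measurable borel"
    and f_hom: "\<And>c x. c > 0 \<Longrightarrow> f (c *\<^sub>R x) = c * f x"
begin

lemma gauge_ball_scale:
  assumes s: "s > 0"
  shows "emeasure lborel {x. f x \<le> s} = ennreal (s ^ DIM('a)) * emeasure lborel {x. f x \<le> 1}"
proof -
  have "emeasure lborel {x. f x \<le> s} =
      emeasure (density (distr lborel borel (\<lambda>x::'a. 0 + s *\<^sub>R x)) (\<lambda>_. ennreal (\<bar>s\<bar>^DIM('a)))) {x. f x \<le> s}"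
    using lborel_affine[of s "0::'a"] s by simp
  also have "\<dots> = ennreal (s ^ DIM('a)) * emeasure (distr lborel borel (\<lambda>x::'a. 0 + s *\<^sub>R x)) {x. f x \<le> s}"
    using s by (subst emeasure_density_const) auto
  also have "emeasure (distr lborel borel (\<lambda>x::'a. 0 + s *\<^sub>R x)) {x. f x \<le> s} = emeasure lborel {x. f x \<le> 1}"
    using s by (subst emeasure_distr) (auto simp: f_hom intro!: arg_cong[where f = "emeasure lborel"])
  finally show ?thesis .
qed

text \<open>Write \<open>exp (- f x)\<close> as the integral of \<open>exp (- s)\<close> over \<open>s
  \<ge> f x\<close> and exchange the integrals: the ball of radius \<open>s\<close>
  contributes \<open>s\<^sup>N\<close> times the volume of the unit ball. This replaces the
  volume of a body by an integral that factors.\<close>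

lemma gauge_ball_laplace:
  assumes pos: "\<And>x. f x \<ge> 0"
  shows "(\<integral>\<^sup>+x. ennreal (exp (- f x)) \<partial>lborel) = ennreal (fact DIM('a)) * emeasure lborel {x. f x \<le> 1}"
proof -
  have "(\<integral>\<^sup>+x. ennreal (exp (- f x)) \<partial>lborel) =
      (\<integral>\<^sup>+x. (\<integral>\<^sup>+s. ennreal (exp (- s)) * indicator {f x..} s \<partial>lborel) \<partial>lborel)"
    by (simp only: nn_integral_exp_from)
  also have "\<dots> = (\<integral>\<^sup>+x. (\<integral>\<^sup>+s. ennreal (exp (- s)) * indicator {(x, s). f x \<le> s} (x, s) \<partial>lborel) \<partial>lborel)"
    by (intro nn_integral_cong) (auto simp: indicator_def)
  also have "\<dots> = (\<integral>\<^sup>+s. (\<integral>\<^sup>+x. ennreal (exp (- s)) * indicator {(x, s). f x \<le> s} (x, s) \<partial>lborel) \<partial>lborel)"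
    by (rule lborel_pair.Fubini'[symmetric]) measurable
  also have "\<dots> = (\<integral>\<^sup>+s. ennreal (exp (- s)) * emeasure lborel {x. f x \<le> s} \<partial>lborel)"
  proof (intro nn_integral_cong)
    fix s :: real
    have "(\<integral>\<^sup>+x. ennreal (exp (- s)) * indicator {(x, s). f x \<le> s} (x, s) \<partial>lborel) =
      (\<integral>\<^sup>+x. ennreal (exp (- s)) * indicator {x. f x \<le> s} x \<partial>lborel)"
      by (intro nn_integral_cong) (auto simp: indicator_def)
    then show "(\<integral>\<^sup>+x. ennreal (exp (- s)) * indicator {(x, s). f x \<le> s} (x, s) \<partial>lborel) =
      ennreal (exp (- s)) * emeasure lborel {x. f x \<le> s}" by (simp add: nn_integral_cmult_indicator)
  qed
  also have "\<dots> = (\<integral>\<^sup>+s. ennreal (s ^ DIM('a) * exp (- s)) * indicator {0<..} s * emeasure lborel {x. f x \<le> 1} \<partial>lborel)"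
  proof (rule nn_integral_cong_AE)
    have "AE s in lborel. s \<noteq> (0::real)" by (rule AE_lborel_singleton)
    then show "AE s in lborel. ennreal (exp (- s)) * emeasure lborel {x. f x \<le> s} =
        ennreal (s ^ DIM('a) * exp (- s)) * indicator {0<..} s * emeasure lborel {x. f x \<le> 1}"
    proof eventually_elim
      fix s :: real assume "s \<noteq> 0"
      show "ennreal (exp (- s)) * emeasure lborel {x. f x \<le> s} =
        ennreal (s ^ DIM('a) * exp (- s)) * indicator {0<..} s * emeasure lborel {x. f x \<le> 1}"
      proof (cases "s > 0")
        case True
        then have e: "ennreal (s ^ DIM('a) * exp (- s)) = ennreal (exp (- s)) * ennreal (s ^ DIM('a))"
          by (subst ennreal_mult[symmetric]) (auto simp: mult.commute)
        have "indicator {0<..} s = (1::ennreal)" using True by simp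
        with e show ?thesis by (simp only: gauge_ball_scale[OF True] mult.assoc mult_1_left)
      next
        case False
        with \<open>s \<noteq> 0\<close> have s: "s < 0" by simp
        have n: "\<not> f x \<le> s" for x by (rule notI, rule notE[OF leD[OF order_trans[OF pos]], OF _ s])
        have "{x. f x \<le> s} = {}" using n by blast
        then show ?thesis using False by (simp only: greaterThan_iff indicator_simps(2)) simp
      qed
    qed
  qed
  also have "\<dots> = ennreal (fact DIM('a)) * emeasure lborel {x. f x \<le> 1}"
    by (subst nn_integral_multc) (auto simp: nn_integral_power_exp)
  finally show ?thesis .
qed

end

lemma laplace_line: "(\<integral>\<^sup>+y. ennreal (exp (- \<bar>y::real\<bar>)) \<partial>lborel) = 2"
proof -
  have s: "{x::real. \<bar>x\<bar> \<le> 1} = {-1..1}" by auto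
  have "(\<integral>\<^sup>+y. ennreal (exp (- \<bar>y::real\<bar>)) \<partial>lborel) = ennreal (fact DIM(real)) * emeasure lborel {x::real. \<bar>x\<bar> \<le> 1}"
    by (rule gauge_ball_laplace) (auto simp: abs_mult)
  then show ?thesis by (simp add: s)
qed

lemma laplace_plane:
  "(\<integral>\<^sup>+y. \<integral>\<^sup>+y'. ennreal (exp (- (2 * sqrt (((y::real)\<^sup>2 + (y'::real)\<^sup>2) / 2)))) \<partial>lborel \<partial>lborel) = ennreal pi"
proof -
  have f: "2 * sqrt (((fst p)\<^sup>2 + (snd p)\<^sup>2) / 2) = sqrt 2 * norm p" for p :: "real \<times> real"
  proof -
    have "2 * sqrt (((fst p)\<^sup>2 + (snd p)\<^sup>2) / 2) = (2 / sqrt 2) * norm p"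
      by (cases p) (simp add: norm_Pair real_sqrt_divide)
    then show ?thesis by (simp add: real_div_sqrt)
  qed
  have s: "{p :: real \<times> real. sqrt 2 * norm p \<le> 1} = cball 0 (1 / sqrt 2)"
    by (auto simp: field_simps)
  have "(\<integral>\<^sup>+y. \<integral>\<^sup>+y'. ennreal (exp (- (2 * sqrt (((y::real)\<^sup>2 + (y'::real)\<^sup>2) / 2)))) \<partial>lborel \<partial>lborel) =
      (\<integral>\<^sup>+y. \<integral>\<^sup>+y'. (\<lambda>p :: real \<times> real. ennreal (exp (- (sqrt 2 * norm p)))) (y, y') \<partial>lborel \<partial>lborel)"
    using f[of "(_, _)"] by (simp only: fst_conv snd_conv)
  also have "\<dots> = (\<integral>\<^sup>+p. ennreal (exp (- (sqrt 2 * norm (p :: real \<times> real)))) \<partial>(lborel \<Otimes>\<^sub>M lborel))"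
    by (rule lborel.nn_integral_fst, simp only: lborel_prod, measurable)
  also have "\<dots> = (\<integral>\<^sup>+p. ennreal (exp (- (sqrt 2 * norm (p :: real \<times> real)))) \<partial>lborel)"
    by (simp only: lborel_prod)
  also have "\<dots> = ennreal (fact DIM(real \<times> real)) * emeasure lborel {p :: real \<times> real. sqrt 2 * norm p \<le> 1}"
    by (rule gauge_ball_laplace) auto
  also have "\<dots> = ennreal 2 * ennreal (pi * (1 / sqrt 2) ^ 2)"
    unfolding s by (subst emeasure_cball) (auto simp: unit_ball_vol_2 fact_numeral power_divide)
  also have "\<dots> = ennreal pi"
    by (subst ennreal_mult[symmetric]) (auto simp: power_divide)
  finally show ?thesis .
qed

text \<open>For a conjugation \<open>c\<close> of the indices and \<open>x\<^sub>e = u\<^sub>e +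
  v\<^sub>e\<close>, \<open>x\<^bsub>c e\<^esub> = u\<^sub>e - v\<^sub>e\<close>, the summands
  are the absolute values of \<open>u\<^sub>e + i v\<^sub>e\<close>.\<close>

definition pair_gauge :: "('i \<Rightarrow> 'i) \<Rightarrow> 'i set \<Rightarrow> ('i \<Rightarrow> real) \<Rightarrow> real" where
  "pair_gauge c I x = (\<Sum>e\<in>I. sqrt (((x e)\<^sup>2 + (x (c e))\<^sup>2) / 2))"

lemma pair_gauge_measurable:
  assumes "J \<subseteq> I" "c ` J \<subseteq> I"
  shows "pair_gauge c J \<in> borel_measurable (Pi\<^sub>M I (\<lambda>_. lborel))"
  unfolding pair_gauge_def
proof (rule borel_measurable_sum)
  fix e assume e: "e \<in> J"
  have "e \<in> I" "c e \<in> I" using e assms by auto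
  then have [measurable]: "(\<lambda>x. x e) \<in> borel_measurable (Pi\<^sub>M I (\<lambda>_. lborel :: real measure))"
    "(\<lambda>x. x (c e)) \<in> borel_measurable (Pi\<^sub>M I (\<lambda>_. lborel :: real measure))"
    using measurable_component_singleton[of _ I "\<lambda>_. lborel :: real measure"] by (auto simp: measurable_lborel1)
  show "(\<lambda>x. sqrt (((x e)\<^sup>2 + (x (c e))\<^sup>2) / 2)) \<in> borel_measurable (Pi\<^sub>M I (\<lambda>_. lborel))" by measurable
qed

lemma pair_gauge_cong: "(\<And>e. e \<in> I \<Longrightarrow> x e = y e \<and> x (c e) = y (c e)) \<Longrightarrow> pair_gauge c I x = pair_gauge c I y"
  unfolding pair_gauge_def by (intro sum.cong) auto

lemma pair_gauge_upd:
  assumes "e \<notin> J" "c ` J \<subseteq> J"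
  shows "pair_gauge c J (x(e := y)) = pair_gauge c J x"
proof (rule pair_gauge_cong)
  fix i assume i: "i \<in> J"
  then have "c i \<in> J" using assms(2) by blast
  then have "i \<noteq> e" "c i \<noteq> e" using i assms(1) by metis+
  then show "(x(e := y)) i = x i \<and> (x(e := y)) (c i) = x (c i)" by simp
qed

text \<open>The integrand factors over the orbits of \<open>c\<close>: a fixed index contributes the
  integral over a line, a pair of indices the one over a plane.\<close>

lemma laplace_pair_gauge:
  fixes c :: "'i \<Rightarrow> 'i"
  assumes inv: "\<And>e. c (c e) = e" and I: "finite I" "c ` I \<subseteq> I"
  shows "(\<integral>\<^sup>+x. ennreal (exp (- pair_gauge c I x)) \<partial>(Pi\<^sub>M I (\<lambda>_. lborel))) =
    ennreal (2 ^ card {e\<in>I. c e = e} * pi ^ (card {e\<in>I. c e \<noteq> e} div 2))"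
  using I
proof (induction I rule: finite_psubset_induct)
  case (psubset I)
  interpret product_sigma_finite "\<lambda>_::'i. lborel :: real measure" ..
  show ?case
  proof (cases "I = {}")
    case True
    show ?thesis unfolding True by (subst nn_integral_empty) (auto simp: pair_gauge_def)
  next
    case False
    then obtain e where e: "e \<in> I" by blast
    have ce: "c e \<in> I" using e psubset.prems by auto
    define J where "J = I - {e, c e}"
    have J: "J \<subset> I" "finite J" using e psubset.hyps by (auto simp: J_def)
    have cJ: "c ` J \<subseteq> J" using psubset.prems inv by (auto simp: J_def) (metis inv)+
    note IH = psubset.IH[OF J(1) cJ]
    have FI: "(\<lambda>x. ennreal (exp (- pair_gauge c I x))) \<in> borel_measurable (Pi\<^sub>M I (\<lambda>_. lborel))"
      using pair_gauge_measurable[of I I c] psubset.prems by simp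
    have mJ: "pair_gauge c J \<in> borel_measurable (Pi\<^sub>M J (\<lambda>_. lborel))"
      using pair_gauge_measurable[of J J c] cJ by simp
    show ?thesis
    proof (cases "c e = e")
      case True
      have IJ: "I = insert e J" "e \<notin> J" using e True by (auto simp: J_def)
      have split: "pair_gauge c I (x(e := y)) = \<bar>y\<bar> + pair_gauge c J x" for x y
      proof -
        have "pair_gauge c J (x(e := y)) = pair_gauge c J x"
          by (rule pair_gauge_upd[OF IJ(2) cJ])
        then show ?thesis unfolding IJ(1) using IJ(2) J(2) True by (simp add: pair_gauge_def)
      qed
      have "(\<integral>\<^sup>+x. ennreal (exp (- pair_gauge c I x)) \<partial>(Pi\<^sub>M I (\<lambda>_. lborel))) =
        (\<integral>\<^sup>+x. (\<integral>\<^sup>+y. ennreal (exp (- pair_gauge c I (x(e := y)))) \<partial>lborel) \<partial>(Pi\<^sub>M J (\<lambda>_. lborel)))"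
        using product_nn_integral_insert[OF J(2) IJ(2)] FI unfolding IJ(1) by blast
      also have "\<dots> = (\<integral>\<^sup>+x. (\<integral>\<^sup>+y. ennreal (exp (- \<bar>y\<bar>)) * ennreal (exp (- pair_gauge c J x)) \<partial>lborel) \<partial>(Pi\<^sub>M J (\<lambda>_. lborel)))"
        by (simp only: split minus_add_distrib exp_add ennreal_mult exp_ge_zero)
      also have "\<dots> = (\<integral>\<^sup>+x. 2 * ennreal (exp (- pair_gauge c J x)) \<partial>(Pi\<^sub>M J (\<lambda>_. lborel)))"
        by (subst nn_integral_multc) (auto simp: laplace_line)
      also have "\<dots> = 2 * (\<integral>\<^sup>+x. ennreal (exp (- pair_gauge c J x)) \<partial>(Pi\<^sub>M J (\<lambda>_. lborel)))"
        by (rule nn_integral_cmult) (use mJ in simp)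
      also have "\<dots> = ennreal 2 * ennreal (2 ^ card {e\<in>J. c e = e} * pi ^ (card {e\<in>J. c e \<noteq> e} div 2))"
        by (simp only: IH) simp
      also have "{e\<in>J. c e \<noteq> e} = {e\<in>I. c e \<noteq> e}" using IJ(1) True by auto
      also have "ennreal 2 * ennreal (2 ^ card {e\<in>J. c e = e} * pi ^ (card {e\<in>I. c e \<noteq> e} div 2)) =
          ennreal (2 ^ Suc (card {e\<in>J. c e = e}) * pi ^ (card {e\<in>I. c e \<noteq> e} div 2))"
        by (subst ennreal_mult[symmetric]) (auto simp: mult.assoc)
      also have "Suc (card {e\<in>J. c e = e}) = card {e\<in>I. c e = e}"
      proof -
        have "{e\<in>I. c e = e} = insert e {e\<in>J. c e = e}" using IJ(1) True by auto
        then show ?thesis using IJ(2) J(2) by simp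
      qed
      finally show ?thesis .
    next
      case False
      define e' where "e' = c e"
      have ee: "e \<noteq> e'" "c e' = e" "c e = e'" using False inv by (auto simp: e'_def)
      have IJ: "I = insert e (insert e' J)" "e \<notin> insert e' J" "e' \<notin> J" "e \<notin> J"
        using e ce ee(1) unfolding J_def ee(3) by blast+
      have split: "pair_gauge c I (x(e := y)) = 2 * sqrt ((y\<^sup>2 + (x e')\<^sup>2) / 2) + pair_gauge c J x" for x y
      proof -
        have "pair_gauge c J (x(e := y)) = pair_gauge c J x"
          by (rule pair_gauge_upd[OF IJ(4) cJ])
        moreover have "pair_gauge c I z = sqrt (((z e)\<^sup>2 + (z e')\<^sup>2) / 2) + (sqrt (((z e')\<^sup>2 + (z e)\<^sup>2) / 2) + pair_gauge c J z)" for z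
          unfolding IJ(1) pair_gauge_def using IJ(2-4) J(2) by (simp add: ee(2,3))
        ultimately show ?thesis using ee(1) by (simp add: add.commute[of "(x e')\<^sup>2"])
      qed
      have split': "pair_gauge c J (x(e' := y)) = pair_gauge c J x" for x y
        by (rule pair_gauge_upd[OF IJ(3) cJ])
      have "(\<integral>\<^sup>+x. ennreal (exp (- pair_gauge c I x)) \<partial>(Pi\<^sub>M I (\<lambda>_. lborel))) =
        (\<integral>\<^sup>+y. (\<integral>\<^sup>+x. ennreal (exp (- pair_gauge c I (x(e := y)))) \<partial>(Pi\<^sub>M (insert e' J) (\<lambda>_. lborel))) \<partial>lborel)"
        using product_nn_integral_insert_rev[OF _ IJ(2)] J(2) FI unfolding IJ(1) by blast
      also have "\<dots> = (\<integral>\<^sup>+y. (\<integral>\<^sup>+x. ennreal (exp (- (2 * sqrt ((y\<^sup>2 + (x e')\<^sup>2) / 2) + pair_gauge c J x))) \<partial>(Pi\<^sub>M (insert e' J) (\<lambda>_. lborel))) \<partial>lborel)"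
        by (simp only: split)
      also have "\<dots> = (\<integral>\<^sup>+y. (\<integral>\<^sup>+y'. (\<integral>\<^sup>+x. ennreal (exp (- (2 * sqrt ((y\<^sup>2 + y'\<^sup>2) / 2)))) * ennreal (exp (- pair_gauge c J x)) \<partial>(Pi\<^sub>M J (\<lambda>_. lborel))) \<partial>lborel) \<partial>lborel)"
      proof (rule nn_integral_cong)
        fix y :: real
        have [measurable]: "(\<lambda>x. x e') \<in> borel_measurable (Pi\<^sub>M (insert e' J) (\<lambda>_. lborel :: real measure))"
          using measurable_component_singleton[of e' "insert e' J" "\<lambda>_. lborel :: real measure"] by (simp add: measurable_lborel1)
        have [measurable]: "pair_gauge c J \<in> borel_measurable (Pi\<^sub>M (insert e' J) (\<lambda>_. lborel))"
          by (rule pair_gauge_measurable) (use cJ in auto)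
        have "(\<integral>\<^sup>+x. ennreal (exp (- (2 * sqrt ((y\<^sup>2 + (x e')\<^sup>2) / 2) + pair_gauge c J x))) \<partial>(Pi\<^sub>M (insert e' J) (\<lambda>_. lborel))) =
          (\<integral>\<^sup>+y'. (\<integral>\<^sup>+x. ennreal (exp (- (2 * sqrt ((y\<^sup>2 + ((x(e' := y')) e')\<^sup>2) / 2) + pair_gauge c J (x(e' := y'))))) \<partial>(Pi\<^sub>M J (\<lambda>_. lborel))) \<partial>lborel)"
          by (rule product_nn_integral_insert_rev[OF J(2) IJ(3)]) measurable
        then show "(\<integral>\<^sup>+x. ennreal (exp (- (2 * sqrt ((y\<^sup>2 + (x e')\<^sup>2) / 2) + pair_gauge c J x))) \<partial>(Pi\<^sub>M (insert e' J) (\<lambda>_. lborel))) =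
          (\<integral>\<^sup>+y'. (\<integral>\<^sup>+x. ennreal (exp (- (2 * sqrt ((y\<^sup>2 + y'\<^sup>2) / 2)))) * ennreal (exp (- pair_gauge c J x)) \<partial>(Pi\<^sub>M J (\<lambda>_. lborel))) \<partial>lborel)"
          by (simp only: split' fun_upd_same minus_add_distrib exp_add ennreal_mult exp_ge_zero)
      qed
      also have "\<dots> = (\<integral>\<^sup>+y. (\<integral>\<^sup>+y'. ennreal (exp (- (2 * sqrt ((y\<^sup>2 + y'\<^sup>2) / 2)))) * (\<integral>\<^sup>+x. ennreal (exp (- pair_gauge c J x)) \<partial>(Pi\<^sub>M J (\<lambda>_. lborel))) \<partial>lborel) \<partial>lborel)"
        by (subst nn_integral_cmult) (use mJ in auto)
      also have "\<dots> = ennreal pi * (\<integral>\<^sup>+x. ennreal (exp (- pair_gauge c J x)) \<partial>(Pi\<^sub>M J (\<lambda>_. lborel)))"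
        by (subst nn_integral_multc, measurable, subst nn_integral_multc, measurable, simp only: laplace_plane)
      also have "\<dots> = ennreal pi * ennreal (2 ^ card {e\<in>J. c e = e} * pi ^ (card {e\<in>J. c e \<noteq> e} div 2))"
        by (simp only: IH)
      also have "{e\<in>J. c e = e} = {e\<in>I. c e = e}" using IJ(1) ee by auto
      also have "ennreal pi * ennreal (2 ^ card {e\<in>I. c e = e} * pi ^ (card {e\<in>J. c e \<noteq> e} div 2)) =
          ennreal (2 ^ card {e\<in>I. c e = e} * pi ^ Suc (card {e\<in>J. c e \<noteq> e} div 2))"
        by (subst ennreal_mult[symmetric]) (auto simp: mult_ac)
      also have "Suc (card {e\<in>J. c e \<noteq> e} div 2) = card {e\<in>I. c e \<noteq> e} div 2"
      proof -
        have "{e\<in>I. c e \<noteq> e} = insert e (insert e' {e\<in>J. c e \<noteq> e})" using IJ(1) ee by auto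
        then have "card {e\<in>I. c e \<noteq> e} = Suc (Suc (card {e\<in>J. c e \<noteq> e}))" using IJ(2-4) J(2) ee(1) by simp
        then show ?thesis by simp
      qed
      finally show ?thesis .
    qed
  qed
qed

lemma volume_pair_gauge:
  fixes c :: "'e::finite \<Rightarrow> 'e"
  assumes inv: "\<And>e. c (c e) = e"
  shows "emeasure lborel {x :: real^'e. pair_gauge c UNIV (($) x) \<le> 1} =
    ennreal (2 ^ card {e. c e = e} * pi ^ (card {e. c e \<noteq> e} div 2) / fact CARD('e))"
proof -
  define f :: "real^'e \<Rightarrow> real" where "f x = pair_gauge c UNIV (($) x)" for x
  have f_meas [measurable]: "f \<in> borel_measurable borel"
    unfolding f_def pair_gauge_def by (intro borel_measurable_continuous_onI continuous_intros) auto
  have f_hom: "f (a *\<^sub>R x) = a * f x" if a: "a > 0" for a x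
  proof -
    have "sqrt (((a * u)\<^sup>2 + (a * v)\<^sup>2) / 2) = a * sqrt ((u\<^sup>2 + v\<^sup>2) / 2)" for u v
    proof -
      have "((a * u)\<^sup>2 + (a * v)\<^sup>2) / 2 = a\<^sup>2 * ((u\<^sup>2 + v\<^sup>2) / 2)" by (simp add: power_mult_distrib field_simps)
      then show ?thesis using a by (simp only: real_sqrt_mult) simp
    qed
    then show ?thesis by (simp add: f_def pair_gauge_def sum_distrib_left)
  qed
  have f_pos: "f x \<ge> 0" for x by (simp add: f_def pair_gauge_def sum_nonneg)
  define ax :: "'e \<Rightarrow> real^'e" where "ax e = axis e 1" for e
  have ax_inj: "inj ax" by (auto simp: ax_def inj_def axis_eq_axis)
  have Basis_ax: "(Basis :: (real^'e) set) = range ax" by (auto simp: Basis_vec_def ax_def)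
  define c' :: "real^'e \<Rightarrow> real^'e" where "c' b = (\<chi> e. b $ c e)" for b
  have c'_inv: "c' (c' b) = b" for b by (simp add: c'_def inv vec_eq_iff)
  have c'_ax: "c' (ax e) = ax (c e)" for e
  proof -
    have "c i = e \<longleftrightarrow> i = c e" for i using inv by metis
    then show ?thesis by (simp add: c'_def ax_def vec_eq_iff axis_def)
  qed
  have cB: "c' ` Basis \<subseteq> Basis" by (auto simp: Basis_ax c'_ax)
  have card: "card {b\<in>Basis. c' b = b} = card {e. c e = e}" "card {b\<in>Basis. c' b \<noteq> b} = card {e. c e \<noteq> e}"
  proof -
    have "{b\<in>Basis. c' b = b} = ax ` {e. c e = e}" "{b\<in>Basis. c' b \<noteq> b} = ax ` {e. c e \<noteq> e}"
      using injD[OF ax_inj] by (auto simp: Basis_ax c'_ax)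
    then show "card {b\<in>Basis. c' b = b} = card {e. c e = e}" "card {b\<in>Basis. c' b \<noteq> b} = card {e. c e \<noteq> e}"
      using ax_inj by (simp_all add: card_image inj_on_def)
  qed
  have comp: "f (\<Sum>b\<in>Basis. g b *\<^sub>R b) = pair_gauge c' Basis g" for g
  proof -
    have "(\<Sum>b\<in>Basis. g b *\<^sub>R b) = (\<Sum>e\<in>UNIV. g (ax e) *\<^sub>R ax e)"
      unfolding Basis_ax by (rule sum.reindex[OF ax_inj, unfolded o_def])
    then have co: "(\<Sum>b\<in>Basis. g b *\<^sub>R b) $ e = g (ax e)" for e
      by (simp add: ax_def axis_def if_distrib[of "(*) _"] cong: if_cong)
    have "pair_gauge c' Basis g = (\<Sum>e\<in>UNIV. sqrt (((g (ax e))\<^sup>2 + (g (c' (ax e)))\<^sup>2) / 2))"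
      unfolding pair_gauge_def Basis_ax by (rule sum.reindex[OF ax_inj, unfolded o_def])
    then show ?thesis by (simp only: f_def pair_gauge_def co c'_ax)
  qed
  have "ennreal (fact CARD('e)) * emeasure lborel {x. f x \<le> 1} = (\<integral>\<^sup>+x. ennreal (exp (- f x)) \<partial>lborel)"
    using gauge_ball_laplace[of f, OF f_meas f_hom f_pos] by simp
  also have "\<dots> = (\<integral>\<^sup>+g. ennreal (exp (- f (\<Sum>b\<in>Basis. g b *\<^sub>R b))) \<partial>(\<Pi>\<^sub>M b\<in>Basis. lborel))"
    by (subst lborel_eq, subst nn_integral_distr) measurable
  also have "\<dots> = ennreal (2 ^ card {e. c e = e} * pi ^ (card {e. c e \<noteq> e} div 2))"
    unfolding comp card[symmetric] by (rule laplace_pair_gauge[OF c'_inv finite_Basis cB])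
  finally have e: "ennreal (fact CARD('e)) * emeasure lborel {x. f x \<le> 1} = ennreal (2 ^ card {e. c e = e} * pi ^ (card {e. c e \<noteq> e} div 2))" .
  have "emeasure lborel {x. f x \<le> 1} = ennreal (inverse (fact CARD('e))) * (ennreal (fact CARD('e)) * emeasure lborel {x. f x \<le> 1})"
    unfolding mult.assoc[symmetric] by (subst ennreal_mult[symmetric]) auto
  also have "\<dots> = ennreal (2 ^ card {e. c e = e} * pi ^ (card {e. c e \<noteq> e} div 2) / fact CARD('e))"
    unfolding e by (subst ennreal_mult[symmetric]) (auto simp: field_simps)
  finally show ?thesis by (simp only: f_def)
qed

section \<open>Conjugate linear forms\<close>

lemma det_of_real: "Determinants.det (\<chi> i j. (of_real (A $ i $ j) :: complex)) = of_real (Determinants.det (A :: real^'e::finite^'e))"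
  by (simp add: Determinants.det_def)

lemma det_cnj: "Determinants.det (\<chi> i j. cnj (A $ i $ j)) = cnj (Determinants.det (A :: complex^'e::finite^'e))"
  by (simp add: Determinants.det_def)

definition form_gauge :: "complex^'e::finite^'e \<Rightarrow> real^'e \<Rightarrow> real" where
  "form_gauge S y = (\<Sum>i\<in>UNIV. cmod (\<Sum>j\<in>UNIV. S $ i $ j * of_real (y $ j)))"

lemma form_gauge_measurable [measurable]: "form_gauge S \<in> borel_measurable borel"
  unfolding form_gauge_def by (intro borel_measurable_continuous_onI continuous_intros)

lemma form_gauge_scale: "a > 0 \<Longrightarrow> form_gauge S (a *\<^sub>R y) = a * form_gauge S y"
proof -
  assume a: "a > 0"
  have "(\<Sum>j\<in>UNIV. S $ i $ j * of_real ((a *\<^sub>R y) $ j)) = of_real a * (\<Sum>j\<in>UNIV. S $ i $ j * of_real (y $ j))" for i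
    by (simp add: sum_distrib_left mult_ac)
  then show ?thesis using a unfolding form_gauge_def by (simp only: norm_mult norm_of_real abs_of_pos sum_distrib_left[symmetric])
qed

lemma form_gauge_diff: "form_gauge S (y - y') \<le> form_gauge S y + form_gauge S y'"
proof -
  have "(\<Sum>j\<in>UNIV. S $ i $ j * of_real ((y - y') $ j)) =
    (\<Sum>j\<in>UNIV. S $ i $ j * of_real (y $ j)) - (\<Sum>j\<in>UNIV. S $ i $ j * of_real (y' $ j))" for i
    by (simp add: sum_subtractf right_diff_distrib)
  then show ?thesis
    unfolding form_gauge_def sum.distrib[symmetric] by (intro sum_mono) (simp only: norm_triangle_ineq4)
qed

text \<open>Linear forms that complex conjugation permutes, as it does with the embeddings of a number
  field. The well order of the index type serves the transformation formula for volumes of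
  linear images.\<close>

locale conjugate_forms =
  fixes c :: "'e::{finite,wellorder} \<Rightarrow> 'e" and S :: "complex^'e::_^'e::_"
  assumes c_invol: "\<And>e. c (c e) = e" and conj_c: "\<And>i j. S $ c i $ j = cnj (S $ i $ j)"
    and det: "Determinants.det S \<noteq> 0"
begin

lemma odd_sum:
  fixes g :: "'e \<Rightarrow> real"
  assumes "\<And>i. g (c i) = - g i" shows "(\<Sum>i\<in>UNIV. g i) = 0"
proof -
  have "bij c" using c_invol by (rule involuntory_imp_bij)
  then have "(\<Sum>i\<in>UNIV. g (c i)) = (\<Sum>i\<in>UNIV. g i)" by (rule sum.reindex_bij_betw)
  then show ?thesis by (simp add: assms sum_negf)
qed

text \<open>Conjugate indices yield the real forms \<open>u + v\<close> and \<open>u - v\<close> for the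
  complex form \<open>u + i v\<close>.\<close>

definition real_form :: "real^'e::_^'e::_" where
  "real_form = (\<chi> i j. Re (S $ i $ j) + Im (S $ i $ j))"

text \<open>The Gram matrices of both systems of forms agree, since the mixed products of real and
  imaginary parts cancel between conjugate indices.\<close>

lemma det_real_form: "\<bar>Determinants.det real_form\<bar> = cmod (Determinants.det S)"
proof -
  define G where "G = Finite_Cartesian_Product.transpose real_form ** real_form"
  define H where "H = Finite_Cartesian_Product.transpose (\<chi> i j. cnj (S $ i $ j)) ** S"
  have "H = (\<chi> i j. of_real (G $ i $ j))"
  proof (simp only: vec_eq_iff vec_lambda_beta, intro allI)
    fix j k
    have z1: "(\<Sum>i\<in>UNIV. Re (S $ i $ j) * Im (S $ i $ k) - Im (S $ i $ j) * Re (S $ i $ k)) = 0"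
      by (rule odd_sum) (simp add: conj_c)
    have z2: "(\<Sum>i\<in>UNIV. Re (S $ i $ j) * Im (S $ i $ k) + Im (S $ i $ j) * Re (S $ i $ k)) = 0"
      by (rule odd_sum) (simp add: conj_c)
    have H: "H $ j $ k = (\<Sum>i\<in>UNIV. cnj (S $ i $ j) * S $ i $ k)"
      by (simp add: H_def transpose_def matrix_matrix_mult_def)
    have "G $ j $ k = (\<Sum>i\<in>UNIV. (Re (S $ i $ j) * Re (S $ i $ k) + Im (S $ i $ j) * Im (S $ i $ k)) +
        (Re (S $ i $ j) * Im (S $ i $ k) + Im (S $ i $ j) * Re (S $ i $ k)))"
      by (simp add: G_def transpose_def matrix_matrix_mult_def real_form_def algebra_simps)
    also have "\<dots> = (\<Sum>i\<in>UNIV. Re (S $ i $ j) * Re (S $ i $ k) + Im (S $ i $ j) * Im (S $ i $ k))"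
      by (subst sum.distrib) (simp only: z2 add_0_right)
    finally have G: "G $ j $ k = (\<Sum>i\<in>UNIV. Re (S $ i $ j) * Re (S $ i $ k) + Im (S $ i $ j) * Im (S $ i $ k))" .
    show "H $ j $ k = of_real (G $ j $ k)"
    proof (rule complex_eqI)
      show "Re (H $ j $ k) = Re (of_real (G $ j $ k))" by (simp add: H G Re_sum)
      show "Im (H $ j $ k) = Im (of_real (G $ j $ k))" using z1 by (simp add: H Im_sum)
    qed
  qed
  then have "Determinants.det H = of_real (Determinants.det G)" by (simp only: det_of_real)
  moreover have "Determinants.det H = cnj (Determinants.det S) * Determinants.det S"
    by (simp only: H_def det_mul Determinants.det_transpose det_cnj)
  moreover have "Determinants.det G = (Determinants.det real_form)\<^sup>2"
    by (simp only: G_def det_mul Determinants.det_transpose power2_eq_square)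
  ultimately have "(of_real ((Determinants.det real_form)\<^sup>2) :: complex) = of_real ((cmod (Determinants.det S))\<^sup>2)"
    by (simp only: mult.commute complex_norm_square)
  then have "(Determinants.det real_form)\<^sup>2 = (cmod (Determinants.det S))\<^sup>2" by (simp only: of_real_eq_iff)
  then have "sqrt ((Determinants.det real_form)\<^sup>2) = sqrt ((cmod (Determinants.det S))\<^sup>2)" by (simp only:)
  then show ?thesis by (simp only: real_sqrt_abs abs_norm_cancel)
qed

lemma form_gauge_pair: "form_gauge S y = pair_gauge c UNIV (($) (real_form *v y))"
  unfolding form_gauge_def pair_gauge_def
proof (rule sum.cong[OF refl])
  fix i
  define u v where "u = (\<Sum>j\<in>UNIV. Re (S $ i $ j) * y $ j)" and "v = (\<Sum>j\<in>UNIV. Im (S $ i $ j) * y $ j)"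
  have 1: "(real_form *v y) $ i = u + v" "(real_form *v y) $ c i = u - v"
    by (simp_all add: u_def v_def matrix_vector_mult_def real_form_def conj_c algebra_simps sum.distrib sum_subtractf sum_negf)
  have "(\<Sum>j\<in>UNIV. S $ i $ j * of_real (y $ j)) = Complex u v"
    by (rule complex_eqI) (simp_all add: u_def v_def Re_sum Im_sum)
  moreover have "((u + v)\<^sup>2 + (u - v)\<^sup>2) / 2 = u\<^sup>2 + v\<^sup>2" by (simp add: power2_eq_square algebra_simps)
  ultimately show "cmod (\<Sum>j\<in>UNIV. S $ i $ j * of_real (y $ j)) =
      sqrt ((((real_form *v y) $ i)\<^sup>2 + ((real_form *v y) $ c i)\<^sup>2) / 2)"
    by (simp only: 1 complex_norm)
qed

definition gauge_volume :: real where
  "gauge_volume = 2 ^ card {e. c e = e} * pi ^ (card {e. c e \<noteq> e} div 2) / (fact CARD('e) * cmod (Determinants.det S))"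

text \<open>The inverse of the real forms maps the ball of the pair gauge onto the ball in question.\<close>

lemma volume_form_gauge:
  assumes \<rho>: "\<rho> > 0"
  shows "emeasure lborel {y. form_gauge S y \<le> \<rho>} = ennreal (\<rho> ^ CARD('e) * gauge_volume)"
proof -
  define V where "V = 2 ^ card {e. c e = e} * pi ^ (card {e. c e \<noteq> e} div 2) / fact CARD('e)"
  define W where "W = {x :: real^'e::_. pair_gauge c UNIV (($) x) \<le> 1}"
  have V0: "V \<ge> 0" by (simp add: V_def)
  have Wm: "W \<in> sets borel"
  proof -
    have "(\<lambda>x :: real^'e::_. pair_gauge c UNIV (($) x)) \<in> borel_measurable borel"
      unfolding pair_gauge_def by (intro borel_measurable_continuous_onI continuous_intros) auto
    then show ?thesis unfolding W_def by measurable
  qed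
  have W: "emeasure lborel W = ennreal V" unfolding W_def V_def by (rule volume_pair_gauge[OF c_invol])
  have We: "emeasure lebesgue W = ennreal V" using W Wm by simp
  have Wl: "W \<in> lmeasurable" using We Wm by (intro fmeasurableI) auto
  have Wv: "measure lebesgue W = V" using We V0 by (simp add: measure_def)
  define A where "A = real_form"
  have dA: "Determinants.det A \<noteq> 0" using det_real_form det by (auto simp: A_def)
  then have "invertible A" by (simp add: invertible_det_nz)
  then obtain B where B: "A ** B = mat 1" "B ** A = mat 1" by (auto simp: invertible_def)
  have dB: "Determinants.det A * Determinants.det B = 1" using B(1) by (metis det_mul det_I)
  define P where "P = {y. form_gauge S y \<le> 1}"
  have "P = (\<lambda>w. B *v w) ` W"
  proof (rule Set.set_eqI)
    fix y
    have BA: "B *v (A *v y) = y" by (simp add: matrix_vector_mul_assoc B)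
    have AB: "A *v (B *v w) = w" for w by (simp add: matrix_vector_mul_assoc B)
    have "y \<in> P \<longleftrightarrow> A *v y \<in> W" by (simp only: P_def W_def A_def form_gauge_pair mem_Collect_eq)
    also have "\<dots> \<longleftrightarrow> y \<in> (\<lambda>w. B *v w) ` W"
    proof
      assume "A *v y \<in> W"
      then have "B *v (A *v y) \<in> (\<lambda>w. B *v w) ` W" by (rule imageI)
      then show "y \<in> (\<lambda>w. B *v w) ` W" by (simp only: BA)
    next
      assume "y \<in> (\<lambda>w. B *v w) ` W"
      then obtain w where "y = B *v w" "w \<in> W" by (elim imageE)
      then show "A *v y \<in> W" by (simp only: AB)
    qed
    finally show "y \<in> P \<longleftrightarrow> y \<in> (\<lambda>w. B *v w) ` W" .
  qed
  then have Pl: "P \<in> lmeasurable" and Pm: "measure lebesgue P = \<bar>Determinants.det B\<bar> * V"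
    using measurable_linear_image[OF matrix_vector_mul_linear Wl, of B] measure_linear_image[OF matrix_vector_mul_linear Wl, of B]
    by (simp_all add: Wv matrix_of_matrix_vector_mul)
  have "\<bar>Determinants.det A\<bar> * \<bar>Determinants.det B\<bar> = 1" by (simp only: abs_mult[symmetric] dB abs_one)
  then have "\<bar>Determinants.det B\<bar> = 1 / cmod (Determinants.det S)"
    using det_real_form det by (simp add: A_def field_simps)
  then have Pm': "measure lebesgue P = gauge_volume" using Pm by (simp add: V_def gauge_volume_def)
  have Pb: "P \<in> sets borel" unfolding P_def by measurable
  have "emeasure lborel P = emeasure lebesgue P" using Pb by simp
  also have "\<dots> = ennreal gauge_volume" using emeasure_eq_measure2[OF Pl] Pm' by (simp only:)
  finally have P1: "emeasure lborel P = ennreal gauge_volume" .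
  have "emeasure lborel {y. form_gauge S y \<le> \<rho>} = ennreal (\<rho> ^ DIM(real^'e::_)) * emeasure lborel {y. form_gauge S y \<le> 1}"
    by (rule gauge_ball_scale[OF form_gauge_measurable form_gauge_scale \<rho>])
  also have "\<dots> = ennreal (\<rho> ^ CARD('e) * gauge_volume)"
    using P1 \<rho> by (subst ennreal_mult) (auto simp: P_def gauge_volume_def)
  finally show ?thesis .
qed

text \<open>Points in one translate of a ball of radius \<open>\<rho> / 2\<close> differ by vectors of
  the ball of radius \<open>\<rho>\<close>.\<close>

lemma close_integer_points:
  assumes \<rho>: "\<rho> > 0"
  obtains X where "finite X" "real (card X) \<ge> (\<rho> / 2) ^ CARD('e) * gauge_volume"
    "\<forall>z\<in>X. \<forall>z'\<in>X. form_gauge S (int_vec z - int_vec z') \<le> \<rho>"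
proof -
  define w where "w = (\<rho> / 2) ^ CARD('e) * gauge_volume"
  have w: "w > 0" using \<rho> det by (simp add: w_def gauge_volume_def)
  define m where "m = nat (\<lceil>w\<rceil> - 1)"
  have m: "real m < w" "w \<le> real (Suc m)" using w by (auto simp: m_def) linarith+
  have "emeasure lborel {y. form_gauge S y \<le> \<rho> / 2} = ennreal w"
    using volume_form_gauge[of "\<rho> / 2"] \<rho> by (simp only: w_def)
  moreover have "of_nat m < ennreal w" using m(1) by (simp add: ennreal_of_nat_eq_real_of_nat ennreal_less_iff)
  ultimately have "emeasure lborel {y. form_gauge S y \<le> \<rho> / 2} > of_nat m" by simp
  then obtain t X where X: "finite X" "card X > m" "\<forall>z\<in>X. t + int_vec z \<in> {y. form_gauge S y \<le> \<rho> / 2}"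
    by (rule many_points_in_translate[rotated]) measurable
  show ?thesis
  proof (rule that[OF X(1)])
    show "real (card X) \<ge> (\<rho> / 2) ^ CARD('e) * gauge_volume" using m(2) X(2) by (simp only: w_def[symmetric])
    show "\<forall>z\<in>X. \<forall>z'\<in>X. form_gauge S (int_vec z - int_vec z') \<le> \<rho>"
    proof (intro ballI)
      fix z z' assume z: "z \<in> X" "z' \<in> X"
      have "form_gauge S (int_vec z - int_vec z') = form_gauge S ((t + int_vec z) - (t + int_vec z'))"
        by (simp only: add_diff_cancel_left)
      also have "\<dots> \<le> form_gauge S (t + int_vec z) + form_gauge S (t + int_vec z')" by (rule form_gauge_diff)
      also have "\<dots> \<le> \<rho> / 2 + \<rho> / 2" using X(3) z by (intro add_mono) auto
      finally show "form_gauge S (int_vec z - int_vec z') \<le> \<rho>" by simp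
    qed
  qed
qed

end

text \<open>The image of the unit cube under \<open>A\<close> has volume \<open>|det A|\<close>, and every translate of the integer points
  has in it at least one point from each class modulo the lattice of \<open>A\<close>.\<close>

lemma card_residues_le_det:
  fixes A :: "real^'e::{finite,wellorder}^'e::_" and X :: "('e \<Rightarrow> int) set"
  assumes A: "\<And>z. \<exists>w. A *v int_vec z = int_vec w" and det: "Determinants.det A \<noteq> 0"
    and X: "finite X" "\<And>x y w. x \<in> X \<Longrightarrow> y \<in> X \<Longrightarrow> int_vec x - int_vec y = A *v int_vec w \<Longrightarrow> x = y"
  shows "real (card X) \<le> \<bar>Determinants.det A\<bar>"
proof -
  obtain B where B: "A ** B = mat 1" "B ** A = mat 1"
    using det by (auto simp: invertible_det_nz[symmetric] invertible_def)
  have BA: "B *v (A *v y) = y" and AB: "A *v (B *v y) = y" for y :: "real^'e::_"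
    by (simp_all add: matrix_vector_mul_assoc B)
  define P where "P = (\<lambda>w. A *v w) ` unit_cube"
  have Pv: "P = (\<lambda>w. B *v w) -` unit_cube"
  proof (rule Set.set_eqI)
    fix y show "y \<in> P \<longleftrightarrow> y \<in> (\<lambda>w. B *v w) -` unit_cube"
      unfolding P_def by (metis AB BA image_iff vimage_eq)
  qed
  have "(\<lambda>w. B *v w) \<in> borel_measurable borel"
    by (intro borel_measurable_continuous_onI linear_continuous_on matrix_vector_mul_bounded_linear)
  then have Pb: "P \<in> sets borel" unfolding Pv using measurable_sets_borel[OF _ unit_cube_borel] by blast
  have "\<exists>Y. finite Y \<and> card Y = card X \<and> (\<forall>z\<in>Y. t + int_vec z \<in> P)" for t
  proof -
    define w where "w x = (\<lambda>e. \<lfloor>(B *v (t + int_vec x)) $ e\<rfloor>)" for x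
    have w: "B *v (t + int_vec x) - int_vec (w x) \<in> unit_cube" for x by (simp only: unit_cube_translate w_def)
    obtain a where a: "\<And>z. A *v int_vec z = int_vec (a z)" using A by metis
    define z where "z x = (\<lambda>e. x e - a (w x) e)" for x
    have zi: "int_vec (z x) = int_vec x - A *v int_vec (w x)" for x
      by (simp only: a) (simp add: z_def int_vec_def vec_eq_iff)
    have "x = y" if xy: "x \<in> X" "y \<in> X" "z x = z y" for x y
    proof (rule X(2)[OF xy(1,2)])
      have "int_vec x - int_vec y = A *v int_vec (w x) - A *v int_vec (w y)"
        using arg_cong[OF xy(3), of int_vec] unfolding zi by (simp add: algebra_simps)
      also have "\<dots> = A *v int_vec (\<lambda>e. w x e - w y e)"
        by (simp only: matrix_vector_mult_diff_distrib[symmetric]) (simp add: int_vec_def vec_eq_iff minus_vec_def)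
      finally show "int_vec x - int_vec y = A *v int_vec (\<lambda>e. w x e - w y e)" .
    qed
    then have "card (z ` X) = card X" by (intro card_image inj_onI)
    moreover have "t + int_vec (z x) \<in> P" for x
    proof -
      have "t + int_vec (z x) = A *v (B *v (t + int_vec x) - int_vec (w x))"
        by (simp only: zi matrix_vector_mult_diff_distrib AB) (simp add: algebra_simps)
      then show ?thesis unfolding P_def using w by (rule image_eqI)
    qed
    ultimately show ?thesis using X(1) by (intro exI[of _ "z ` X"]) auto
  qed
  then have "of_nat (card X) \<le> emeasure lborel P" by (rule measure_ge_points[OF Pb])
  also have "\<dots> = emeasure lebesgue P" using Pb by simp
  also have "\<dots> = ennreal (\<bar>Determinants.det A\<bar>)"
  proof -
    have e: "emeasure lebesgue (unit_cube :: (real^'e::_) set) = 1" by (simp add: emeasure_unit_cube)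
    then have Ql: "unit_cube \<in> (lmeasurable :: (real^'e::_) set set)" by (intro fmeasurableI) auto
    have "measure lebesgue (unit_cube :: (real^'e::_) set) = 1" using e by (simp add: measure_def)
    then show ?thesis unfolding P_def
      using measurable_linear_image[OF matrix_vector_mul_linear Ql, of A] measure_linear_image[OF matrix_vector_mul_linear Ql, of A]
      by (simp add: emeasure_eq_measure2 matrix_of_matrix_vector_mul)
  qed
  finally show ?thesis by (simp add: ennreal_of_nat_eq_real_of_nat ennreal_le_iff)
qed

section \<open>Counting integers of the field\<close>

text \<open>A bound for finite sets of inequivalent elements gives finiteness of the index along with
  the bound.\<close>

lemma index_le_if_residues_le:
  assumes B: "add_subgroup B"
    and le: "\<And>X. finite X \<Longrightarrow> X \<subseteq> A \<Longrightarrow> (\<And>x y. x \<in> X \<Longrightarrow> y \<in> X \<Longrightarrow> x - y \<in> B \<Longrightarrow> x = y) \<Longrightarrow> real (card X) \<le> C"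
  shows "finite_index A B" "real (index A B) \<le> C"
proof -
  have fin: "real (card Y) \<le> C" if Y: "Y \<subseteq> coset B ` A" "finite Y" for Y
  proof -
    obtain X where X: "X \<subseteq> A" "inj_on (coset B) X" "Y = coset B ` X" using Y(1) subset_image_inj by metis
    have "finite X" using X Y(2) finite_imageD by metis
    then have "real (card X) \<le> C"
      by (rule le[OF _ X(1)]) (use X(2) coset_eq_iff[OF B] in \<open>metis inj_onD\<close>)
    then show ?thesis using card_image[OF X(2)] X(3) by simp
  qed
  show f: "finite_index A B"
  proof (rule ccontr)
    assume "\<not> finite_index A B"
    then have "infinite (coset B ` A)" by (simp add: finite_index_def)
    then obtain Y where Y: "finite Y" "card Y = Suc (nat \<lceil>C\<rceil>)" "Y \<subseteq> coset B ` A"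
      using infinite_arbitrarily_large by blast
    then show False using fin[OF Y(3,1)] by linarith
  qed
  show "real (index A B) \<le> C" using fin[OF order_refl] f by (simp add: finite_index_def index_def)
qed

locale integral_frame = embedding_index K \<sigma>
  for K :: "'k::field_char_0 itself" and \<sigma> :: "'e::{finite,wellorder} \<Rightarrow> 'k \<Rightarrow> complex" +
  fixes b :: "'e \<Rightarrow> 'k"
  assumes b_int: "\<forall>e. b e \<in> ring_of_integers"
    and b_det: "Determinants.det (emb_matrix b) \<noteq> 0"
    and b_span: "\<forall>x\<in>ring_of_integers. \<exists>c. x = (\<Sum>e\<in>UNIV. of_int (c e) * b e)"
    and b_disc: "discriminant K = (Determinants.det (emb_matrix b))\<^sup>2"
begin

abbreviation Z\<^sub>K :: "'k set" where "Z\<^sub>K \<equiv> ring_of_integers"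

definition elt :: "('e \<Rightarrow> int) \<Rightarrow> 'k" where "elt z = (\<Sum>e\<in>UNIV. of_int (z e) * b e)"

definition abs_prod :: "'k \<Rightarrow> real" where "abs_prod x = (\<Prod>i\<in>UNIV. cmod (\<sigma> i x))"

definition abs_sum :: "'k \<Rightarrow> real" where "abs_sum x = (\<Sum>i\<in>UNIV. cmod (\<sigma> i x))"

definition conj_index :: "'e \<Rightarrow> 'e" where "conj_index i = inv_into UNIV \<sigma> (\<lambda>x. cnj (\<sigma> i x))"

lemma elt_bij: "bij_betw elt UNIV Z\<^sub>K"
proof -
  have "elt z \<in> Z\<^sub>K" for z
    unfolding elt_def using b_int by (intro add_subgroup_sum[OF ring_of_integers_subgroup] add_subgroup_int_mult[OF ring_of_integers_subgroup]) blast
  moreover have "\<exists>z. x = elt z" if "x \<in> Z\<^sub>K" for x using b_span that by (simp add: elt_def)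
  moreover have "inj elt" unfolding elt_def by (rule injI) (rule int_combination_unique[OF b_det])
  ultimately show ?thesis unfolding bij_betw_def by blast
qed

lemma elt_diff: "elt z - elt z' = elt (\<lambda>e. z e - z' e)"
  by (simp add: elt_def sum_subtractf left_diff_distrib)

lemma card_elt_preimage: "X \<subseteq> Z\<^sub>K \<Longrightarrow> card (elt -` X) = card X" "X \<subseteq> Z\<^sub>K \<Longrightarrow> finite X \<Longrightarrow> finite (elt -` X)"
proof -
  assume X: "X \<subseteq> Z\<^sub>K"
  have i: "inj elt" using elt_bij by (simp add: bij_betw_def)
  show "card (elt -` X) = card X"
    using X elt_bij by (intro card_vimage_inj[OF i]) (simp add: bij_betw_def)
  show "finite X \<Longrightarrow> finite (elt -` X)" using i by (rule finite_vimageI[rotated])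
qed

lemma \<sigma>_conj_index: "\<sigma> (conj_index i) x = cnj (\<sigma> i x)"
proof -
  have "(\<lambda>x. cnj (\<sigma> i x)) \<in> range \<sigma>" using cnj_embedding[OF \<sigma>_emb] \<sigma>_bij by (simp add: bij_betw_def)
  then have "\<sigma> (conj_index i) = (\<lambda>x. cnj (\<sigma> i x))" unfolding conj_index_def by (rule f_inv_into_f)
  then show ?thesis by simp
qed

lemma \<sigma>_inj: "\<sigma> i = \<sigma> j \<Longrightarrow> i = j"
  using \<sigma>_bij by (auto simp: bij_betw_def inj_def)

sublocale conjugate_forms conj_index "emb_matrix b"
proof
  show "conj_index (conj_index e) = e" for e
    by (rule \<sigma>_inj, rule ext) (simp only: \<sigma>_conj_index complex_cnj_cnj)
  show "emb_matrix b $ conj_index i $ j = cnj (emb_matrix b $ i $ j)" for i j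
    by (simp add: emb_matrix_def \<sigma>_conj_index)
  show "Determinants.det (emb_matrix b) \<noteq> 0" by (rule b_det)
qed

lemma form_gauge_elt: "form_gauge (emb_matrix b) (int_vec z - int_vec z') = abs_sum (elt z - elt z')"
proof -
  have "(\<Sum>j\<in>UNIV. emb_matrix b $ i $ j * complex_of_real ((int_vec z - int_vec z') $ j)) = \<sigma> i (elt z - elt z')" for i
  proof -
    have "\<sigma> i (elt z - elt z') = (\<Sum>j\<in>UNIV. of_int (z j - z' j) * \<sigma> i (b j))"
      by (subst elt_diff) (simp only: elt_def \<sigma>_hom(8) \<sigma>_hom(3) \<sigma>_hom(7))
    also have "\<dots> = (\<Sum>j\<in>UNIV. emb_matrix b $ i $ j * complex_of_real ((int_vec z - int_vec z') $ j))"
      by (intro sum.cong refl) (simp add: emb_matrix_def int_vec_def algebra_simps)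
    finally show ?thesis by (rule sym)
  qed
  then show ?thesis by (simp only: form_gauge_def abs_sum_def)
qed

lemma close_integers:
  assumes \<rho>: "\<rho> > 0"
  obtains T where "finite T" "T \<subseteq> Z\<^sub>K" "real (card T) \<ge> (\<rho> / 2) ^ d * gauge_volume"
    "\<forall>x\<in>T. \<forall>y\<in>T. abs_sum (x - y) \<le> \<rho>"
proof -
  obtain X where X: "finite X" "real (card X) \<ge> (\<rho> / 2) ^ CARD('e) * gauge_volume"
    "\<forall>z\<in>X. \<forall>z'\<in>X. form_gauge (emb_matrix b) (int_vec z - int_vec z') \<le> \<rho>"
    using close_integer_points[OF \<rho>] .
  have c: "card (elt ` X) = card X"
    using elt_bij by (intro card_image) (auto simp: bij_betw_def intro: inj_on_subset)
  show ?thesis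
  proof (rule that[of "elt ` X"])
    show "finite (elt ` X)" using X(1) by simp
    show "elt ` X \<subseteq> Z\<^sub>K" using elt_bij by (auto simp: bij_betw_def)
    show "real (card (elt ` X)) \<ge> (\<rho> / 2) ^ d * gauge_volume" using X(2) by (simp only: c card_e)
    show "\<forall>x\<in>elt ` X. \<forall>y\<in>elt ` X. abs_sum (x - y) \<le> \<rho>" using X(3) by (auto simp: form_gauge_elt)
  qed
qed

lemma card_fixed: "card {e. conj_index e = e} = card (real_places :: ('k \<Rightarrow> complex) set)"
  and card_moved: "card {e. conj_index e \<noteq> e} = 2 * card (complex_places :: ('k \<Rightarrow> complex) set set)"
proof -
  have range: "range \<sigma> = complex_embeddings" using \<sigma>_bij by (simp add: bij_betw_def)
  have real: "conj_index e = e \<longleftrightarrow> \<sigma> e \<in> real_places" for e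
  proof -
    have "conj_index e = e \<longleftrightarrow> (\<forall>x. cnj (\<sigma> e x) = \<sigma> e x)"
      using \<sigma>_conj_index[of e] \<sigma>_inj[of "conj_index e" e] by (metis ext)
    moreover have "range (\<sigma> e) \<subseteq> \<real> \<longleftrightarrow> (\<forall>x. cnj (\<sigma> e x) = \<sigma> e x)"
      unfolding image_subset_iff Reals_cnj_iff by simp
    ultimately show ?thesis using \<sigma>_emb[of e] by (simp add: real_places_def)
  qed
  have inj: "inj_on \<sigma> A" for A using \<sigma>_bij by (auto simp: bij_betw_def intro: inj_on_subset)
  have "\<sigma> ` {e. conj_index e = e} = real_places"
    using range by (auto simp: real real_places_def) 
  then show "card {e. conj_index e = e} = card (real_places :: ('k \<Rightarrow> complex) set)"
    by (metis card_image inj)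
  define N where "N = (complex_embeddings - real_places :: ('k \<Rightarrow> complex) set)"
  have "\<sigma> ` {e. conj_index e \<noteq> e} = N" unfolding N_def range[symmetric] real by blast
  then have cN: "card {e. conj_index e \<noteq> e} = card N" by (metis card_image inj)
  have finN: "finite N" using embeddings_card(1) by (simp add: N_def)
  have cc: "cnj \<circ> (cnj \<circ> \<tau>) = \<tau>" for \<tau> :: "'k \<Rightarrow> complex" by (simp add: fun_eq_iff)
  have cnjN: "cnj \<circ> \<tau> \<in> N \<and> cnj \<circ> \<tau> \<noteq> \<tau>" if t: "\<tau> \<in> N" for \<tau>
  proof -
    have te: "\<tau> \<in> complex_embeddings" and tr: "\<not> range \<tau> \<subseteq> \<real>" using t by (auto simp: N_def real_places_def)
    have ne: "cnj \<circ> \<tau> \<noteq> \<tau>"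
    proof
      assume "cnj \<circ> \<tau> = \<tau>"
      then have "cnj (\<tau> x) = \<tau> x" for x by (metis comp_apply)
      then show False using tr by (auto simp: Reals_cnj_iff)
    qed
    have "(cnj \<circ> \<tau>) \<in> complex_embeddings" using cnj_embedding[OF te] by (simp add: comp_def)
    moreover have "\<not> range (cnj \<circ> \<tau>) \<subseteq> \<real>" using tr by (auto simp: Reals_cnj_iff)
    ultimately show ?thesis using ne by (simp add: N_def real_places_def)
  qed
  have places: "complex_places = (\<lambda>\<tau>. {\<tau>, cnj \<circ> \<tau>}) ` N" by (simp add: complex_places_def N_def)
  have "2 * card (complex_places :: ('k \<Rightarrow> complex) set set) = card (\<Union> complex_places :: ('k \<Rightarrow> complex) set)"
  proof (rule card_partition)
    show "finite (complex_places :: ('k \<Rightarrow> complex) set set)" unfolding places using finN by simp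
    show "finite (\<Union> complex_places :: ('k \<Rightarrow> complex) set)" unfolding places using finN by simp
    show "card P = 2" if P: "P \<in> complex_places" for P :: "('k \<Rightarrow> complex) set"
    proof -
      obtain \<tau> where t: "\<tau> \<in> N" "P = {\<tau>, cnj \<circ> \<tau>}" using P unfolding places by (elim imageE)
      then show ?thesis using cnjN[OF t(1)] by (metis card_2_iff)
    qed
    show "P \<inter> P' = {}" if P: "P \<in> complex_places" "P' \<in> complex_places" "P \<noteq> P'" for P P' :: "('k \<Rightarrow> complex) set"
    proof (rule ccontr)
      assume ne: "P \<inter> P' \<noteq> {}"
      have eq: "P = {x, cnj \<circ> x}" if Px: "P \<in> complex_places" "x \<in> P" for P :: "('k \<Rightarrow> complex) set" and x
      proof -
        obtain \<tau> where t: "P = {\<tau>, cnj \<circ> \<tau>}" using Px(1) unfolding places image_iff by (elim bexE)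
        have "x = \<tau> \<or> x = cnj \<circ> \<tau>" using Px(2) unfolding t by (simp only: insert_iff empty_iff simp_thms)
        then show ?thesis
        proof
          assume "x = \<tau>" then show ?thesis by (simp only: t)
        next
          assume x: "x = cnj \<circ> \<tau>"
          show ?thesis unfolding t x cc by (rule insert_commute)
        qed
      qed
      obtain x where x: "x \<in> P" "x \<in> P'" using ne by blast
      show False using P(3) eq[OF P(1) x(1)] eq[OF P(2) x(2)] by simp
    qed
  qed
  also have "(\<Union> complex_places :: ('k \<Rightarrow> complex) set) = N"
  proof
    show "\<Union> complex_places \<subseteq> N" unfolding places using cnjN by (simp add: UN_subset_iff)
    show "N \<subseteq> \<Union> complex_places" unfolding places by blast
  qed
  finally show "card {e. conj_index e \<noteq> e} = 2 * card (complex_places :: ('k \<Rightarrow> complex) set set)" using cN by simp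
qed

definition minkowski_constant :: real where
  "minkowski_constant = (4 / pi) ^ card (complex_places :: ('k \<Rightarrow> complex) set set) * (fact d / real d ^ d) * sqrt (cmod (discriminant K))"

lemma d_pos: "d > 0" using card_e zero_less_card_finite[where 'a = 'e] by simp

lemma degree_places: "d = card (real_places :: ('k \<Rightarrow> complex) set) + 2 * card (complex_places :: ('k \<Rightarrow> complex) set set)"
proof -
  have "card (UNIV :: 'e set) = card ({e. conj_index e = e} \<union> {e. conj_index e \<noteq> e})" by (rule arg_cong[where f = card]) blast
  also have "\<dots> = card {e. conj_index e = e} + card {e. conj_index e \<noteq> e}" by (rule card_Un_disjoint) auto
  finally show ?thesis by (simp only: card_e card_fixed card_moved)
qed

lemma minkowski_constant_pos: "minkowski_constant > 0"
  using d_pos b_det by (simp add: minkowski_constant_def b_disc)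

text \<open>At radius \<open>d\<close> the factor \<open>d\<^sup>d / d!\<close> of the constant appears;
  a real place contributes \<open>2\<close> to the volume and a complex place
  \<open>\<pi>\<close>, against the \<open>d = r + 2 s\<close> factors \<open>2\<close> from
  halving the radius.\<close>

lemma gauge_volume_eq: "(real d / 2) ^ d * gauge_volume = 1 / minkowski_constant"
proof -
  define r s where "r = card (real_places :: ('k \<Rightarrow> complex) set)" and "s = card (complex_places :: ('k \<Rightarrow> complex) set set)"
  define D where "D = cmod (Determinants.det (emb_matrix b))"
  have D: "D > 0" using b_det by (simp add: D_def)
  have "(2::real) ^ d = 2 ^ r * 4 ^ s" unfolding degree_places r_def[symmetric] s_def[symmetric] power_add power_mult by simp
  then have p: "(real d / 2) ^ d = real d ^ d / (2 ^ r * 4 ^ s)" by (simp only: power_divide)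
  have g: "gauge_volume = 2 ^ r * pi ^ s / (fact d * D)"
    unfolding gauge_volume_def card_fixed card_moved r_def s_def D_def card_e by simp
  have m: "minkowski_constant = (4 ^ s / pi ^ s) * (fact d / real d ^ d) * D"
    unfolding minkowski_constant_def b_disc s_def D_def by (simp add: norm_power power_divide)
  show ?thesis unfolding p g m using D d_pos by (simp add: field_simps)
qed

text \<open>The inequality between the geometric and the arithmetic mean of the conjugates.\<close>

lemma abs_prod_le: "abs_prod x \<le> (abs_sum x / real d) ^ d"
proof (cases "abs_sum x = 0")
  case True
  then have "cmod (\<sigma> i x) = 0" for i
    unfolding abs_sum_def by (subst (asm) sum_nonneg_eq_0_iff) auto
  then have "abs_prod x = 0" by (simp add: abs_prod_def)
  then show ?thesis by (simp add: abs_sum_def sum_nonneg)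
next
  case False
  define m where "m = abs_sum x / real d"
  have "abs_sum x \<ge> 0" by (simp add: abs_sum_def sum_nonneg)
  then have m: "m > 0" using False d_pos by (simp add: m_def)
  \<comment> \<open>\<open>t \<le> exp (t - 1)\<close> for each ratio \<open>t\<close> of a conjugate to the mean; the exponents sum to \<open>0\<close>.\<close>
  have "(\<Prod>i\<in>UNIV. cmod (\<sigma> i x) / m) \<le> (\<Prod>i\<in>UNIV. exp (cmod (\<sigma> i x) / m - 1))"
  proof (rule prod_mono)
    fix i
    have "1 + (cmod (\<sigma> i x) / m - 1) \<le> exp (cmod (\<sigma> i x) / m - 1)" by (rule exp_ge_add_one_self)
    then show "0 \<le> cmod (\<sigma> i x) / m \<and> cmod (\<sigma> i x) / m \<le> exp (cmod (\<sigma> i x) / m - 1)" using m by simp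
  qed
  also have "\<dots> = exp ((\<Sum>i\<in>UNIV. cmod (\<sigma> i x)) / m - real (card (UNIV :: 'e set)))"
    by (simp add: exp_sum[symmetric] sum_subtractf sum_divide_distrib)
  also have "(\<Sum>i\<in>UNIV. cmod (\<sigma> i x)) / m = real d" using False d_pos by (simp add: m_def abs_sum_def)
  finally have "abs_prod x / m ^ d \<le> 1" by (simp add: abs_prod_def prod_dividef card_e)
  then show ?thesis using m by (simp add: m_def)
qed

text \<open>In the coordinates of an integral basis multiplication by \<open>a\<close> has determinant
  \<open>\<plusminus> abs_prod a\<close>.\<close>

lemma residues_le_abs_prod:
  assumes a: "a \<in> Z\<^sub>K" "a \<noteq> 0" and X: "finite X" "X \<subseteq> Z\<^sub>K"
    and sep: "\<And>x y. x \<in> X \<Longrightarrow> y \<in> X \<Longrightarrow> x - y \<in> (*) a ` Z\<^sub>K \<Longrightarrow> x = y"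
  shows "real (card X) \<le> abs_prod a"
proof -
  have "\<forall>k. \<exists>m. a * b k = elt m"
    using elt_bij ring_of_integers_mult[OF a(1)] b_int unfolding bij_betw_def by (metis imageE)
  then obtain m where m: "\<And>k. a * b k = elt (m k)" by metis
  define A :: "real^'e::_^'e::_" where "A = (\<chi> j k. of_int (m k j))"
  define w where "w z = (\<lambda>j. \<Sum>k\<in>UNIV. m k j * z k)" for z
  have Aw: "A *v int_vec z = int_vec (w z)" for z
    by (simp add: A_def w_def int_vec_def matrix_vector_mult_def vec_eq_iff)
  have aw: "a * elt z = elt (w z)" for z
  proof -
    have "a * elt z = (\<Sum>k\<in>UNIV. of_int (z k) * (a * b k))" by (simp add: elt_def sum_distrib_left mult_ac)
    also have "\<dots> = (\<Sum>k\<in>UNIV. \<Sum>j\<in>UNIV. of_int (z k) * (of_int (m k j) * b j))"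
      unfolding m elt_def sum_distrib_left ..
    also have "\<dots> = (\<Sum>j\<in>UNIV. \<Sum>k\<in>UNIV. of_int (z k) * (of_int (m k j) * b j))" by (rule sum.swap)
    also have "\<dots> = elt (w z)" unfolding elt_def w_def of_int_sum sum_distrib_right by (intro sum.cong refl) (simp add: mult_ac)
    finally show ?thesis .
  qed
  have "Determinants.det (\<chi> j k. of_rat (of_int (m k j))) = (\<Prod>i\<in>UNIV. \<sigma> i a)"
    by (rule multiplication_matrix(2)[OF b_det]) (simp add: m elt_def)
  moreover have "(\<chi> j k. of_rat (of_int (m k j))) = (\<chi> j k. (of_real (A $ j $ k) :: complex))"
    by (simp add: A_def)
  ultimately have "complex_of_real (Determinants.det A) = (\<Prod>i\<in>UNIV. \<sigma> i a)" by (simp only: det_of_real)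
  then have dA: "\<bar>Determinants.det A\<bar> = abs_prod a" unfolding abs_prod_def prod_norm by (metis norm_of_real)
  have "abs_prod a \<noteq> 0" using a(2) by (simp add: abs_prod_def \<sigma>_hom(10))
  then have "Determinants.det A \<noteq> 0" using dA by auto
  moreover have "x = y" if xy: "x \<in> elt -` X" "y \<in> elt -` X" "int_vec x - int_vec y = A *v int_vec z" for x y z
  proof -
    have "x e - y e = w z e" for e
    proof -
      have "(int_vec x - int_vec y) $ e = int_vec (w z) $ e" using xy(3) by (simp only: Aw)
      then have "real_of_int (x e - y e) = real_of_int (w z e)" by (simp add: int_vec_def)
      then show ?thesis by (simp only: of_int_eq_iff)
    qed
    then have "elt x - elt y = a * elt z" by (simp only: elt_diff aw)
    moreover have "elt z \<in> Z\<^sub>K" using elt_bij by (auto simp: bij_betw_def)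
    ultimately have "elt x - elt y \<in> (*) a ` Z\<^sub>K" by (rule image_eqI)
    then have "elt x = elt y" using xy(1,2) by (intro sep) simp_all
    then show ?thesis using elt_bij by (auto simp: bij_betw_def inj_def)
  qed
  ultimately have "real (card (elt -` X)) \<le> \<bar>Determinants.det A\<bar>"
    using Aw card_elt_preimage(2)[OF X(2,1)] by (intro card_residues_le_det) blast+
  then show ?thesis by (simp only: dA card_elt_preimage(1)[OF X(2)])
qed

lemma scaled_integers_subgroup: "add_subgroup ((*) a ` Z\<^sub>K)"
  by (rule add_subgroup_image[where g = "(*) a", OF ring_of_integers_subgroup]) (simp add: right_diff_distrib)

lemma index_integers:
  assumes "a \<in> Z\<^sub>K" "a \<noteq> 0"
  shows "finite_index Z\<^sub>K ((*) a ` Z\<^sub>K)" "real (index Z\<^sub>K ((*) a ` Z\<^sub>K)) \<le> abs_prod a"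
  by (rule index_le_if_residues_le[OF scaled_integers_subgroup], rule residues_le_abs_prod[OF assms], blast+)+

lemma common_integral_multiple: "finite X \<Longrightarrow> \<exists>t\<in>Z\<^sub>K. t \<noteq> 0 \<and> (\<forall>x\<in>X. t * x \<in> Z\<^sub>K)"
proof (induction X rule: finite_induct)
  case empty
  then show ?case using ring_of_integers_of_int[of 1, where 'a = 'k] by (intro bexI[of _ 1]) auto
next
  case (insert y X)
  then obtain t where t: "t \<in> Z\<^sub>K" "t \<noteq> 0" "\<forall>x\<in>X. t * x \<in> Z\<^sub>K" by blast
  obtain D :: nat where D: "D > 0" "of_nat D * y \<in> Z\<^sub>K" using integral_multiple by blast
  have D': "of_nat D \<in> Z\<^sub>K" using ring_of_integers_of_int[of "int D", where 'a = 'k] by simp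
  have "of_nat D * t * x \<in> Z\<^sub>K" if "x \<in> insert y X" for x
  proof (cases "x = y")
    case True
    then show ?thesis using ring_of_integers_mult[OF t(1) D(2)] by (simp add: mult_ac)
  next
    case False
    then have "t * x \<in> Z\<^sub>K" using that t(3) by blast
    then show ?thesis using ring_of_integers_mult[OF D'] by (simp add: mult.assoc)
  qed
  then show ?case using D(1) t(2) ring_of_integers_mult[OF D' t(1)] by (intro bexI[of _ "of_nat D * t"]) auto
qed

end

section \<open>Rings containing the algebraic integers\<close>

locale integral_overring = integral_frame K \<sigma> b
  for K :: "'k::field_char_0 itself" and \<sigma> :: "'e::{finite,wellorder} \<Rightarrow> 'k \<Rightarrow> complex" and b +
  fixes R :: "'k set"
  assumes R_subring: "subring R field_ring" and int_R: "Z\<^sub>K \<subseteq> R"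
begin

lemma R_closed:
  shows "x \<in> R \<Longrightarrow> y \<in> R \<Longrightarrow> x + y \<in> R" "x \<in> R \<Longrightarrow> y \<in> R \<Longrightarrow> x * y \<in> R" "of_int m \<in> R"
    "x \<in> R \<Longrightarrow> y \<in> R \<Longrightarrow> x - y \<in> R"
proof -
  show add: "x + y \<in> R" if "x \<in> R" "y \<in> R" for x y
    using subgroup.m_closed[OF subring.axioms(1)[OF R_subring] that] by (simp add: field_ring_def)
  show mult: "x * y \<in> R" if "x \<in> R" "y \<in> R" for x y
    using submonoid.m_closed[OF subring.axioms(2)[OF R_subring] that] by (simp add: field_ring_def)
  show int: "of_int m \<in> R" for m using int_R ring_of_integers_of_int[of m, where 'a = 'k] by blast
  show "x - y \<in> R" if "x \<in> R" "y \<in> R"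
    using add[OF that(1) mult[OF int[of "-1"] that(2)]] by simp
qed

lemma R_subgroup: "add_subgroup R"
  using R_closed(3)[of 0] R_closed(4) by (simp add: add_subgroup_def)

lemma scaled_subgroup: "add_subgroup A \<Longrightarrow> add_subgroup ((*) a ` A)" for A :: "'k set"
  by (rule add_subgroup_image[where g = "(*) a"]) (auto simp: right_diff_distrib)

text \<open>Finitely many elements of \<open>R\<close> have a common denominator, so a multiple of them
  lies in a group \<open>N\<close> of finite index in \<open>\<int>\<^sub>K\<close>. Since
  \<open>N\<close> and \<open>\<int>\<^sub>K\<close> are commensurable, \<open>a\<close> has
  the same index in both; inequivalence modulo \<open>a R\<close> is stronger than modulo
  \<open>a N\<close>.\<close>

lemma overring_residues_le:
  assumes a: "a \<in> Z\<^sub>K" "a \<noteq> 0" and X: "finite X" "X \<subseteq> R"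
    and sep: "\<And>x y. x \<in> X \<Longrightarrow> y \<in> X \<Longrightarrow> x - y \<in> (*) a ` R \<Longrightarrow> x = y"
  shows "real (card X) \<le> abs_prod a"
proof -
  obtain t where t: "t \<in> Z\<^sub>K" "t \<noteq> 0" "\<forall>x\<in>X. t * x \<in> Z\<^sub>K" using common_integral_multiple[OF X(1)] by blast
  define N where "N = (*) t ` {y \<in> R. t * y \<in> Z\<^sub>K}"
  define aN where "aN = (*) a ` N"
  have "add_subgroup {y \<in> R. t * y \<in> Z\<^sub>K}"
    using add_subgroupD(1,2)[OF R_subgroup] add_subgroupD(1,2)[OF ring_of_integers_subgroup[where 'k = 'k]]
    by (simp add: add_subgroup_def right_diff_distrib)
  then have N: "add_subgroup N" unfolding N_def by (rule scaled_subgroup)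
  have aNs: "add_subgroup aN" unfolding aN_def using N by (rule scaled_subgroup)
  have NZ: "N \<subseteq> Z\<^sub>K" by (auto simp: N_def)
  have tZ: "(*) t ` Z\<^sub>K \<subseteq> N"
  proof (rule image_subsetI)
    fix x assume x: "x \<in> Z\<^sub>K"
    show "t * x \<in> N" unfolding N_def by (rule imageI) (use x int_R ring_of_integers_mult[OF t(1) x] in blast)
  qed
  have "finite_index Z\<^sub>K N"
    using index_tower(2)[OF ring_of_integers_subgroup N scaled_subgroup[OF ring_of_integers_subgroup] tZ NZ] index_integers(1)[OF t(1,2)]
    by blast
  note ZN = gen_index_sub[OF ring_of_integers_subgroup N NZ this]
  have aZ: "(*) a ` Z\<^sub>K \<subseteq> Z\<^sub>K" using ring_of_integers_mult[OF a(1)] by (rule image_subsetI)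
  note ZaZ = gen_index_sub[OF ring_of_integers_subgroup scaled_integers_subgroup aZ index_integers(1)[OF a]]
  have inj: "inj_on ((*) a) A" for A using a(2) by (simp add: inj_on_def)
  have img: "gen_index ((*) a ` Z\<^sub>K) aN = gen_index Z\<^sub>K N" "commensurable ((*) a ` Z\<^sub>K) aN"
    unfolding aN_def by (rule gen_index_image[OF ZN(2) _ inj], simp add: right_diff_distrib)+
  note NZ' = commensurable_sym[OF ZN(2)]
  have "gen_index N Z\<^sub>K * gen_index Z\<^sub>K N = gen_index N N" using gen_index_trans(1)[OF NZ' ZN(2)] by simp
  also have "gen_index N N = 1"
  proof -
    have "gen_index Z\<^sub>K N * gen_index N N = gen_index Z\<^sub>K N"
      using gen_index_trans(1)[OF ZN(2) gen_index_trans(2)[OF NZ' ZN(2)]] by simp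
    then show ?thesis using gen_index_pos[OF ZN(2)] by simp
  qed
  finally have one: "gen_index N Z\<^sub>K * gen_index Z\<^sub>K N = 1" .
  note c1 = gen_index_trans[OF NZ' ZaZ(2)]
  note c2 = gen_index_trans[OF c1(2) img(2)]
  have aN: "aN \<subseteq> N"
  proof
    fix x assume "x \<in> aN"
    then obtain y where y: "y \<in> R" "t * y \<in> Z\<^sub>K" "x = a * (t * y)" unfolding aN_def N_def by blast
    have "a * y \<in> {y \<in> R. t * y \<in> Z\<^sub>K}"
      using R_closed(2)[of a y] y(1) int_R a(1) ring_of_integers_mult[OF a(1) y(2)] by (auto simp: mult.left_commute)
    then have "t * (a * y) \<in> N" unfolding N_def by (rule imageI)
    then show "x \<in> N" using y(3) by (simp add: mult.left_commute)
  qed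
  have fi: "finite_index N aN" using c2(2) Int_absorb1[OF aN] by (simp add: commensurable_def)
  have "real (index N aN) = gen_index N aN" using gen_index_sub(1)[OF N aNs aN fi] by simp
  also have "\<dots> = gen_index N Z\<^sub>K * gen_index Z\<^sub>K N * index Z\<^sub>K ((*) a ` Z\<^sub>K)"
    by (simp only: c2(1) c1(1) img(1) ZaZ(1) mult_ac)
  finally have ix: "index N aN = index Z\<^sub>K ((*) a ` Z\<^sub>K)" by (simp add: one)
  have "inj_on (\<lambda>x. coset aN (t * x)) X"
  proof (rule inj_onI)
    fix x y assume xy: "x \<in> X" "y \<in> X" "coset aN (t * x) = coset aN (t * y)"
    then have "t * x - t * y \<in> aN" using coset_eq_iff[OF aNs] by simp
    then obtain z where z: "z \<in> R" "t * x - t * y = a * (t * z)" unfolding aN_def N_def by blast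
    then have "t * (x - y) = t * (a * z)" by (simp add: algebra_simps)
    then have "x - y = a * z" using t(2) by simp
    then show "x = y" using z(1) by (intro sep[OF xy(1,2)]) (rule image_eqI)
  qed
  then have "card X = card ((\<lambda>x. coset aN (t * x)) ` X)" by (rule card_image[symmetric])
  also have "\<dots> \<le> card (coset aN ` N)"
  proof (rule card_mono)
    show "finite (coset aN ` N)" using fi by (simp add: finite_index_def)
    show "(\<lambda>x. coset aN (t * x)) ` X \<subseteq> coset aN ` N"
    proof (rule image_subsetI)
      fix x assume "x \<in> X"
      then have "t * x \<in> N" unfolding N_def using X(2) t(3) by (intro imageI) blast
      then show "coset aN (t * x) \<in> coset aN ` N" by (rule imageI)
    qed
  qed
  finally have "real (card X) \<le> index Z\<^sub>K ((*) a ` Z\<^sub>K)" by (simp only: index_def[symmetric] ix of_nat_le_iff)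
  then show ?thesis using index_integers(2)[OF a] by linarith
qed

lemma index_overring:
  assumes "a \<in> Z\<^sub>K" "a \<noteq> 0"
  shows "finite_index R ((*) a ` R)" "real (index R ((*) a ` R)) \<le> abs_prod a"
  by (rule index_le_if_residues_le[OF scaled_subgroup[OF R_subgroup]], rule overring_residues_le[OF assms], blast+)+

sublocale R: dedekind_subring R
proof
  show "x - y \<in> R" "x * y \<in> R" if "x \<in> R" "y \<in> R" for x y using R_closed(4,2) that by blast+
  show "1 \<in> R" using R_closed(3)[of 1] by simp
  show "finite_index R ((*) x ` R)" if x: "x \<in> R" "x \<noteq> 0" for x
  proof -
    obtain D :: nat where D: "D > 0" "of_nat D * x \<in> Z\<^sub>K" using integral_multiple by blast
    have f: "finite_index R ((*) (of_nat D * x) ` R)" using D x(2) by (intro index_overring) auto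
    have "(*) (of_nat D * x) ` R \<subseteq> (*) x ` R"
    proof (rule image_subsetI)
      fix y assume "y \<in> R"
      then have "of_nat D * y \<in> R" using R_closed(2) R_closed(3)[of "int D"] by simp
      moreover have "of_nat D * x * y = x * (of_nat D * y)" by (simp add: mult_ac)
      ultimately show "of_nat D * x * y \<in> (*) x ` R" by (rule image_eqI[rotated])
    qed
    moreover have "(*) x ` R \<subseteq> R" using R_closed(2) x(1) by blast
    ultimately show ?thesis
      using index_tower(2)[OF R_subgroup scaled_subgroup[OF R_subgroup] scaled_subgroup[OF R_subgroup]] f by blast
  qed
  show "\<exists>a\<in>R. \<exists>b\<in>R. b \<noteq> 0 \<and> k = a / b" for k
  proof -
    obtain D :: nat where D: "D > 0" "of_nat D * k \<in> Z\<^sub>K" using integral_multiple by blast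
    have "of_nat D \<in> R" using R_closed(3)[of "int D"] by simp
    then show ?thesis using D int_R by (intro bexI[of _ "of_nat D * k"] bexI[of _ "of_nat D"]) auto
  qed
  show "1 \<in> J" if J: "ideal_in R J" "\<And>c. c \<in> R \<Longrightarrow> r * c \<in> R \<Longrightarrow> c \<in> J \<and> r * c \<in> J" for J r
    by (rule overring_prufer[OF int_R _ R_closed(4) J(2) algebraic]) (use J(1) in \<open>simp_all add: ideal_in_def\<close>)
qed

lemma canonical_norm_integer_le:
  assumes "x \<in> Z\<^sub>K" shows "canonical_norm R x \<le> abs_prod x"
proof (cases "x = 0")
  case True
  then show ?thesis by (simp add: canonical_norm_def abs_prod_def prod_nonneg)
next
  case False
  then show ?thesis using R.canonical_norm_eq R.elem_norm_in_R[of x] index_overring(2)[OF assms False] int_R assms by auto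
qed

text \<open>A product of \<open>n\<close> sets of integers with small differences has more elements than
  there are classes modulo \<open>\<Lambda>\<close>; two congruent elements differ by the
  vector sought. The radii \<open>\<rho>\<close> are chosen such that the mean inequality
  turns them into the bounds \<open>\<eta>\<close>.\<close>

lemma minkowski:
  fixes \<Lambda> :: "(nat \<Rightarrow> 'k) set" and n :: nat
  defines "Zn \<equiv> {f :: nat \<Rightarrow> 'k. (\<forall>i<n. f i \<in> Z\<^sub>K) \<and> (\<forall>i\<ge>n. f i = 0)}"
  assumes \<Lambda>: "add_subgroup \<Lambda>" "finite_index Zn (Zn \<inter> \<Lambda>)"
    and \<eta>: "\<forall>i<n. \<eta> i > 0" and less: "real (index Zn (Zn \<inter> \<Lambda>)) < (\<Prod>i<n. \<eta> i / minkowski_constant)"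
  obtains f where "f \<in> \<Lambda>" "f \<in> Zn" "f \<noteq> 0" "\<forall>i<n. abs_prod (f i) \<le> \<eta> i"
proof -
  define \<rho> where "\<rho> i = real d * root d (\<eta> i)" for i
  have \<rho>: "\<rho> i > 0" "(\<rho> i / real d) ^ d = \<eta> i" if "i < n" for i
    using d_pos \<eta> that by (simp_all add: \<rho>_def real_root_pow_pos)
  have vol: "(\<rho> i / 2) ^ d * gauge_volume = \<eta> i / minkowski_constant" if "i < n" for i
  proof -
    have "\<rho> i / 2 = \<rho> i / real d * (real d / 2)" using d_pos by simp
    then have "(\<rho> i / 2) ^ d * gauge_volume = (\<rho> i / real d) ^ d * ((real d / 2) ^ d * gauge_volume)"
      by (simp only: power_mult_distrib mult.assoc)
    then show ?thesis using \<rho>(2)[OF that] by (simp only: gauge_volume_eq) simp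
  qed
  have "\<exists>T. i < n \<longrightarrow> finite T \<and> T \<subseteq> Z\<^sub>K \<and> real (card T) \<ge> \<eta> i / minkowski_constant \<and> (\<forall>x\<in>T. \<forall>y\<in>T. abs_sum (x - y) \<le> \<rho> i)" for i
  proof (cases "i < n")
    case True
    obtain T where "finite T" "T \<subseteq> Z\<^sub>K" "real (card T) \<ge> (\<rho> i / 2) ^ d * gauge_volume" "\<forall>x\<in>T. \<forall>y\<in>T. abs_sum (x - y) \<le> \<rho> i"
      using close_integers[OF \<rho>(1)[OF True]] .
    then show ?thesis unfolding vol[OF True] by blast
  qed blast
  then obtain T where T: "\<And>i. i < n \<Longrightarrow> finite (T i) \<and> T i \<subseteq> Z\<^sub>K \<and> real (card (T i)) \<ge> \<eta> i / minkowski_constant \<and>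
      (\<forall>x\<in>T i. \<forall>y\<in>T i. abs_sum (x - y) \<le> \<rho> i)" by metis
  define ext where "ext f = (\<lambda>i. if i < n then f i else (0 :: 'k))" for f
  define F where "F = (\<Pi>\<^sub>E i\<in>{..<n}. T i)"
  have finF: "finite F" unfolding F_def using T by (intro finite_PiE) auto
  have extF: "ext f \<in> Zn" if "f \<in> F" for f
  proof -
    have "f i \<in> Z\<^sub>K" if "i < n" for i using T[OF that] \<open>f \<in> F\<close> that unfolding F_def by blast
    then show ?thesis by (simp add: Zn_def ext_def)
  qed
  have Zn: "add_subgroup Zn"
    using add_subgroupD(1,2)[OF ring_of_integers_subgroup[where 'k = 'k]] by (simp add: Zn_def add_subgroup_def)
  have ZL: "add_subgroup (Zn \<inter> \<Lambda>)" using Zn \<Lambda>(1) by (rule add_subgroup_Int)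
  have "real (index Zn (Zn \<inter> \<Lambda>)) < (\<Prod>i<n. real (card (T i)))"
    using less by (rule less_le_trans) (intro prod_mono, use T \<eta> minkowski_constant_pos in \<open>auto simp: less_imp_le\<close>)
  also have "\<dots> = real (card F)" by (simp add: F_def card_PiE)
  finally have "card (coset (Zn \<inter> \<Lambda>) ` Zn) < card F" by (simp add: index_def)
  moreover have "card ((\<lambda>f. coset (Zn \<inter> \<Lambda>) (ext f)) ` F) \<le> card (coset (Zn \<inter> \<Lambda>) ` Zn)"
  proof (rule card_mono)
    show "finite (coset (Zn \<inter> \<Lambda>) ` Zn)" using \<Lambda>(2) by (simp add: finite_index_def)
    show "(\<lambda>f. coset (Zn \<inter> \<Lambda>) (ext f)) ` F \<subseteq> coset (Zn \<inter> \<Lambda>) ` Zn"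
      by (rule image_subsetI, rule imageI, rule extF)
  qed
  ultimately have "\<not> inj_on (\<lambda>f. coset (Zn \<inter> \<Lambda>) (ext f)) F" using card_image by fastforce
  then obtain f g where fg: "f \<in> F" "g \<in> F" "coset (Zn \<inter> \<Lambda>) (ext f) = coset (Zn \<inter> \<Lambda>) (ext g)" "f \<noteq> g"
    unfolding inj_on_def by blast
  have "ext f - ext g \<in> Zn \<inter> \<Lambda>" using fg(3) coset_eq_iff[OF ZL] by blast
  moreover have "ext f - ext g \<noteq> 0"
  proof
    assume "ext f - ext g = 0"
    then have e: "ext f i = ext g i" for i by (metis eq_iff_diff_eq_0)
    have "f i = g i" if "i \<in> {..<n}" for i using e[of i] that by (simp add: ext_def)
    then have "f = g" using fg(1,2) unfolding F_def by (intro PiE_ext)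
    then show False using fg(4) by blast
  qed
  moreover have "abs_prod ((ext f - ext g) i) \<le> \<eta> i" if i: "i < n" for i
  proof -
    have "f i \<in> T i" "g i \<in> T i" using fg(1,2) i unfolding F_def by (auto simp: PiE_iff)
    then have "abs_sum (f i - g i) \<le> \<rho> i" using T[OF i] by blast
    moreover have "abs_sum (f i - g i) \<ge> 0" by (simp add: abs_sum_def sum_nonneg)
    ultimately have "(abs_sum (f i - g i) / real d) ^ d \<le> (\<rho> i / real d) ^ d"
      by (intro power_mono divide_right_mono) auto
    then have "abs_prod (f i - g i) \<le> \<eta> i" using abs_prod_le[of "f i - g i"] \<rho>(2)[OF i] by linarith
    then show ?thesis using i by (simp add: ext_def)
  qed
  ultimately show ?thesis using that[of "ext f - ext g"] by blast
qed

lemma invertible_det: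
  assumes "M \<in> carrier_mat n n" "invertible_mat M"
  shows "Determinant.det M \<noteq> (0 :: 'k)"
proof
  assume z: "Determinant.det M = 0"
  obtain B where B: "inverts_mat M B" "inverts_mat B M" using assms(2) unfolding invertible_mat_def by blast
  have BM: "B * M = 1\<^sub>m (dim_row B)" and MB: "M * B = 1\<^sub>m (dim_row M)" using B by (simp_all add: inverts_mat_def)
  have "dim_col (B * M) = n" using assms(1) by simp
  then have "dim_row B = n" unfolding BM by simp
  moreover have "dim_col (M * B) = dim_row M" unfolding MB by simp
  then have "dim_col B = n" using assms(1) by simp
  ultimately have Bc: "B \<in> carrier_mat n n" by (rule carrier_matI)
  have "Determinant.det (M * B) = Determinant.det M * Determinant.det B" using assms(1) Bc by (rule Determinant.det_mult)
  then show False using z MB assms(1) by simp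
qed

text \<open>A multiple \<open>\<beta> M L\<close> of the image lies in \<open>R\<^sup>n\<close>, and its
  index there is the left side of the inequality times \<open>|\<beta>|\<^sup>n\<close>. The
  index of its trace in the integer vectors is at most as large, and the factor
  \<open>|\<beta>|\<close> is absorbed in each bound \<open>\<epsilon>\<^sub>i\<close>.\<close>

theorem strict_linear_form:
  assumes M: "M \<in> carrier_mat n n" "invertible_mat M" and L: "is_lattice R n L"
    and \<epsilon>: "\<forall>i<n. \<epsilon> i > 0"
    and less: "canonical_norm R (Determinant.det M) * covol R n L < (\<Prod>i<n. \<epsilon> i / minkowski_constant)"
  obtains x where "x \<in> L" "x \<noteq> 0\<^sub>v n" "\<forall>i<n. canonical_norm R (\<Sum>j<n. M $$ (i, j) * vec_index x j) \<le> \<epsilon> i"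
proof -
  have dM: "Determinant.det M \<noteq> 0" using invertible_det[OF M] .
  note L' = R.covol_eq_index[OF L]
  have "R.lattice_map n (mat_apply n M)"
    using R.distortion_det(1)[OF M(1) dM] .
  then have "R.lattice_like n (mat_apply n M ` of_vec ` L)" using L'(1) by (rule R.lattice_map_image)
  then obtain \<beta> where \<beta>: "\<beta> \<in> R" "\<beta> \<noteq> 0" "\<forall>f \<in> mat_apply n M ` of_vec ` L. vscale \<beta> f \<in> R.std_lattice n"
    unfolding R.lattice_like_def by (elim conjE bexE)
  define A where "A = \<beta> \<cdot>\<^sub>m M"
  have A: "A \<in> carrier_mat n n" using M(1) by (simp add: A_def)
  have detA: "Determinant.det A = \<beta> ^ n * Determinant.det M" using M(1) by (simp add: A_def det_smult)
  then have dA: "Determinant.det A \<noteq> 0" using dM \<beta>(2) by simp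
  have Aap: "mat_apply n A f = vscale \<beta> (mat_apply n M f)" for f
    using M(1) by (auto simp: mat_apply_def vscale_def A_def fun_eq_iff sum_distrib_left mult.assoc)
  note gA = R.distortion_det[OF A dA]
  define \<Lambda> where "\<Lambda> = mat_apply n A ` of_vec ` L"
  have \<Lambda>: "R.lattice_like n \<Lambda>" unfolding \<Lambda>_def using gA(1) L'(1) by (rule R.lattice_map_image)
  have \<Lambda>s: "add_subgroup \<Lambda>" using \<Lambda> by (simp add: R.lattice_like_def)
  have \<Lambda>R: "\<Lambda> \<subseteq> R.std_lattice n"
  proof
    fix h assume "h \<in> \<Lambda>"
    then obtain f where "h = mat_apply n A f" "f \<in> of_vec ` L" unfolding \<Lambda>_def by blast
    then show "h \<in> R.std_lattice n" using \<beta>(3) by (simp only: Aap) blast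
  qed
  have stds: "add_subgroup (R.std_lattice n)" using R.std_lattice_like by (simp add: R.lattice_like_def)
  have fi: "finite_index (R.std_lattice n) \<Lambda>"
    using R.lattice_like_commensurable[OF R.std_lattice_like \<Lambda>] Int_absorb1[OF \<Lambda>R] by (simp add: commensurable_def)
  have "real (index (R.std_lattice n) \<Lambda>) = gen_index (R.std_lattice n) \<Lambda>"
    using gen_index_sub(1)[OF stds \<Lambda>s \<Lambda>R fi] by simp
  also have "\<dots> = R.elem_norm (Determinant.det A) * covol R n L"
    unfolding \<Lambda>_def R.distortion_index[OF gA(1) L'(1)] gA(2) L'(2) ..
  also have "R.elem_norm (Determinant.det A) = R.elem_norm \<beta> ^ n * canonical_norm R (Determinant.det M)"
    unfolding detA using dM \<beta>(2) by (simp add: R.elem_norm_mult R.elem_norm_power R.canonical_norm_eq)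
  finally have ix: "real (index (R.std_lattice n) \<Lambda>) = R.elem_norm \<beta> ^ n * (canonical_norm R (Determinant.det M) * covol R n L)"
    by (simp only: mult.assoc)
  have N\<beta>: "R.elem_norm \<beta> > 0" using \<beta>(2) by (rule R.elem_norm_pos)
  define Zn where "Zn = {f :: nat \<Rightarrow> 'k. (\<forall>i<n. f i \<in> Z\<^sub>K) \<and> (\<forall>i\<ge>n. f i = 0)}"
  have Zn: "add_subgroup Zn"
    using add_subgroupD(1,2)[OF ring_of_integers_subgroup[where 'k = 'k]] by (simp add: Zn_def add_subgroup_def)
  have ZR: "Zn \<subseteq> R.std_lattice n" using int_R by (auto simp: Zn_def R.std_lattice_def coord_space_def)
  note ii = index_Int_le[OF Zn \<Lambda>s ZR fi]
  have "real (index Zn (Zn \<inter> \<Lambda>)) \<le> R.elem_norm \<beta> ^ n * (canonical_norm R (Determinant.det M) * covol R n L)"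
    unfolding ix[symmetric] using ii(1) by simp
  also have "\<dots> < R.elem_norm \<beta> ^ n * (\<Prod>i<n. \<epsilon> i / minkowski_constant)" using less N\<beta> by simp
  also have "\<dots> = (\<Prod>i<n. R.elem_norm \<beta> * \<epsilon> i / minkowski_constant)"
  proof -
    have "(\<Prod>i<n. R.elem_norm \<beta> * \<epsilon> i / minkowski_constant) = (\<Prod>i<n. R.elem_norm \<beta> * (\<epsilon> i / minkowski_constant))" by simp
    then show ?thesis by (simp only: prod.distrib) simp
  qed
  finally have lt: "real (index Zn (Zn \<inter> \<Lambda>)) < (\<Prod>i<n. R.elem_norm \<beta> * \<epsilon> i / minkowski_constant)" .
  have pos: "\<forall>i<n. R.elem_norm \<beta> * \<epsilon> i > 0" using N\<beta> \<epsilon> by simp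
  obtain h where h: "h \<in> \<Lambda>" "h \<in> Zn" "h \<noteq> 0" "\<forall>i<n. abs_prod (h i) \<le> R.elem_norm \<beta> * \<epsilon> i"
    using minkowski[OF \<Lambda>s ii(2)[unfolded Zn_def] pos lt[unfolded Zn_def]] unfolding Zn_def by blast
  obtain x where x: "x \<in> L" "h = mat_apply n A (of_vec x)" using h(1) unfolding \<Lambda>_def by blast
  have xc: "x \<in> carrier_vec n" using x(1) L'(3) by blast
  show ?thesis
  proof (rule that[OF x(1)])
    show "x \<noteq> 0\<^sub>v n"
    proof
      assume "x = 0\<^sub>v n"
      then have "h = 0" unfolding x(2) by (simp add: of_vec_zero mat_apply_def fun_eq_iff)
      then show False using h(3) by blast
    qed
    show "\<forall>i<n. canonical_norm R (\<Sum>j<n. M $$ (i, j) * vec_index x j) \<le> \<epsilon> i"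
    proof (intro allI impI)
      fix i assume i: "i < n"
      define y where "y = (\<Sum>j<n. M $$ (i, j) * vec_index x j)"
      have "h i = \<beta> * y"
        using i xc unfolding x(2) Aap by (simp add: vscale_def mat_apply_def y_def of_vec_def)
      moreover have "canonical_norm R (h i) \<le> R.elem_norm \<beta> * \<epsilon> i"
        using canonical_norm_integer_le[of "h i"] h(2,4) i by (fastforce simp: Zn_def)
      ultimately have le: "canonical_norm R (\<beta> * y) \<le> R.elem_norm \<beta> * \<epsilon> i" by simp
      show "canonical_norm R y \<le> \<epsilon> i"
      proof (cases "y = 0")
        case True
        then show ?thesis using \<epsilon> i by (simp add: canonical_norm_def less_imp_le)
      next
        case False
        then have "R.elem_norm \<beta> * R.elem_norm y \<le> R.elem_norm \<beta> * \<epsilon> i"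
          using le \<beta>(2) by (simp add: R.canonical_norm_eq R.elem_norm_mult)
        then show ?thesis using N\<beta> False by (simp add: R.canonical_norm_eq)
      qed
    qed
  qed
qed

end

section \<open>The linear constant\<close>

context integral_overring
begin

lemma norm_group_eq: "norm_group R = R.elem_norm ` {x. x \<noteq> 0}"
  unfolding norm_group_def by (rule image_cong[OF refl]) (simp add: R.canonical_norm_eq)

abbreviation "G \<equiv> closed_norm_group R"

lemma norm_in_G: "x \<noteq> 0 \<Longrightarrow> canonical_norm R x \<in> G"
  using R.elem_norm_pos[of x] closure_subset[of "norm_group R"]
  by (auto simp: closed_norm_group_def norm_group_eq R.canonical_norm_eq)

lemma G_pos: "g \<in> G \<Longrightarrow> g > 0" by (simp add: closed_norm_group_def)

lemma G_limit: "g \<in> G \<longleftrightarrow> g > 0 \<and> (\<exists>f. (\<forall>k. f k \<in> norm_group R) \<and> f \<longlonglongrightarrow> g)"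
  by (auto simp: closed_norm_group_def closure_sequential)

lemma norm_group_mult: "u \<in> norm_group R \<Longrightarrow> v \<in> norm_group R \<Longrightarrow> u * v \<in> norm_group R"
proof -
  assume "u \<in> norm_group R" "v \<in> norm_group R"
  then obtain x y where "x \<noteq> 0" "u = R.elem_norm x" "y \<noteq> 0" "v = R.elem_norm y"
    unfolding norm_group_eq by blast
  then show ?thesis unfolding norm_group_eq by (intro image_eqI[of _ _ "x * y"]) (simp_all add: R.elem_norm_mult)
qed

lemma norm_group_inverse: "u \<in> norm_group R \<Longrightarrow> inverse u \<in> norm_group R"
proof -
  assume "u \<in> norm_group R"
  then obtain x where x: "x \<noteq> 0" "u = R.elem_norm x" unfolding norm_group_eq by blast
  have "R.elem_norm (inverse x) * R.elem_norm x = 1"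
    using x(1) R.elem_norm_mult[of "inverse x" x] R.elem_norm_1 by simp
  then have "inverse u = R.elem_norm (inverse x)" using x(2) R.elem_norm_pos[OF x(1)] by (simp add: field_simps)
  then show ?thesis unfolding norm_group_eq using x(1) by (intro image_eqI[of _ _ "inverse x"]) simp_all
qed

lemma G_mult: "u \<in> G \<Longrightarrow> v \<in> G \<Longrightarrow> u * v \<in> G"
proof -
  assume uv: "u \<in> G" "v \<in> G"
  obtain f g where "\<forall>k. f k \<in> norm_group R" "f \<longlonglongrightarrow> u" "\<forall>k. g k \<in> norm_group R" "g \<longlonglongrightarrow> v"
    using uv unfolding G_limit by blast
  then have "\<forall>k. f k * g k \<in> norm_group R" "(\<lambda>k. f k * g k) \<longlonglongrightarrow> u * v"
    using norm_group_mult tendsto_mult by blast+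
  moreover have "u * v > 0" using G_pos uv by simp
  ultimately show ?thesis unfolding G_limit by (intro conjI exI[of _ "\<lambda>k. f k * g k"])
qed

lemma G_inverse: "u \<in> G \<Longrightarrow> inverse u \<in> G"
proof -
  assume u: "u \<in> G"
  obtain f where f: "\<forall>k. f k \<in> norm_group R" "f \<longlonglongrightarrow> u" using u unfolding G_limit by blast
  have "(\<lambda>k. inverse (f k)) \<longlonglongrightarrow> inverse u" using f(2) G_pos[OF u] by (intro tendsto_inverse) auto
  moreover have "\<forall>k. inverse (f k) \<in> norm_group R" using f(1) norm_group_inverse by blast
  moreover have "inverse u > 0" using G_pos[OF u] by simp
  ultimately show ?thesis unfolding G_limit by (intro conjI exI[of _ "\<lambda>k. inverse (f k)"])
qed

lemma G_1: "1 \<in> G" using norm_in_G[of 1] by (simp add: R.canonical_norm_eq R.elem_norm_1)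

lemma G_power: "u \<in> G \<Longrightarrow> u ^ k \<in> G"
  by (induction k) (simp_all add: G_1 G_mult)

text \<open>A smaller constant would yield a nonzero algebraic integer of norm less than
  \<open>1\<close>.\<close>

lemma minkowski_constant_ge_1: "minkowski_constant \<ge> 1"
proof (rule ccontr)
  assume "\<not> ?thesis"
  then obtain \<eta> where \<eta>: "minkowski_constant < \<eta>" "\<eta> < 1" using dense by (auto simp: not_le)
  define Zn where "Zn = {f :: nat \<Rightarrow> 'k. (\<forall>i<1. f i \<in> Z\<^sub>K) \<and> (\<forall>i\<ge>1. f i = 0)}"
  have "add_subgroup Zn"
    using add_subgroupD(1,2)[OF ring_of_integers_subgroup[where 'k = 'k]] by (simp add: Zn_def add_subgroup_def)
  then have i1: "index Zn (Zn \<inter> UNIV) = 1" and f1: "finite_index Zn (Zn \<inter> UNIV)"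
    using index_self[of Zn] by simp_all
  have p: "\<forall>i<1::nat. (\<lambda>_. \<eta>) i > 0" using \<eta>(1) minkowski_constant_pos by simp
  have l: "real (index Zn (Zn \<inter> UNIV)) < (\<Prod>i<1::nat. \<eta> / minkowski_constant)"
    using \<eta>(1) minkowski_constant_pos by (simp add: i1[simplified])
  obtain f :: "nat \<Rightarrow> 'k" where "f \<in> UNIV" and f: "f \<in> {f. (\<forall>i<1. f i \<in> Z\<^sub>K) \<and> (\<forall>i\<ge>1. f i = 0)}" "f \<noteq> 0" "\<forall>i<1. abs_prod (f i) \<le> \<eta>"
    by (rule minkowski[OF add_subgroup_UNIV f1[unfolded Zn_def] p l[unfolded Zn_def]])
  have f1: "f i = 0" if "i \<ge> 1" for i using f(1) that by simp
  have nz: "f 0 \<noteq> 0"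
  proof
    assume z: "f 0 = 0"
    have "f i = 0" for i
    proof (cases "i = 0")
      case True then show ?thesis using z by simp
    next
      case False then show ?thesis by (intro f1) simp
    qed
    then have "f = 0" unfolding fun_eq_iff zero_fun_apply by blast
    with f(2) show False by (rule notE)
  qed
  have f0: "f 0 \<in> Z\<^sub>K" using f(1) by simp
  have "f 0 \<in> R" using f0 int_R by blast
  then have "canonical_norm R (f 0) = real (index R ((*) (f 0) ` R))"
    using R.canonical_norm_eq[OF nz] R.elem_norm_in_R[OF _ nz] by simp
  moreover have "index R ((*) (f 0) ` R) > 0" by (rule index_pos[OF R_subgroup index_overring(1)[OF f0 nz]])
  ultimately have "canonical_norm R (f 0) \<ge> 1" by simp
  moreover have "abs_prod (f 0) \<le> \<eta>" using f(3) by simp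
  ultimately show False using canonical_norm_integer_le[OF f0] \<eta>(2) by linarith
qed

text \<open>All elements of the closed norm group below \<open>\<mu>\<close> are admissible. If they do
  not approach \<open>\<mu>\<close> and the group is nontrivial, let \<open>C\<^sub>0 < \<mu>
  \<le> C\<^sub>1\<close> be its elements adjacent to \<open>\<mu>\<close>; then it has no
  elements between \<open>1\<close> and \<open>C\<^sub>1 / C\<^sub>0\<close>. Multiplying one
  \<open>\<epsilon>\<^sub>i\<close> by some \<open>q < C\<^sub>1 / C\<^sub>0\<close> makes the
  inequality for \<open>C\<^sub>1\<close> strict, and a norm at most \<open>q
  \<epsilon>\<^sub>i\<close> is at most \<open>\<epsilon>\<^sub>i\<close>.\<close>

theorem linear_constant_ge:
  assumes n: "n \<ge> 1"
  shows "linear_constant R n \<ge> ereal (minkowski_constant powi (- int n))"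
proof -
  define \<mu> where "\<mu> = inverse (minkowski_constant ^ n)"
  have \<mu>: "\<mu> > 0" using minkowski_constant_pos by (simp add: \<mu>_def)
  have prod: "(\<Prod>i<n. \<epsilon> i / minkowski_constant) = \<mu> * (\<Prod>i<n. \<epsilon> i)" for \<epsilon>
    by (simp add: \<mu>_def prod_dividef field_simps)
  have pp: "(\<Prod>i<n. \<epsilon> i) > 0" if "\<forall>i<n. \<epsilon> i \<in> G" for \<epsilon>
    using that G_pos by (intro prod_pos) auto
  have upper: "ereal C \<le> linear_constant R n" if "C \<in> G" "admissible_constant R n C" for C
    unfolding linear_constant_def by (rule Sup_upper) (use that in blast)
  have adm_less: "admissible_constant R n C" if C: "C < \<mu>" for C
    unfolding admissible_constant_def
  proof (intro allI impI, elim conjE)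
    fix M :: "'k mat" and L \<epsilon>
    assume h: "M \<in> carrier_mat n n" "invertible_mat M" "is_lattice R n L" "\<forall>i<n. \<epsilon> i \<in> G"
      and le: "canonical_norm R (Determinant.det M) * covol R n L \<le> C * (\<Prod>i<n. \<epsilon> i)"
    have lt: "canonical_norm R (Determinant.det M) * covol R n L < (\<Prod>i<n. \<epsilon> i / minkowski_constant)"
      unfolding prod using le by (rule le_less_trans) (use C pp[OF h(4)] in simp)
    have "\<forall>i<n. \<epsilon> i > 0" using h(4) G_pos by blast
    then show "\<exists>x\<in>L. x \<noteq> 0\<^sub>v n \<and> (\<forall>i<n. canonical_norm R (\<Sum>j<n. M $$ (i, j) * vec_index x j) \<le> \<epsilon> i)"
      using strict_linear_form[OF h(1-3) _ lt] by blast
  qed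
  have reach: "\<exists>C\<in>G. C \<ge> \<mu> \<and> admissible_constant R n C" if gap: "\<exists>c<\<mu>. \<forall>g\<in>G. \<not> (c < g \<and> g < \<mu>)"
  proof (cases "G = {1}")
    case True
    have "\<mu> \<le> 1" using minkowski_constant_ge_1 by (simp add: \<mu>_def inverse_le_1_iff)
    moreover have "admissible_constant R n 1"
      unfolding admissible_constant_def
    proof (intro allI impI, elim conjE)
      fix M :: "'k mat" and L \<epsilon>
      assume h: "M \<in> carrier_mat n n" "invertible_mat M" "is_lattice R n L" "\<forall>i<n. \<epsilon> i \<in> G"
      define X where "X = canonical_norm R (Determinant.det M) * covol R n L"
      define B where "B = max 1 (X / \<mu> + 1)"
      have B1: "B \<ge> 1" by (simp add: B_def)
      have "X / \<mu> < B" by (simp add: B_def)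
      also have "B \<le> B ^ n" using n B1 by (intro self_le_power) simp_all
      finally have lt: "X < (\<Prod>i<n. B / minkowski_constant)"
        unfolding prod[of "\<lambda>_. B"] using \<mu> by (simp add: field_simps)
      have "B > 0" using B1 by linarith
      then have "\<forall>i<n. (\<lambda>_. B) i > 0" by simp
      then obtain x where x: "x \<in> L" "x \<noteq> 0\<^sub>v n"
        using strict_linear_form[OF h(1-3) _ lt[unfolded X_def]] by blast
      have "canonical_norm R y \<le> 1" for y
        using norm_in_G[of y] True by (cases "y = 0") (simp_all add: canonical_norm_def)
      moreover have "\<epsilon> i = 1" if "i < n" for i using h(4) True that by simp
      ultimately show "\<exists>x\<in>L. x \<noteq> 0\<^sub>v n \<and> (\<forall>i<n. canonical_norm R (\<Sum>j<n. M $$ (i, j) * vec_index x j) \<le> \<epsilon> i)"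
        using x by (intro bexI[of _ x]) simp_all
    qed
    ultimately show ?thesis using G_1 by blast
  next
    case False
    obtain c where c: "c < \<mu>" "\<And>g. g \<in> G \<Longrightarrow> \<not> (c < g \<and> g < \<mu>)" using gap by blast
    obtain v where v: "v \<in> G" "v \<noteq> 1" using False G_1 by blast
    obtain u where u: "u \<in> G" "u > 1"
    proof (cases "v > 1")
      case True then show ?thesis using v that by blast
    next
      case False
      then have "inverse v > 1" using v(2) G_pos[OF v(1)] by (simp add: one_less_inverse_iff)
      then show ?thesis using G_inverse[OF v(1)] that by blast
    qed
    obtain k where k: "u ^ k > \<mu>" using real_arch_pow[OF u(2)] by blast
    obtain l where l: "u ^ l > inverse \<mu>" using real_arch_pow[OF u(2)] by blast
    define S where "S = closure (norm_group R) \<inter> {\<mu>..}"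
    have SG: "S \<subseteq> G" using \<mu> by (auto simp: S_def closed_norm_group_def)
    have "u ^ k \<in> S" using G_power[OF u(1), of k] k by (auto simp: S_def closed_norm_group_def)
    then have C1S: "Inf S \<in> S"
      by (intro closed_contains_Inf) (auto simp: S_def intro!: bdd_belowI[of _ \<mu>] closed_Int)
    define C\<^sub>1 where "C\<^sub>1 = Inf S"
    have C1: "C\<^sub>1 \<in> G" "C\<^sub>1 \<ge> \<mu>" using C1S SG by (auto simp: C\<^sub>1_def S_def)
    have C1_le: "C\<^sub>1 \<le> g" if "g \<in> G" "g \<ge> \<mu>" for g
      unfolding C\<^sub>1_def by (rule cInf_lower) (use that in \<open>auto simp: S_def closed_norm_group_def intro!: bdd_belowI[of _ \<mu>]\<close>)
    define g\<^sub>0 where "g\<^sub>0 = inverse (u ^ l)"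
    have g0: "g\<^sub>0 \<in> G" using G_inverse[OF G_power[OF u(1)]] by (simp add: g\<^sub>0_def)
    have "inverse (u ^ l) < inverse (inverse \<mu>)" using l \<mu> by (intro less_imp_inverse_less) simp_all
    then have "g\<^sub>0 < \<mu>" by (simp add: g\<^sub>0_def)
    then have g0c: "g\<^sub>0 \<le> c" using c(2)[OF g0] by linarith
    define T where "T = closure (norm_group R) \<inter> {g\<^sub>0..c}"
    have "g\<^sub>0 \<in> T" using g0 g0c by (simp add: T_def closed_norm_group_def)
    then have C0T: "Sup T \<in> T"
      by (intro closed_contains_Sup) (auto simp: T_def intro!: bdd_aboveI[of _ c] closed_Int)
    define C\<^sub>0 where "C\<^sub>0 = Sup T"
    have C0: "C\<^sub>0 \<in> G" "C\<^sub>0 \<le> c" "C\<^sub>0 > 0" using C0T G_pos[OF g0] by (auto simp: C\<^sub>0_def T_def closed_norm_group_def)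
    have C0_ge: "g \<le> C\<^sub>0" if g: "g \<in> G" "g < \<mu>" for g
    proof (cases "g\<^sub>0 \<le> g")
      case True
      have "g \<le> c" using c(2)[OF g(1)] g(2) by linarith
      then have "g \<in> T" using True g(1) by (simp add: T_def closed_norm_group_def)
      then show ?thesis unfolding C\<^sub>0_def by (rule cSup_upper) (auto simp: T_def intro!: bdd_aboveI[of _ c])
    next
      case False
      then show ?thesis using C0T by (simp add: C\<^sub>0_def T_def)
    qed
    have no_gap: "\<not> (1 < g \<and> g < C\<^sub>1 / C\<^sub>0)" if g: "g \<in> G" for g
    proof
      assume "1 < g \<and> g < C\<^sub>1 / C\<^sub>0"
      then have "C\<^sub>0 < C\<^sub>0 * g" "C\<^sub>0 * g < C\<^sub>1" using C0(3) by (simp_all add: field_simps)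
      then show False using C0_ge[OF G_mult[OF C0(1) g]] C1_le[OF G_mult[OF C0(1) g]] by linarith
    qed
    have "C\<^sub>1 / \<mu> < C\<^sub>1 / C\<^sub>0" using C0 c(1) \<mu> G_pos[OF C1(1)] by (intro divide_strict_left_mono) auto
    then obtain q where q: "C\<^sub>1 / \<mu> < q" "q < C\<^sub>1 / C\<^sub>0" using dense by blast
    have "1 \<le> C\<^sub>1 / \<mu>" using C1(2) \<mu> by simp
    then have q1: "q > 1" using q(1) by linarith
    have "admissible_constant R n C\<^sub>1"
      unfolding admissible_constant_def
    proof (intro allI impI, elim conjE)
      fix M :: "'k mat" and L \<epsilon>
      assume h: "M \<in> carrier_mat n n" "invertible_mat M" "is_lattice R n L" "\<forall>i<n. \<epsilon> i \<in> G"
        and le: "canonical_norm R (Determinant.det M) * covol R n L \<le> C\<^sub>1 * (\<Prod>i<n. \<epsilon> i)"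
      define \<epsilon>' where "\<epsilon>' i = (if i = 0 then q * \<epsilon> i else \<epsilon> i)" for i
      have "(\<Prod>i<n. \<epsilon>' i) = (\<Prod>i<n. (if i = 0 then q else 1) * \<epsilon> i)"
        by (rule prod.cong) (simp_all add: \<epsilon>'_def)
      also have "\<dots> = q * (\<Prod>i<n. \<epsilon> i)" using n by (simp add: prod.distrib)
      finally have p': "(\<Prod>i<n. \<epsilon>' i) = q * (\<Prod>i<n. \<epsilon> i)" .
      have "C\<^sub>1 < \<mu> * q" using q(1) \<mu> by (simp add: field_simps)
      then have "C\<^sub>1 * (\<Prod>i<n. \<epsilon> i) < \<mu> * q * (\<Prod>i<n. \<epsilon> i)" using pp[OF h(4)] by simp
      then have lt: "canonical_norm R (Determinant.det M) * covol R n L < (\<Prod>i<n. \<epsilon>' i / minkowski_constant)"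
        unfolding prod p' using le by (simp add: mult.assoc)
      have "\<forall>i<n. \<epsilon>' i > 0" using h(4) G_pos q1 by (simp add: \<epsilon>'_def)
      then obtain x where x: "x \<in> L" "x \<noteq> 0\<^sub>v n"
        "\<forall>i<n. canonical_norm R (\<Sum>j<n. M $$ (i, j) * vec_index x j) \<le> \<epsilon>' i"
        using strict_linear_form[OF h(1-3) _ lt] by blast
      have tighten: "canonical_norm R y \<le> \<epsilon> i" if y: "canonical_norm R y \<le> \<epsilon>' i" and i: "i < n" for y i
      proof (cases "i = 0 \<and> y \<noteq> 0")
        case True
        have \<epsilon>: "\<epsilon> i \<in> G" "\<epsilon> i > 0" using h(4) i G_pos by blast+
        have "canonical_norm R y * inverse (\<epsilon> i) \<in> G" using True norm_in_G G_inverse[OF \<epsilon>(1)] G_mult by blast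
        then have "\<not> (1 < canonical_norm R y * inverse (\<epsilon> i) \<and> canonical_norm R y * inverse (\<epsilon> i) < C\<^sub>1 / C\<^sub>0)"
          by (rule no_gap)
        moreover have "canonical_norm R y * inverse (\<epsilon> i) \<le> q"
          using y True \<epsilon>(2) by (simp add: \<epsilon>'_def field_simps)
        ultimately have "canonical_norm R y * inverse (\<epsilon> i) \<le> 1" using q(2) by linarith
        then show ?thesis using \<epsilon>(2) by (simp add: field_simps)
      next
        case False
        then show ?thesis
          using y G_pos h(4) i by (cases "y = 0") (auto simp: \<epsilon>'_def canonical_norm_def less_imp_le)
      qed
      show "\<exists>x\<in>L. x \<noteq> 0\<^sub>v n \<and> (\<forall>i<n. canonical_norm R (\<Sum>j<n. M $$ (i, j) * vec_index x j) \<le> \<epsilon> i)"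
        using x tighten by blast
    qed
    then show ?thesis using C1 by blast
  qed
  have goal: "ereal \<mu> \<le> linear_constant R n" if gap: "\<exists>c<\<mu>. \<forall>g\<in>G. \<not> (c < g \<and> g < \<mu>)"
  proof -
    obtain C where C: "C \<in> G" "C \<ge> \<mu>" "admissible_constant R n C" using reach[OF gap] by blast
    have "ereal \<mu> \<le> ereal C" using C(2) by simp
    also have "\<dots> \<le> linear_constant R n" using C(1,3) by (rule upper)
    finally show ?thesis .
  qed
  have "ereal \<mu> \<le> linear_constant R n"
  proof (rule ccontr)
    assume nle: "\<not> ?thesis"
    then obtain z where z: "linear_constant R n < ereal z" "ereal z < ereal \<mu>"
      using ereal_dense2[of "linear_constant R n" "ereal \<mu>"] by (auto simp: not_le)
    have "z < \<mu>" using z(2) by simp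
    then obtain g where g: "g \<in> G" "z < g" "g < \<mu>" using goal nle by blast
    have "ereal g \<le> linear_constant R n" using upper[OF g(1) adm_less[OF g(3)]] .
    then have "ereal g < ereal z" using z(1) by (rule le_less_trans)
    then show False using g(2) by simp
  qed
  then show ?thesis by (simp add: \<mu>_def power_int_minus)
qed

end

section \<open>An index type for the embeddings\<close>

text \<open>An initial segment of the natural numbers, whose order supplies the well-ordered index type;
  the lower bound \<open>1\<close> makes the type nonempty for every field.\<close>

typedef (overloaded) 'k embedding_number = "{..<max 1 (field_degree TYPE('k::field_char_0))}"
  by (rule exI[of _ 0]) simp

instance embedding_number :: (field_char_0) finite
proof
  have "finite (Rep_embedding_number ` (UNIV :: 'a embedding_number set))"
    by (rule finite_subset[of _ "{..<max 1 (field_degree TYPE('a))}"]) (use Rep_embedding_number in auto)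
  then show "finite (UNIV :: 'a embedding_number set)"
    by (rule finite_imageD) (simp add: inj_on_def Rep_embedding_number_inject)
qed

instantiation embedding_number :: (field_char_0) wellorder
begin

definition less_eq_embedding_number :: "'a embedding_number \<Rightarrow> 'a embedding_number \<Rightarrow> bool" where
  "x \<le> y \<longleftrightarrow> Rep_embedding_number x \<le> Rep_embedding_number y"

definition less_embedding_number :: "'a embedding_number \<Rightarrow> 'a embedding_number \<Rightarrow> bool" where
  "x < y \<longleftrightarrow> Rep_embedding_number x < Rep_embedding_number y"

instance
proof
  fix P :: "'a embedding_number \<Rightarrow> bool" and a
  assume step: "\<And>x. (\<And>y. y < x \<Longrightarrow> P y) \<Longrightarrow> P x"
  show "P a"
    by (induction a rule: measure_induct_rule[of Rep_embedding_number]) (rule step, simp add: less_embedding_number_def)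
qed (auto simp: less_eq_embedding_number_def less_embedding_number_def Rep_embedding_number_inject)

end

lemma (in num_field) ex_numbering:
  obtains \<sigma> :: "'k embedding_number \<Rightarrow> 'k \<Rightarrow> complex" where "bij_betw \<sigma> UNIV complex_embeddings"
proof -
  have K: "field_degree TYPE('k) = d" by (simp add: field_degree_def)
  have "d > 0"
  proof (rule ccontr)
    assume "\<not> d > 0"
    then show False using qcoord_sum[of 1] by simp
  qed
  have "card (UNIV :: 'k embedding_number set) = card (Rep_embedding_number ` (UNIV :: 'k embedding_number set))"
    by (rule card_image[symmetric]) (simp add: inj_on_def Rep_embedding_number_inject)
  also have "Rep_embedding_number ` (UNIV :: 'k embedding_number set) = {..<max 1 (field_degree TYPE('k))}"
    using type_definition.Rep_range[OF type_definition_embedding_number] .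
  finally have "card (UNIV :: 'k embedding_number set) = card (complex_embeddings :: ('k \<Rightarrow> complex) set)"
    using \<open>d > 0\<close> by (simp add: K embeddings_card(2))
  then obtain \<sigma> :: "'k embedding_number \<Rightarrow> 'k \<Rightarrow> complex" where "bij_betw \<sigma> UNIV complex_embeddings"
    using finite_same_card_bij[OF finite[of UNIV] embeddings_card(1)] by blast
  then show ?thesis by (rule that)
qed

theorem theorem5p10:
  fixes R :: "'k::field_char_0 set" and r s d n :: nat and M\<^sub>K :: real
  assumes "number_field TYPE('k)"
    and "r = card (real_places :: ('k \<Rightarrow> complex) set)"
    and "s = card (complex_places :: ('k \<Rightarrow> complex) set set)"
    and "d = r + 2 * s"
    and "subring R field_ring"
    and "ring_of_integers \<subseteq> R"
    and "M\<^sub>K = (4 / pi) ^ s * (fact d / real d ^ d) * sqrt (cmod (discriminant TYPE('k)))"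
    and "n \<ge> 1"
  shows "linear_constant R n \<ge> ereal (M\<^sub>K powi (- int n))"
proof -
  interpret K: num_field "TYPE('k)" by unfold_locales (rule assms(1))
  obtain \<sigma> :: "'k embedding_number \<Rightarrow> 'k \<Rightarrow> complex" where \<sigma>: "bij_betw \<sigma> UNIV complex_embeddings"
    using K.ex_numbering .
  interpret E: embedding_index "TYPE('k)" \<sigma> by unfold_locales (rule \<sigma>)
  obtain b where b: "\<forall>e. b e \<in> ring_of_integers" "Determinants.det (E.emb_matrix b) \<noteq> 0"
    "\<forall>x\<in>ring_of_integers. \<exists>c. x = (\<Sum>e\<in>UNIV. of_int (c e) * b e)"
    "discriminant TYPE('k) = (Determinants.det (E.emb_matrix b))\<^sup>2"
    using E.discriminant_basis .
  interpret F: integral_overring "TYPE('k)" \<sigma> b R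
    by (intro integral_overring.intro integral_frame.intro integral_frame_axioms.intro
        integral_overring_axioms.intro E.embedding_index_axioms b assms(5,6))
  have "M\<^sub>K = F.minkowski_constant"
    unfolding F.minkowski_constant_def F.degree_places assms(7) unfolding assms(2-4) ..
  then show ?thesis using F.linear_constant_ge[OF assms(8)] by simp
qed

end
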